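(* Let $g$ be an entire function and $f$ be a transcendental meromorphic function such that $0<\lambda_f(p,q)\le\rho_f(p,q)<\infty$, where $p$ and $q$ are positive integers with $p\ge q$. Let $F=f^{\alpha}Q[f]$, where $Q[f]$ is a differential polynomial in $f$. Let $\mu,\beta$ be real numbers with $0<\mu<\beta<\rho_g$. Then for any integer $\alpha\ge 1$: (i) if $q=1$, $$\limsup_{r\to\infty}\frac{\log^{[p-1]}T_{f\circ g}(r)}{\log^{[p-1]}T_F(\exp(r^{\mu}))}=\infty;$$ (ii) if $q=2$, $$\limsup_{r\to\infty}\frac{\log^{[p-1]}T_{f\circ g}(r)}{\log^{[p-1]}T_F(\exp(r^{\mu}))}\ge\frac{\beta\,\lambda_f(p,q)}{\mu\,\rho_f(p,q)};$$ (iii) if $q>2$, $$\limsup_{r\to\infty}\frac{\log^{[p-1]}T_{f\circ g}(r)}{\log^{[p-1]}T_F(\exp(r^{\mu}))}\ge\frac{\lambda_f(p,q)}{\rho_f(p,q)}.$$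
   Context: All functions are defined on the complex plane $\mathbb{C}$. Iterated logarithms: $\log^{[0]}x=x$, and for positive integers $k$, $\log^{[k]}x=\log(\log^{[k-1]}x)$ (for $x$ large enough that this is defined). $T_h(r)$ is the Nevanlinna characteristic function of a meromorphic function $h$, and $M_g(r)=\max_{|z|=r}|g(z)|$ for an entire function $g$. The order of an entire function $g$ is $\rho_g=\limsup_{r\to\infty}\frac{\log\log M_g(r)}{\log r}$ (possibly $\infty$). For positive integers $p\ge q$, the $(p,q)$-th order and $(p,q)$-th lower order of a meromorphic function $f$ are $$\rho_f(p,q)=\limsup_{r\to\infty}\frac{\log^{[p-1]}T_f(r)}{\log^{[q]}r},\qquad \lambda_f(p,q)=\liminf_{r\to\infty}\frac{\log^{[p-1]}T_f(r)}{\log^{[q]}r}.$$ A monomial generated by a transcendental meromorphic function $f$ is an expression $M[f]=f^{n_0}(f^{(1)})^{n_1}\cdots(f^{(k)})^{n_k}$ with non-negative integers $n_0,\dots,n_k$. A differential polynomial generated by (in) $f$ is an expression $Q[f]=a_1M_1[f]+\cdots+a_sM_s[f]$, where $M_1[f],\dots,M_s[f]$ are monomials in $f$ and $a_1,\dots,a_s$ are nonzero constants.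
   Formalization: The formal theorem additionally assumes that Q[f] is not identically zero; otherwise (e.g. f = exp, Q[f] = f' − f, p = 2, q = 1) F vanishes identically, T_F = 0 and the denominator log^{[p-1]} T_F is undefined. *)

theory Defs
  imports "HOL-Complex_Analysis.Complex_Analysis"
begin

text \<open>
  A meromorphic function is represented, as in \<open>meromorphic_on\<close>, by a total function
  \<open>complex \<Rightarrow> complex\<close> whose values on a discrete set (in particular at the poles) are arbitrary.
  Identities between meromorphic functions are therefore stated off a discrete set, that is,
  with the filter \<open>cosparse UNIV\<close>.
\<close>

definition transcendental_meromorphic :: "(complex \<Rightarrow> complex) \<Rightarrow> bool" where
  "transcendental_meromorphic f \<longleftrightarrow>
     f meromorphic_on UNIV \<and>
     \<not> (\<exists>a b :: complex poly. b \<noteq> 0 \<and> (\<forall>\<^sub>F z in cosparse UNIV. f z = poly a z / poly b z))"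

definition iter_log :: "nat \<Rightarrow> real \<Rightarrow> real" where
  "iter_log k = (ln ^^ k)"

definition log_plus :: "real \<Rightarrow> real" where
  "log_plus x = ln (max 1 x)"

definition proximity :: "(complex \<Rightarrow> complex) \<Rightarrow> real \<Rightarrow> real" where
  "proximity f r =
     1 / (2 * pi) * integral {0..2 * pi} (\<lambda>\<theta>. log_plus (cmod (f (of_real r * cis \<theta>))))"

text \<open>Poles in the closed disc, counted with multiplicity (\<open>zorder\<close> is negative at a pole).\<close>

definition pole_count :: "(complex \<Rightarrow> complex) \<Rightarrow> real \<Rightarrow> nat" where
  "pole_count f t = (\<Sum>z | z \<in> cball 0 t \<and> is_pole f z. nat (- zorder f z))"

definition counting :: "(complex \<Rightarrow> complex) \<Rightarrow> real \<Rightarrow> real" where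
  "counting f r =
     integral {0..r} (\<lambda>t. (real (pole_count f t) - real (pole_count f 0)) / t)
     + real (pole_count f 0) * ln r"

definition nevanlinna_T :: "(complex \<Rightarrow> complex) \<Rightarrow> real \<Rightarrow> real" where
  "nevanlinna_T f r = proximity f r + counting f r"

definition max_modulus :: "(complex \<Rightarrow> complex) \<Rightarrow> real \<Rightarrow> real" where
  "max_modulus g r = (SUP z\<in>sphere 0 r. cmod (g z))"

definition entire_order :: "(complex \<Rightarrow> complex) \<Rightarrow> ereal" where
  "entire_order g = Limsup at_top (\<lambda>r. ereal (ln (ln (max_modulus g r)) / ln r))"

definition pq_order :: "nat \<Rightarrow> nat \<Rightarrow> (complex \<Rightarrow> complex) \<Rightarrow> ereal" where
  "pq_order p q f =
     Limsup at_top (\<lambda>r. ereal (iter_log (p - 1) (nevanlinna_T f r) / iter_log q r))"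

definition pq_lower_order :: "nat \<Rightarrow> nat \<Rightarrow> (complex \<Rightarrow> complex) \<Rightarrow> ereal" where
  "pq_lower_order p q f =
     Liminf at_top (\<lambda>r. ereal (iter_log (p - 1) (nevanlinna_T f r) / iter_log q r))"

text \<open>The list \<open>[n\<^sub>0, \<dots>, n\<^sub>k]\<close> of exponents encodes \<open>f ^ n\<^sub>0 * (f') ^ n\<^sub>1 * \<dots>\<close>.\<close>

definition diff_monomial :: "nat list \<Rightarrow> (complex \<Rightarrow> complex) \<Rightarrow> complex \<Rightarrow> complex" where
  "diff_monomial ns f z = (\<Prod>i<length ns. ((deriv ^^ i) f z) ^ (ns ! i))"

definition diff_polynomial_in :: "(complex \<Rightarrow> complex) \<Rightarrow> (complex \<Rightarrow> complex) \<Rightarrow> bool" where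
  "diff_polynomial_in f Q \<longleftrightarrow>
     (\<exists>ts :: (complex \<times> nat list) list.
        ts \<noteq> [] \<and> (\<forall>(a, ns)\<in>set ts. a \<noteq> 0 \<and> ns \<noteq> []) \<and>
        Q = (\<lambda>z. \<Sum>(a, ns)\<leftarrow>ts. a * diff_monomial ns f z))"

end

theory Submission
  imports Defs "HOL-Real_Asymp.Real_Asymp"
begin

text \<open>
  The denominator is bounded above because \<open>T\<close> is subadditive under sums and products and
  \<open>T(r, f') = O(T(2 r, f))\<close>, so that \<open>T(r, F) = O(T(K r, f))\<close> off a countable set of radii.
  It tends to infinity since \<open>f\<^sup>\<alpha> Q\<close> is not constant: if it were \<open>c \<noteq> 0\<close>, then
  \<open>v = 1 / f\<close> would be entire with \<open>Q = c v\<^sup>\<alpha>\<close>, but \<open>Q\<close> is bounded at the points where \<open>v\<close> attains its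
  maximum modulus, because \<open>f\<close> and its derivatives are small there.

  For the numerator, fix \<open>\<beta> < b < \<rho>\<^sub>g\<close>. There are arbitrarily large \<open>\<rho>\<close> such that all values \<open>w\<close> with
  \<open>D < |w| \<le> R = exp (\<rho>\<^sup>b)\<close> satisfy \<open>N(\<rho>, 1 / (g - w)) \<ge> \<rho>\<^sup>b\<close>: a value that is taken too rarely at a
  record of \<open>ln M(r, g) / r\<^sup>b\<close> (with a slightly larger \<open>b\<close>) forces another record soon after, the exceptional
  values of consecutive records are close to each other by the second main theorem, and so all of them lie
  in one disc. Summing over the zeros, ones and poles of \<open>f\<close> in the disc of radius
  \<open>R\<close>, each weighted by its preimages under \<open>g\<close>, bounds \<open>N(R, \<phi>)\<close> by \<open>N(r, \<phi> \<circ> g) + O(ln R)\<close>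
  for \<open>\<phi> = f, 1 / f, 1 / (f - 1)\<close> and \<open>r \<ge> \<rho>\<close>; the second main theorem for \<open>f\<close> turns this into \<open>T(t, f) \<le> 6 T(r, f \<circ> g)\<close>
  for some \<open>t \<ge> R / 8\<close>. Iterated logarithms do not see the constants, which leaves the quotient of
  \<open>\<lambda>\<^sub>f log\<^sup>[\<^sup>q\<^sup>-\<^sup>1\<^sup>] r\<^sup>\<beta>\<close> by \<open>\<rho>\<^sub>f log\<^sup>[\<^sup>q\<^sup>-\<^sup>1\<^sup>] r\<^sup>\<mu>\<close>.
\<close>

section \<open>Circle means\<close>

text \<open>Only circles avoiding zeros, poles and the points where a representative has an
  arbitrary value are controlled. Estimates therefore hold off a countable set of radii, or for all
  good radii beyond a threshold, and the conclusion, being a limsup, needs just one suitable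
  \<open>r\<close> beyond each bound. This is why the lower estimate for \<open>f \<circ> g\<close>
  is proved for every good \<open>r \<ge> \<rho>\<close> and not only at \<open>\<rho>\<close>:
  within \<open>(\<rho>, \<rho> + 1)\<close> the radius can still be moved so that
  \<open>exp (r powr \<mu>)\<close> misses the exceptional set of \<open>F\<close>. The move costs a
  slightly larger exponent than \<beta>, available because \<beta> is strictly below the order. As
  \<open>f\<close> may have poles, \<open>T(r, f \<circ> g)\<close> is not accessible through
  maximum moduli; hence the count of preimages of zeros, ones and poles. The auxiliary exponent
  \<open>b\<close> lies strictly between consecutive integers, which separates the Taylor terms of
  lower order from those of higher order. The case \<open>p = 1\<close> cannot occur, since
  \<open>T(r, f) / ln r\<close> is unbounded for transcendental \<open>f\<close>; so at least one
  logarithm is always taken and constant factors disappear.\<close>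

definition cmean :: "(complex \<Rightarrow> real) \<Rightarrow> real \<Rightarrow> real" where
  "cmean u r = 1 / (2 * pi) * integral {0..2 * pi} (\<lambda>\<theta>. u (of_real r * cis \<theta>))"

lemma proximity_eq_cmean: "proximity f r = cmean (\<lambda>z. log_plus (cmod (f z))) r"
  by (simp add: proximity_def cmean_def)

lemma circle_continuous:
  fixes u :: "complex \<Rightarrow> 'a::topological_space"
  assumes "continuous_on (sphere 0 r) u" "0 \<le> r"
  shows "continuous_on {0..2 * pi} (\<lambda>\<theta>. u (of_real r * cis \<theta>))"
  by (rule continuous_on_compose2[OF assms(1)])
     (use assms(2) in \<open>auto intro!: continuous_intros simp: norm_mult\<close>)

lemma circle_integrable:
  assumes "continuous_on (sphere 0 r) u" "0 \<le> r"
  shows "(\<lambda>\<theta>. u (of_real r * cis \<theta>) :: real) integrable_on {0..2 * pi}"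
  using circle_continuous[OF assms] by (rule integrable_continuous_real)

lemma cmean_has_integral:
  assumes "continuous_on (sphere 0 r) u" "0 \<le> r"
  shows "((\<lambda>\<theta>. u (of_real r * cis \<theta>)) has_integral (2 * pi * cmean u r)) {0..2 * pi}"
  using circle_integrable[OF assms] by (simp add: cmean_def has_integral_integral)

lemma cmeanI:
  assumes "((\<lambda>\<theta>. u (of_real r * cis \<theta>)) has_integral (2 * pi * m)) {0..2 * pi}"
  shows "cmean u r = m"
  using assms by (simp add: cmean_def integral_unique)

lemma cmean_add:
  assumes "continuous_on (sphere 0 r) u" "continuous_on (sphere 0 r) v" "0 \<le> r"
  shows "cmean (\<lambda>z. u z + v z) r = cmean u r + cmean v r"
  by (rule cmeanI) (use has_integral_add[OF cmean_has_integral[OF assms(1,3)]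
    cmean_has_integral[OF assms(2,3)]] in \<open>simp add: algebra_simps\<close>)

lemma cmean_cmult: "cmean (\<lambda>z. c * u z) r = c * cmean u r"
  by (simp add: cmean_def)

lemma cmean_const [simp]: "cmean (\<lambda>z. c) r = c"
  by (simp add: cmean_def)

lemma cmean_diff:
  assumes "continuous_on (sphere 0 r) u" "continuous_on (sphere 0 r) v" "0 \<le> r"
  shows "cmean (\<lambda>z. u z - v z) r = cmean u r - cmean v r"
  by (rule cmeanI) (use has_integral_diff[OF cmean_has_integral[OF assms(1,3)]
    cmean_has_integral[OF assms(2,3)]] in \<open>simp add: algebra_simps\<close>)

lemma cmean_sum:
  assumes "finite A" "\<And>p. p \<in> A \<Longrightarrow> continuous_on (sphere 0 r) (u p)" "0 \<le> r"
  shows "cmean (\<lambda>z. \<Sum>p\<in>A. u p z) r = (\<Sum>p\<in>A. cmean (u p) r)"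
  using assms(1,2)
proof (induction A rule: finite_induct)
  case (insert p A)
  have "continuous_on (sphere 0 r) (\<lambda>z. \<Sum>p\<in>A. u p z)"
    using insert.prems by (intro continuous_on_sum) auto
  then show ?case
    using insert cmean_add[of r "u p" "\<lambda>z. \<Sum>p\<in>A. u p z"] \<open>0 \<le> r\<close> by auto
qed auto

lemma cmean_mono:
  assumes "continuous_on (sphere 0 r) u" "continuous_on (sphere 0 r) v" "0 \<le> r"
    and "\<And>z. cmod z = r \<Longrightarrow> u z \<le> v z"
  shows "cmean u r \<le> cmean v r"
proof -
  have "2 * pi * cmean u r \<le> 2 * pi * cmean v r"
    by (rule has_integral_le[OF cmean_has_integral[OF assms(1,3)] cmean_has_integral[OF assms(2,3)]])
       (use assms(3,4) in \<open>auto simp: norm_mult\<close>)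
  then show ?thesis by simp
qed

lemma cmean_cong:
  assumes "\<And>z. cmod z = r \<Longrightarrow> u z = v z" "0 \<le> r"
  shows "cmean u r = cmean v r"
proof -
  have "(\<lambda>\<theta>. u (of_real r * cis \<theta>)) = (\<lambda>\<theta>. v (of_real r * cis \<theta>))"
    using assms by (auto simp: norm_mult)
  then show ?thesis by (simp add: cmean_def)
qed

lemma cmean_le:
  assumes "continuous_on (sphere 0 r) u" "0 \<le> r" "\<And>z. cmod z = r \<Longrightarrow> u z \<le> c"
  shows "cmean u r \<le> c"
  using cmean_mono[of r u "\<lambda>_. c"] assms by auto

lemma cmean_ge:
  assumes "continuous_on (sphere 0 r) u" "0 \<le> r" "\<And>z. cmod z = r \<Longrightarrow> c \<le> u z"
  shows "c \<le> cmean u r"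
  using cmean_mono[of r "\<lambda>_. c" u] assms by auto

lemma circle_mean_holomorphic:
  assumes "h holomorphic_on ball 0 R" "0 < r" "r < R"
  shows "((\<lambda>\<theta>. h (of_real r * cis \<theta>)) has_integral (of_real (2 * pi) * h 0)) {0..2 * pi}"
proof -
  have "((\<lambda>u. h u / (u - 0)) has_contour_integral (2 * of_real pi * \<i> * h 0)) (circlepath 0 r)"
    by (rule Cauchy_integral_circlepath_simple)
       (use assms in \<open>auto intro!: holomorphic_on_subset[OF assms(1)]\<close>)
  then have "((\<lambda>t. h (r * cis t) / (r * cis t) * r * \<i> * cis t) has_integral (2 * of_real pi * \<i> * h 0)) {0..2*pi}"
    unfolding circlepath_def by (subst (asm) has_contour_integral_part_circlepath_iff) auto
  then have "((\<lambda>t. \<i> * h (r * cis t)) has_integral (2 * of_real pi * \<i> * h 0)) {0..2*pi}"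
    using assms(2) by (simp add: field_simps)
  from has_integral_mult_right[OF this, of "-\<i>"] show ?thesis
    by (simp add: mult.assoc[symmetric]) (simp add: algebra_simps)
qed

lemma cmean_Re_holomorphic:
  assumes "h holomorphic_on ball 0 R" "0 < r" "r < R"
  shows "cmean (\<lambda>z. Re (h z)) r = Re (h 0)"
  by (rule cmeanI) (use has_integral_linear[OF circle_mean_holomorphic[OF assms] bounded_linear_Re]
        in \<open>simp add: o_def\<close>)

lemma circle_coeff_holomorphic:
  assumes "h holomorphic_on ball 0 R" "0 < r" "r < R"
  shows "((\<lambda>\<theta>. h (of_real r * cis \<theta>) * cis (- real n * \<theta>)) has_integral
     (of_real (2 * pi) * ((deriv ^^ n) h 0 / fact n) * r ^ n)) {0..2 * pi}"
proof -
  have "((\<lambda>u. h u / (u - 0) ^ Suc n) has_contour_integral ((2 * pi * \<i>) / fact n * (deriv ^^ n) h 0)) (circlepath 0 r)"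
    by (rule Cauchy_has_contour_integral_higher_derivative_circlepath)
       (use assms in \<open>auto intro!: holomorphic_on_subset[OF assms(1)] holomorphic_on_imp_continuous_on\<close>)
  then have *: "((\<lambda>t. h (r * cis t) / (r * cis t) ^ Suc n * r * \<i> * cis t) has_integral (2 * of_real pi * \<i> / fact n * (deriv ^^ n) h 0)) {0..2*pi}"
    unfolding circlepath_def by (subst (asm) has_contour_integral_part_circlepath_iff) auto
  have "h (r * cis t) / (r * cis t) ^ Suc n * r * \<i> * cis t = \<i> / r ^ n * (h (of_real r * cis t) * cis (- real n * t))" for t
  proof -
    have "cis (- real n * t) = inverse (cis t ^ n)"
      by (simp add: Complex.DeMoivre cis_inverse)
    then show ?thesis using assms(2)
      by (simp add: field_simps power_mult_distrib)
  qed
  with * have "((\<lambda>t. \<i> / r ^ n * (h (of_real r * cis t) * cis (- real n * t))) has_integral (2 * of_real pi * \<i> / fact n * (deriv ^^ n) h 0)) {0..2*pi}"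
    by simp
  from has_integral_mult_right[OF this, of "- \<i> * r ^ n"]
  have "((\<lambda>t. (- \<i> * r ^ n) * (\<i> / r ^ n * (h (of_real r * cis t) * cis (- real n * t)))) has_integral
    (- \<i> * r ^ n) * (2 * of_real pi * \<i> / fact n * (deriv ^^ n) h 0)) {0..2*pi}" .
  moreover have "(- \<i> * r ^ n) * (\<i> / r ^ n * x) = x" for x
    using assms(2) by simp
  moreover have "(- \<i> * r ^ n) * (2 * of_real pi * \<i> / fact n * x) = of_real (2 * pi) * (x / fact n) * r ^ n" for x
    by (simp add: algebra_simps)
  ultimately show ?thesis by simp
qed

text \<open>On a circle \<open>cnj h\<close> has no Fourier coefficients of positive order. Adding
  its vanishing n-th coefficient to that of \<open>h\<close> replaces \<open>h\<close> by
  \<open>2 * Re h\<close>, so the mean of \<open>|Re h|\<close> alone controls the Taylor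
  coefficients of order at least 1.\<close>

lemma coeff_bound_Re:
  assumes "h holomorphic_on ball 0 R" "0 < r" "r < R" "n \<ge> 1"
  shows "cmod ((deriv ^^ n) h 0 / fact n) * r ^ n \<le> 2 * cmean (\<lambda>z. \<bar>Re (h z)\<bar>) r"
proof -
  let ?c = "(deriv ^^ n) h 0 / fact n"
  have conth: "continuous_on (sphere 0 r) h"
    by (intro holomorphic_on_imp_continuous_on holomorphic_on_subset[OF assms(1)]) (use assms in auto)
  have "((\<lambda>\<theta>. (h (of_real r * cis \<theta>) * (of_real r * cis \<theta>) ^ n)) has_integral (of_real (2 * pi) * (h 0 * 0 ^ n))) {0..2 * pi}"
    by (rule circle_mean_holomorphic[of "\<lambda>z. h z * z ^ n" R]) (use assms in \<open>auto intro!: holomorphic_intros\<close>)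
  then have "((\<lambda>\<theta>. cnj (h (of_real r * cis \<theta>) * (of_real r * cis \<theta>) ^ n)) has_integral cnj 0) {0..2 * pi}"
    using assms(4) has_integral_cnj[of "\<lambda>\<theta>. h (of_real r * cis \<theta>) * (of_real r * cis \<theta>) ^ n" 0]
    by (simp add: power_0_left o_def)
  then have "((\<lambda>\<theta>. of_real (r ^ n) * (cnj (h (of_real r * cis \<theta>)) * cis (- real n * \<theta>))) has_integral 0) {0..2 * pi}"
    by (simp add: Complex.DeMoivre power_mult_distrib cis_cnj mult_ac)
  from has_integral_mult_right[OF this, of "1 / of_real (r ^ n)"]
  have "((\<lambda>\<theta>. cnj (h (of_real r * cis \<theta>)) * cis (- real n * \<theta>)) has_integral 0) {0..2 * pi}"
    using assms(2) by simp
  from has_integral_add[OF circle_coeff_holomorphic[OF assms(1-3)] this, of n]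
  have I: "((\<lambda>\<theta>. of_real (2 * Re (h (of_real r * cis \<theta>))) * cis (- real n * \<theta>)) has_integral
     (of_real (2 * pi) * ?c * r ^ n)) {0..2 * pi}"
    by (simp add: ring_distribs(2)[symmetric] complex_add_cnj)
  have c: "continuous_on (sphere 0 r) (\<lambda>z. 2 * \<bar>Re (h z)\<bar>)"
    by (intro continuous_intros conth)
  have J: "((\<lambda>\<theta>. 2 * \<bar>Re (h (of_real r * cis \<theta>))\<bar>) has_integral (2 * pi * cmean (\<lambda>z. 2 * \<bar>Re (h z)\<bar>) r)) {0..2 * pi}"
    by (rule cmean_has_integral[OF c]) (use assms in auto)
  have "cmod (of_real (2 * pi) * ?c * r ^ n) = cmod (integral {0..2*pi} (\<lambda>\<theta>. of_real (2 * Re (h (of_real r * cis \<theta>))) * cis (- real n * \<theta>)))"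
    by (simp only: integral_unique[OF I])
  also have "\<dots> \<le> integral {0..2*pi} (\<lambda>\<theta>. 2 * \<bar>Re (h (of_real r * cis \<theta>))\<bar>)"
    by (rule integral_norm_bound_integral) (use I J in \<open>auto simp: norm_mult has_integral_integrable\<close>)
  also have "\<dots> = 2 * pi * cmean (\<lambda>z. 2 * \<bar>Re (h z)\<bar>) r"
    by (rule integral_unique[OF J])
  finally have "cmod (of_real (2 * pi) * ?c * r ^ n) \<le> 2 * pi * cmean (\<lambda>z. 2 * \<bar>Re (h z)\<bar>) r" .
  then have "2 * pi * (cmod ?c * r ^ n) \<le> 2 * pi * (2 * cmean (\<lambda>z. \<bar>Re (h z)\<bar>) r)"
    using assms(2) by (simp add: norm_mult norm_power cmean_cmult norm_divide)
  then show ?thesis by (rule mult_left_le_imp_le) auto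
qed

text \<open>A Borel-Caratheodory inequality with the mean of \<open>|Re h|\<close> in place of a
  maximum: the coefficient bounds are summed as a geometric series of ratio
  \<open>|z| / r\<close>.\<close>

lemma holomorphic_dist_bound_Re:
  assumes "h holomorphic_on ball 0 R" "0 < r" "r < R" "cmod z < r"
  shows "cmod (h z - h 0) \<le> 2 * cmean (\<lambda>z. \<bar>Re (h z)\<bar>) r * (cmod z / (r - cmod z))"
proof -
  let ?M = "2 * cmean (\<lambda>z. \<bar>Re (h z)\<bar>) r"
  let ?c = "\<lambda>n. (deriv ^^ n) h 0 / fact n"
  have "(\<lambda>n. ?c n * (z - 0) ^ n) sums h z"
    by (rule holomorphic_power_series[OF assms(1)]) (use assms in auto)
  then have "(\<lambda>n. ?c (Suc n) * z ^ Suc n) sums (h z - h 0)"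
    by (subst sums_Suc_iff) auto
  moreover have bd: "cmod (?c (Suc n) * z ^ Suc n) \<le> ?M * (cmod z / r) * (cmod z / r) ^ n" for n
  proof -
    have "cmod (?c (Suc n)) * r ^ Suc n \<le> ?M"
      by (rule coeff_bound_Re[OF assms(1-3)]) auto
    then have "cmod (?c (Suc n)) * r ^ Suc n * (cmod z / r) ^ Suc n \<le> ?M * (cmod z / r) ^ Suc n"
      using assms(2) by (intro mult_right_mono) auto
    moreover have "cmod (?c (Suc n)) * r ^ Suc n * (cmod z / r) ^ Suc n = cmod (?c (Suc n) * z ^ Suc n)"
      using assms(2) by (simp only: norm_mult norm_power power_divide) simp
    ultimately show ?thesis by (simp only: power_Suc mult.assoc)
  qed
  have g: "(\<lambda>n. ?M * (cmod z / r) * (cmod z / r) ^ n) sums (?M * (cmod z / r) * (1 / (1 - cmod z / r)))"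
    by (intro sums_mult geometric_sums) (use assms in auto)
  ultimately have "cmod (h z - h 0) \<le> ?M * (cmod z / r) * (1 / (1 - cmod z / r))"
    using bd g by (metis (no_types, lifting) sums_unique suminf_cong norm_suminf_le sums_summable)
  also have "\<dots> = ?M * (cmod z / (r - cmod z))"
    using assms by (simp add: field_simps)
  finally show ?thesis .
qed

section \<open>Counting functions\<close>

text \<open>Being nonzero off a discrete set makes \<open>zorder\<close> meaningful at every point,
  which fails for the zero function.\<close>

definition nzmero :: "(complex \<Rightarrow> complex) \<Rightarrow> bool" where
  "nzmero f \<longleftrightarrow> f meromorphic_on UNIV \<and> eventually (\<lambda>z. f z \<noteq> 0) (cosparse UNIV)"

text \<open>The case distinction gives 0 also where the function vanishes identically nearby and
  \<open>zorder\<close> carries no information.\<close>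

definition pord :: "(complex \<Rightarrow> complex) \<Rightarrow> complex \<Rightarrow> nat" where
  "pord f z = (if is_pole f z then nat (- zorder f z) else 0)"

text \<open>The radii for Jensen's formula. Analyticity at the points of the circle also rules out
  that the representative takes an arbitrary value there.\<close>

definition good :: "(complex \<Rightarrow> complex) \<Rightarrow> real \<Rightarrow> bool" where
  "good f r \<longleftrightarrow> 0 < r \<and> (\<forall>z. cmod z = r \<longrightarrow> f analytic_on {z} \<and> f z \<noteq> 0)"

text \<open>The weight with which a point \<open>p\<close> contributes to the counting function at radius \<open>r\<close>.\<close>

definition wt :: "real \<Rightarrow> complex \<Rightarrow> real" where
  "wt r p = (if cmod p \<le> r then ln r - (if p = 0 then 0 else ln (cmod p)) else 0)"

lemma nzmero_meromorphic: "nzmero f \<Longrightarrow> f meromorphic_on A"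
  unfolding nzmero_def using meromorphic_on_subset by blast

lemma nzmero_eventually: "nzmero f \<Longrightarrow> eventually (\<lambda>w. f w \<noteq> 0) (at z)"
  unfolding nzmero_def using eventually_cosparse_imp_eventually_at by blast

lemma nzmero_frequently: "nzmero f \<Longrightarrow> frequently (\<lambda>w. f w \<noteq> 0) (at z)"
  using nzmero_eventually eventually_frequently at_neq_bot by blast

lemma nzmero_iso: "nzmero f \<Longrightarrow> isolated_singularity_at f z"
  using nzmero_meromorphic meromorphic_at_iff by blast

lemma nzmero_ness: "nzmero f \<Longrightarrow> not_essential f z"
  using nzmero_meromorphic meromorphic_at_iff by blast

lemmas nzmero_facts = nzmero_meromorphic nzmero_eventually nzmero_frequently nzmero_iso nzmero_ness

lemma meromorphic_zero_or_nzmero: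
  assumes "f meromorphic_on UNIV"
  shows "eventually (\<lambda>z. f z = 0) (cosparse UNIV) \<or> nzmero f"
  using meromorphic_imp_constant_or_avoid[OF assms, of 0] assms by (auto simp: nzmero_def)

lemma nzmero_inverse: "nzmero f \<Longrightarrow> nzmero (\<lambda>z. 1 / f z)"
  unfolding nzmero_def by (auto intro!: meromorphic_intros elim!: eventually_mono)

lemma nzmero_mult: "nzmero f \<Longrightarrow> nzmero g \<Longrightarrow> nzmero (\<lambda>z. f z * g z)"
  unfolding nzmero_def mult_eq_0_iff de_Morgan_disj
  by (auto intro!: meromorphic_intros eventually_conj)

lemma nzmero_powi: "nzmero f \<Longrightarrow> nzmero (\<lambda>z. f z powi n)"
  unfolding nzmero_def by (elim conjE, intro conjI meromorphic_intros) (assumption, erule eventually_mono, simp)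

lemma nzmero_const: "c \<noteq> 0 \<Longrightarrow> nzmero (\<lambda>z. c)"
  unfolding nzmero_def by auto

lemma nzmero_prod:
  assumes "finite A" "\<And>p. p \<in> A \<Longrightarrow> nzmero (f p)"
  shows "nzmero (\<lambda>z. \<Prod>p\<in>A. f p z)"
  using assms by (induction A rule: finite_induct) (auto intro: nzmero_mult nzmero_const)

lemma pord_eq_zorder:
  assumes "nzmero f" shows "pord f z = nat (- zorder f z)"
  using assms neg_zorder_imp_is_pole[of f z] unfolding pord_def
  by (cases "is_pole f z") (use nzmero_facts in force)+

lemma zorder_recip:
  assumes "nzmero f" shows "zorder (\<lambda>z. 1 / f z) z = - zorder f z"
  using zorder_inverse[of f z] assms by (simp add: nzmero_facts inverse_eq_divide)

lemma pord_recip: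
  assumes "nzmero f" shows "pord (\<lambda>z. 1 / f z) z = nat (zorder f z)"
  using pord_eq_zorder[OF nzmero_inverse[OF assms]] by (simp add: zorder_recip[OF assms])

lemma zorder_eq_pord:
  assumes "nzmero f" shows "zorder f z = int (pord (\<lambda>z. 1 / f z) z) - int (pord f z)"
  using assms by (simp add: pord_eq_zorder pord_recip)

lemma not_pole_pord: "\<not> is_pole f z \<Longrightarrow> pord f z = 0"
  by (simp add: pord_def)

lemma finite_cball_cosparse:
  assumes "eventually P (cosparse (UNIV :: complex set))"
  shows "finite {z. cmod z \<le> r \<and> \<not> P z}"
proof -
  have "{z. \<not> P z} sparse_in cball 0 r"
    using assms by (auto simp: eventually_cosparse intro: sparse_in_subset)
  from sparse_in_compact_finite[OF this compact_cball]
  have "finite (cball 0 r \<inter> {z. \<not> P z})" .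
  moreover have "cball 0 r \<inter> {z. \<not> P z} = {z. cmod z \<le> r \<and> \<not> P z}" by auto
  ultimately show ?thesis by simp
qed

lemma finite_poles:
  assumes "f meromorphic_on UNIV" shows "finite {z. cmod z \<le> r \<and> is_pole f z}"
  using finite_cball_cosparse[OF meromorphic_on_imp_not_pole_cosparse[OF assms]] by simp

lemma finite_pord:
  assumes "f meromorphic_on UNIV" shows "finite {z. cmod z \<le> r \<and> pord f z \<noteq> 0}"
  by (rule finite_subset[OF _ finite_poles[OF assms, of r]]) (auto simp: pord_def split: if_splits)

lemma finite_zorder:
  assumes "nzmero f" shows "finite {z. cmod z \<le> r \<and> zorder f z \<noteq> 0}"
  by (rule finite_subset[OF _ finite_UnI[OF finite_pord[of f r] finite_pord[of "\<lambda>z. 1 / f z" r]]])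
     (use assms in \<open>auto simp: zorder_eq_pord nzmero_inverse nzmero_meromorphic\<close>)

lemma countable_bad:
  assumes "nzmero f" shows "countable {r. 0 < r \<and> \<not> good f r}"
proof -
  have "eventually (\<lambda>z. f analytic_on {z} \<and> f z \<noteq> 0) (cosparse UNIV)"
    using meromorphic_on_imp_analytic_cosparse[OF nzmero_meromorphic[OF assms]] assms
    unfolding nzmero_def by (auto intro: eventually_conj)
  then have "countable (UNIV \<inter> {z. \<not> (f analytic_on {z} \<and> f z \<noteq> 0)})"
    by (intro sparse_imp_countable) (auto simp: eventually_cosparse)
  then have "countable (cmod ` {z. \<not> (f analytic_on {z} \<and> f z \<noteq> 0)})" by auto
  then show ?thesis by (rule countable_subset[rotated]) (auto simp: good_def)
qed

text \<open>The bad radii of finitely many functions are countable, an open interval is not. This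
  allows one radius to be chosen for several functions at once.\<close>

lemma ex_good:
  assumes "finite F" "\<And>f. f \<in> F \<Longrightarrow> nzmero f" "0 \<le> a" "a < (b::real)"
  obtains r where "a < r" "r < b" "\<And>f. f \<in> F \<Longrightarrow> good f r"
proof -
  let ?B = "\<Union>f\<in>F. {r. 0 < r \<and> \<not> good f r}"
  have "countable ?B" using assms(1,2) countable_bad by (intro countable_UN) (auto intro: countable_finite)
  then have "\<not> {a<..<b} \<subseteq> ?B"
    using uncountable_open_interval[of a b] assms(4) countable_subset by blast
  then show ?thesis using that assms(3) by fastforce
qed

lemma good_pos: "good f r \<Longrightarrow> 0 < r" by (simp add: good_def)

lemma good_continuous:
  assumes "good f r" shows "continuous_on (sphere 0 r) f"
  by (rule continuous_at_imp_continuous_on)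
     (use assms in \<open>auto simp: good_def intro: analytic_at_imp_isCont\<close>)

lemma good_zorder:
  assumes "good f r" "cmod z = r" shows "zorder f z = 0"
  using assms by (auto simp: good_def intro!: zorder_eq_0I)

lemma good_recip: "good f r \<Longrightarrow> good (\<lambda>z. 1 / f z) r"
  by (auto simp: good_def intro!: analytic_intros)

lemma good_not_pole: "good f r \<Longrightarrow> cmod z = r \<Longrightarrow> \<not> is_pole f z"
  by (auto simp: good_def dest: analytic_at_imp_no_pole)

lemma wt_nonneg: "1 \<le> r \<Longrightarrow> 0 \<le> wt r p"
  by (auto simp: wt_def)

lemma wt_mono: "0 < r \<Longrightarrow> r \<le> s \<Longrightarrow> wt r p \<le> wt s p"
  by (auto simp: wt_def)

lemma wt_has_integral:
  assumes "p \<noteq> 0" "cmod p \<le> r"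
  shows "((\<lambda>t. if cmod p \<le> t then 1 / t else 0) has_integral (ln r - ln (cmod p))) {0..r}"
proof -
  have "((\<lambda>t. 1 / t) has_integral (ln r - ln (cmod p))) {cmod p..r}"
    by (rule fundamental_theorem_of_calculus)
       (use assms in \<open>auto intro!: derivative_eq_intros simp: has_real_derivative_iff_has_vector_derivative[symmetric]
          intro: less_le_trans[of 0 "cmod p"]\<close>)
  then have "((\<lambda>t. if t \<in> cbox (cmod p) r then 1 / t else 0) has_integral (ln r - ln (cmod p))) (cbox 0 r)"
    by (intro has_integral_restrict_closed_subinterval) auto
  then have "((\<lambda>t. if t \<in> cbox (cmod p) r then 1 / t else 0) has_integral (ln r - ln (cmod p))) {0..r}"
    by simp
  then show ?thesis by (rule has_integral_eq[rotated]) auto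
qed

lemma counting_eq:
  assumes "f meromorphic_on UNIV" "0 < r" "finite A" "\<And>z. cmod z \<le> r \<Longrightarrow> pord f z \<noteq> 0 \<Longrightarrow> z \<in> A"
  shows "counting f r = (\<Sum>p\<in>A. real (pord f p) * wt r p)"
proof -
  define P where "P = {z. cmod z \<le> r \<and> is_pole f z}"
  have finP: "finite P" unfolding P_def by (rule finite_poles[OF assms(1)])
  have pc: "real (pole_count f t) = (\<Sum>p\<in>P. if cmod p \<le> t then real (pord f p) else 0)" if "t \<le> r" for t
  proof -
    have "{z. z \<in> cball 0 t \<and> is_pole f z} = {p \<in> P. cmod p \<le> t}"
      using that by (auto simp: P_def)
    then have "pole_count f t = (\<Sum>p | p \<in> P \<and> cmod p \<le> t. nat (- zorder f p))"
      by (simp add: pole_count_def)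
    also have "\<dots> = (\<Sum>p | p \<in> P \<and> cmod p \<le> t. pord f p)"
      by (rule sum.cong) (auto simp: P_def pord_def)
    also have "\<dots> = (\<Sum>p\<in>P. if cmod p \<le> t then pord f p else 0)"
      using finP by (simp add: sum.inter_filter)
    finally show ?thesis by (simp add: if_distrib cong: if_cong)
  qed
  have pc0: "real (pole_count f 0) = (\<Sum>p\<in>P. if p = 0 then real (pord f p) else 0)"
    using pc[of 0] assms(2) by (simp cong: if_cong)
  let ?g = "\<lambda>p t. if p = 0 then 0 else real (pord f p) * (if cmod p \<le> t then 1 / t else 0)"
  have "((\<lambda>t. \<Sum>p\<in>P. ?g p t) has_integral (\<Sum>p\<in>P. if p = 0 then 0 else real (pord f p) * (ln r - ln (cmod p)))) {0..r}"
  proof (rule has_integral_sum[OF finP])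
    fix p assume "p \<in> P"
    then show "(?g p has_integral (if p = 0 then 0 else real (pord f p) * (ln r - ln (cmod p)))) {0..r}"
      using has_integral_mult_right[OF wt_has_integral[of p r], of "real (pord f p)"] by (auto simp: P_def)
  qed
  moreover have "(\<Sum>p\<in>P. ?g p t) = (real (pole_count f t) - real (pole_count f 0)) / t" if "t \<in> {0..r}" for t
  proof -
    have "real (pole_count f t) - real (pole_count f 0)
      = (\<Sum>p\<in>P. (if cmod p \<le> t then real (pord f p) else 0) - (if p = 0 then real (pord f p) else 0))"
      using that by (simp add: pc pc0 sum_subtractf)
    then show ?thesis
      using that by (auto simp: sum_divide_distrib intro!: sum.cong)
  qed
  ultimately have "((\<lambda>t. (real (pole_count f t) - real (pole_count f 0)) / t) has_integral
     (\<Sum>p\<in>P. if p = 0 then 0 else real (pord f p) * (ln r - ln (cmod p)))) {0..r}"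
    by (rule has_integral_eq[rotated]) auto
  then have "counting f r = (\<Sum>p\<in>P. if p = 0 then 0 else real (pord f p) * (ln r - ln (cmod p))) + (\<Sum>p\<in>P. if p = 0 then real (pord f p) else 0) * ln r"
    unfolding counting_def pc0[symmetric] by (simp add: integral_unique)
  also have "\<dots> = (\<Sum>p\<in>P. real (pord f p) * wt r p)"
    unfolding sum_distrib_right sum.distrib[symmetric]
    by (rule sum.cong) (auto simp: wt_def P_def)
  also have "\<dots> = (\<Sum>p\<in>P \<union> A. real (pord f p) * wt r p)"
    by (rule sum.mono_neutral_left) (use finP assms(3) in \<open>auto simp: P_def wt_def pord_def\<close>)
  also have "\<dots> = (\<Sum>p\<in>A. real (pord f p) * wt r p)"
    by (rule sum.mono_neutral_right) (use finP assms(3,4) in \<open>auto simp: P_def wt_def\<close>)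
  finally show ?thesis .
qed

lemma counting_eq':
  assumes "f meromorphic_on UNIV" "0 < r"
  shows "counting f r = (\<Sum>p | cmod p \<le> r \<and> pord f p \<noteq> 0. real (pord f p) * wt r p)"
  by (rule counting_eq[OF assms finite_pord[OF assms(1)]]) auto

lemma counting_nonneg:
  assumes "f meromorphic_on UNIV" "1 \<le> r" shows "0 \<le> counting f r"
  using assms by (auto simp: counting_eq' intro!: sum_nonneg mult_nonneg_nonneg wt_nonneg)

lemma counting_mono:
  assumes "f meromorphic_on UNIV" "0 < r" "r \<le> s" shows "counting f r \<le> counting f s"
proof -
  let ?A = "{z. cmod z \<le> s \<and> pord f z \<noteq> 0}"
  have "counting f r = (\<Sum>p\<in>?A. real (pord f p) * wt r p)"
    by (rule counting_eq[OF assms(1,2) finite_pord[OF assms(1)]]) (use assms in auto)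
  also have "\<dots> \<le> (\<Sum>p\<in>?A. real (pord f p) * wt s p)"
    by (intro sum_mono mult_left_mono wt_mono) (use assms in auto)
  also have "\<dots> = counting f s"
    by (rule counting_eq[symmetric, OF assms(1) _ finite_pord[OF assms(1)]]) (use assms in auto)
  finally show ?thesis .
qed

text \<open>The weights are nonnegative for \<open>r \<ge> 1\<close>, so inequalities between pole
  orders at each point carry over to the counting functions.\<close>

lemma counting_subadditive:
  assumes "f meromorphic_on UNIV" "finite I" "\<And>i. i \<in> I \<Longrightarrow> g i meromorphic_on UNIV" "1 \<le> r"
    and "\<And>z. cmod z \<le> r \<Longrightarrow> real (pord f z) \<le> (\<Sum>i\<in>I. c i * real (pord (g i) z))"
  shows "counting f r \<le> (\<Sum>i\<in>I. c i * counting (g i) r)"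
proof -
  let ?A = "{z. cmod z \<le> r \<and> pord f z \<noteq> 0} \<union> (\<Union>i\<in>I. {z. cmod z \<le> r \<and> pord (g i) z \<noteq> 0})"
  have fin: "finite ?A" using assms finite_pord by auto
  have "counting f r = (\<Sum>p\<in>?A. real (pord f p) * wt r p)"
    by (rule counting_eq[OF assms(1) _ fin]) (use assms in auto)
  also have "\<dots> \<le> (\<Sum>p\<in>?A. (\<Sum>i\<in>I. c i * real (pord (g i) p)) * wt r p)"
    by (intro sum_mono mult_right_mono wt_nonneg assms) auto
  also have "\<dots> = (\<Sum>i\<in>I. c i * (\<Sum>p\<in>?A. real (pord (g i) p) * wt r p))"
    unfolding sum_distrib_left sum_distrib_right by (subst sum.swap) (simp add: mult_ac)
  also have "\<dots> = (\<Sum>i\<in>I. c i * counting (g i) r)"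
  proof (rule sum.cong[OF refl])
    fix i assume i: "i \<in> I"
    have "counting (g i) r = (\<Sum>p\<in>?A. real (pord (g i) p) * wt r p)"
      by (rule counting_eq[OF assms(3)[OF i] _ fin]) (use assms i in auto)
    then show "c i * (\<Sum>p\<in>?A. real (pord (g i) p) * wt r p) = c i * counting (g i) r" by simp
  qed
  finally show ?thesis .
qed

section \<open>Jensen's formula\<close>

text \<open>The factor \<open>r\<close> normalises the modulus to 1 on the circle of radius
  \<open>r\<close>.\<close>

definition blaschke :: "real \<Rightarrow> complex \<Rightarrow> complex \<Rightarrow> complex" where
  "blaschke r p z = of_real r * (z - p) / (of_real (r\<^sup>2) - cnj p * z)"

text \<open>\<open>zor_poly f 0 0\<close> is the leading Laurent coefficient at 0; its logarithm
  stands for \<open>ln |f 0|\<close> in Jensen's formula when 0 may be a zero or a pole.\<close>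

definition lead_ln :: "(complex \<Rightarrow> complex) \<Rightarrow> real" where
  "lead_ln f = ln (cmod (zor_poly f 0 0))"

lemma blaschke_denom_nonzero:
  assumes "cmod p < r" "cmod z \<le> r" shows "of_real (r\<^sup>2) - cnj p * z \<noteq> 0"
proof
  assume "of_real (r\<^sup>2) - cnj p * z = 0"
  then have "cnj p * z = of_real (r\<^sup>2)" by simp
  then have "cmod (cnj p * z) = r\<^sup>2" by (simp only: norm_of_real) simp
  moreover have "cmod p * cmod z < r * r"
    by (cases "z = 0") (use assms in \<open>auto intro!: mult_less_le_imp_less mult_pos_pos intro: le_less_trans[of 0 "cmod p"]\<close>)
  ultimately show False by (simp add: norm_mult power2_eq_square)
qed

lemma blaschke_analytic:
  assumes "cmod p < r" "cmod z \<le> r" shows "blaschke r p analytic_on {z}"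
  unfolding blaschke_def using blaschke_denom_nonzero[OF assms]
  by (auto intro!: analytic_intros)

lemma blaschke_eq_0_iff:
  assumes "cmod p < r" "cmod z \<le> r" shows "blaschke r p z = 0 \<longleftrightarrow> z = p"
  using blaschke_denom_nonzero[OF assms] assms le_less_trans[of 0 "cmod p" r] by (auto simp: blaschke_def)

text \<open>The right-hand side is nonnegative inside the disc and zero on its boundary, which
  yields both the bound by 1 and the equality on the circle.\<close>

lemma blaschke_identity:
  "(cmod (of_real (r\<^sup>2) - cnj p * z))\<^sup>2 - (cmod (of_real r * (z - p)))\<^sup>2
     = (r\<^sup>2 - (cmod z)\<^sup>2) * (r\<^sup>2 - (cmod p)\<^sup>2)"
proof -
  obtain a b c d where [simp]: "z = Complex a b" "p = Complex c d" by (metis complex.exhaust)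
  show ?thesis by (simp add: cmod_power2) (simp add: power2_eq_square algebra_simps)
qed

lemma blaschke_norm_le_1:
  assumes "cmod p < r" "cmod z \<le> r" shows "cmod (blaschke r p z) \<le> 1"
proof -
  have "(cmod (of_real r * (z - p)))\<^sup>2 \<le> (cmod (of_real (r\<^sup>2) - cnj p * z))\<^sup>2"
  proof -
    have "0 \<le> (r\<^sup>2 - (cmod z)\<^sup>2) * (r\<^sup>2 - (cmod p)\<^sup>2)"
      using assms by (intro mult_nonneg_nonneg) (auto simp: power_mono)
    then show ?thesis using blaschke_identity[of r p z] by linarith
  qed
  then have "cmod (of_real r * (z - p)) \<le> cmod (of_real (r\<^sup>2) - cnj p * z)"
    by (rule power2_le_imp_le) auto
  then show ?thesis unfolding blaschke_def norm_divide
    using blaschke_denom_nonzero[OF assms] by (subst divide_le_eq_1) auto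
qed

lemma blaschke_norm_eq_1:
  assumes "cmod p < r" "cmod z = r" shows "cmod (blaschke r p z) = 1"
proof -
  have "(cmod (of_real r * (z - p)))\<^sup>2 = (cmod (of_real (r\<^sup>2) - cnj p * z))\<^sup>2"
    using blaschke_identity[of r p z] assms by simp
  then have "cmod (of_real r * (z - p)) = cmod (of_real (r\<^sup>2) - cnj p * z)"
    by (rule power2_eq_imp_eq) auto
  then show ?thesis unfolding blaschke_def norm_divide
    using blaschke_denom_nonzero[of p r z] assms by auto
qed

lemma nzmero_linear: "a \<noteq> 0 \<Longrightarrow> nzmero (\<lambda>z. a * z + b)"
proof -
  assume a: "a \<noteq> 0"
  have "eventually (\<lambda>w. a * w + b \<noteq> 0) (at z)" for z
  proof -
    have "a * w + b \<noteq> 0 \<longleftrightarrow> w \<noteq> - b / a" for w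
      using a by (auto simp: field_simps add_eq_0_iff)
    then show ?thesis using eventually_neq_at_within[of "- b / a" z UNIV] by simp
  qed
  then show ?thesis unfolding nzmero_def by (auto simp: eventually_cosparse_open_eq intro!: meromorphic_intros)
qed

lemma blaschke_nzmero:
  assumes "cmod p < r" shows "nzmero (blaschke r p)"
proof -
  have r: "r > 0" using assms le_less_trans[of 0 "cmod p" r] by auto
  have 1: "nzmero (\<lambda>z. of_real r * (z - p))"
    using nzmero_linear[of "of_real r" "- of_real r * p"] r by (simp add: algebra_simps)
  have 2: "nzmero (\<lambda>z. of_real (r\<^sup>2) - cnj p * z)"
    using nzmero_linear[of "- cnj p" "of_real (r\<^sup>2)"] nzmero_const[of "of_real (r\<^sup>2)"] r
    by (cases "p = 0") (auto simp: algebra_simps)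
  from nzmero_mult[OF 1 nzmero_inverse[OF 2]] show ?thesis
    by (simp add: blaschke_def[abs_def])
qed

lemma zorder_blaschke:
  assumes "cmod p < r" "cmod z \<le> r" shows "zorder (blaschke r p) z = (if z = p then 1 else 0)"
proof (cases "z = p")
  case False
  then show ?thesis using blaschke_eq_0_iff[OF assms] blaschke_analytic[OF assms]
    by (auto intro!: zorder_eq_0I)
next
  case True
  have r: "r > 0" using assms le_less_trans[of 0 "cmod p" r] by auto
  let ?h = "\<lambda>z. of_real r / (of_real (r\<^sup>2) - cnj p * z)"
  have h: "?h analytic_on {p}"
    using blaschke_denom_nonzero[of p r p] assms True by (auto intro!: analytic_intros)
  then obtain S where S: "open S" "p \<in> S" "?h holomorphic_on S"
    using analytic_at by blast
  have "zorder (blaschke r p) p = 1"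
    by (rule zorder_eqI[OF S])
       (use blaschke_denom_nonzero[of p r p] assms True r in \<open>auto simp: blaschke_def\<close>)
  then show ?thesis using True by simp
qed

lemma good_finite_zeros:
  assumes "nzmero f" shows "finite {p. cmod p < r \<and> zorder f p \<noteq> 0}"
  by (rule finite_subset[OF _ finite_zorder[OF assms, of r]]) auto

text \<open>By compactness \<open>G\<close> is analytic and zero-free on a slightly larger disc,
  which is contractible. The larger disc is what lets mean value formulas be applied on the circle
  of radius \<open>r\<close> itself.\<close>

lemma holomorphic_log_cball:
  assumes r: "0 < r" and G: "\<And>z. cmod z \<le> r \<Longrightarrow> G analytic_on {z} \<and> G z \<noteq> 0"
  obtains h R where "r < R" "h holomorphic_on ball 0 R" "\<And>z. z \<in> ball 0 R \<Longrightarrow> G z = exp (h z)"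
proof -
  from G have "G analytic_on cball 0 r"
    by (subst analytic_on_analytic_at) auto
  then obtain S where S: "open S" "cball 0 r \<subseteq> S" "G holomorphic_on S"
    by (metis analytic_on_holomorphic)
  define S' where "S' = S \<inter> G -` (- {0})"
  have "open S'" unfolding S'_def
    using continuous_on_open_vimage[OF S(1), of G] holomorphic_on_imp_continuous_on[OF S(3)]
    by (metis Int_commute open_Compl closed_singleton finite.emptyI finite_insert finite_imp_closed)
  moreover have "cball 0 r \<subseteq> S'" unfolding S'_def using G S(2) by auto
  ultimately obtain e where e: "e > 0" "(\<Union>x\<in>cball 0 r. ball x e) \<subseteq> S'"
    using compact_subset_open_imp_ball_epsilon_subset[OF compact_cball] by blast
  have sub: "ball 0 (r + e) \<subseteq> S'"
  proof
    fix z :: complex assume z: "z \<in> ball 0 (r + e)"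
    \<comment> \<open>The radial projection of \<open>z\<close> to the closed disc, at distance
      \<open>|z| - r < e\<close> when \<open>z\<close> lies outside.\<close>
    define x where "x = (if cmod z \<le> r then z else of_real (r / cmod z) * z)"
    have "x \<in> cball 0 r \<and> z \<in> ball x e"
    proof (cases "cmod z \<le> r")
      case False
      then have "z - x = of_real (1 - r / cmod z) * z" by (simp add: x_def algebra_simps)
      then have "cmod (z - x) = \<bar>1 - r / cmod z\<bar> * cmod z" by (simp only: norm_mult norm_of_real)
      also have "\<dots> = cmod z - r" using False r less_trans[of 0 r "cmod z"] by (auto simp: field_simps abs_if)
      finally show ?thesis using False z r by (auto simp: x_def norm_mult norm_divide dist_norm norm_minus_commute)
    qed (use e in \<open>auto simp: x_def\<close>)
    then show "z \<in> S'" using e(2) by blast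
  qed
  have "G holomorphic_on ball 0 (r + e)"
    by (rule holomorphic_on_subset[OF S(3)]) (use sub in \<open>auto simp: S'_def\<close>)
  moreover have "G z \<noteq> 0" if "z \<in> ball 0 (r + e)" for z
    using sub that by (auto simp: S'_def)
  ultimately obtain h where h: "h holomorphic_on ball 0 (r + e)" "\<And>z. z \<in> ball 0 (r + e) \<Longrightarrow> G z = exp (h z)"
    using contractible_imp_holomorphic_log[of G "ball 0 (r + e)"] convex_imp_contractible convex_ball by metis
  then show ?thesis using that[of "r + e" h] e by auto
qed

text \<open>Dividing by the Blaschke product with the same zeros and poles makes all orders in the
  closed disc zero. After removal of singularities the quotient is analytic and zero-free, and so an
  exponential. The identity is restricted to points where \<open>f\<close> is analytic of order 0,
  because elsewhere the value of \<open>f\<close> may be arbitrary.\<close>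

lemma blaschke_factorization:
  assumes f: "nzmero f" and gd: "good f r"
  obtains h R where "r < R" "h holomorphic_on ball 0 R"
    "\<And>z. cmod z \<le> r \<Longrightarrow> f analytic_on {z} \<Longrightarrow> zorder f z = 0 \<Longrightarrow>
       f z = exp (h z) * (\<Prod>p | cmod p < r \<and> zorder f p \<noteq> 0. blaschke r p z powi zorder f p)"
proof -
  define A where "A = {p. cmod p < r \<and> zorder f p \<noteq> 0}"
  have finA: "finite A" unfolding A_def by (rule good_finite_zeros[OF f])
  have r: "r > 0" using gd by (rule good_pos)
  define k where "k = (\<lambda>z. f z * (\<Prod>p\<in>A. blaschke r p z powi (- zorder f p)))"
  have bl: "nzmero (\<lambda>z. blaschke r p z powi (- zorder f p))" if "p \<in> A" for p
    using that by (intro nzmero_powi blaschke_nzmero) (auto simp: A_def)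
  have prodnz: "nzmero (\<lambda>z. \<Prod>p\<in>A. blaschke r p z powi (- zorder f p))"
    by (rule nzmero_prod[OF finA bl])
  have k: "nzmero k" unfolding k_def by (rule nzmero_mult[OF f prodnz])
  have zk: "zorder k z = 0" if z: "cmod z \<le> r" for z
  proof -
    have "zorder k z = zorder f z + zorder (\<lambda>z. \<Prod>p\<in>A. blaschke r p z powi (- zorder f p)) z"
      unfolding k_def by (rule zorder_mult) (use f prodnz nzmero_facts in auto)
    also have "zorder (\<lambda>z. \<Prod>p\<in>A. blaschke r p z powi (- zorder f p)) z = (\<Sum>p\<in>A. zorder (\<lambda>z. blaschke r p z powi (- zorder f p)) z)"
      by (rule zorder_prod) (use bl prodnz nzmero_facts in auto)
    also have "\<dots> = (\<Sum>p\<in>A. - zorder f p * (if z = p then 1 else 0))"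
    proof (rule sum.cong[OF refl])
      fix p assume p: "p \<in> A"
      then have "nzmero (blaschke r p)" by (intro blaschke_nzmero) (auto simp: A_def)
      then have "zorder (\<lambda>z. blaschke r p z powi (- zorder f p)) z = - zorder f p * zorder (blaschke r p) z"
        by (intro zorder_power_int) (use nzmero_facts in auto)
      then show "zorder (\<lambda>z. blaschke r p z powi (- zorder f p)) z = - zorder f p * (if z = p then 1 else 0)"
        using zorder_blaschke[of p r z] p z by (auto simp: A_def)
    qed
    also have "\<dots> = (if z \<in> A then - zorder f z else 0)"
      using finA by (simp add: if_distrib[of "\<lambda>x. _ * x"] sum.delta cong: if_cong)
    finally show ?thesis using z good_zorder[OF gd, of z] by (auto simp: A_def split: if_splits)
  qed
  define G where "G = remove_sings k"
  have G: "G analytic_on {z} \<and> G z \<noteq> 0" if z: "cmod z \<le> r" for z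
  proof -
    have "\<not> is_pole k z"
      using isolated_pole_imp_neg_zorder[OF nzmero_iso[OF k], of z] zk[OF z] by auto
    then obtain c where c: "k \<midarrow>z\<rightarrow> c"
      using nzmero_ness[OF k, of z] unfolding not_essential_def by blast
    have "c \<noteq> 0"
    proof
      assume "c = 0"
      then have "isolated_zero k z" using c nzmero_eventually[OF k] by (simp add: isolated_zero_def)
      then have "zorder k z > 0"
        using zorder_isolated_zero_pos'[of k z] nzmero_iso[OF k] by blast
      then show False using zk[OF z] by simp
    qed
    then show ?thesis unfolding G_def
      using remove_sings_analytic_at[OF nzmero_iso[OF k] c] remove_sings_eqI[OF c] by auto
  qed
  then obtain h R where h: "r < R" "h holomorphic_on ball 0 R" "\<And>z. z \<in> ball 0 R \<Longrightarrow> G z = exp (h z)"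
    using holomorphic_log_cball[of r G] r by metis
  have "f z = exp (h z) * (\<Prod>p\<in>A. blaschke r p z powi zorder f p)"
    if z: "cmod z \<le> r" "f analytic_on {z}" "zorder f z = 0" for z
  proof -
    have nz: "blaschke r p z \<noteq> 0" if "p \<in> A" for p
      using that z blaschke_eq_0_iff[of p r z] by (auto simp: A_def)
    have "k analytic_on {z}" unfolding k_def
      by (intro analytic_intros z analytic_on_prod) (use z nz in \<open>auto simp: A_def intro!: analytic_intros blaschke_analytic\<close>)
    then have "G z = k z" unfolding G_def by simp
    moreover have "G z = exp (h z)" using h(1) h(3)[of z] z by auto
    ultimately have "exp (h z) * (\<Prod>p\<in>A. blaschke r p z powi zorder f p) =
        f z * ((\<Prod>p\<in>A. blaschke r p z powi (- zorder f p)) * (\<Prod>p\<in>A. blaschke r p z powi zorder f p))"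
      by (simp add: k_def)
    also have "(\<Prod>p\<in>A. blaschke r p z powi (- zorder f p)) * (\<Prod>p\<in>A. blaschke r p z powi zorder f p) = 1"
      unfolding prod.distrib[symmetric] using nz by (intro prod.neutral) (simp add: power_int_minus)
    finally show ?thesis by simp
  qed
  then show ?thesis using that[of R h] h unfolding A_def by auto
qed

lemma ln_power_int: "0 < x \<Longrightarrow> ln (x powi n) = of_int n * ln (x :: real)"
  using powr_real_of_int'[of x n] by (metis less_eq_real_def ln_powr order_less_irrefl)

lemma sum_zorder_wt:
  assumes f: "nzmero f" and gd: "good f r"
  shows "(\<Sum>p | cmod p < r \<and> zorder f p \<noteq> 0. real_of_int (zorder f p) * wt r p)
    = counting (\<lambda>z. 1 / f z) r - counting f r"
proof -
  define A where "A = {p. cmod p < r \<and> zorder f p \<noteq> 0}"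
  have finA: "finite A" unfolding A_def by (rule good_finite_zeros[OF f])
  have z0: "cmod z < r" if "zorder f z \<noteq> 0" "cmod z \<le> r" for z
    using good_zorder[OF gd, of z] that by force
  have "counting f r = (\<Sum>p\<in>A. real (pord f p) * wt r p)"
    by (rule counting_eq[OF nzmero_meromorphic[OF f] good_pos[OF gd] finA])
       (use z0 in \<open>auto simp: A_def pord_eq_zorder[OF f]\<close>)
  moreover have "counting (\<lambda>z. 1 / f z) r = (\<Sum>p\<in>A. real (pord (\<lambda>z. 1 / f z) p) * wt r p)"
    by (rule counting_eq[OF nzmero_meromorphic[OF nzmero_inverse[OF f]] good_pos[OF gd] finA])
       (use z0 in \<open>auto simp: A_def pord_recip[OF f]\<close>)
  moreover have "(\<Sum>p\<in>A. real_of_int (zorder f p) * wt r p) =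
     (\<Sum>p\<in>A. real (pord (\<lambda>z. 1 / f z) p) * wt r p) - (\<Sum>p\<in>A. real (pord f p) * wt r p)"
    unfolding sum_subtractf[symmetric]
    by (rule sum.cong) (auto simp: zorder_eq_pord[OF f] algebra_simps)
  ultimately show ?thesis by (simp add: A_def)
qed

text \<open>Poisson-Jensen in the form used throughout: Blaschke factors have modulus 1 on the
  circle, so \<open>ln |f|\<close> and \<open>Re h\<close> agree there and have the same mean
  \<open>Re (h 0)\<close>; this number is found by comparing leading coefficients at 0.\<close>

lemma blaschke_log_factorization:
  assumes f: "nzmero f" and gd: "good f r"
  obtains h R where "r < R" "h holomorphic_on ball 0 R"
    "\<And>z. cmod z \<le> r \<Longrightarrow> f analytic_on {z} \<Longrightarrow> zorder f z = 0 \<Longrightarrow>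
       f z = exp (h z) * (\<Prod>p | cmod p < r \<and> zorder f p \<noteq> 0. blaschke r p z powi zorder f p)"
    "\<And>z. cmod z \<le> r \<Longrightarrow> f analytic_on {z} \<Longrightarrow> zorder f z = 0 \<Longrightarrow>
       ln (cmod (f z)) = Re (h z) + (\<Sum>p | cmod p < r \<and> zorder f p \<noteq> 0.
          real_of_int (zorder f p) * ln (cmod (blaschke r p z)))"
    "\<And>z. cmod z = r \<Longrightarrow> ln (cmod (f z)) = Re (h z)"
    "Re (h 0) = lead_ln f + counting (\<lambda>z. 1 / f z) r - counting f r"
    "cmean (\<lambda>z. ln (cmod (f z))) r = Re (h 0)"
proof -
  define A where "A = {p. cmod p < r \<and> zorder f p \<noteq> 0}"
  have finA: "finite A" unfolding A_def by (rule good_finite_zeros[OF f])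
  have r: "r > 0" using gd by (rule good_pos)
  obtain h R where h: "r < R" "h holomorphic_on ball 0 R"
    and fh: "\<And>z. cmod z \<le> r \<Longrightarrow> f analytic_on {z} \<Longrightarrow> zorder f z = 0 \<Longrightarrow>
       f z = exp (h z) * (\<Prod>p\<in>A. blaschke r p z powi zorder f p)"
    using blaschke_factorization[OF f gd] unfolding A_def by blast
  have lf: "ln (cmod (f z)) = Re (h z) + (\<Sum>p\<in>A. real_of_int (zorder f p) * ln (cmod (blaschke r p z)))"
    if z: "cmod z \<le> r" "f analytic_on {z}" "zorder f z = 0" for z
  proof -
    have nz: "blaschke r p z \<noteq> 0" if "p \<in> A" for p
      using that z blaschke_eq_0_iff[of p r z] by (auto simp: A_def)
    have "ln (cmod (f z)) = ln (exp (Re (h z)) * (\<Prod>p\<in>A. cmod (blaschke r p z) powi zorder f p))"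
      by (simp add: fh[OF z] norm_mult prod_norm[symmetric] norm_power_int)
    also have "\<dots> = Re (h z) + ln (\<Prod>p\<in>A. cmod (blaschke r p z) powi zorder f p)"
      using nz by (subst ln_mult_pos) (auto intro!: prod_pos)
    also have "ln (\<Prod>p\<in>A. cmod (blaschke r p z) powi zorder f p) = (\<Sum>p\<in>A. ln (cmod (blaschke r p z) powi zorder f p))"
      using nz by (intro ln_prod finA) auto
    also have "\<dots> = (\<Sum>p\<in>A. real_of_int (zorder f p) * ln (cmod (blaschke r p z)))"
      using nz by (intro sum.cong refl ln_power_int) auto
    finally show ?thesis .
  qed
  have circ: "ln (cmod (f z)) = Re (h z)" if z: "cmod z = r" for z
  proof -
    have "ln (cmod (f z)) = Re (h z) + (\<Sum>p\<in>A. real_of_int (zorder f p) * ln (cmod (blaschke r p z)))"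
      using gd z good_zorder[OF gd z] by (intro lf) (auto simp: good_def)
    also have "(\<Sum>p\<in>A. real_of_int (zorder f p) * ln (cmod (blaschke r p z))) = 0"
      using z by (intro sum.neutral) (auto simp: A_def blaschke_norm_eq_1)
    finally show ?thesis by simp
  qed
  have mean: "cmean (\<lambda>z. ln (cmod (f z))) r = Re (h 0)"
    using cmean_cong[of r "\<lambda>z. ln (cmod (f z))" "\<lambda>z. Re (h z)"] circ r cmean_Re_holomorphic[OF h(2) r h(1)] by simp
  have "Re (h 0) = lead_ln f + (\<Sum>p\<in>A. real_of_int (zorder f p) * wt r p)"
  proof -
    define e where "e = zorder f 0"
    \<comment> \<open>As \<open>f\<close> may have a zero or a pole at 0, both sides are divided by
      \<open>z powi e\<close> before the limit is taken. \<open>K\<close> is the right-hand side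
      after that division: the factor of \<open>p = 0\<close> is \<open>w / r\<close>, of which
      \<open>r powi (-e)\<close> is left.\<close>
    define K where "K = (\<lambda>w. exp (h w) * of_real r powi (- e) * (\<Prod>p\<in>A - {0}. blaschke r p w powi zorder f p))"
    obtain s where s: "zor_poly f 0 0 \<noteq> 0" "s > 0" "zor_poly f 0 holomorphic_on cball 0 s"
      using zorder_exist[OF nzmero_iso[OF f] nzmero_ness[OF f] nzmero_frequently[OF f], of 0] by blast
    have "isCont (zor_poly f 0) 0"
      by (rule analytic_at_imp_isCont) (use s in \<open>auto simp: analytic_at intro!: exI[of _ "ball 0 s"] holomorphic_on_subset[OF s(3)]\<close>)
    then have t1: "zor_poly f 0 \<midarrow>0\<rightarrow> zor_poly f 0 0" by (simp add: isCont_def)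
    have "h analytic_on {0}" using h r by (auto simp: analytic_at intro!: exI[of _ "ball 0 R"])
    then have "K analytic_on {0}" unfolding K_def
      by (intro analytic_intros analytic_on_prod)
         (use r in \<open>auto simp: A_def blaschke_eq_0_iff intro!: blaschke_analytic\<close>)
    then have t2: "K \<midarrow>0\<rightarrow> K 0" using analytic_at_imp_isCont isCont_def by blast
    have "eventually (\<lambda>w. f analytic_on {w} \<and> f w \<noteq> 0) (at 0)"
      by (intro eventually_conj nzmero_eventually[OF f]
            eventually_cosparse_imp_eventually_at[OF meromorphic_on_imp_analytic_cosparse[OF nzmero_meromorphic[OF f]]]) auto
    moreover have "eventually (\<lambda>w. w \<in> ball 0 r - {0}) (at (0::complex))"
      using r by (intro eventually_at_in_open) auto
    moreover have "eventually (\<lambda>w. zor_poly f 0 w = f w * (w - 0) powi - zorder f 0) (at 0)"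
      by (rule zor_poly_eq) (use f nzmero_facts in auto)
    ultimately have "eventually (\<lambda>w. zor_poly f 0 w = K w) (at 0)"
    proof eventually_elim
      case (elim w)
      have "f w = exp (h w) * (\<Prod>p\<in>A. blaschke r p w powi zorder f p)"
        using elim by (intro fh zorder_eq_0I) auto
      also have "(\<Prod>p\<in>A. blaschke r p w powi zorder f p) = (w / of_real r) powi e * (\<Prod>p\<in>A - {0}. blaschke r p w powi zorder f p)"
      proof (cases "0 \<in> A")
        case True
        have "blaschke r 0 w = w / of_real r"
          using r by (simp add: blaschke_def power2_eq_square)
        then show ?thesis using finA True by (simp add: prod.remove e_def)
      next
        case False
        then have "e = 0" using r by (simp add: A_def e_def)
        then show ?thesis using False by simp
      qed
      finally have "f w * w powi (-e) = exp (h w) * ((w / of_real r) powi e * w powi (-e)) * (\<Prod>p\<in>A - {0}. blaschke r p w powi zorder f p)"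
        by simp
      also have "(w / of_real r) powi e * w powi (-e) = of_real r powi (-e)"
        using elim r by (simp add: power_int_divide_distrib power_int_minus field_simps)
      finally show ?case using elim by (simp add: K_def e_def)
    qed
    then have "K \<midarrow>0\<rightarrow> zor_poly f 0 0" using t1 by (simp add: filterlim_cong)
    then have "zor_poly f 0 0 = K 0" using t2 by (rule tendsto_unique[rotated]) simp
    then have "lead_ln f = ln (cmod (K 0))" by (simp add: lead_ln_def)
    also have "cmod (K 0) = exp (Re (h 0)) * (r powi (-e) * (\<Prod>p\<in>A - {0}. (cmod p / r) powi zorder f p))"
    proof -
      have "cmod (blaschke r p 0) = cmod p / r" for p
        using r by (simp add: blaschke_def norm_mult norm_divide norm_power power2_eq_square)
      then show ?thesis using r by (simp add: K_def norm_mult prod_norm[symmetric] norm_power_int)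
    qed
    also have "ln \<dots> = Re (h 0) + (ln (r powi (-e)) + ln (\<Prod>p\<in>A - {0}. (cmod p / r) powi zorder f p))"
      using r by (subst ln_mult_pos; (subst ln_mult_pos)?) (auto intro!: prod_pos mult_pos_pos zero_less_power_int divide_pos_pos)
    also have "ln (\<Prod>p\<in>A - {0}. (cmod p / r) powi zorder f p) = (\<Sum>p\<in>A - {0}. ln ((cmod p / r) powi zorder f p))"
      using finA r by (intro ln_prod) auto
    also have "\<dots> = (\<Sum>p\<in>A - {0}. - (real_of_int (zorder f p) * wt r p))"
      using r by (intro sum.cong refl) (auto simp: A_def ln_power_int ln_div wt_def algebra_simps)
    also have "ln (r powi (-e)) = - (if 0 \<in> A then real_of_int (zorder f 0) * wt r 0 else 0)"
      using r by (auto simp: ln_power_int wt_def A_def e_def)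
    finally have "Re (h 0) = lead_ln f + ((if 0 \<in> A then real_of_int (zorder f 0) * wt r 0 else 0) + (\<Sum>p\<in>A - {0}. real_of_int (zorder f p) * wt r p))"
      by (simp add: sum_negf)
    also have "(if 0 \<in> A then real_of_int (zorder f 0) * wt r 0 else 0) + (\<Sum>p\<in>A - {0}. real_of_int (zorder f p) * wt r p)
       = (\<Sum>p\<in>A. real_of_int (zorder f p) * wt r p)"
      using finA by (cases "0 \<in> A") (auto simp: sum.remove)
    finally show ?thesis .
  qed
  then have R0: "Re (h 0) = lead_ln f + counting (\<lambda>z. 1 / f z) r - counting f r"
    using sum_zorder_wt[OF f gd] by (simp add: A_def)
  show ?thesis
    by (rule that[OF h _ _ circ R0 mean]) (use fh lf in \<open>simp_all add: A_def\<close>)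
qed

theorem jensen:
  assumes "nzmero f" "good f r"
  shows "cmean (\<lambda>z. ln (cmod (f z))) r = lead_ln f + counting (\<lambda>z. 1 / f z) r - counting f r"
  by (rule blaschke_log_factorization[OF assms]) simp

section \<open>Calculus of the characteristic function\<close>

text \<open>Zeros are allowed on the circle, so that this condition, unlike \<open>good\<close>,
  passes to sums; it suffices for the proximity function.\<close>

definition reg :: "(complex \<Rightarrow> complex) \<Rightarrow> real \<Rightarrow> bool" where
  "reg f r \<longleftrightarrow> 0 < r \<and> (\<forall>z. cmod z = r \<longrightarrow> f analytic_on {z})"

lemma good_imp_reg: "good f r \<Longrightarrow> reg f r" by (simp add: good_def reg_def)

lemma reg_mult: "reg f r \<Longrightarrow> reg g r \<Longrightarrow> reg (\<lambda>z. f z * g z) r"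
  by (auto simp: reg_def intro!: analytic_intros)

lemma reg_add: "reg f r \<Longrightarrow> reg g r \<Longrightarrow> reg (\<lambda>z. f z + g z) r"
  by (auto simp: reg_def intro!: analytic_intros)

lemma reg_const: "0 < r \<Longrightarrow> reg (\<lambda>z. c) r"
  by (auto simp: reg_def)

section \<open>The positive logarithm and the proximity function\<close>

lemma log_plus_nonneg: "0 \<le> log_plus x" by (simp add: log_plus_def)

lemma log_plus_mono: "x \<le> y \<Longrightarrow> log_plus x \<le> log_plus y" by (auto simp: log_plus_def)

lemma ln_le_log_plus: "ln x \<le> log_plus x" if "0 < x"
  using that by (auto simp: log_plus_def)

lemma log_plus_le: "log_plus x \<le> c" if "0 \<le> c" "0 < x \<Longrightarrow> ln x \<le> c"
  using that by (cases "x \<le> 1") (auto simp: log_plus_def max_def)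

lemma log_plus_diff: "0 < x \<Longrightarrow> log_plus x - log_plus (1 / x) = ln x"
  by (cases "x \<le> 1") (auto simp: log_plus_def max_def ln_div)

lemma log_plus_abs: "0 < x \<Longrightarrow> log_plus x + log_plus (1 / x) = \<bar>ln x\<bar>"
  by (cases "x \<le> 1") (auto simp: log_plus_def max_def ln_div)

lemma log_plus_mult: "0 \<le> x \<Longrightarrow> 0 \<le> y \<Longrightarrow> log_plus (x * y) \<le> log_plus x + log_plus y"
  by (rule log_plus_le)
     (auto simp: zero_less_mult_iff ln_mult log_plus_nonneg intro!: add_mono ln_le_log_plus)

lemma log_plus_add:
  assumes "0 \<le> x" "0 \<le> y" shows "log_plus (x + y) \<le> log_plus x + log_plus y + ln 2"
proof -
  have "log_plus (x + y) \<le> log_plus (2 * max x y)" by (rule log_plus_mono) auto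
  also have "\<dots> \<le> log_plus 2 + log_plus (max x y)" by (rule log_plus_mult) (use assms in auto)
  also have "log_plus 2 = ln 2" by (simp add: log_plus_def)
  also have "log_plus (max x y) \<le> log_plus x + log_plus y"
    using log_plus_nonneg[of x] log_plus_nonneg[of y] by (auto simp: max_def)
  finally show ?thesis by linarith
qed

lemma continuous_on_log_plus: "continuous_on A u \<Longrightarrow> continuous_on A (\<lambda>z. log_plus (u z))"
  unfolding log_plus_def by (intro continuous_on_ln continuous_on_max continuous_on_const) (assumption, smt)

lemma reg_continuous: "reg f r \<Longrightarrow> continuous_on (sphere 0 r) f"
  by (rule continuous_at_imp_continuous_on)
     (auto simp: reg_def intro: analytic_at_imp_isCont)

lemma reg_log_plus_continuous:
  assumes "reg f r" shows "continuous_on (sphere 0 r) (\<lambda>z. log_plus (cmod (f z)))"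
  by (intro continuous_on_log_plus continuous_on_norm reg_continuous assms)

lemma good_ln_continuous:
  assumes "good f r" shows "continuous_on (sphere 0 r) (\<lambda>z. ln (cmod (f z)))"
  by (intro continuous_on_ln continuous_on_norm good_continuous assms) (use assms in \<open>auto simp: good_def\<close>)

lemma proximity_nonneg: "reg f r \<Longrightarrow> 0 \<le> proximity f r"
  unfolding proximity_eq_cmean
  by (intro cmean_ge reg_log_plus_continuous) (auto simp: log_plus_nonneg reg_def)

lemma proximity_mult:
  assumes "reg f r" "reg g r" shows "proximity (\<lambda>z. f z * g z) r \<le> proximity f r + proximity g r"
proof -
  have r: "0 \<le> r" using assms by (auto simp: reg_def)
  show ?thesis unfolding proximity_eq_cmean
    by (subst cmean_add[symmetric], (intro reg_log_plus_continuous assms r)+, rule cmean_mono)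
       (auto intro!: reg_log_plus_continuous[of "\<lambda>z. f z * g z", unfolded norm_mult] reg_log_plus_continuous
          reg_mult assms r continuous_on_add simp: norm_mult log_plus_mult)
qed

lemma proximity_add:
  assumes "reg f r" "reg g r" shows "proximity (\<lambda>z. f z + g z) r \<le> proximity f r + proximity g r + ln 2"
proof -
  have r: "0 \<le> r" using assms by (auto simp: reg_def)
  have "cmean (\<lambda>z. log_plus (cmod (f z + g z))) r \<le> cmean (\<lambda>z. log_plus (cmod (f z)) + log_plus (cmod (g z)) + ln 2) r"
    by (rule cmean_mono)
       (auto intro!: reg_log_plus_continuous reg_add assms r continuous_on_add continuous_on_const
             intro: order_trans[OF log_plus_mono[OF norm_triangle_ineq] log_plus_add])
  also have "\<dots> = cmean (\<lambda>z. log_plus (cmod (f z))) r + cmean (\<lambda>z. log_plus (cmod (g z))) r + ln 2"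
    by (subst cmean_add, (intro continuous_on_add reg_log_plus_continuous assms r continuous_on_const)+,
        subst cmean_add, (intro reg_log_plus_continuous assms r)+) simp
  finally show ?thesis unfolding proximity_eq_cmean .
qed

lemma cmean_ln_eq_proximity:
  assumes "good f r"
  shows "cmean (\<lambda>z. ln (cmod (f z))) r = proximity f r - proximity (\<lambda>z. 1 / f z) r"
proof -
  have r: "0 \<le> r" using assms by (auto simp: good_def)
  have "cmean (\<lambda>z. ln (cmod (f z))) r = cmean (\<lambda>z. log_plus (cmod (f z)) - log_plus (cmod (1 / f z))) r"
    by (rule cmean_cong) (use assms r in \<open>auto simp: good_def norm_divide log_plus_diff\<close>)
  also have "\<dots> = proximity f r - proximity (\<lambda>z. 1 / f z) r"
    unfolding proximity_eq_cmean
    by (rule cmean_diff) (intro reg_log_plus_continuous good_imp_reg good_recip assms r)+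
  finally show ?thesis .
qed

lemma cmean_abs_ln_eq_proximity:
  assumes "good f r"
  shows "cmean (\<lambda>z. \<bar>ln (cmod (f z))\<bar>) r = proximity f r + proximity (\<lambda>z. 1 / f z) r"
proof -
  have r: "0 \<le> r" using assms by (auto simp: good_def)
  have "cmean (\<lambda>z. \<bar>ln (cmod (f z))\<bar>) r = cmean (\<lambda>z. log_plus (cmod (f z)) + log_plus (cmod (1 / f z))) r"
    by (rule cmean_cong) (use assms r in \<open>auto simp: good_def norm_divide log_plus_abs\<close>)
  also have "\<dots> = proximity f r + proximity (\<lambda>z. 1 / f z) r"
    unfolding proximity_eq_cmean
    by (rule cmean_add) (intro reg_log_plus_continuous good_imp_reg good_recip assms r)+
  finally show ?thesis .
qed

text \<open>Jensen's formula with \<open>ln |f|\<close> split as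
  \<open>log_plus |f| - log_plus (1 / |f|)\<close>; for the value 0 the error term is exactly
  \<open>lead_ln f\<close>.\<close>

theorem first_main_theorem:
  assumes "nzmero f" "good f r"
  shows "nevanlinna_T (\<lambda>z. 1 / f z) r = nevanlinna_T f r - lead_ln f"
  using jensen[OF assms] cmean_ln_eq_proximity[OF assms(2)] by (simp add: nevanlinna_T_def)

lemma nevanlinna_T_nonneg:
  assumes "f meromorphic_on UNIV" "reg f r" "1 \<le> r" shows "0 \<le> nevanlinna_T f r"
  using proximity_nonneg[OF assms(2)] counting_nonneg[OF assms(1,3)] by (simp add: nevanlinna_T_def)

lemma counting_le_T:
  assumes "reg f r" shows "counting f r \<le> nevanlinna_T f r"
  using proximity_nonneg[OF assms] by (simp add: nevanlinna_T_def)

lemma proximity_le_T: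
  assumes "f meromorphic_on UNIV" "1 \<le> r" shows "proximity f r \<le> nevanlinna_T f r"
  using counting_nonneg[OF assms] by (simp add: nevanlinna_T_def)

section \<open>Pole orders and counting functions of sums, products and derivatives\<close>

lemma pord_local:
  assumes "f meromorphic_on {z}" "frequently (\<lambda>w. f w \<noteq> 0) (at z)"
  shows "pord f z = nat (- zorder f z)"
proof (cases "is_pole f z")
  case False
  then show ?thesis
    using neg_zorder_imp_is_pole[of f z] assms unfolding pord_def meromorphic_at_iff by force
qed (simp add: pord_def)

lemma pole_frequently_nonzero: "is_pole f z \<Longrightarrow> frequently (\<lambda>w. f w \<noteq> 0) (at z)"
  for f :: "complex \<Rightarrow> complex"
  using non_zero_neighbour_pole[of f z] eventually_frequently at_neq_bot by blast

lemma pord_cong: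
  assumes "eventually (\<lambda>w. f w = g w) (at z)" shows "pord f z = pord g z"
  unfolding pord_def using is_pole_cong[OF assms refl] zorder_cong[OF assms refl] by simp

lemma pord_mult:
  assumes "f meromorphic_on {z}" "g meromorphic_on {z}"
  shows "pord (\<lambda>w. f w * g w) z \<le> pord f z + pord g z"
proof (cases "is_pole (\<lambda>w. f w * g w) z")
  case True
  then have "frequently (\<lambda>w. f w * g w \<noteq> 0) (at z)" by (rule pole_frequently_nonzero)
  then have fr: "frequently (\<lambda>w. f w \<noteq> 0) (at z)" "frequently (\<lambda>w. g w \<noteq> 0) (at z)"
    by (auto elim: frequently_elim1)
  from zorder_mult[OF assms(1) fr(1) assms(2) fr(2)]
  show ?thesis using True by (simp add: pord_local[OF assms(1) fr(1)] pord_local[OF assms(2) fr(2)]) (simp add: pord_def)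
qed (simp add: pord_def)

lemma pord_add:
  assumes "f meromorphic_on {z}" "g meromorphic_on {z}"
  shows "pord (\<lambda>w. f w + g w) z \<le> pord f z + pord g z"
proof (cases "is_pole (\<lambda>w. f w + g w) z")
  case True
  show ?thesis
  proof (cases "frequently (\<lambda>w. f w \<noteq> 0) (at z) \<and> frequently (\<lambda>w. g w \<noteq> 0) (at z)")
    case fr: True
    have "zorder (\<lambda>w. f w + g w) z \<ge> - int (pord f z + pord g z)"
      by (rule zorder_add_ge)
         (use fr assms pole_frequently_nonzero[OF True] in \<open>auto simp: pord_local\<close>)
    then show ?thesis using True by (simp add: pord_def[of "\<lambda>w. f w + g w"])
  next
    case False
    then consider "eventually (\<lambda>w. f w = 0) (at z)" | "eventually (\<lambda>w. g w = 0) (at z)"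
      by (auto simp: frequently_def)
    then show ?thesis
    proof cases
      case 1
      then have "pord (\<lambda>w. f w + g w) z = pord g z"
        by (intro pord_cong) (auto elim: eventually_mono)
      then show ?thesis by simp
    next
      case 2
      then have "pord (\<lambda>w. f w + g w) z = pord f z"
        by (intro pord_cong) (auto elim: eventually_mono)
      then show ?thesis by simp
    qed
  qed
qed (simp add: pord_def)

text \<open>A pole of order \<open>n \<ge> 1\<close> turns into one of order
  \<open>n + 1 \<le> 2 * n\<close>.\<close>

lemma pord_deriv:
  assumes "f meromorphic_on {z}" shows "pord (deriv f) z \<le> 2 * pord f z"
proof (cases "is_pole (deriv f) z")
  case True
  then have p: "is_pole f z" using is_pole_deriv_iff[OF assms] by simp
  have "zorder f z < 0" using isolated_pole_imp_neg_zorder p assms meromorphic_at_iff by blast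
  moreover have "zorder (deriv f) z = zorder f z - 1"
    by (rule zorder_deriv_minus_1)
       (use assms pole_frequently_nonzero[OF p] \<open>zorder f z < 0\<close> in \<open>auto simp: meromorphic_at_iff\<close>)
  ultimately show ?thesis using p True by (simp add: pord_def)
qed (simp add: pord_def)

lemma counting_mult:
  assumes "f meromorphic_on UNIV" "g meromorphic_on UNIV" "1 \<le> r"
  shows "counting (\<lambda>z. f z * g z) r \<le> counting f r + counting g r"
proof -
  have m: "f meromorphic_on {z}" "g meromorphic_on {z}" for z
    using assms meromorphic_on_subset by blast+
  have "counting (\<lambda>z. f z * g z) r \<le> (\<Sum>b\<in>{True,False}. 1 * counting (if b then f else g) r)"
    by (rule counting_subadditive)
       (use assms pord_mult[OF m] in \<open>auto intro!: meromorphic_intros simp flip: of_nat_add\<close>)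
  then show ?thesis by simp
qed

lemma counting_add:
  assumes "f meromorphic_on UNIV" "g meromorphic_on UNIV" "1 \<le> r"
  shows "counting (\<lambda>z. f z + g z) r \<le> counting f r + counting g r"
proof -
  have m: "f meromorphic_on {z}" "g meromorphic_on {z}" for z
    using assms meromorphic_on_subset by blast+
  have "counting (\<lambda>z. f z + g z) r \<le> (\<Sum>b\<in>{True,False}. 1 * counting (if b then f else g) r)"
    by (rule counting_subadditive)
       (use assms pord_add[OF m] in \<open>auto intro!: meromorphic_intros simp flip: of_nat_add\<close>)
  then show ?thesis by simp
qed

lemma counting_deriv:
  assumes "f meromorphic_on UNIV" "1 \<le> r"
  shows "counting (deriv f) r \<le> 2 * counting f r"
proof -
  have m: "f meromorphic_on {z}" for z
    using assms meromorphic_on_subset by blast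
  have "counting (deriv f) r \<le> (\<Sum>b\<in>{True}. 2 * counting f r)"
    by (rule counting_subadditive)
       (use assms pord_deriv[OF m] of_nat_mono[OF pord_deriv[OF m]] in \<open>auto intro!: meromorphic_intros\<close>)
  then show ?thesis by simp
qed

lemma counting_const: "counting (\<lambda>z. c) r = 0" if "0 < r"
proof -
  have "\<not> is_pole (\<lambda>z. c) z" for z :: complex
    by (rule analytic_at_imp_no_pole) simp
  then show ?thesis using that
    by (subst counting_eq'[OF _ that]) (auto simp: pord_def)
qed

lemma T_mult:
  assumes "f meromorphic_on UNIV" "g meromorphic_on UNIV" "reg f r" "reg g r" "1 \<le> r"
  shows "nevanlinna_T (\<lambda>z. f z * g z) r \<le> nevanlinna_T f r + nevanlinna_T g r"
  using proximity_mult[OF assms(3,4)] counting_mult[OF assms(1,2,5)] by (simp add: nevanlinna_T_def)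

lemma T_add:
  assumes "f meromorphic_on UNIV" "g meromorphic_on UNIV" "reg f r" "reg g r" "1 \<le> r"
  shows "nevanlinna_T (\<lambda>z. f z + g z) r \<le> nevanlinna_T f r + nevanlinna_T g r + ln 2"
  using proximity_add[OF assms(3,4)] counting_add[OF assms(1,2,5)] by (simp add: nevanlinna_T_def)

lemma T_const: "nevanlinna_T (\<lambda>z. c) r = log_plus (cmod c)" if "0 < r"
  using counting_const[OF that] by (simp add: nevanlinna_T_def proximity_eq_cmean)

lemma counting_minus_const:
  assumes "f meromorphic_on UNIV" "1 \<le> r"
  shows "counting (\<lambda>z. f z - a) r = counting f r"
proof (rule antisym)
  show "counting (\<lambda>z. f z - a) r \<le> counting f r"
    using counting_add[OF assms(1) meromorphic_on_const, of r "- a"] assms counting_const[of r "-a"] by simp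
  have "(\<lambda>z. f z - a) meromorphic_on UNIV" using assms by (intro meromorphic_intros) auto
  from counting_add[OF this meromorphic_on_const, of r a] show "counting f r \<le> counting (\<lambda>z. f z - a) r"
    using assms counting_const[of r a] by simp
qed

section \<open>The characteristic function of the derivative\<close>

lemma cmean_ln_blaschke:
  assumes p: "cmod p < \<rho>" and r: "0 < r" "r < \<rho>" and ne: "cmod p \<noteq> r"
  shows "cmean (\<lambda>z. ln (cmod (blaschke \<rho> p z))) r = ln (max r (cmod p) / \<rho>)"
proof -
  have main: "cmean (\<lambda>z. ln (cmod (u z))) r = ln (cmod (u 0))"
    if u: "\<And>z. cmod z \<le> r \<Longrightarrow> u analytic_on {z} \<and> u z \<noteq> 0" for u
  proof -
    obtain h R where h: "r < R" "h holomorphic_on ball 0 R" "\<And>z. z \<in> ball 0 R \<Longrightarrow> u z = exp (h z)"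
      using holomorphic_log_cball[OF r(1) u] by blast
    have "cmean (\<lambda>z. ln (cmod (u z))) r = cmean (\<lambda>z. Re (h z)) r"
      by (rule cmean_cong) (use h r in auto)
    then show ?thesis using cmean_Re_holomorphic[OF h(2) r(1) h(1)] h r by simp
  qed
  show ?thesis
  proof (cases "cmod p < r")
    case False
    have "cmean (\<lambda>z. ln (cmod (blaschke \<rho> p z))) r = ln (cmod (blaschke \<rho> p 0))"
      by (rule main) (use False p r ne in \<open>auto simp: blaschke_eq_0_iff intro!: blaschke_analytic\<close>)
    then show ?thesis using False r
      by (simp add: blaschke_def norm_mult norm_divide norm_power power2_eq_square)
  next
    case True
    \<comment> \<open>The zero \<open>p\<close> inside the smaller disc is removed by dividing by
      \<open>blaschke r p\<close>, which has modulus 1 on the circle of integration;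
      \<open>u\<close> is zero-free, and the mean value property applies to
      \<open>ln |u|\<close>.\<close>
    define u where "u = (\<lambda>z. of_real \<rho> * (of_real (r\<^sup>2) - cnj p * z) / (of_real r * (of_real (\<rho>\<^sup>2) - cnj p * z)))"
    have d: "of_real (\<rho>\<^sup>2) - cnj p * z \<noteq> 0" "of_real (r\<^sup>2) - cnj p * z \<noteq> 0" if "cmod z \<le> r" for z
      using blaschke_denom_nonzero[of p \<rho> z] blaschke_denom_nonzero[of p r z] that True r p by auto
    have "cmean (\<lambda>z. ln (cmod (u z))) r = ln (cmod (u 0))"
      by (rule main) (use d r in \<open>auto simp: u_def intro!: analytic_intros\<close>)
    also have "cmod (u 0) = r / \<rho>"
      using r by (simp add: u_def norm_mult norm_divide norm_power power2_eq_square)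
    finally have 1: "cmean (\<lambda>z. ln (cmod (u z))) r = ln (r / \<rho>)" .
    have "cmod (blaschke \<rho> p z) = cmod (u z)" if "cmod z = r" for z
    proof -
      have "cmod (blaschke r p z) = 1" using True that by (rule blaschke_norm_eq_1)
      moreover have "blaschke \<rho> p z = u z * blaschke r p z"
        using d[of z] that r by (simp add: u_def blaschke_def)
      ultimately show ?thesis by (simp add: norm_mult)
    qed
    then have "cmean (\<lambda>z. ln (cmod (blaschke \<rho> p z))) r = cmean (\<lambda>z. ln (cmod (u z))) r"
      by (intro cmean_cong) (use r in auto)
    then show ?thesis using 1 True by (simp add: max_def)
  qed
qed

lemma cauchy_deriv_bound:
  assumes "f holomorphic_on ball 0 \<rho>" "0 < s" "cmod z + s < \<rho>" "\<And>w. cmod (w - z) \<le> s \<Longrightarrow> cmod (f w) \<le> M"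
  shows "cmod (deriv f z) \<le> M / s"
proof -
  have sub: "cball z s \<subseteq> ball 0 \<rho>"
  proof
    fix w assume "w \<in> cball z s"
    then have "cmod (w - z) \<le> s" by (simp add: dist_norm norm_minus_commute)
    then show "w \<in> ball 0 \<rho>" using norm_triangle_ineq[of z "w - z"] assms(3) by simp
  qed
  have "cmod ((deriv ^^ 1) f z) \<le> fact 1 * M / s ^ 1"
    by (rule Cauchy_inequality)
       (use assms sub in \<open>auto intro!: holomorphic_on_subset[OF assms(1)] holomorphic_on_imp_continuous_on
          simp: norm_minus_commute\<close>)
  then show ?thesis by simp
qed

text \<open>The poles of \<open>f\<close> are split off as a Blaschke product \<open>B\<close> of a larger disc, so that \<open>f = E / B\<close>
  with \<open>E\<close> bounded in terms of the boundary values of \<open>f\<close>, and \<open>f' = (E' B - E B') / B\<^sup>2\<close>.\<close>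

lemma T_deriv:
  assumes f: "nzmero f" and gr: "good f r" and g\<rho>: "good f \<rho>" and r: "1 \<le> r" "2 * r \<le> \<rho>" "4 \<le> \<rho>"
  shows "nevanlinna_T (deriv f) r \<le> 20 * nevanlinna_T f \<rho> + 7 * \<bar>lead_ln f\<bar> + ln 2"
proof -
  obtain h R where h: "\<rho> < R" "h holomorphic_on ball 0 R"
    and fh: "\<And>z. cmod z \<le> \<rho> \<Longrightarrow> f analytic_on {z} \<Longrightarrow> zorder f z = 0 \<Longrightarrow>
       f z = exp (h z) * (\<Prod>p | cmod p < \<rho> \<and> zorder f p \<noteq> 0. blaschke \<rho> p z powi zorder f p)"
    and circ: "\<And>z. cmod z = \<rho> \<Longrightarrow> ln (cmod (f z)) = Re (h z)"
    and mean: "cmean (\<lambda>z. ln (cmod (f z))) \<rho> = Re (h 0)"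
    by (rule blaschke_log_factorization[OF f g\<rho>], rule that) assumption+
  have \<rho>0: "\<rho> > 0" using r by simp
  define M where "M = cmean (\<lambda>z. \<bar>Re (h z)\<bar>) \<rho>"
  have Mf: "M = proximity f \<rho> + proximity (\<lambda>z. 1 / f z) \<rho>"
    unfolding M_def cmean_abs_ln_eq_proximity[OF g\<rho>, symmetric]
    by (rule cmean_cong) (use circ \<rho>0 in auto)
  have M2: "M \<le> 2 * nevanlinna_T f \<rho> + \<bar>lead_ln f\<bar>"
    using Mf first_main_theorem[OF f g\<rho>]
      proximity_le_T[OF nzmero_meromorphic[OF f], of \<rho>]
      proximity_le_T[OF nzmero_meromorphic[OF nzmero_inverse[OF f]], of \<rho>] r by simp
  have M0: "0 \<le> M" unfolding Mf
    using proximity_nonneg[OF good_imp_reg[OF g\<rho>]] proximity_nonneg[OF good_imp_reg[OF good_recip[OF g\<rho>]]] by simp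
  have hc: "continuous_on (sphere 0 \<rho>) (\<lambda>z. Re (h z))"
    by (intro continuous_intros holomorphic_on_imp_continuous_on holomorphic_on_subset[OF h(2)]) (use h in auto)
  have h0: "\<bar>Re (h 0)\<bar> \<le> M"
  proof -
    have 1: "cmean (\<lambda>z. Re (h z)) \<rho> = Re (h 0)" by (rule cmean_Re_holomorphic[OF h(2) \<rho>0 h(1)])
    have "cmean (\<lambda>z. Re (h z)) \<rho> \<le> M" unfolding M_def
      by (rule cmean_mono) (use hc \<rho>0 in \<open>auto intro!: continuous_on_rabs\<close>)
    moreover have "cmean (\<lambda>z. - 1 * Re (h z)) \<rho> \<le> M" unfolding M_def
      by (rule cmean_mono) (use hc \<rho>0 in \<open>auto intro!: continuous_on_rabs continuous_on_minus\<close>)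
    ultimately show ?thesis using 1 cmean_cmult[of "-1" "\<lambda>z. Re (h z)" \<rho>] by simp
  qed
  \<comment> \<open>For \<open>|z| \<le> 3 * \<rho> / 4\<close> the quotient
    \<open>|z| / (\<rho> - |z|)\<close> is at most 3, hence 7 = 1 + 2 * 3.\<close>
  have hb: "Re (h z) \<le> 7 * M" if "cmod z \<le> 3 * \<rho> / 4" for z
  proof -
    have "Re (h z) - Re (h 0) \<le> cmod (h z - h 0)"
      using complex_Re_le_cmod[of "h z - h 0"] by simp
    also have "\<dots> \<le> 2 * M * (cmod z / (\<rho> - cmod z))"
      unfolding M_def by (rule holomorphic_dist_bound_Re[OF h(2) \<rho>0 h(1)]) (use that \<rho>0 in auto)
    also have "\<dots> \<le> 2 * M * 3"
      by (intro mult_left_mono) (use that \<rho>0 M0 in \<open>auto simp: divide_le_eq\<close>)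
    finally show ?thesis using h0 by linarith
  qed
  define A where "A = {p. cmod p < \<rho> \<and> zorder f p \<noteq> 0}"
  have finA: "finite A" unfolding A_def by (rule good_finite_zeros[OF f])
  define E where "E = (\<lambda>z. exp (h z) * (\<Prod>p\<in>A. blaschke \<rho> p z ^ nat (zorder f p)))"
  define B where "B = (\<lambda>z. \<Prod>p\<in>A. blaschke \<rho> p z ^ pord f p)"
  have bla: "blaschke \<rho> p analytic_on ball 0 \<rho>" if "p \<in> A" for p
    using that by (subst analytic_on_analytic_at) (auto simp: A_def intro!: blaschke_analytic)
  have "h holomorphic_on ball 0 \<rho>" by (rule holomorphic_on_subset[OF h(2)]) (use h in auto)
  then have Eh: "E holomorphic_on ball 0 \<rho>" unfolding E_def
    by (intro holomorphic_on_mult holomorphic_on_exp' holomorphic_on_prod holomorphic_on_power analytic_imp_holomorphic[OF bla])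
  have Bh: "B holomorphic_on ball 0 \<rho>" unfolding B_def
    by (intro holomorphic_on_prod holomorphic_on_power analytic_imp_holomorphic[OF bla])
  have b1: "cmod (\<Prod>p\<in>A. blaschke \<rho> p z ^ n p) \<le> 1" if "cmod z \<le> \<rho>" for z and n :: "complex \<Rightarrow> nat"
    unfolding prod_norm[symmetric] norm_power
    by (rule prod_le_1) (use that in \<open>auto simp: A_def intro!: power_le_one blaschke_norm_le_1\<close>)
  have Eb: "cmod (E z) \<le> exp (7 * M)" if "cmod z \<le> 3 * \<rho> / 4" for z
  proof -
    have "cmod (E z) = exp (Re (h z)) * cmod (\<Prod>p\<in>A. blaschke \<rho> p z ^ nat (zorder f p))"
      by (simp add: E_def norm_mult)
    also have "\<dots> \<le> exp (7 * M) * 1"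
      by (intro mult_mono b1) (use hb[OF that] that \<rho>0 in auto)
    finally show ?thesis by simp
  qed
  \<comment> \<open>Since \<open>2 * r \<le> \<rho>\<close>, discs of radius
    \<open>\<rho> / 4\<close> around points of the circle stay where the bounds hold; since
    \<open>4 \<le> \<rho>\<close>, Cauchy's estimate then costs no factor.\<close>
  have in_disc: "cmod w \<le> 3 * \<rho> / 4" if "cmod z = r" "cmod (w - z) \<le> \<rho> / 4" for z w
    using norm_triangle_ineq[of z "w - z"] that r by simp
  have E'b: "cmod (deriv E z) \<le> exp (7 * M)" if "cmod z = r" for z
  proof -
    have "cmod (deriv E z) \<le> exp (7 * M) / (\<rho> / 4)"
    proof (rule cauchy_deriv_bound[OF Eh])
      fix w assume "cmod (w - z) \<le> \<rho> / 4"
      then show "cmod (E w) \<le> exp (7 * M)" by (intro Eb in_disc[OF that])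
    qed (use that r in auto)
    also have "\<dots> \<le> exp (7 * M) / 1" by (rule divide_left_mono) (use r in auto)
    finally show ?thesis by simp
  qed
  have B'b: "cmod (deriv B z) \<le> 1" if "cmod z = r" for z
  proof -
    have "cmod (deriv B z) \<le> 1 / (\<rho> / 4)"
    proof (rule cauchy_deriv_bound[OF Bh])
      fix w assume "cmod (w - z) \<le> \<rho> / 4"
      then show "cmod (B w) \<le> 1" unfolding B_def by (intro b1) (use in_disc[OF that, of w] \<rho>0 in linarith)
    qed (use that r in auto)
    also have "\<dots> \<le> 1" using r by (simp add: divide_le_eq)
    finally show ?thesis .
  qed
  have Bnz: "B z \<noteq> 0" if "cmod z = r" for z
    unfolding B_def using finA that r good_zorder[OF gr that] by (auto simp: A_def blaschke_eq_0_iff)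
  have f'b: "cmod (deriv f z) \<le> 2 * exp (7 * M) / (cmod (B z))\<^sup>2" if z: "cmod z = r" for z
  proof -
    have fa: "f analytic_on {z}" "f z \<noteq> 0" using gr z by (auto simp: good_def)
    then obtain S where S: "open S" "z \<in> S" "f holomorphic_on S" using analytic_at by blast
    have "isCont f z" using fa analytic_at_imp_isCont by blast
    then have "eventually (\<lambda>w. f w \<noteq> 0) (nhds z)"
      using fa(2) tendsto_imp_eventually_ne[of f "f z" "at z" 0] by (simp add: isCont_def eventually_nhds_conv_at)
    moreover have "eventually (\<lambda>w. w \<in> S) (nhds z)" using S by (simp add: eventually_nhds_in_open)
    moreover have "eventually (\<lambda>w. w \<in> ball 0 \<rho>) (nhds z)" using z r by (intro eventually_nhds_in_open) auto
    ultimately have "eventually (\<lambda>w. f w = E w / B w) (nhds z)"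
    proof eventually_elim
      case (elim w)
      have fw: "f analytic_on {w}" using S elim by (auto simp: analytic_at)
      have "f w = exp (h w) * (\<Prod>p\<in>A. blaschke \<rho> p w powi zorder f p)"
        unfolding A_def by (rule fh) (use elim fw in \<open>auto intro!: zorder_eq_0I\<close>)
      also have "(\<Prod>p\<in>A. blaschke \<rho> p w powi zorder f p) = (\<Prod>p\<in>A. blaschke \<rho> p w ^ nat (zorder f p) / blaschke \<rho> p w ^ pord f p)"
        by (rule prod.cong) (auto simp: pord_eq_zorder[OF f] power_int_def field_simps)
      finally show ?case by (simp add: E_def B_def prod_dividef)
    qed
    then have "deriv f z = deriv (\<lambda>w. E w / B w) z" by (intro deriv_cong_ev) auto
    also have "\<dots> = (deriv E z * B z - E z * deriv B z) / (B z)\<^sup>2"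
      using holomorphic_on_imp_differentiable_at[OF Eh] holomorphic_on_imp_differentiable_at[OF Bh] z r Bnz[OF z]
      by (intro deriv_divide) (auto simp: field_differentiable_def)
    also have "cmod \<dots> \<le> (cmod (deriv E z) * cmod (B z) + cmod (E z) * cmod (deriv B z)) / (cmod (B z))\<^sup>2"
      unfolding norm_divide norm_power norm_mult[symmetric] by (intro divide_right_mono norm_triangle_ineq4) auto
    also have "\<dots> \<le> (exp (7 * M) * 1 + exp (7 * M) * 1) / (cmod (B z))\<^sup>2"
      by (intro divide_right_mono add_mono mult_mono E'b B'b Eb z)
         (use z r in \<open>auto simp: B_def intro!: b1\<close>)
    finally show ?thesis by simp
  qed
  have reg': "reg (deriv f) r"
    using gr by (auto simp: reg_def good_def intro!: analytic_intros)
  have lnB: "ln (cmod (B z)) = (\<Sum>p\<in>A. real (pord f p) * ln (cmod (blaschke \<rho> p z)))" if z: "cmod z = r" for z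
  proof -
    have nz: "blaschke \<rho> p z \<noteq> 0" if "p \<in> A" for p
      using that z r good_zorder[OF gr z] by (auto simp: A_def blaschke_eq_0_iff)
    then show ?thesis unfolding B_def prod_norm[symmetric] norm_power
      by (subst ln_prod[OF finA]) (auto simp: ln_realpow)
  qed
  have blc: "continuous_on (sphere 0 r) (\<lambda>z. ln (cmod (blaschke \<rho> p z)))" if "p \<in> A" for p
    using that r good_zorder[OF gr]
    by (intro continuous_on_ln continuous_on_norm holomorphic_on_imp_continuous_on
          holomorphic_on_subset[OF analytic_imp_holomorphic[OF bla]]) (auto simp: A_def blaschke_eq_0_iff)
  have "proximity (deriv f) r \<le> cmean (\<lambda>z. (ln 2 + 7 * M) + - 2 * (\<Sum>p\<in>A. real (pord f p) * ln (cmod (blaschke \<rho> p z)))) r"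
    unfolding proximity_eq_cmean
  proof (rule cmean_mono)
    show "continuous_on (sphere 0 r) (\<lambda>z. log_plus (cmod (deriv f z)))" by (rule reg_log_plus_continuous[OF reg'])
    show "continuous_on (sphere 0 r) (\<lambda>z. ln 2 + 7 * M + - 2 * (\<Sum>p\<in>A. real (pord f p) * ln (cmod (blaschke \<rho> p z))))"
      by (intro continuous_intros blc)
    show "0 \<le> r" using r by simp
    fix z assume z: "cmod z = r"
    have B1: "cmod (B z) \<le> 1" unfolding B_def by (rule b1) (use z r in auto)
    show "log_plus (cmod (deriv f z)) \<le> ln 2 + 7 * M + - 2 * (\<Sum>p\<in>A. real (pord f p) * ln (cmod (blaschke \<rho> p z)))"
    proof (rule log_plus_le)
      show "0 \<le> ln 2 + 7 * M + - 2 * (\<Sum>p\<in>A. real (pord f p) * ln (cmod (blaschke \<rho> p z)))"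
      proof -
        have "ln (cmod (B z)) \<le> 0" using B1 Bnz[OF z] by simp
        moreover have "0 \<le> ln (2 :: real)" by simp
        ultimately have "0 \<le> ln 2 + 7 * M + - 2 * ln (cmod (B z))" using M0 by linarith
        then show ?thesis by (simp only: lnB[OF z])
      qed
      assume "0 < cmod (deriv f z)"
      then have "ln (cmod (deriv f z)) \<le> ln (2 * exp (7 * M) / (cmod (B z))\<^sup>2)"
        using f'b[OF z] Bnz[OF z] by (subst ln_le_cancel_iff) auto
      also have "\<dots> = ln 2 + 7 * M - 2 * ln (cmod (B z))"
        using Bnz[OF z] by (simp add: ln_div ln_mult ln_realpow)
      finally show "ln (cmod (deriv f z)) \<le> ln 2 + 7 * M + - 2 * (\<Sum>p\<in>A. real (pord f p) * ln (cmod (blaschke \<rho> p z)))"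
        by (simp add: lnB[OF z])
    qed
  qed
  also have "\<dots> = ln 2 + 7 * M + - 2 * (\<Sum>p\<in>A. real (pord f p) * cmean (\<lambda>z. ln (cmod (blaschke \<rho> p z))) r)"
  proof -
    have "cmean (\<lambda>z. \<Sum>p\<in>A. real (pord f p) * ln (cmod (blaschke \<rho> p z))) r
        = (\<Sum>p\<in>A. real (pord f p) * cmean (\<lambda>z. ln (cmod (blaschke \<rho> p z))) r)"
      using r by (subst cmean_sum[OF finA]) (auto intro!: continuous_intros blc simp: cmean_cmult)
    moreover have "cmean (\<lambda>z. (ln 2 + 7 * M) + - 2 * (\<Sum>p\<in>A. real (pord f p) * ln (cmod (blaschke \<rho> p z)))) r
        = (ln 2 + 7 * M) + cmean (\<lambda>z. - 2 * (\<Sum>p\<in>A. real (pord f p) * ln (cmod (blaschke \<rho> p z)))) r"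
      using r by (subst cmean_add) (auto intro!: continuous_intros blc)
    ultimately show ?thesis by (simp only: cmean_cmult)
  qed
  also have "\<dots> = ln 2 + 7 * M + 2 * (\<Sum>p\<in>A. real (pord f p) * - cmean (\<lambda>z. ln (cmod (blaschke \<rho> p z))) r)"
    by (simp add: sum_negf)
  \<comment> \<open>Each pole pays at most its weight at radius \<open>\<rho>\<close>, so the mean
    of \<open>- ln |B|\<close> is bounded by the counting function.\<close>
  also have "(\<Sum>p\<in>A. real (pord f p) * - cmean (\<lambda>z. ln (cmod (blaschke \<rho> p z))) r) \<le> (\<Sum>p\<in>A. real (pord f p) * wt \<rho> p)"
  proof (intro sum_mono mult_left_mono)
    fix p assume p: "p \<in> A"
    have "cmean (\<lambda>z. ln (cmod (blaschke \<rho> p z))) r = ln (max r (cmod p) / \<rho>)"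
      by (rule cmean_ln_blaschke) (use p r good_zorder[OF gr] in \<open>auto simp: A_def\<close>)
    also have "\<dots> = ln (max r (cmod p)) - ln \<rho>" using r by (subst ln_div) auto
    finally show "- cmean (\<lambda>z. ln (cmod (blaschke \<rho> p z))) r \<le> wt \<rho> p"
      using p r by (auto simp: wt_def A_def)
  qed auto
  also have "(\<Sum>p\<in>A. real (pord f p) * wt \<rho> p) = counting f \<rho>"
  proof (rule counting_eq[symmetric, OF nzmero_meromorphic[OF f] \<rho>0 finA])
    fix z assume "cmod z \<le> \<rho>" "pord f z \<noteq> 0"
    then have "zorder f z \<noteq> 0" by (auto simp: pord_eq_zorder[OF f])
    with \<open>cmod z \<le> \<rho>\<close> good_zorder[OF g\<rho>, of z] show "z \<in> A" by (force simp: A_def)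
  qed
  finally have "proximity (deriv f) r \<le> ln 2 + 7 * M + 2 * counting f \<rho>" by simp
  moreover have "counting (deriv f) r \<le> 2 * counting f \<rho>"
    using counting_deriv[OF nzmero_meromorphic[OF f], of r] counting_mono[OF nzmero_meromorphic[OF f], of r \<rho>] r by simp
  moreover have "4 * counting f \<rho> + 14 * nevanlinna_T f \<rho> \<le> 20 * nevanlinna_T f \<rho>"
    using counting_le_T[OF good_imp_reg[OF g\<rho>]]
      nevanlinna_T_nonneg[OF nzmero_meromorphic[OF f] good_imp_reg[OF g\<rho>]] r by simp
  ultimately show ?thesis using M2 by (simp add: nevanlinna_T_def)
qed

section \<open>A second main theorem\<close>

lemma has_field_derivative_prod_log:
  fixes g :: "'a \<Rightarrow> complex \<Rightarrow> complex"
  assumes "finite A" "\<And>p. p \<in> A \<Longrightarrow> (g p has_field_derivative (d p * g p z)) (at z)"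
  shows "((\<lambda>w. \<Prod>p\<in>A. g p w) has_field_derivative ((\<Sum>p\<in>A. d p) * (\<Prod>p\<in>A. g p z))) (at z)"
  using assms
proof (induction A rule: finite_induct)
  case (insert a A)
  have "((\<lambda>w. g a w * (\<Prod>p\<in>A. g p w)) has_field_derivative
      (g a z * ((\<Sum>p\<in>A. d p) * (\<Prod>p\<in>A. g p z)) + d a * g a z * (\<Prod>p\<in>A. g p z))) (at z)"
    by (intro DERIV_mult' insert) auto
  then show ?case using insert.hyps by (simp add: algebra_simps)
qed auto

lemma has_field_derivative_blaschke_powi:
  assumes "cmod p < \<rho>" "cmod z \<le> \<rho>" "z \<noteq> p"
  shows "((\<lambda>w. blaschke \<rho> p w powi e) has_field_derivative
    (of_int e * (1 / (z - p) + cnj p / (of_real (\<rho>\<^sup>2) - cnj p * z)) * blaschke \<rho> p z powi e)) (at z)"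
proof -
  define D where "D = of_real (\<rho>\<^sup>2) - cnj p * z"
  have D: "D \<noteq> 0" unfolding D_def by (rule blaschke_denom_nonzero[OF assms(1,2)])
  have b: "blaschke \<rho> p z \<noteq> 0" using assms by (simp add: blaschke_eq_0_iff)
  have bD: "blaschke \<rho> p z = of_real \<rho> * (z - p) / D" by (simp add: blaschke_def D_def)
  have "(blaschke \<rho> p has_field_derivative
      ((of_real \<rho> * 1) * D - of_real \<rho> * (z - p) * (0 - cnj p * 1)) / (D * D)) (at z)"
    unfolding blaschke_def[abs_def] D_def
    by (rule derivative_eq_intros refl)+ (use D in \<open>auto simp: D_def\<close>)
  also have "((of_real \<rho> * 1) * D - of_real \<rho> * (z - p) * (0 - cnj p * 1)) / (D * D)
      = blaschke \<rho> p z * (1 / (z - p) + cnj p / D)"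
    unfolding bD using D assms(3) by (simp add: divide_simps) (simp add: algebra_simps)
  finally have "((\<lambda>w. blaschke \<rho> p w powi e) has_field_derivative
     (of_int e * blaschke \<rho> p z powi (e - 1) * (blaschke \<rho> p z * (1 / (z - p) + cnj p / D)))) (at z)"
    using b by (intro DERIV_power_int) auto
  also have "of_int e * blaschke \<rho> p z powi (e - 1) * (blaschke \<rho> p z * (1 / (z - p) + cnj p / D))
     = of_int e * (1 / (z - p) + cnj p / D) * blaschke \<rho> p z powi e"
    using b by (simp add: power_int_diff)
  finally show ?thesis by (simp add: D_def)
qed

lemma eventually_nhds_good_point:
  assumes "f analytic_on {z}" "f z \<noteq> 0"
  shows "eventually (\<lambda>w. f analytic_on {w} \<and> f w \<noteq> 0) (nhds z)"
proof -
  obtain S where S: "open S" "z \<in> S" "f holomorphic_on S" using assms analytic_at by blast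
  have "isCont f z" using assms analytic_at_imp_isCont by blast
  then have "eventually (\<lambda>w. f w \<noteq> 0) (nhds z)"
    using assms(2) tendsto_imp_eventually_ne[of f "f z" "at z" 0] by (simp add: isCont_def eventually_nhds_conv_at)
  moreover have "eventually (\<lambda>w. w \<in> S) (nhds z)" using S by (simp add: eventually_nhds_in_open)
  ultimately show ?thesis by eventually_elim (use S in \<open>auto simp: analytic_at\<close>)
qed

text \<open>The logarithmic derivative of \<open>f = exp h * product\<close> is
  \<open>deriv h\<close> plus one term for each Blaschke factor. The first is controlled by the
  boundary values through \<open>holomorphic_dist_bound_Re\<close> and Cauchy's estimate; the others
  consist of \<open>1 / (z - p)\<close>, at most \<open>1 / \<sigma>\<close>, and of the
  contribution of the reflected point, at most \<open>1 / (\<rho> - |z|)\<close>.\<close>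

lemma log_deriv_bound:
  assumes f: "nzmero f" and g\<rho>: "good f \<rho>" and z: "cmod z < \<rho>" "f analytic_on {z}" "f z \<noteq> 0"
    and \<sigma>: "0 < \<sigma>" "\<And>p. cmod p < \<rho> \<Longrightarrow> zorder f p \<noteq> 0 \<Longrightarrow> \<sigma> \<le> cmod (z - p)"
  shows "cmod (deriv f z) \<le> cmod (f z) *
    (8 * (proximity f \<rho> + proximity (\<lambda>z. 1 / f z) \<rho>) * \<rho> / (\<rho> - cmod z)\<^sup>2
     + (\<Sum>p | cmod p < \<rho> \<and> zorder f p \<noteq> 0. \<bar>real_of_int (zorder f p)\<bar>) * (1 / \<sigma> + 1 / (\<rho> - cmod z)))"
proof -
  obtain h R where h: "\<rho> < R" "h holomorphic_on ball 0 R"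
    and fh: "\<And>z. cmod z \<le> \<rho> \<Longrightarrow> f analytic_on {z} \<Longrightarrow> zorder f z = 0 \<Longrightarrow>
       f z = exp (h z) * (\<Prod>p | cmod p < \<rho> \<and> zorder f p \<noteq> 0. blaschke \<rho> p z powi zorder f p)"
    and circ: "\<And>z. cmod z = \<rho> \<Longrightarrow> ln (cmod (f z)) = Re (h z)"
    by (rule blaschke_log_factorization[OF f g\<rho>], rule that) assumption+
  have \<rho>0: "\<rho> > 0" using g\<rho> by (rule good_pos)
  define M where "M = cmean (\<lambda>z. \<bar>Re (h z)\<bar>) \<rho>"
  have Mf: "M = proximity f \<rho> + proximity (\<lambda>z. 1 / f z) \<rho>"
    unfolding M_def cmean_abs_ln_eq_proximity[OF g\<rho>, symmetric]
    by (rule cmean_cong) (use circ \<rho>0 in auto)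
  have M0: "0 \<le> M" unfolding Mf
    using proximity_nonneg[OF good_imp_reg[OF g\<rho>]] proximity_nonneg[OF good_imp_reg[OF good_recip[OF g\<rho>]]] by simp
  define A where "A = {p. cmod p < \<rho> \<and> zorder f p \<noteq> 0}"
  have finA: "finite A" unfolding A_def by (rule good_finite_zeros[OF f])
  define d where "d = (\<lambda>p. of_int (zorder f p) * (1 / (z - p) + cnj p / (of_real (\<rho>\<^sup>2) - cnj p * z)))"
  have hol: "h holomorphic_on ball 0 \<rho>" by (rule holomorphic_on_subset[OF h(2)]) (use h in auto)
  have zA: "z \<noteq> p" if "p \<in> A" for p using \<sigma> that by (force simp: A_def)
  have "eventually (\<lambda>w. f analytic_on {w} \<and> f w \<noteq> 0) (nhds z)" by (rule eventually_nhds_good_point[OF z(2,3)])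
  moreover have "eventually (\<lambda>w. w \<in> ball 0 \<rho>) (nhds z)" using z by (intro eventually_nhds_in_open) auto
  ultimately have ev: "eventually (\<lambda>w. f w = exp (h w) * (\<Prod>p\<in>A. blaschke \<rho> p w powi zorder f p)) (nhds z)"
    unfolding A_def by eventually_elim (rule fh, auto intro!: zorder_eq_0I)
  have dh: "(h has_field_derivative deriv h z) (at z)"
    using holomorphic_derivI[OF hol] z by auto
  have dprod: "((\<lambda>w. \<Prod>p\<in>A. blaschke \<rho> p w powi zorder f p) has_field_derivative
        ((\<Sum>p\<in>A. d p) * (\<Prod>p\<in>A. blaschke \<rho> p z powi zorder f p))) (at z)"
    unfolding d_def
    by (rule has_field_derivative_prod_log[OF finA], rule has_field_derivative_blaschke_powi)
       (use z zA in \<open>auto simp: A_def\<close>)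
  have "((\<lambda>w. exp (h w) * (\<Prod>p\<in>A. blaschke \<rho> p w powi zorder f p)) has_field_derivative
      (exp (h z) * ((\<Sum>p\<in>A. d p) * (\<Prod>p\<in>A. blaschke \<rho> p z powi zorder f p))
        + exp (h z) * deriv h z * (\<Prod>p\<in>A. blaschke \<rho> p z powi zorder f p))) (at z)"
    by (intro DERIV_mult' dprod DERIV_fun_exp dh)
  then have "deriv (\<lambda>w. exp (h w) * (\<Prod>p\<in>A. blaschke \<rho> p w powi zorder f p)) z
    = (exp (h z) * (\<Prod>p\<in>A. blaschke \<rho> p z powi zorder f p)) * (deriv h z + (\<Sum>p\<in>A. d p))"
    by (subst DERIV_imp_deriv, assumption) (simp add: algebra_simps)
  moreover have "f z = exp (h z) * (\<Prod>p\<in>A. blaschke \<rho> p z powi zorder f p)"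
    using ev by (rule eventually_nhds_x_imp_x)
  moreover have "deriv f z = deriv (\<lambda>w. exp (h w) * (\<Prod>p\<in>A. blaschke \<rho> p w powi zorder f p)) z"
    by (rule deriv_cong_ev[OF ev refl])
  ultimately have df: "deriv f z = f z * (deriv h z + (\<Sum>p\<in>A. d p))" by simp
  have h': "cmod (deriv h z) \<le> 8 * M * \<rho> / (\<rho> - cmod z)\<^sup>2"
  proof -
    \<comment> \<open>Half of the distance to the circle goes into the disc for Cauchy's estimate
      and half into the bound for \<open>h\<close>, which gives 8 = 2 * 2 * 2.\<close>
    define s where "s = (\<rho> - cmod z) / 2"
    have s: "s > 0" using z by (simp add: s_def)
    have "cmod (deriv (\<lambda>w. h w - h 0) z) \<le> (2 * M * (\<rho> / s)) / s"
    proof (rule cauchy_deriv_bound)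
      show "(\<lambda>w. h w - h 0) holomorphic_on ball 0 \<rho>" by (intro holomorphic_intros hol)
      show "cmod z + s < \<rho>" using z by (simp add: s_def field_simps)
      fix w assume w: "cmod (w - z) \<le> s"
      have w1: "cmod w \<le> \<rho> - s" using norm_triangle_ineq[of z "w - z"] w by (simp add: s_def field_simps)
      have "cmod (h w - h 0) \<le> 2 * M * (cmod w / (\<rho> - cmod w))"
        unfolding M_def by (rule holomorphic_dist_bound_Re[OF h(2) \<rho>0 h(1)]) (use w1 s in auto)
      also have "\<dots> \<le> 2 * M * (\<rho> / s)"
        by (intro mult_left_mono frac_le) (use w1 s M0 \<rho>0 in auto)
      finally show "cmod (h w - h 0) \<le> 2 * M * (\<rho> / s)" .
    qed (use s in auto)
    also have "deriv (\<lambda>w. h w - h 0) z = deriv h z"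
      using dh by (intro DERIV_imp_deriv derivative_eq_intros) auto
    also have "(2 * M * (\<rho> / s)) / s = 8 * M * \<rho> / (\<rho> - cmod z)\<^sup>2"
      using z by (simp add: s_def power2_eq_square)
    finally show ?thesis .
  qed
  have dp: "cmod (d p) \<le> \<bar>real_of_int (zorder f p)\<bar> * (1 / \<sigma> + 1 / (\<rho> - cmod z))" if p: "p \<in> A" for p
  proof -
    have "cmod (1 / (z - p)) \<le> 1 / \<sigma>"
      using \<sigma>(1) \<sigma>(2)[of p] p unfolding norm_divide norm_one by (intro frac_le) (auto simp: A_def)
    moreover have "cmod (cnj p / (of_real (\<rho>\<^sup>2) - cnj p * z)) \<le> 1 / (\<rho> - cmod z)"
    proof -
      have "cmod (cnj p * z) \<le> \<rho> * cmod z" using p by (auto simp: norm_mult A_def intro: mult_right_mono)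
      then have "\<rho> * (\<rho> - cmod z) \<le> cmod (of_real (\<rho>\<^sup>2)) - cmod (cnj p * z)"
        by (simp add: power2_eq_square algebra_simps norm_mult)
      also have "\<dots> \<le> cmod (of_real (\<rho>\<^sup>2) - cnj p * z)" by (rule norm_triangle_ineq2)
      finally have "cmod (cnj p / (of_real (\<rho>\<^sup>2) - cnj p * z)) \<le> \<rho> / (\<rho> * (\<rho> - cmod z))"
        unfolding norm_divide using p z \<rho>0 by (intro frac_le) (auto simp: A_def)
      then show ?thesis using \<rho>0 by simp
    qed
    ultimately have "cmod (1 / (z - p) + cnj p / (of_real (\<rho>\<^sup>2) - cnj p * z)) \<le> 1 / \<sigma> + 1 / (\<rho> - cmod z)"
      by (meson add_mono norm_triangle_ineq order_trans)
    then show ?thesis unfolding d_def norm_mult by (intro mult_mono) auto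
  qed
  have "cmod (\<Sum>p\<in>A. d p) \<le> (\<Sum>p\<in>A. \<bar>real_of_int (zorder f p)\<bar> * (1 / \<sigma> + 1 / (\<rho> - cmod z)))"
    by (rule sum_norm_le) (rule dp)
  then have "cmod (deriv h z + (\<Sum>p\<in>A. d p)) \<le> 8 * M * \<rho> / (\<rho> - cmod z)\<^sup>2 + (\<Sum>p\<in>A. \<bar>real_of_int (zorder f p)\<bar>) * (1 / \<sigma> + 1 / (\<rho> - cmod z))"
    unfolding sum_distrib_right using h' by (meson add_mono norm_triangle_ineq order_trans)
  then show ?thesis unfolding df norm_mult Mf[symmetric] A_def[symmetric] by (intro mult_left_mono) auto
qed

lemma ln_ratio_ge: "0 < a \<Longrightarrow> a < b \<Longrightarrow> (b - a) / b \<le> ln (b / a)" for a b :: real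
  using ln_le_minus_one[of "a / b"] by (simp add: ln_div field_simps)

text \<open>A zero or pole in the smaller disc has weight at least
  \<open>ln (\<rho>' / \<rho>) \<ge> (\<rho>' - \<rho>) / \<rho>'\<close> at radius
  \<open>\<rho>'\<close>, and the total weight is bounded by the counting functions of
  \<open>f\<close> and \<open>1 / f\<close>.\<close>

lemma divisor_count_bound:
  assumes f: "nzmero f" and g: "good f \<rho>'" and \<rho>: "1 \<le> \<rho>" "\<rho> < \<rho>'"
  shows "(\<Sum>p | cmod p < \<rho> \<and> zorder f p \<noteq> 0. \<bar>real_of_int (zorder f p)\<bar>)
     \<le> (2 * nevanlinna_T f \<rho>' + \<bar>lead_ln f\<bar>) * (\<rho>' / (\<rho>' - \<rho>))"
proof -
  let ?A = "{p. cmod p < \<rho> \<and> zorder f p \<noteq> 0}" and ?A' = "{p. cmod p \<le> \<rho>' \<and> zorder f p \<noteq> 0}"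
  have finA': "finite ?A'" by (rule finite_zorder[OF f])
  have l0: "0 < ln (\<rho>' / \<rho>)" using \<rho> by simp
  have "(\<Sum>p\<in>?A. \<bar>real_of_int (zorder f p)\<bar>) * ln (\<rho>' / \<rho>) \<le> (\<Sum>p\<in>?A. \<bar>real_of_int (zorder f p)\<bar> * wt \<rho>' p)"
    unfolding sum_distrib_right
  proof (intro sum_mono mult_left_mono)
    fix p assume p: "p \<in> ?A"
    show "ln (\<rho>' / \<rho>) \<le> wt \<rho>' p"
      using p \<rho> by (auto simp: wt_def ln_div)
  qed auto
  also have "\<dots> \<le> (\<Sum>p\<in>?A'. \<bar>real_of_int (zorder f p)\<bar> * wt \<rho>' p)"
    by (rule sum_mono2[OF finA']) (use \<rho> in \<open>auto intro!: mult_nonneg_nonneg wt_nonneg\<close>)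
  also have "\<dots> = (\<Sum>p\<in>?A'. real (pord f p) * wt \<rho>' p + real (pord (\<lambda>z. 1 / f z) p) * wt \<rho>' p)"
    by (rule sum.cong) (auto simp: pord_eq_zorder[OF f] pord_recip[OF f] abs_if)
  also have "\<dots> = counting f \<rho>' + counting (\<lambda>z. 1 / f z) \<rho>'"
    unfolding sum.distrib
    by (subst (1 2) counting_eq[OF nzmero_meromorphic _ finA'])
       (use f \<rho> in \<open>auto simp: nzmero_inverse pord_eq_zorder[OF f] pord_recip[OF f]\<close>)
  also have "\<dots> \<le> 2 * nevanlinna_T f \<rho>' + \<bar>lead_ln f\<bar>"
    using counting_le_T[OF good_imp_reg[OF g]] counting_le_T[OF good_imp_reg[OF good_recip[OF g]]]
      first_main_theorem[OF f g] by linarith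
  finally have 1: "(\<Sum>p\<in>?A. \<bar>real_of_int (zorder f p)\<bar>) * ln (\<rho>' / \<rho>) \<le> 2 * nevanlinna_T f \<rho>' + \<bar>lead_ln f\<bar>" .
  have "(\<Sum>p\<in>?A. \<bar>real_of_int (zorder f p)\<bar>) * ((\<rho>' - \<rho>) / \<rho>') \<le> (\<Sum>p\<in>?A. \<bar>real_of_int (zorder f p)\<bar>) * ln (\<rho>' / \<rho>)"
    by (intro mult_left_mono ln_ratio_ge sum_nonneg) (use \<rho> in auto)
  then have "(\<Sum>p\<in>?A. \<bar>real_of_int (zorder f p)\<bar>) * ((\<rho>' - \<rho>) / \<rho>') \<le> 2 * nevanlinna_T f \<rho>' + \<bar>lead_ln f\<bar>"
    using 1 by linarith
  then show ?thesis using \<rho> by (simp add: field_simps)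
qed

text \<open>Pigeonhole: of \<open>N + 1\<close> subintervals of equal length one has no point of
  \<open>X\<close> in its interior, and \<open>u\<close> is its midpoint.\<close>

lemma separated_point:
  fixes X :: "real set"
  assumes fin: "finite X" and N: "card X \<le> N" and s: "0 < s"
  obtains u where "a \<le> u - s / (2 * (real N + 1))" "u + s / (2 * (real N + 1)) \<le> a + s"
    "\<And>x. x \<in> X \<Longrightarrow> s / (2 * (real N + 1)) \<le> \<bar>x - u\<bar>"
proof -
  define w where "w = s / (real N + 1)"
  have w: "w > 0" "(real N + 1) * w = s" using s by (auto simp: w_def)
  have "\<exists>i\<le>N. \<forall>x\<in>X. \<not> (a + real i * w < x \<and> x < a + real (Suc i) * w)"
  proof (rule ccontr)
    assume "\<not> ?thesis"
    then obtain x where x: "\<And>i. i \<le> N \<Longrightarrow> x i \<in> X \<and> a + real i * w < x i \<and> x i < a + real (Suc i) * w"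
      by metis
    have "inj_on x {..N}"
    proof (rule linorder_inj_onI)
      fix i j assume ij: "i < j" "i \<in> {..N}" "j \<in> {..N}"
      have "real (Suc i) * w \<le> real j * w" using ij w by (intro mult_right_mono) auto
      then show "x i \<noteq> x j" using x[of i] x[of j] ij by auto
    qed auto
    then have "card (x ` {..N}) = Suc N" by (simp add: card_image)
    moreover have "x ` {..N} \<subseteq> X" using x by auto
    then have "card (x ` {..N}) \<le> card X" by (rule card_mono[OF fin])
    ultimately show False using N by simp
  qed
  then obtain i where i: "i \<le> N" "\<And>x. x \<in> X \<Longrightarrow> \<not> (a + real i * w < x \<and> x < a + real (Suc i) * w)"
    by blast
  have d: "s / (2 * (real N + 1)) = w / 2" by (simp add: w_def)
  have "real (Suc i) * w \<le> (real N + 1) * w" using i w by (intro mult_right_mono) auto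
  moreover have "real (Suc i) * w = real i * w + w" by (simp add: algebra_simps)
  ultimately have iN: "real i * w + w \<le> s" using w(2) by linarith
  show ?thesis
  proof (rule that[of "a + real i * w + w / 2"])
    show "a \<le> a + real i * w + w / 2 - s / (2 * (real N + 1))" unfolding d using w by simp
    show "a + real i * w + w / 2 + s / (2 * (real N + 1)) \<le> a + s" unfolding d using iN by simp
    fix x assume "x \<in> X"
    then show "s / (2 * (real N + 1)) \<le> \<bar>x - (a + real i * w + w / 2)\<bar>"
      unfolding d using i(2)[of x] w by (auto simp: algebra_simps abs_if not_less)
  qed
qed

lemma T_minus_one_le:
  assumes "G meromorphic_on UNIV" "reg G r" "1 \<le> r"
  shows "nevanlinna_T (\<lambda>z. G z - 1) r \<le> nevanlinna_T G r + ln 2"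
  using T_add[OF assms(1) meromorphic_on_const assms(2) reg_const assms(3), of "-1"] T_const[of r "-1"] assms(3)
  by (simp add: log_plus_def)

lemma card_le_sum_abs:
  assumes "finite A" "\<And>p. p \<in> A \<Longrightarrow> e p \<noteq> (0::int)"
  shows "real (card A) \<le> (\<Sum>p\<in>A. \<bar>real_of_int (e p)\<bar>)"
proof -
  have "real (card A) = (\<Sum>p\<in>A. 1)" by simp
  also have "\<dots> \<le> (\<Sum>p\<in>A. \<bar>real_of_int (e p)\<bar>)"
    by (intro sum_mono) (use assms(2) in force)
  finally show ?thesis .
qed

text \<open>One size parameter \<open>\<Theta>\<close> replaces all characteristic functions. The
  characteristic is allowed up to \<open>2 * \<Theta>\<close> so that \<open>G - 1\<close> is
  covered along with \<open>G\<close>; then \<open>2 * T + |lead_ln f|\<close>, which bounds both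
  the proximity functions and the divisor, is at most \<open>5 * \<Theta>\<close>.\<close>

lemma log_deriv_bound_T:
  assumes f: "nzmero f" and g: "good f \<rho>" "good f \<rho>'"
    and rad: "1 \<le> \<rho>" "0 < s" "cmod z + s \<le> \<rho>" "\<rho> + s \<le> \<rho>'"
    and \<Theta>: "1 \<le> \<Theta>" "nevanlinna_T f \<rho> \<le> 2 * \<Theta>" "nevanlinna_T f \<rho>' \<le> 2 * \<Theta>" "\<bar>lead_ln f\<bar> \<le> \<Theta>"
    and z: "f analytic_on {z}" "f z \<noteq> 0"
    and \<sigma>: "0 < \<sigma>" "\<And>p. cmod p < \<rho> \<Longrightarrow> zorder f p \<noteq> 0 \<Longrightarrow> \<sigma> \<le> cmod (z - p)"
  shows "cmod (deriv f z) \<le> cmod (f z) * (40 * (\<Theta> * \<rho>' / s) / s + 5 * (\<Theta> * \<rho>' / s) * (1 / \<sigma> + 1 / s))"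
proof -
  have "cmod z < \<rho>" using rad by simp
  note log_deriv_bound[OF f g(1) this z \<sigma>]
  also have "cmod (f z) * (8 * (proximity f \<rho> + proximity (\<lambda>z. 1 / f z) \<rho>) * \<rho> / (\<rho> - cmod z)\<^sup>2
     + (\<Sum>p | cmod p < \<rho> \<and> zorder f p \<noteq> 0. \<bar>real_of_int (zorder f p)\<bar>) * (1 / \<sigma> + 1 / (\<rho> - cmod z)))
    \<le> cmod (f z) * (40 * (\<Theta> * \<rho>' / s) / s + 5 * (\<Theta> * \<rho>' / s) * (1 / \<sigma> + 1 / s))"
  proof (intro mult_left_mono add_mono)
    have M: "proximity f \<rho> + proximity (\<lambda>z. 1 / f z) \<rho> \<le> 5 * \<Theta>"
      using first_main_theorem[OF f g(1)] proximity_le_T[OF nzmero_meromorphic[OF f], of \<rho>]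
        proximity_le_T[OF nzmero_meromorphic[OF nzmero_inverse[OF f]], of \<rho>] rad \<Theta> by linarith
    have M0: "0 \<le> proximity f \<rho> + proximity (\<lambda>z. 1 / f z) \<rho>"
      using proximity_nonneg[OF good_imp_reg[OF g(1)]] proximity_nonneg[OF good_imp_reg[OF good_recip[OF g(1)]]] by simp
    have "8 * (proximity f \<rho> + proximity (\<lambda>z. 1 / f z) \<rho>) * \<rho> / (\<rho> - cmod z)\<^sup>2
       \<le> 8 * (5 * \<Theta>) * \<rho>' / s\<^sup>2"
      using M M0 rad \<Theta> by (intro frac_le mult_mono power_mono) auto
    then show "8 * (proximity f \<rho> + proximity (\<lambda>z. 1 / f z) \<rho>) * \<rho> / (\<rho> - cmod z)\<^sup>2
       \<le> 40 * (\<Theta> * \<rho>' / s) / s" by (simp add: power2_eq_square)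
    have "(\<Sum>p | cmod p < \<rho> \<and> zorder f p \<noteq> 0. \<bar>real_of_int (zorder f p)\<bar>)
        \<le> (2 * nevanlinna_T f \<rho>' + \<bar>lead_ln f\<bar>) * (\<rho>' / (\<rho>' - \<rho>))"
      by (rule divisor_count_bound[OF f g(2)]) (use rad in auto)
    also have "\<dots> \<le> (5 * \<Theta>) * (\<rho>' / s)"
      by (intro mult_mono frac_le) (use rad \<Theta> in auto)
    finally have n: "(\<Sum>p | cmod p < \<rho> \<and> zorder f p \<noteq> 0. \<bar>real_of_int (zorder f p)\<bar>) \<le> 5 * (\<Theta> * \<rho>' / s)"
      by simp
    show "(\<Sum>p | cmod p < \<rho> \<and> zorder f p \<noteq> 0. \<bar>real_of_int (zorder f p)\<bar>) * (1 / \<sigma> + 1 / (\<rho> - cmod z))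
      \<le> 5 * (\<Theta> * \<rho>' / s) * (1 / \<sigma> + 1 / s)"
      by (intro mult_mono n add_mono order_refl frac_le) (use rad \<Theta> \<sigma> in \<open>auto intro!: add_nonneg_nonneg\<close>)
  qed auto
  finally show ?thesis .
qed

text \<open>No point is close to both 0 and 1, so one of \<open>|G|\<close>, \<open>|G - 1|\<close>
  is at least 1/2 and the other one is at least \<open>|G'| / A\<close>. For large
  \<open>|G|\<close> both are of the size of \<open>G\<close>, which yields the additional
  \<open>log_plus |G|\<close>. Taking means turns this into a second main inequality.\<close>

lemma two_value_pointwise:
  fixes G G' :: complex
  assumes "cmod G' \<le> A * cmod G" "cmod G' \<le> A * cmod (G - 1)" "1 \<le> A" "G \<noteq> 0" "G \<noteq> 1" "G' \<noteq> 0"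
  shows "ln (cmod G') + log_plus (cmod G) - ln (4 * A) \<le> ln (cmod G) + ln (cmod (G - 1))"
proof -
  have "cmod G' * max 1 (cmod G) \<le> 4 * A * (cmod G * cmod (G - 1))"
  proof (cases "cmod G \<ge> 2")
    case True
    have "cmod G \<le> 2 * cmod (G - 1)" using norm_triangle_ineq[of "G - 1" 1] True by simp
    then have "A * cmod G * cmod G \<le> A * cmod G * (2 * cmod (G - 1))" using assms by (intro mult_left_mono) auto
    moreover have "cmod G' * max 1 (cmod G) \<le> A * cmod G * cmod G"
      using True assms by (intro mult_mono) auto
    moreover have "0 \<le> A * (cmod G * cmod (G - 1))" using assms by simp
    ultimately show ?thesis by simp
  next
    case False
    have h: "1 \<le> cmod G + cmod (G - 1)" using norm_triangle_ineq4[of G "G - 1"] by simp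
    have c: "cmod G' \<le> 2 * A * (cmod G * cmod (G - 1))"
    proof (cases "cmod G \<ge> 1 / 2")
      case True
      have "A * cmod (G - 1) * 1 \<le> A * cmod (G - 1) * (2 * cmod G)" using assms True by (intro mult_left_mono) auto
      then show ?thesis using assms(2) by (simp add: mult_ac)
    next
      case False
      then have "A * cmod G * 1 \<le> A * cmod G * (2 * cmod (G - 1))" using assms h by (intro mult_left_mono) auto
      then show ?thesis using assms(1) by (simp add: mult_ac)
    qed
    have "cmod G' * max 1 (cmod G) \<le> 2 * A * (cmod G * cmod (G - 1)) * 2"
      using False assms by (intro mult_mono c) auto
    then show ?thesis by simp
  qed
  then have "ln (cmod G' * max 1 (cmod G)) \<le> ln (4 * A * (cmod G * cmod (G - 1)))"
    using assms by (subst ln_le_cancel_iff) (auto intro!: mult_pos_pos)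
  moreover have "ln (cmod G' * max 1 (cmod G)) = ln (cmod G') + log_plus (cmod G)"
    using assms by (subst ln_mult_pos) (auto simp: log_plus_def)
  moreover have "ln (4 * A * (cmod G * cmod (G - 1))) = ln (4 * A) + (ln (cmod G) + ln (cmod (G - 1)))"
    using assms by (subst ln_mult_pos, simp, simp, subst ln_mult_pos[of "cmod G"]) auto
  ultimately show ?thesis by linarith
qed

text \<open>A weak form of the second fundamental theorem for the values \<open>0\<close>, \<open>1\<close>, \<open>\<infinity>\<close>: instead of an
  exceptional set of radii there is one radius in every interval, chosen to be
  far from the moduli of all zeros, ones and poles.\<close>

theorem second_main_estimate:
  assumes G: "nzmero G" and G1: "nzmero (\<lambda>z. G z - 1)" and G': "nzmero (deriv G)"
    and g: "good G \<rho>" "good G \<rho>'" "good (\<lambda>z. G z - 1) \<rho>" "good (\<lambda>z. G z - 1) \<rho>'"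
    and rad: "1 \<le> a" "0 < s" "a + s + s \<le> \<rho>" "\<rho> + s \<le> \<rho>'"
    and \<Theta>: "1 \<le> \<Theta>" "nevanlinna_T G \<rho> \<le> \<Theta>" "nevanlinna_T G \<rho>' \<le> \<Theta>"
      "\<bar>lead_ln G\<bar> \<le> \<Theta>" "\<bar>lead_ln (\<lambda>z. G z - 1)\<bar> \<le> \<Theta>"
    and F: "finite F" "\<And>f. f \<in> F \<Longrightarrow> nzmero f"
  obtains t where "a < t" "t < a + s" "\<And>f. f \<in> F \<Longrightarrow> good f t" "good G t"
    "nevanlinna_T G t \<le> counting G t + counting (\<lambda>z. 1 / G z) t + counting (\<lambda>z. 1 / (G z - 1)) t
       + ln (1200 * (\<Theta> * \<rho>' / s)\<^sup>2 * (1 + 1 / s)) + lead_ln G + lead_ln (\<lambda>z. G z - 1) - lead_ln (deriv G)"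
proof -
  define X where "X = \<Theta> * \<rho>' / s"
  have "s \<le> \<rho>'" using rad by simp
  then have "1 * s \<le> \<Theta> * \<rho>'" using \<Theta> rad by (intro mult_mono) auto
  then have X1: "1 \<le> X" using rad by (simp add: X_def)
  have \<rho>1: "1 \<le> \<rho>" "\<rho> < \<rho>'" using rad by auto
  have l2: "ln 2 \<le> (1::real)" using ln_le_minus_one[of 2] by simp
  have T1: "nevanlinna_T (\<lambda>z. G z - 1) \<rho> \<le> 2 * \<Theta>" "nevanlinna_T (\<lambda>z. G z - 1) \<rho>' \<le> 2 * \<Theta>"
    using T_minus_one_le[OF nzmero_meromorphic[OF G] good_imp_reg[OF g(1)]]
      T_minus_one_le[OF nzmero_meromorphic[OF G] good_imp_reg[OF g(2)]] \<rho>1 \<Theta> l2 by linarith+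
  have T0: "nevanlinna_T G \<rho> \<le> 2 * \<Theta>" "nevanlinna_T G \<rho>' \<le> 2 * \<Theta>" using \<Theta> by linarith+
  have cnt: "real (card {p. cmod p < \<rho> \<and> zorder f p \<noteq> 0}) \<le> 5 * X"
    if f: "nzmero f" "good f \<rho>'" "nevanlinna_T f \<rho>' \<le> 2 * \<Theta>" "\<bar>lead_ln f\<bar> \<le> \<Theta>" for f
  proof -
    have "real (card {p. cmod p < \<rho> \<and> zorder f p \<noteq> 0}) \<le> (\<Sum>p | cmod p < \<rho> \<and> zorder f p \<noteq> 0. \<bar>real_of_int (zorder f p)\<bar>)"
      by (rule card_le_sum_abs) (use good_finite_zeros[OF f(1)] in auto)
    also have "\<dots> \<le> (2 * nevanlinna_T f \<rho>' + \<bar>lead_ln f\<bar>) * (\<rho>' / (\<rho>' - \<rho>))"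
      by (rule divisor_count_bound[OF f(1,2) \<rho>1])
    also have "\<dots> \<le> (5 * \<Theta>) * (\<rho>' / s)"
      by (intro mult_mono frac_le) (use rad \<Theta> f in auto)
    finally show ?thesis by (simp add: X_def)
  qed
  define A0 where "A0 = {p. cmod p < \<rho> \<and> zorder G p \<noteq> 0}"
  define A1 where "A1 = {p. cmod p < \<rho> \<and> zorder (\<lambda>z. G z - 1) p \<noteq> 0}"
  define P where "P = cmod ` (A0 \<union> A1)"
  define N where "N = card P"
  have fin: "finite A0" "finite A1" unfolding A0_def A1_def by (intro good_finite_zeros G G1)+
  have "N \<le> card A0 + card A1"
    using card_image_le[of "A0 \<union> A1" cmod] card_Un_le[of A0 A1] fin unfolding N_def P_def by simp
  then have "real N \<le> real (card A0) + real (card A1)" by linarith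
  also have "\<dots> \<le> 10 * X"
    using cnt[OF G g(2) T0(2) \<Theta>(4)] cnt[OF G1 g(4) T1(2) \<Theta>(5)] unfolding A0_def A1_def by linarith
  finally have N: "real N \<le> 10 * X" .
  \<comment> \<open>As the number of moduli to be avoided is \<open>O(X)\<close>, the gap is at
    least of order \<open>s / X\<close>; such a gap enters the final estimate only through a
    logarithm.\<close>
  define \<delta> where "\<delta> = s / (2 * (real N + 1))"
  obtain u where u: "a \<le> u - \<delta>" "u + \<delta> \<le> a + s" "\<And>x. x \<in> P \<Longrightarrow> \<delta> \<le> \<bar>x - u\<bar>"
    using separated_point[of P N s a] fin rad unfolding \<delta>_def N_def P_def by blast
  have \<delta>: "\<delta> > 0" unfolding \<delta>_def using rad by simp
  define F' where "F' = insert G (insert (\<lambda>z. G z - 1) (insert (deriv G) F))"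
  \<comment> \<open>The centre \<open>u\<close> of the gap need not be a good radius, so half of the
    gap is spent on moving it.\<close>
  obtain t where t: "u - \<delta> / 2 < t" "t < u + \<delta> / 2" and gt: "\<And>f. f \<in> F' \<Longrightarrow> good f t"
    by (rule ex_good[of F' "u - \<delta> / 2" "u + \<delta> / 2"]) (use F G G1 G' u rad \<delta> in \<open>auto simp: F'_def\<close>)
  have tas: "a < t" "t < a + s" using t u \<delta> by auto
  have gG: "good G t" "good (\<lambda>z. G z - 1) t" "good (deriv G) t" using gt by (auto simp: F'_def)
  define \<sigma> where "\<sigma> = \<delta> / 2"
  have \<sigma>0: "0 < \<sigma>" using \<delta> by (simp add: \<sigma>_def)
  have sep: "\<sigma> \<le> cmod (z - p)" if "p \<in> A0 \<union> A1" "cmod z = t" for z p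
  proof -
    have "\<delta> \<le> \<bar>cmod p - u\<bar>" using u(3)[of "cmod p"] that by (auto simp: P_def)
    moreover have "\<bar>cmod z - cmod p\<bar> \<le> cmod (z - p)" by (rule norm_triangle_ineq3)
    ultimately show ?thesis using t that by (simp add: \<sigma>_def)
  qed
  \<comment> \<open>Quadratic in \<open>X\<close>: one factor counts the zeros, ones and poles, the
    other comes from their distance. The computation below gives
    \<open>200 * X\<^sup>2 + 65 * X\<close>, and \<open>1 + 1 / s\<close> in place of
    \<open>1 / s\<close> also ensures \<open>1 \<le> A\<close>.\<close>
  define A where "A = 300 * X\<^sup>2 * (1 + 1 / s)"
  have "1 * (1 * 1) \<le> 300 * (X\<^sup>2 * (1 + 1 / s))"
    by (intro mult_mono) (use X1 rad in \<open>auto simp: one_le_power\<close>)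
  then have A1': "1 \<le> A" unfolding A_def by simp
  have XX: "X \<le> X\<^sup>2" using X1 by (simp add: power2_eq_square)
  have Abd: "40 * X / s + 5 * X * (1 / \<sigma> + 1 / s) \<le> A"
  proof -
    have "1 / \<sigma> = 4 * (real N + 1) / s" using rad by (simp add: \<sigma>_def \<delta>_def)
    also have "\<dots> \<le> 4 * (10 * X + 1) / s" using N rad by (intro divide_right_mono) auto
    finally have "5 * X * (1 / \<sigma> + 1 / s) \<le> 5 * X * (4 * (10 * X + 1) / s + 1 / s)"
      using X1 by (intro mult_left_mono add_right_mono) auto
    then have "40 * X / s + 5 * X * (1 / \<sigma> + 1 / s) \<le> 40 * X / s + 5 * X * (4 * (10 * X + 1) / s + 1 / s)" by simp
    also have "\<dots> = (200 * X\<^sup>2 + 65 * X) * (1 / s)" using rad by (simp add: field_simps power2_eq_square)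
    also have "\<dots> \<le> (300 * X\<^sup>2) * (1 + 1 / s)" using XX X1 rad by (intro mult_mono) auto
    finally show ?thesis by (simp add: A_def)
  qed
  have LD: "cmod (deriv G z) \<le> A * cmod (G z)" "cmod (deriv G z) \<le> A * cmod (G z - 1)" if z: "cmod z = t" for z
  proof -
    have "cmod (deriv G z) \<le> cmod (G z) * (40 * X / s + 5 * X * (1 / \<sigma> + 1 / s))"
      unfolding X_def
      by (rule log_deriv_bound_T[OF G g(1,2) \<rho>1(1) rad(2) _ rad(4) \<Theta>(1) T0 \<Theta>(4) _ _ \<sigma>0])
         (use z tas rad gG sep[OF _ z] in \<open>auto simp: good_def A0_def\<close>)
    also have "\<dots> \<le> cmod (G z) * A" by (intro mult_left_mono Abd) auto
    finally show "cmod (deriv G z) \<le> A * cmod (G z)" by (simp add: mult_ac)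
    have Gz: "G analytic_on {z}" using gG z by (auto simp: good_def)
    have "cmod (deriv (\<lambda>z. G z - 1) z) \<le> cmod (G z - 1) * (40 * X / s + 5 * X * (1 / \<sigma> + 1 / s))"
      unfolding X_def
      by (rule log_deriv_bound_T[OF G1 g(3,4) \<rho>1(1) rad(2) _ rad(4) \<Theta>(1) T1 \<Theta>(5) _ _ \<sigma>0])
         (use z tas rad gG sep[OF _ z] in \<open>auto simp: good_def A1_def\<close>)
    also have "\<dots> \<le> cmod (G z - 1) * A" by (intro mult_left_mono Abd) auto
    also have "deriv (\<lambda>z. G z - 1) z = deriv G z"
      using Gz analytic_on_imp_differentiable_at[of G "{z}" z] by (subst deriv_diff) auto
    finally show "cmod (deriv G z) \<le> A * cmod (G z - 1)" by (simp add: mult_ac)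
  qed
  have t0: "0 \<le> t" "1 \<le> t" "0 < t" using tas rad by auto
  \<comment> \<open>In Jensen's formula the poles cancel: \<open>G\<close> and \<open>G - 1\<close>
    together subtract \<open>2 * N(t, G)\<close>, and \<open>N(t, G')\<close> is at most that. What
    remains bounds the proximity function of \<open>G\<close>, to which \<open>N(t, G)\<close> is
    added at the end.\<close>
  have "cmean (\<lambda>z. ln (cmod (deriv G z)) + log_plus (cmod (G z)) - ln (4 * A)) t
     \<le> cmean (\<lambda>z. ln (cmod (G z)) + ln (cmod (G z - 1))) t"
  proof (rule cmean_mono)
    fix z :: complex assume z: "cmod z = t"
    show "ln (cmod (deriv G z)) + log_plus (cmod (G z)) - ln (4 * A) \<le> ln (cmod (G z)) + ln (cmod (G z - 1))"
      by (rule two_value_pointwise) (use LD[OF z] A1' gG z in \<open>auto simp: good_def\<close>)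
  qed (use t0 in \<open>auto intro!: continuous_intros good_ln_continuous gG reg_log_plus_continuous good_imp_reg\<close>)
  moreover have "cmean (\<lambda>z. ln (cmod (deriv G z)) + log_plus (cmod (G z)) - ln (4 * A)) t
      = cmean (\<lambda>z. ln (cmod (deriv G z))) t + proximity G t - ln (4 * A)"
    unfolding proximity_eq_cmean
    by (subst cmean_diff, (intro continuous_intros good_ln_continuous gG reg_log_plus_continuous good_imp_reg t0)+,
        subst cmean_add, (intro continuous_intros good_ln_continuous gG reg_log_plus_continuous good_imp_reg t0)+) simp
  moreover have "cmean (\<lambda>z. ln (cmod (G z)) + ln (cmod (G z - 1))) t
     = cmean (\<lambda>z. ln (cmod (G z))) t + cmean (\<lambda>z. ln (cmod (G z - 1))) t"
    by (rule cmean_add) (intro good_ln_continuous gG t0)+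
  moreover note jensen[OF G gG(1)] jensen[OF G1 gG(2)] jensen[OF G' gG(3)]
  moreover have "counting (\<lambda>z. G z - 1) t = counting G t"
    by (rule counting_minus_const[OF nzmero_meromorphic[OF G] t0(2)])
  moreover have "counting (deriv G) t \<le> 2 * counting G t"
    by (rule counting_deriv[OF nzmero_meromorphic[OF G] t0(2)])
  moreover have "0 \<le> counting (\<lambda>z. 1 / deriv G z) t"
    by (rule counting_nonneg[OF nzmero_meromorphic[OF nzmero_inverse[OF G']] t0(2)])
  moreover have "ln (4 * A) = ln (1200 * (\<Theta> * \<rho>' / s)\<^sup>2 * (1 + 1 / s))"
    by (rule arg_cong[of _ _ ln]) (simp add: A_def X_def)
  ultimately have T: "nevanlinna_T G t \<le> counting G t + counting (\<lambda>z. 1 / G z) t + counting (\<lambda>z. 1 / (G z - 1)) t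
       + ln (1200 * (\<Theta> * \<rho>' / s)\<^sup>2 * (1 + 1 / s)) + lead_ln G + lead_ln (\<lambda>z. G z - 1) - lead_ln (deriv G)"
    unfolding nevanlinna_T_def by linarith
  show ?thesis by (rule that[OF tas _ gG(1) T]) (use gt in \<open>auto simp: F'_def\<close>)
qed

section \<open>The growth of differential polynomials\<close>

lemma le_mult_left_ge_1: "1 \<le> K \<Longrightarrow> x \<le> r \<Longrightarrow> 0 \<le> r \<Longrightarrow> x \<le> K * r" for x :: real
  using mult_right_mono[of 1 K r] by linarith

lemma countable_nonreg:
  assumes "f meromorphic_on UNIV" shows "countable {r. 0 < r \<and> \<not> reg f r}"
proof -
  have "countable (UNIV \<inter> {z. \<not> f analytic_on {z}})"
    using meromorphic_on_imp_sparse_singularities[OF assms] by (intro sparse_imp_countable) auto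
  then have "countable (cmod ` {z. \<not> f analytic_on {z}})" by auto
  then show ?thesis by (rule countable_subset[rotated]) (auto simp: reg_def)
qed

text \<open>A growth class closed under sums, products and differentiation. The factor
  \<open>K\<close> leaves room for the larger radius that a derivative requires, the summand
  \<open>C\<close> for constants and leading coefficients, and \<open>B\<close> for the circles
  through singularities.\<close>

definition dominated :: "(real \<Rightarrow> real) \<Rightarrow> (complex \<Rightarrow> complex) \<Rightarrow> bool" where
  "dominated \<Phi> h \<longleftrightarrow> h meromorphic_on UNIV \<and> (\<exists>C K r0 B. 0 \<le> C \<and> 1 \<le> K \<and> countable B \<and>
     (\<forall>r\<ge>r0. r \<notin> B \<longrightarrow> reg h r \<and> nevanlinna_T h r \<le> C * \<Phi> (K * r) + C))"

lemma dominatedI: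
  assumes "h meromorphic_on UNIV" "0 \<le> C" "1 \<le> K" "countable B"
    "\<And>r. r0 \<le> r \<Longrightarrow> r \<notin> B \<Longrightarrow> reg h r \<and> nevanlinna_T h r \<le> C * \<Phi> (K * r) + C"
  shows "dominated \<Phi> h"
  unfolding dominated_def using assms by blast

text \<open>Covers the functions that vanish off a discrete set, to which \<open>T_deriv\<close>
  does not apply; the circles through the exceptional points go into \<open>B\<close>.\<close>

lemma dominated_cosparse_zero:
  assumes "h meromorphic_on UNIV" "eventually (\<lambda>z. h z = 0) (cosparse UNIV)"
    and "\<And>x. x0 \<le> x \<Longrightarrow> 0 \<le> \<Phi> x"
  shows "dominated \<Phi> h"
proof -
  define B where "B = cmod ` {z. \<not> (h analytic_on {z} \<and> h z = 0)}"
  have "eventually (\<lambda>z. h analytic_on {z} \<and> h z = 0) (cosparse UNIV)"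
    using meromorphic_on_imp_analytic_cosparse[OF assms(1)] assms(2) by (rule eventually_conj)
  then have "countable (UNIV \<inter> {z. \<not> (h analytic_on {z} \<and> h z = 0)})"
    by (intro sparse_imp_countable) (auto simp: eventually_cosparse)
  then have B: "countable B" unfolding B_def by auto
  have np: "\<not> is_pole h z" for z
    using pole_frequently_nonzero[of h z] eventually_cosparse_imp_eventually_at[OF assms(2), of z UNIV]
    by (auto simp: frequently_def)
  show ?thesis
  proof (rule dominatedI[OF assms(1), of 1 1 B "max 1 x0"])
    fix r assume r: "max 1 x0 \<le> r" "r \<notin> B"
    then have z: "h analytic_on {z} \<and> h z = 0" if "cmod z = r" for z using that by (auto simp: B_def)
    have "proximity h r = cmean (\<lambda>z. 0) r"
      unfolding proximity_eq_cmean by (rule cmean_cong) (use z r in \<open>auto simp: log_plus_def\<close>)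
    moreover have "counting h r = 0"
      using r by (subst counting_eq'[OF assms(1)]) (auto simp: pord_def np)
    ultimately show "reg h r \<and> nevanlinna_T h r \<le> 1 * \<Phi> (1 * r) + 1"
      using z r assms(3)[of r] by (auto simp: reg_def nevanlinna_T_def)
  qed (use B in auto)
qed

lemma dominated_const:
  assumes "\<And>x. x0 \<le> x \<Longrightarrow> 0 \<le> \<Phi> x" shows "dominated \<Phi> (\<lambda>z. c)"
proof (rule dominatedI[of _ "log_plus (cmod c)" 1 "{}" "max 1 x0"])
  fix r assume "max 1 x0 \<le> r"
  then show "reg (\<lambda>z. c) r \<and> nevanlinna_T (\<lambda>z. c) r \<le> log_plus (cmod c) * \<Phi> (1 * r) + log_plus (cmod c)"
    using assms[of r] by (auto simp: T_const reg_const log_plus_nonneg)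
qed (auto simp: log_plus_nonneg)

lemma dominated_binary:
  assumes mono: "\<And>x y. x0 \<le> x \<Longrightarrow> x \<le> y \<Longrightarrow> \<Phi> x \<le> \<Phi> y" and nn: "\<And>x. x0 \<le> x \<Longrightarrow> 0 \<le> \<Phi> x"
    and f: "dominated \<Phi> f" and g: "dominated \<Phi> g" and h: "h meromorphic_on UNIV" and c: "0 \<le> c"
    and T: "\<And>r. reg f r \<Longrightarrow> reg g r \<Longrightarrow> 1 \<le> r \<Longrightarrow> reg h r \<and> nevanlinna_T h r \<le> nevanlinna_T f r + nevanlinna_T g r + c"
  shows "dominated \<Phi> h"
proof -
  obtain C1 K1 r1 B1 where 1: "0 \<le> C1" "1 \<le> K1" "countable B1"
    "\<And>r. r \<ge> r1 \<Longrightarrow> r \<notin> B1 \<Longrightarrow> reg f r \<and> nevanlinna_T f r \<le> C1 * \<Phi> (K1 * r) + C1"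
    using f unfolding dominated_def by metis
  obtain C2 K2 r2 B2 where 2: "0 \<le> C2" "1 \<le> K2" "countable B2"
    "\<And>r. r \<ge> r2 \<Longrightarrow> r \<notin> B2 \<Longrightarrow> reg g r \<and> nevanlinna_T g r \<le> C2 * \<Phi> (K2 * r) + C2"
    using g unfolding dominated_def by metis
  let ?C = "C1 + C2 + c" and ?K = "max K1 K2"
  show ?thesis
  proof (rule dominatedI[OF h, of ?C ?K "B1 \<union> B2" "Max {r1, r2, 1, x0}"])
    fix r assume r: "Max {r1, r2, 1, x0} \<le> r" "r \<notin> B1 \<union> B2"
    then have r': "r1 \<le> r" "r2 \<le> r" "1 \<le> r" "x0 \<le> r" by auto
    have "x0 \<le> K * r" if "1 \<le> K" for K
      using that r' by (intro le_mult_left_ge_1) auto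
    then have "\<Phi> (K1 * r) \<le> \<Phi> (?K * r)" "\<Phi> (K2 * r) \<le> \<Phi> (?K * r)" "0 \<le> \<Phi> (?K * r)"
      using 1 2 r' by (auto intro!: mono nn mult_right_mono)
    then have "C1 * \<Phi> (K1 * r) \<le> C1 * \<Phi> (?K * r)" "C2 * \<Phi> (K2 * r) \<le> C2 * \<Phi> (?K * r)" "0 \<le> c * \<Phi> (?K * r)"
      using 1 2 c by (auto intro!: mult_left_mono)
    moreover have fr: "reg f r \<and> nevanlinna_T f r \<le> C1 * \<Phi> (K1 * r) + C1" using 1(4)[of r] r r' by auto
    moreover have gr: "reg g r \<and> nevanlinna_T g r \<le> C2 * \<Phi> (K2 * r) + C2" using 2(4)[of r] r r' by auto
    moreover have "reg h r \<and> nevanlinna_T h r \<le> nevanlinna_T f r + nevanlinna_T g r + c"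
      using T[of r] fr gr r' by auto
    ultimately show "reg h r \<and> nevanlinna_T h r \<le> ?C * \<Phi> (?K * r) + ?C"
      by (auto simp: distrib_right)
  qed (use 1 2 c in auto)
qed

lemma dominated_mult:
  assumes mono: "\<And>x y. x0 \<le> x \<Longrightarrow> x \<le> y \<Longrightarrow> \<Phi> x \<le> \<Phi> y" and nn: "\<And>x. x0 \<le> x \<Longrightarrow> 0 \<le> \<Phi> x"
    and f: "dominated \<Phi> f" and g: "dominated \<Phi> g"
  shows "dominated \<Phi> (\<lambda>z. f z * g z)"
proof -
  have m: "f meromorphic_on UNIV" "g meromorphic_on UNIV" using f g by (auto simp: dominated_def)
  show ?thesis
    by (rule dominated_binary[OF mono nn f g, where c = 0])
       (use m T_mult[OF m] in \<open>auto intro!: meromorphic_intros reg_mult\<close>)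
qed

lemma dominated_add:
  assumes mono: "\<And>x y. x0 \<le> x \<Longrightarrow> x \<le> y \<Longrightarrow> \<Phi> x \<le> \<Phi> y" and nn: "\<And>x. x0 \<le> x \<Longrightarrow> 0 \<le> \<Phi> x"
    and f: "dominated \<Phi> f" and g: "dominated \<Phi> g"
  shows "dominated \<Phi> (\<lambda>z. f z + g z)"
proof -
  have m: "f meromorphic_on UNIV" "g meromorphic_on UNIV" using f g by (auto simp: dominated_def)
  show ?thesis
    by (rule dominated_binary[OF mono nn f g, where c = "ln 2"])
       (use m T_add[OF m] in \<open>auto intro!: meromorphic_intros reg_add\<close>)
qed

lemma dominated_deriv:
  assumes mono: "\<And>x y. x0 \<le> x \<Longrightarrow> x \<le> y \<Longrightarrow> \<Phi> x \<le> \<Phi> y" and nn: "\<And>x. x0 \<le> x \<Longrightarrow> 0 \<le> \<Phi> x"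
    and f: "dominated \<Phi> f"
  shows "dominated \<Phi> (deriv f)"
proof -
  have m: "f meromorphic_on UNIV" using f by (auto simp: dominated_def)
  then have m': "deriv f meromorphic_on UNIV" by (rule meromorphic_on_deriv)
  show ?thesis
  proof (cases "nzmero f")
    case False
    then have ev: "eventually (\<lambda>z. f z = 0) (cosparse UNIV)" using meromorphic_zero_or_nzmero[OF m] by simp
    have "eventually (\<lambda>z. deriv f z = 0) (at x)" for x
    proof -
      obtain S where S: "open S" "x \<in> S" "\<And>z. z \<in> S \<Longrightarrow> z \<noteq> x \<Longrightarrow> f z = 0"
        using eventually_cosparse_imp_eventually_at[OF ev, of x UNIV] unfolding eventually_at_topological by auto
      have "eventually (\<lambda>z. z \<in> S - {x}) (at x)" using S by (intro eventually_at_in_open) auto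
      then show ?thesis
      proof eventually_elim
        case (elim z)
        have "eventually (\<lambda>w. w \<in> S - {x}) (nhds z)"
          using S elim by (intro eventually_nhds_in_open) auto
        then have "eventually (\<lambda>w. f w = 0) (nhds z)" by eventually_elim (use S in auto)
        then have "deriv f z = deriv (\<lambda>_. 0) z" by (rule deriv_cong_ev) simp
        then show ?case by simp
      qed
    qed
    then show ?thesis
      by (intro dominated_cosparse_zero[OF m' _ nn]) (auto simp: eventually_cosparse_open_eq)
  next
    case True
    obtain C K r1 B where 1: "0 \<le> C" "1 \<le> K" "countable B"
      "\<And>r. r \<ge> r1 \<Longrightarrow> r \<notin> B \<Longrightarrow> reg f r \<and> nevanlinna_T f r \<le> C * \<Phi> (K * r) + C"
      using f unfolding dominated_def by metis
    let ?B = "{r. 0 < r \<and> \<not> good f r}"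
    let ?C = "20 * C + 7 * \<bar>lead_ln f\<bar> + ln 2"
    show ?thesis
    proof (rule dominatedI[OF m', of ?C "3 * K" ?B "Max {r1, 2, x0}"])
      fix r assume r: "Max {r1, 2, x0} \<le> r" "r \<notin> ?B"
      then have r': "r1 \<le> r" "2 \<le> r" "x0 \<le> r" "good f r" by auto
      \<comment> \<open>\<open>T_deriv\<close> refers to a radius beyond \<open>2 * r\<close>, at
        which the bound for \<open>f\<close> must be available; any radius in
        \<open>(2 * r, 3 * r)\<close> off a countable set serves, whence
        \<open>3 * K\<close>.\<close>
      have "countable (B \<union> ?B)" using 1 countable_bad[OF True] by auto
      then have "\<not> {2 * r<..<3 * r} \<subseteq> B \<union> ?B"
        using uncountable_open_interval[of "2 * r" "3 * r"] r'(2) countable_subset by (auto dest: countable_subset)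
      then obtain \<rho> where \<rho>: "2 * r < \<rho>" "\<rho> < 3 * r" "\<rho> \<notin> B" "good f \<rho>" using r' by fastforce
      have "nevanlinna_T (deriv f) r \<le> 20 * nevanlinna_T f \<rho> + 7 * \<bar>lead_ln f\<bar> + ln 2"
        by (rule T_deriv[OF True r'(4) \<rho>(4)]) (use r' \<rho> in auto)
      also have "nevanlinna_T f \<rho> \<le> C * \<Phi> (K * \<rho>) + C" using 1(4)[of \<rho>] \<rho> r' by auto
      also have "\<Phi> (K * \<rho>) \<le> \<Phi> (3 * K * r)"
      proof (rule mono)
        show "x0 \<le> K * \<rho>" using 1(2) \<rho> r' by (intro le_mult_left_ge_1) auto
        show "K * \<rho> \<le> 3 * K * r" using 1(2) \<rho> mult_left_mono[of \<rho> "3 * r" K] by simp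
      qed
      finally have "nevanlinna_T (deriv f) r \<le> 20 * (C * \<Phi> (3 * K * r) + C) + 7 * \<bar>lead_ln f\<bar> + ln 2"
        using 1(1) by (simp add: mult_left_mono)
      also have "\<dots> \<le> ?C * \<Phi> (3 * K * r) + ?C"
      proof -
        have "x0 \<le> 3 * K * r" using 1(2) r' by (intro le_mult_left_ge_1) auto
        then have "0 \<le> (7 * \<bar>lead_ln f\<bar> + ln 2) * \<Phi> (3 * K * r)" by (intro mult_nonneg_nonneg nn) auto
        then show ?thesis by (simp add: algebra_simps)
      qed
      finally show "reg (deriv f) r \<and> nevanlinna_T (deriv f) r \<le> ?C * \<Phi> (3 * K * r) + ?C"
        using r'(4) by (auto simp: reg_def good_def intro!: analytic_intros)
    qed (use 1 countable_bad[OF True] in auto)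
  qed
qed

lemma dominated_higher_deriv:
  assumes "\<And>x y. x0 \<le> x \<Longrightarrow> x \<le> y \<Longrightarrow> \<Phi> x \<le> \<Phi> y" "\<And>x. x0 \<le> x \<Longrightarrow> 0 \<le> \<Phi> x" "dominated \<Phi> f"
  shows "dominated \<Phi> ((deriv ^^ n) f)"
  by (induction n) (use assms(3) dominated_deriv[OF assms(1,2)] in auto)

lemma dominated_power:
  assumes "\<And>x y. x0 \<le> x \<Longrightarrow> x \<le> y \<Longrightarrow> \<Phi> x \<le> \<Phi> y" "\<And>x. x0 \<le> x \<Longrightarrow> 0 \<le> \<Phi> x" "dominated \<Phi> f"
  shows "dominated \<Phi> (\<lambda>z. f z ^ n)"
  by (induction n) (use assms(3) dominated_mult[OF assms(1,2)] dominated_const[OF assms(2)] in auto)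

lemma dominated_diff_monomial:
  assumes "\<And>x y. x0 \<le> x \<Longrightarrow> x \<le> y \<Longrightarrow> \<Phi> x \<le> \<Phi> y" "\<And>x. x0 \<le> x \<Longrightarrow> 0 \<le> \<Phi> x" "dominated \<Phi> f"
  shows "dominated \<Phi> (diff_monomial ns f)"
proof -
  have "dominated \<Phi> (\<lambda>z. \<Prod>i<m. ((deriv ^^ i) f z) ^ (ns ! i))" for m
    by (induction m)
       (auto intro!: dominated_mult[OF assms(1,2)] dominated_power[OF assms(1,2)]
          dominated_higher_deriv[OF assms] dominated_const[OF assms(2)])
  then show ?thesis by (simp add: diff_monomial_def[abs_def])
qed

lemma dominated_diff_polynomial:
  assumes "\<And>x y. x0 \<le> x \<Longrightarrow> x \<le> y \<Longrightarrow> \<Phi> x \<le> \<Phi> y" "\<And>x. x0 \<le> x \<Longrightarrow> 0 \<le> \<Phi> x" "dominated \<Phi> f"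
    and "diff_polynomial_in f Q"
  shows "dominated \<Phi> Q"
proof -
  have "dominated \<Phi> (\<lambda>z. \<Sum>(a, ns)\<leftarrow>ts. a * diff_monomial ns f z)" for ts :: "(complex \<times> nat list) list"
    by (induction ts)
       (auto intro!: dominated_add[OF assms(1,2)] dominated_mult[OF assms(1,2)] dominated_const[OF assms(2)]
          dominated_diff_monomial[OF assms(1-3)])
  then show ?thesis using assms(4) by (auto simp: diff_polynomial_in_def)
qed

section \<open>Slow growth and rationality\<close>

text \<open>Borel's growth lemma with an explicit location of the radius. If every step
  \<open>x \<mapsto> x + \<delta> / \<psi> x\<close> multiplied \<open>\<psi>\<close> by more than
  \<open>\<kappa>\<close>, the steps would shrink geometrically and their sum would stay within the
  stated bound, while \<open>\<psi>\<close> became arbitrarily large along them; this contradicts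
  monotonicity.\<close>

lemma borel_growth:
  fixes \<psi> :: "real \<Rightarrow> real"
  assumes mono: "\<And>x y. r0 \<le> x \<Longrightarrow> x \<le> y \<Longrightarrow> \<psi> x \<le> \<psi> y"
    and pos: "0 < \<psi> r0" and \<kappa>: "1 < \<kappa>" and \<delta>: "0 < \<delta>"
  obtains r where "r0 \<le> r" "r \<le> r0 + \<delta> * \<kappa> / ((\<kappa> - 1) * \<psi> r0)" "\<psi> (r + \<delta> / \<psi> r) \<le> \<kappa> * \<psi> r"
proof -
  let ?b = "r0 + \<delta> * \<kappa> / ((\<kappa> - 1) * \<psi> r0)"
  have "\<exists>r. r0 \<le> r \<and> r \<le> ?b \<and> \<psi> (r + \<delta> / \<psi> r) \<le> \<kappa> * \<psi> r"
  proof (rule ccontr)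
    assume "\<not> ?thesis"
    then have H: "\<kappa> * \<psi> r < \<psi> (r + \<delta> / \<psi> r)" if "r0 \<le> r" "r \<le> ?b" for r using that by force
    define x where "x = rec_nat r0 (\<lambda>n y. y + \<delta> / \<psi> y)"
    have x0: "x 0 = r0" and xS: "x (Suc n) = x n + \<delta> / \<psi> (x n)" for n by (auto simp: x_def)
    have geo: "(\<Sum>i<n. (1 / \<kappa>) ^ i) \<le> \<kappa> / (\<kappa> - 1)" for n
    proof -
      have "(\<Sum>i<n. (1 / \<kappa>) ^ i) = (1 - (1 / \<kappa>) ^ n) / (1 - 1 / \<kappa>)"
        using \<kappa> by (subst sum_gp_strict) auto
      also have "\<dots> \<le> 1 / (1 - 1 / \<kappa>)" using \<kappa> by (intro divide_right_mono) auto
      also have "\<dots> = \<kappa> / (\<kappa> - 1)" using \<kappa> by (simp add: field_simps)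
      finally show ?thesis .
    qed
    have xb: "r0 + \<delta> / \<psi> r0 * (\<Sum>i<n. (1 / \<kappa>) ^ i) \<le> ?b" for n
      using mult_left_mono[OF geo[of n], of "\<delta> / \<psi> r0"] pos \<delta> by (simp add: field_simps)
    have inv: "\<kappa> ^ n * \<psi> r0 \<le> \<psi> (x n) \<and> r0 \<le> x n \<and> x n \<le> r0 + \<delta> / \<psi> r0 * (\<Sum>i<n. (1 / \<kappa>) ^ i)" for n
    proof (induction n)
      case (Suc n)
      have p: "0 < \<kappa> ^ n * \<psi> r0" using \<kappa> pos by simp
      then have px: "0 < \<psi> (x n)" using Suc by linarith
      have "\<kappa> * \<psi> (x n) < \<psi> (x (Suc n))" unfolding xS using Suc xb[of n] by (intro H) auto
      moreover have "\<kappa> * (\<kappa> ^ n * \<psi> r0) \<le> \<kappa> * \<psi> (x n)" using Suc \<kappa> by (intro mult_left_mono) auto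
      moreover have "\<delta> / \<psi> (x n) \<le> \<delta> / (\<kappa> ^ n * \<psi> r0)" using Suc p \<delta> by (intro frac_le) auto
      moreover have "\<delta> / (\<kappa> ^ n * \<psi> r0) = \<delta> / \<psi> r0 * (1 / \<kappa>) ^ n" by (simp add: power_divide)
      moreover have "0 < \<delta> / \<psi> (x n)" using px \<delta> by simp
      ultimately show ?case using Suc by (simp add: xS algebra_simps)
    qed (simp add: x0)
    obtain n where "\<psi> ?b / \<psi> r0 < \<kappa> ^ n" using real_arch_pow[OF \<kappa>] by blast
    then have "\<psi> ?b < \<kappa> ^ n * \<psi> r0" using pos by (simp add: field_simps)
    also have "\<dots> \<le> \<psi> (x n)" using inv by blast
    also have "\<dots> \<le> \<psi> ?b" using inv[of n] xb[of n] by (intro mono) auto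
    finally show False by simp
  qed
  then show ?thesis using that by blast
qed

section \<open>Maximum modulus of entire functions and lower bounds for \<open>T\<close>\<close>

lemma max_modulus_attained:
  assumes "g holomorphic_on UNIV" "0 \<le> r"
  obtains z where "cmod z = r" "cmod (g z) = max_modulus g r" "\<And>w. cmod w = r \<Longrightarrow> cmod (g w) \<le> max_modulus g r"
proof -
  have c: "continuous_on (sphere 0 r) (\<lambda>z. cmod (g z))"
    by (intro continuous_on_norm holomorphic_on_imp_continuous_on holomorphic_on_subset[OF assms(1)]) auto
  have ne: "sphere 0 r \<noteq> ({} :: complex set)" using assms(2) by simp
  obtain z where z: "z \<in> sphere 0 r" "\<And>w. w \<in> sphere 0 r \<Longrightarrow> cmod (g w) \<le> cmod (g z)"
    using continuous_attains_sup[OF compact_sphere ne c] by blast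
  have "max_modulus g r = cmod (g z)" unfolding max_modulus_def
    using z ne by (intro cSup_eq_maximum) auto
  then show ?thesis using that[of z] z by auto
qed

lemma max_modulus_bound:
  assumes "g holomorphic_on UNIV" "cmod z \<le> r"
  shows "cmod (g z) \<le> max_modulus g r"
proof -
  have r: "0 \<le> r" using assms(2) norm_ge_zero order_trans by blast
  obtain x where x: "\<And>w. cmod w = r \<Longrightarrow> cmod (g w) \<le> max_modulus g r"
    using max_modulus_attained[OF assms(1) r] by blast
  show ?thesis
    by (rule maximum_modulus_frontier[of g "cball 0 r"])
       (use assms x in \<open>auto intro!: holomorphic_on_subset[OF assms(1)] holomorphic_on_imp_continuous_on\<close>)
qed

lemma max_modulus_mono:
  assumes "g holomorphic_on UNIV" "0 \<le> r" "r \<le> s"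
  shows "max_modulus g r \<le> max_modulus g s"
  using max_modulus_attained[OF assms(1,2)] max_modulus_bound[OF assms(1)] assms(3) by metis

lemma max_modulus_unbounded:
  assumes "g holomorphic_on UNIV" "\<not> g constant_on UNIV"
  obtains r0 where "0 \<le> r0" "\<And>r. r0 \<le> r \<Longrightarrow> K \<le> max_modulus g r"
proof -
  have "\<not> bounded (range g)" using Liouville_theorem[OF assms(1)] assms(2) by blast
  then obtain z where "K < cmod (g z)" by (auto simp: bounded_iff not_le)
  then have "K \<le> max_modulus g r" if "cmod z \<le> r" for r
    using max_modulus_bound[OF assms(1) that] by linarith
  then show ?thesis using that[of "cmod z"] by auto
qed

lemma entire_analytic: "g holomorphic_on UNIV \<Longrightarrow> g analytic_on A"
  using analytic_on_holomorphic by blast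

lemma entire_meromorphic: "g holomorphic_on UNIV \<Longrightarrow> g meromorphic_on A"
  using analytic_on_imp_meromorphic_on entire_analytic by blast

lemma nzmero_entire:
  assumes "g holomorphic_on UNIV" "g z0 \<noteq> 0" shows "nzmero g"
proof -
  have "\<not> eventually (\<lambda>z. g z = 0) (cosparse UNIV)"
  proof
    assume "eventually (\<lambda>z. g z = 0) (cosparse UNIV)"
    then have "eventually (\<lambda>z. g z = 0) (at z0)" using eventually_cosparse_imp_eventually_at by blast
    moreover have "eventually (\<lambda>z. g z \<noteq> 0) (at z0)"
      using eventually_nhds_good_point[OF entire_analytic[OF assms(1)] assms(2)]
      by (auto simp: eventually_at_filter elim: eventually_mono)
    ultimately have "eventually (\<lambda>z. False) (at z0)" by eventually_elim auto
    then show False by simp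
  qed
  then show ?thesis using meromorphic_zero_or_nzmero[OF entire_meromorphic[OF assms(1)]] by blast
qed

lemma entire_pord: "g holomorphic_on UNIV \<Longrightarrow> pord g z = 0"
  using analytic_at_imp_no_pole[OF entire_analytic] by (simp add: pord_def)

lemma entire_counting: "g holomorphic_on UNIV \<Longrightarrow> 0 < r \<Longrightarrow> counting g r = 0"
  using counting_eq'[OF entire_meromorphic] entire_pord by simp

text \<open>Without poles the Blaschke terms are nonpositive, so \<open>ln |g| \<le> Re h\<close>.
  Moreover \<open>Re (h 0) \<ge> - |lead_ln g|\<close> bounds the proximity function of
  \<open>1 / g\<close> by that of \<open>g\<close>, and only the latter remains. This is the passage
  from proximity functions back to maximum moduli.\<close>

lemma entire_log_bound:
  assumes g: "g holomorphic_on UNIV" "nzmero g" and gd: "good g \<rho>" and z: "cmod z < \<rho>" "1 \<le> \<rho>" "g z \<noteq> 0"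
  shows "ln (cmod (g z)) \<le> proximity g \<rho> + (4 * proximity g \<rho> + 2 * \<bar>lead_ln g\<bar>) * (cmod z / (\<rho> - cmod z))"
proof -
  obtain h R where h: "\<rho> < R" "h holomorphic_on ball 0 R"
    and lf: "\<And>z. cmod z \<le> \<rho> \<Longrightarrow> g analytic_on {z} \<Longrightarrow> zorder g z = 0 \<Longrightarrow>
       ln (cmod (g z)) = Re (h z) + (\<Sum>p | cmod p < \<rho> \<and> zorder g p \<noteq> 0.
          real_of_int (zorder g p) * ln (cmod (blaschke \<rho> p z)))"
    and circ: "\<And>z. cmod z = \<rho> \<Longrightarrow> ln (cmod (g z)) = Re (h z)"
    and h0: "Re (h 0) = lead_ln g + counting (\<lambda>z. 1 / g z) \<rho> - counting g \<rho>"
    and hm: "cmean (\<lambda>z. ln (cmod (g z))) \<rho> = Re (h 0)"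
    by (rule blaschke_log_factorization[OF g(2) gd], rule that) assumption+
  have \<rho>0: "0 < \<rho>" using z by simp
  have p0: "0 \<le> proximity (\<lambda>z. 1 / g z) \<rho>" "0 \<le> proximity g \<rho>"
    by (intro proximity_nonneg good_imp_reg good_recip gd)+
  have h0p: "Re (h 0) = proximity g \<rho> - proximity (\<lambda>z. 1 / g z) \<rho>"
    using hm cmean_ln_eq_proximity[OF gd] by simp
  have M: "cmean (\<lambda>z. \<bar>Re (h z)\<bar>) \<rho> = proximity g \<rho> + proximity (\<lambda>z. 1 / g z) \<rho>"
    unfolding cmean_abs_ln_eq_proximity[OF gd, symmetric]
    by (rule cmean_cong) (use circ \<rho>0 in auto)
  have "counting g \<rho> = 0" by (rule entire_counting[OF g(1) \<rho>0])
  moreover have "0 \<le> counting (\<lambda>z. 1 / g z) \<rho>"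
    by (rule counting_nonneg[OF nzmero_meromorphic[OF nzmero_inverse[OF g(2)]] z(2)])
  ultimately have "- \<bar>lead_ln g\<bar> \<le> Re (h 0)" using h0 by linarith
  then have M2: "2 * cmean (\<lambda>z. \<bar>Re (h z)\<bar>) \<rho> \<le> 4 * proximity g \<rho> + 2 * \<bar>lead_ln g\<bar>"
    using M h0p by linarith
  have "ln (cmod (g z)) = Re (h z) + (\<Sum>p | cmod p < \<rho> \<and> zorder g p \<noteq> 0.
          real_of_int (zorder g p) * ln (cmod (blaschke \<rho> p z)))"
    by (rule lf) (use z entire_analytic[OF g(1)] in \<open>auto intro!: zorder_eq_0I\<close>)
  also have "\<dots> \<le> Re (h z) + 0"
  proof (intro add_left_mono sum_nonpos)
    fix p assume p: "p \<in> {p. cmod p < \<rho> \<and> zorder g p \<noteq> 0}"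
    have "0 \<le> zorder g p" using zorder_eq_pord[OF g(2), of p] entire_pord[OF g(1)] by simp
    moreover have "ln (cmod (blaschke \<rho> p z)) \<le> 0"
      using p z blaschke_norm_le_1[of p \<rho> z] by (cases "blaschke \<rho> p z = 0") auto
    ultimately show "real_of_int (zorder g p) * ln (cmod (blaschke \<rho> p z)) \<le> 0"
      by (simp add: mult_nonneg_nonpos)
  qed
  also have "Re (h z) \<le> Re (h 0) + cmod (h z - h 0)" using complex_Re_le_cmod[of "h z - h 0"] by simp
  also have "cmod (h z - h 0) \<le> 2 * cmean (\<lambda>z. \<bar>Re (h z)\<bar>) \<rho> * (cmod z / (\<rho> - cmod z))"
    by (rule holomorphic_dist_bound_Re[OF h(2) \<rho>0 h(1) z(1)])
  also have "\<dots> \<le> (4 * proximity g \<rho> + 2 * \<bar>lead_ln g\<bar>) * (cmod z / (\<rho> - cmod z))"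
    using M2 z by (intro mult_right_mono) auto
  finally show ?thesis using h0p p0 by linarith
qed

text \<open>A single zero of \<open>F - F z0\<close> at a point \<open>z0 \<noteq> 0\<close> already
  contributes \<open>ln R - ln |z0|\<close> to a counting function, and the first main theorem
  transfers this to \<open>T\<close>. It makes the iterated logarithms in the denominator
  positive.\<close>

lemma T_lower_nonconstant:
  assumes F: "F meromorphic_on UNIV" and nc: "\<And>c. \<not> eventually (\<lambda>z. F z = c) (cosparse UNIV)"
  obtains C R0 B where "countable B" "\<And>R. R0 \<le> R \<Longrightarrow> R \<notin> B \<Longrightarrow> reg F R \<and> ln R - C \<le> nevanlinna_T F R"
proof -
  have "eventually (\<lambda>z. F analytic_on {z}) (cosparse UNIV)" by (rule meromorphic_on_imp_analytic_cosparse[OF F])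
  then have "eventually (\<lambda>z. F analytic_on {z} \<and> z \<noteq> 0) (at 0)"
    by (intro eventually_conj eventually_cosparse_imp_eventually_at[where A = UNIV] eventually_neq_at_within UNIV_I)
  then obtain z0 where z0: "F analytic_on {z0}" "z0 \<noteq> 0"
    using eventually_happens'[of "at (0::complex)"] by auto
  define G where "G = (\<lambda>z. F z - F z0)"
  have Gm: "G meromorphic_on UNIV" unfolding G_def by (intro meromorphic_intros F)
  have G: "nzmero G" using meromorphic_zero_or_nzmero[OF Gm] nc[of "F z0"] by (auto simp: G_def)
  have "G analytic_on {z0}" unfolding G_def by (intro analytic_intros z0)
  then have "zorder G z0 > 0" using zorder_pos_iff'[of G z0] nzmero_frequently[OF G] by (simp add: G_def)
  then have p1: "1 \<le> pord (\<lambda>z. 1 / G z) z0" by (simp add: pord_recip[OF G])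
  define C where "C = ln (cmod z0) - lead_ln G + log_plus (cmod (F z0)) + ln 2"
  define B where "B = {r. 0 < r \<and> \<not> good G r} \<union> {r. 0 < r \<and> \<not> reg F r}"
  show ?thesis
  proof (rule that)
    show "countable B" unfolding B_def using countable_bad[OF G] countable_nonreg[OF F] by auto
    fix R assume R: "max 1 (cmod z0) \<le> R" "R \<notin> B"
    then have gd: "good G R" and rF: "reg F R" by (auto simp: B_def)
    let ?A = "{z. cmod z \<le> R \<and> pord (\<lambda>z. 1 / G z) z \<noteq> 0}"
    have m: "(\<lambda>z. 1 / G z) meromorphic_on UNIV" using nzmero_meromorphic[OF nzmero_inverse[OF G]] .
    have "ln R - ln (cmod z0) = wt R z0" using R z0 by (auto simp: wt_def)
    also have "\<dots> \<le> real (pord (\<lambda>z. 1 / G z) z0) * wt R z0"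
      using p1 wt_nonneg[of R z0] R mult_right_mono[of 1 "real (pord (\<lambda>z. 1 / G z) z0)" "wt R z0"] by simp
    also have "\<dots> \<le> (\<Sum>p\<in>?A. real (pord (\<lambda>z. 1 / G z) p) * wt R p)"
      using R p1 by (intro member_le_sum finite_pord m) (auto intro!: mult_nonneg_nonneg wt_nonneg)
    also have "\<dots> = counting (\<lambda>z. 1 / G z) R" using R by (intro counting_eq'[symmetric] m) auto
    also have "\<dots> \<le> nevanlinna_T (\<lambda>z. 1 / G z) R" by (intro counting_le_T good_imp_reg good_recip gd)
    also have "\<dots> = nevanlinna_T G R - lead_ln G" by (rule first_main_theorem[OF G gd])
    finally have "ln R - ln (cmod z0) \<le> nevanlinna_T G R - lead_ln G" .
    moreover have "nevanlinna_T G R \<le> nevanlinna_T F R + log_plus (cmod (F z0)) + ln 2"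
      using T_add[OF F meromorphic_on_const rF reg_const, of "- F z0"] T_const[of R "- F z0"] R
      by (simp add: G_def)
    ultimately have "ln R - C \<le> nevanlinna_T F R" unfolding C_def by linarith
    then show "reg F R \<and> ln R - C \<le> nevanlinna_T F R" using rF by blast
  qed
qed

section \<open>Functions of logarithmic growth are rational\<close>

lemma entire_remove_sings:
  assumes f: "nzmero f" and ord: "\<And>z. 0 \<le> zorder f z"
  shows "remove_sings f holomorphic_on UNIV"
proof -
  have "remove_sings f analytic_on {z}" for z
  proof -
    have "\<not> is_pole f z"
      using isolated_pole_imp_neg_zorder[OF nzmero_iso[OF f], of z] ord[of z] by auto
    then obtain c where "f \<midarrow>z\<rightarrow> c" using nzmero_ness[OF f, of z] unfolding not_essential_def by blast
    then show ?thesis by (rule remove_sings_analytic_at[OF nzmero_iso[OF f]])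
  qed
  then have "remove_sings f analytic_on UNIV" by (subst analytic_on_analytic_at) auto
  then show ?thesis by (rule analytic_imp_holomorphic)
qed

lemma remove_sings_cosparse_eq:
  assumes "f meromorphic_on UNIV" shows "eventually (\<lambda>z. remove_sings f z = f z) (cosparse UNIV)"
  by (rule eventually_remove_sings_eq[OF assms])

lemma nzmero_remove_sings:
  assumes "nzmero f" shows "nzmero (remove_sings f)"
proof -
  have "eventually (\<lambda>z. remove_sings f z \<noteq> 0) (cosparse UNIV)"
    using remove_sings_cosparse_eq[OF nzmero_meromorphic[OF assms]] assms unfolding nzmero_def
    by (auto elim: eventually_elim2)
  then show ?thesis using nzmero_meromorphic[OF assms] by (auto simp: nzmero_def intro: remove_sings_meromorphic)
qed

lemma zorder_linear_power: "zorder (\<lambda>w. (w - p) ^ n) z = (if z = p then int n else 0)"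
proof (cases "z = p")
  case True
  have "zorder (\<lambda>w. (w - p) ^ n) p = int n"
    by (rule zorder_eqI[of UNIV _ "\<lambda>_. 1"]) auto
  then show ?thesis using True by simp
next
  case False
  then show ?thesis by (auto intro!: zorder_eq_0I analytic_intros)
qed

text \<open>The bound is available only for some arbitrarily large \<open>R\<close>; Cauchy's
  inequality on these circles still annihilates every coefficient of order at least
  \<open>m\<close>.\<close>

lemma entire_polynomial_if_slow:
  assumes E: "E holomorphic_on UNIV"
    and slow: "\<And>R0. \<exists>R\<ge>R0. \<forall>z. cmod z \<le> R \<longrightarrow> cmod (E z) \<le> C * R powr K"
  obtains a where "\<And>z. E z = poly a z"
proof -
  \<comment> \<open>The additional 1 leaves a factor \<open>1 / R\<close> in Cauchy's
    inequality.\<close>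
  define m where "m = nat \<lceil>K\<rceil> + 1"
  have C0: "0 \<le> C"
  proof -
    obtain R where "R \<ge> 1" "\<forall>z. cmod z \<le> R \<longrightarrow> cmod (E z) \<le> C * R powr K" using slow by blast
    then have "0 \<le> C * R powr K" using norm_ge_zero order_trans by (metis norm_zero zero_le_one)
    then show ?thesis using \<open>R \<ge> 1\<close> by (simp add: zero_le_mult_iff)
  qed
  have z: "(deriv ^^ n) E 0 = 0" if n: "m \<le> n" for n
  proof (rule ccontr)
    assume nz: "(deriv ^^ n) E 0 \<noteq> 0"
    define d where "d = cmod ((deriv ^^ n) E 0)"
    have d: "0 < d" using nz by (simp add: d_def)
    obtain R where R: "R \<ge> max 1 (fact n * C / d + 1)" "\<forall>z. cmod z \<le> R \<longrightarrow> cmod (E z) \<le> C * R powr K" using slow by blast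
    have "d \<le> fact n * (C * R powr K) / R ^ n" unfolding d_def
      by (rule Cauchy_inequality)
         (use R in \<open>auto intro!: holomorphic_on_subset[OF E] holomorphic_on_imp_continuous_on\<close>)
    also have "R powr K \<le> R powr (real n - 1)"
      using R n by (intro powr_mono) (auto simp: m_def, linarith)
    also have "R powr (real n - 1) = R ^ n / R" using R by (simp add: powr_diff powr_realpow)
    finally have "d \<le> fact n * (C * (R ^ n / R)) / R ^ n" using R C0 by (simp add: mult_left_mono divide_right_mono)
    then have "d \<le> fact n * C / R" using R by simp
    then have "d * R \<le> fact n * C" using R by (simp add: field_simps)
    moreover have "fact n * C < d * R"
    proof -
      have "fact n * C / d < R" using R by auto
      then show ?thesis using d by (simp add: field_simps)
    qed
    ultimately show False by simp
  qed
  define a where "a = (\<Sum>k<m. monom ((deriv ^^ k) E 0 / fact k) k)"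
  have "E z = poly a z" for z
  proof -
    have "(\<lambda>n. (deriv ^^ n) E 0 / fact n * (z - 0) ^ n) sums E z"
      by (rule holomorphic_power_series[of E 0 "cmod z + 1"]) (auto intro: holomorphic_on_subset[OF E])
    moreover have "(\<lambda>n. (deriv ^^ n) E 0 / fact n * (z - 0) ^ n) sums (\<Sum>k<m. (deriv ^^ k) E 0 / fact k * (z - 0) ^ k)"
      by (rule sums_finite) (use \<open>\<And>n. m \<le> n \<Longrightarrow> (deriv ^^ n) E 0 = 0\<close> in auto)
    ultimately have "E z = (\<Sum>k<m. (deriv ^^ k) E 0 / fact k * (z - 0) ^ k)" by (rule sums_unique2)
    then show ?thesis by (simp add: a_def poly_sum poly_monom)
  qed
  then show ?thesis by (rule that)
qed

text \<open>Each pole eventually weighs at least \<open>ln R / 2\<close>, so there are only finitely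
  many. The product of \<open>f\<close> with the polynomial having these zeros is entire with
  proximity function \<open>O(ln R)\<close>; by \<open>entire_log_bound\<close> its modulus on the
  disc of radius \<open>R / 2\<close> is at most a power of \<open>R\<close>, and it is a
  polynomial.\<close>

lemma rational_if_slow:
  assumes f: "nzmero f" and slow: "\<And>R0. \<exists>R\<ge>R0. good f R \<and> nevanlinna_T f R \<le> K * ln R"
  obtains a b :: "complex poly" where "b \<noteq> 0" "eventually (\<lambda>z. f z = poly a z / poly b z) (cosparse UNIV)"
proof -
  define S where "S = {p. pord f p \<noteq> 0}"
  have m: "f meromorphic_on UNIV" by (rule nzmero_meromorphic[OF f])
  have "card A \<le> nat \<lceil>2 * K\<rceil>" if A: "A \<subseteq> S" "finite A" for A
  proof -
    \<comment> \<open>Both \<open>|p| \<le> R\<close> and \<open>ln |p| \<le> ln R / 2\<close> are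
      needed; \<open>|p|\<^sup>2 + |p| \<le> R\<close> gives them together.\<close>
    obtain R where R: "R \<ge> Max (insert 2 ((\<lambda>p. (cmod p)\<^sup>2 + cmod p) ` A))" "good f R" "nevanlinna_T f R \<le> K * ln R"
      using slow by blast
    then have R2: "2 \<le> R" "\<And>p. p \<in> A \<Longrightarrow> (cmod p)\<^sup>2 + cmod p \<le> R" using A by auto
    have "real (card A) * (ln R / 2) = (\<Sum>p\<in>A. ln R / 2)" by simp
    also have "\<dots> \<le> (\<Sum>p\<in>A. real (pord f p) * wt R p)"
    proof (rule sum_mono)
      fix p assume p: "p \<in> A"
      have "ln R / 2 \<le> wt R p"
      proof (cases "p = 0")
        case False
        have "ln ((cmod p)\<^sup>2) \<le> ln R" using R2(1) R2(2)[OF p] False by (subst ln_le_cancel_iff) (auto, smt norm_ge_zero)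
        moreover have "cmod p \<le> R" using R2(2)[OF p] by (smt zero_le_power2)
        ultimately show ?thesis using False by (simp add: wt_def ln_realpow)
      qed (use R2 in \<open>auto simp: wt_def\<close>)
      moreover have "1 \<le> real (pord f p)" using p A by (auto simp: S_def)
      moreover have "0 \<le> wt R p" using R2 by (intro wt_nonneg) auto
      ultimately show "ln R / 2 \<le> real (pord f p) * wt R p" using mult_right_mono[of 1 "real (pord f p)" "wt R p"] by linarith
    qed
    also have "\<dots> \<le> (\<Sum>p\<in>{z. cmod z \<le> R \<and> pord f z \<noteq> 0}. real (pord f p) * wt R p)"
    proof (rule sum_mono2[OF finite_pord[OF m]])
      show "A \<subseteq> {z. cmod z \<le> R \<and> pord f z \<noteq> 0}"
      proof
        fix p assume p: "p \<in> A"
        have "cmod p \<le> R" using R2(2)[OF p] by (smt zero_le_power2)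
        then show "p \<in> {z. cmod z \<le> R \<and> pord f z \<noteq> 0}" using p A by (auto simp: S_def)
      qed
    qed (use R2 in \<open>auto intro!: mult_nonneg_nonneg wt_nonneg\<close>)
    also have "\<dots> = counting f R" using R2 by (intro counting_eq'[symmetric] m) auto
    also have "\<dots> \<le> K * ln R" using counting_le_T[OF good_imp_reg[OF R(2)]] R(3) by linarith
    finally have "(real (card A) / 2) * ln R \<le> K * ln R" by simp
    then have "real (card A) / 2 \<le> K" using R2 by (subst (asm) mult_le_cancel_right) auto
    then show ?thesis by linarith
  qed
  then have finS: "finite S" using finite_if_finite_subsets_card_bdd by blast
  define Pl where "Pl = (\<lambda>z. \<Prod>p\<in>S. (z - p) ^ pord f p)"
  have lin: "nzmero (\<lambda>z. (z - p) ^ n)" for p :: complex and n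
    using nzmero_powi[OF nzmero_linear[of 1 "-p"], of "int n"] by simp
  have Pl: "nzmero Pl" unfolding Pl_def by (rule nzmero_prod[OF finS lin])
  have PlZ: "zorder Pl z = int (pord f z)" for z
  proof -
    have "zorder Pl z = (\<Sum>p\<in>S. zorder (\<lambda>z. (z - p) ^ pord f p) z)"
      unfolding Pl_def by (rule zorder_prod) (use lin Pl nzmero_facts in \<open>auto simp: Pl_def\<close>)
    also have "\<dots> = (\<Sum>p\<in>S. if z = p then int (pord f p) else 0)" by (simp add: zorder_linear_power)
    also have "\<dots> = int (pord f z)" using finS by (auto simp: sum.delta S_def)
    finally show ?thesis .
  qed
  define E0 where "E0 = (\<lambda>z. f z * Pl z)"
  have E0: "nzmero E0" unfolding E0_def by (rule nzmero_mult[OF f Pl])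
  have "0 \<le> zorder E0 z" for z
  proof -
    have "zorder E0 z = zorder f z + zorder Pl z" unfolding E0_def
      by (rule zorder_mult) (use f Pl nzmero_facts in auto)
    then show ?thesis by (simp add: PlZ zorder_eq_pord[OF f])
  qed
  define E where "E = remove_sings E0"
  have E: "E holomorphic_on UNIV" unfolding E_def by (rule entire_remove_sings[OF E0]) fact
  have Enz: "nzmero E" unfolding E_def by (rule nzmero_remove_sings[OF E0])
  define N where "N = (\<Sum>p\<in>S. pord f p)"
  have Pbd: "cmod (Pl z) \<le> (2 * R) ^ N" if "cmod z \<le> R" "\<And>p. p \<in> S \<Longrightarrow> cmod p \<le> R" for z R
  proof -
    have "cmod (Pl z) \<le> (\<Prod>p\<in>S. (2 * R) ^ pord f p)"
      unfolding Pl_def prod_norm[symmetric] norm_power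
      by (intro prod_mono conjI power_mono) (use that norm_triangle_ineq4[of z] in \<open>auto intro: order_trans\<close>, smt)
    then show ?thesis by (simp add: N_def power_sum)
  qed
  define K' where "K' = \<bar>K\<bar> + 2 * real N"
  have "\<exists>R\<ge>R0. \<forall>z. cmod z \<le> R \<longrightarrow> cmod (E z) \<le> (exp (2 * \<bar>lead_ln E\<bar>) * 2 powr (5 * K')) * R powr (5 * K')" for R0
  proof -
    obtain R where R: "R \<ge> Max (insert 2 (insert (2 * R0) (cmod ` S)))" "good f R" "nevanlinna_T f R \<le> K * ln R"
      using slow by blast
    then have R2: "2 \<le> R" "2 * R0 \<le> R" "\<And>p. p \<in> S \<Longrightarrow> cmod p \<le> R" using finS by auto
    have PA: "Pl analytic_on {z}" "cmod z = R \<Longrightarrow> Pl z \<noteq> 0" for z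
    proof -
      show "Pl analytic_on {z}" unfolding Pl_def by (intro analytic_intros analytic_on_prod)
      assume z: "cmod z = R"
      have "z \<notin> S" using good_not_pole[OF R(2) z] by (auto simp: S_def pord_def)
      then show "Pl z \<noteq> 0" using finS by (auto simp: Pl_def)
    qed
    have gE: "good E0 R" using R(2) PA by (auto simp: good_def E0_def intro!: analytic_intros)
    have EE: "E z = E0 z" if "cmod z = R" for z using gE that by (auto simp: good_def E_def)
    have gE: "good E R" using gE EE E by (auto simp: good_def intro: entire_analytic)
    have "proximity E R = proximity E0 R" unfolding proximity_eq_cmean
      by (rule cmean_cong) (use EE R2 in auto)
    also have "\<dots> \<le> proximity f R + proximity Pl R" unfolding E0_def
      by (rule proximity_mult) (use R(2) R2 PA in \<open>auto simp: reg_def good_def\<close>)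
    also have "proximity f R \<le> K * ln R" using proximity_le_T[OF m, of R] R(3) R2(1) by linarith
    also have "proximity Pl R \<le> real N * ln (2 * R)" unfolding proximity_eq_cmean
    proof (rule cmean_le)
      show "continuous_on (sphere 0 R) (\<lambda>z. log_plus (cmod (Pl z)))"
        by (rule reg_log_plus_continuous) (use PA R2 in \<open>auto simp: reg_def\<close>)
      fix z assume z: "cmod z = R"
      have "log_plus (cmod (Pl z)) \<le> log_plus ((2 * R) ^ N)" by (intro log_plus_mono Pbd) (use z R2 in auto)
      also have "\<dots> = ln ((2 * R) ^ N)" using R2 one_le_power[of "2 * R" N] by (auto simp: log_plus_def max_def)
      also have "\<dots> = real N * ln (2 * R)" by (rule ln_realpow)
      finally show "log_plus (cmod (Pl z)) \<le> real N * ln (2 * R)" .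
    qed (use R2 in auto)
    also have "real N * ln (2 * R) \<le> real N * (2 * ln R)"
      using R2 by (intro mult_left_mono) (auto simp: ln_mult)
    also have "K * ln R + real N * (2 * ln R) \<le> K' * ln R"
      using R2 by (simp add: K'_def distrib_right mult_right_mono)
    finally have pE: "proximity E R \<le> K' * ln R" by linarith
    have "cmod (E z) \<le> (exp (2 * \<bar>lead_ln E\<bar>) * 2 powr (5 * K')) * (R / 2) powr (5 * K')" if z: "cmod z \<le> R / 2" for z
    proof (cases "E z = 0")
      case False
      have p0: "0 \<le> proximity E R" by (intro proximity_nonneg good_imp_reg gE)
      have "ln (cmod (E z)) \<le> proximity E R + (4 * proximity E R + 2 * \<bar>lead_ln E\<bar>) * (cmod z / (R - cmod z))"
        by (rule entire_log_bound[OF E Enz gE]) (use z R2 False in auto)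
      also have "\<dots> \<le> proximity E R + (4 * proximity E R + 2 * \<bar>lead_ln E\<bar>) * 1"
        by (intro add_left_mono mult_left_mono) (use z R2 p0 in \<open>auto simp: divide_le_eq\<close>)
      also have "\<dots> \<le> 5 * K' * ln R + 2 * \<bar>lead_ln E\<bar>" using pE by simp
      finally have "cmod (E z) \<le> exp (5 * K' * ln R + 2 * \<bar>lead_ln E\<bar>)"
        using False by (metis exp_le_cancel_iff exp_ln zero_less_norm_iff)
      also have "\<dots> = exp (2 * \<bar>lead_ln E\<bar>) * R powr (5 * K')" using R2 by (simp add: exp_add powr_def)
      also have "R powr (5 * K') = 2 powr (5 * K') * (R / 2) powr (5 * K')"
        using R2 by (simp add: powr_mult[symmetric])
      finally show ?thesis by simp
    qed auto
    then show ?thesis using R2 by (intro exI[of _ "R / 2"]) auto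
  qed
  then obtain a where a: "\<And>z. E z = poly a z" using entire_polynomial_if_slow[OF E] by metis
  define b where "b = (\<Prod>p\<in>S. [:- p, 1:] ^ pord f p)"
  have b: "poly b z = Pl z" for z by (simp add: b_def Pl_def poly_prod poly_power)
  have "b \<noteq> 0" using finS by (auto simp: b_def)
  moreover have "eventually (\<lambda>z. f z = poly a z / poly b z) (cosparse UNIV)"
  proof -
    have "eventually (\<lambda>z. Pl z \<noteq> 0) (cosparse UNIV)" using Pl by (simp add: nzmero_def)
    moreover have "eventually (\<lambda>z. E z = E0 z) (cosparse UNIV)"
      unfolding E_def by (rule remove_sings_cosparse_eq[OF nzmero_meromorphic[OF E0]])
    ultimately show ?thesis by eventually_elim (simp add: b a[symmetric] E0_def)
  qed
  ultimately show ?thesis by (rule that)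
qed

lemma transcendental_nzmero:
  assumes "transcendental_meromorphic f" shows "nzmero f"
proof (rule ccontr)
  assume "\<not> nzmero f"
  then have "eventually (\<lambda>z. f z = poly 0 z / poly 1 z) (cosparse UNIV)"
    using meromorphic_zero_or_nzmero assms by (auto simp: transcendental_meromorphic_def)
  then show False using assms unfolding transcendental_meromorphic_def by (metis zero_neq_one)
qed

lemma transcendental_T_growth:
  assumes "transcendental_meromorphic f"
  obtains R0 where "\<And>R. R0 \<le> R \<Longrightarrow> good f R \<Longrightarrow> K * ln R < nevanlinna_T f R"
proof -
  have "\<exists>R0. \<forall>R\<ge>R0. good f R \<longrightarrow> K * ln R < nevanlinna_T f R"
  proof (rule ccontr)
    assume "\<not> ?thesis"
    then have "\<And>R0. \<exists>R\<ge>R0. good f R \<and> nevanlinna_T f R \<le> K * ln R" by (meson not_less)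
    then obtain a b :: "complex poly" where "b \<noteq> 0" "eventually (\<lambda>z. f z = poly a z / poly b z) (cosparse UNIV)"
      using rational_if_slow[OF transcendental_nzmero[OF assms]] by metis
    then show False using assms unfolding transcendental_meromorphic_def by blast
  qed
  then show ?thesis using that by blast
qed

section \<open>Nonconstancy of \<open>f\<^sup>\<alpha> Q\<close>\<close>

text \<open>With the terms \<open>ts\<close> as an argument the same differential expression can
  also be formed from functions that agree with \<open>f\<close> only off a discrete set.\<close>

definition dpoly :: "(complex \<times> nat list) list \<Rightarrow> (complex \<Rightarrow> complex) \<Rightarrow> complex \<Rightarrow> complex" where
  "dpoly ts f z = (\<Sum>(a, ns)\<leftarrow>ts. a * diff_monomial ns f z)"

lemma dpoly_cong:
  assumes "eventually (\<lambda>w. f w = g w) (nhds z)" shows "dpoly ts f z = dpoly ts g z"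
  using higher_deriv_cong_ev[OF assms refl] by (simp add: dpoly_def diff_monomial_def)

lemma dpoly_analytic:
  assumes "f analytic_on {z}" shows "dpoly ts f analytic_on {z}"
proof -
  have "diff_monomial ns f analytic_on {z}" for ns
    unfolding diff_monomial_def[abs_def] by (intro analytic_intros analytic_on_prod assms)
  then show ?thesis unfolding dpoly_def[abs_def]
    by (induction ts) (auto intro!: analytic_intros)
qed

lemma dpoly_bound:
  assumes "\<And>i. i < k \<Longrightarrow> cmod ((deriv ^^ i) f z) \<le> 1" "\<And>a ns. (a, ns) \<in> set ts \<Longrightarrow> length ns \<le> k"
  shows "cmod (dpoly ts f z) \<le> (\<Sum>(a, ns)\<leftarrow>ts. cmod a)"
  using assms(2)
proof (induction ts)
  case (Cons t ts)
  obtain a ns where t: "t = (a, ns)" by (cases t)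
  have "cmod (diff_monomial ns f z) \<le> 1"
    unfolding diff_monomial_def prod_norm[symmetric] norm_power
    by (rule prod_le_1) (use assms(1) Cons.prems[of a ns] t in \<open>auto intro!: power_le_one\<close>)
  then have "cmod (a * diff_monomial ns f z) \<le> cmod a"
    using mult_left_mono[of "cmod (diff_monomial ns f z)" 1 "cmod a"] by (simp add: norm_mult)
  moreover have "cmod (dpoly ts f z) \<le> (\<Sum>(a, ns)\<leftarrow>ts. cmod a)" by (rule Cons.IH) (use Cons.prems in auto)
  ultimately show ?case unfolding t dpoly_def
    using norm_triangle_ineq[of "a * diff_monomial ns f z" "\<Sum>(a, ns)\<leftarrow>ts. a * diff_monomial ns f z"] by simp
qed (simp add: dpoly_def)

lemma isCont_eventually_const:
  fixes F :: "complex \<Rightarrow> complex"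
  assumes "isCont F z" "eventually (\<lambda>w. F w = c) (at z)" shows "F z = c"
proof -
  have "(F \<longlongrightarrow> c) (at z)" using assms(2) by (rule tendsto_eventually)
  then show ?thesis using assms(1) by (auto simp: isCont_def intro: tendsto_unique[rotated])
qed

text \<open>Near a point where an entire function attains its maximum modulus on a circle, its reciprocal
  is small together with its first \<open>k\<close> derivatives.\<close>

lemma small_reciprocal_derivs:
  assumes v: "v holomorphic_on UNIV" "\<not> v constant_on UNIV"
  obtains z where "L < cmod (v z)" "0 < cmod (v z)" "\<And>i. i < k \<Longrightarrow> cmod ((deriv ^^ i) (\<lambda>w. 1 / v w) z) \<le> 1"
proof -
  \<comment> \<open>The loss below is the k-th power of \<open>X powr \<epsilon> * ln X\<close>, up
    to a constant at most \<open>X powr (2 * \<epsilon> * k)\<close>. It has to stay below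
    \<open>X powr (1 / 2)\<close>, because the reciprocal gains a full factor
    \<open>1 / X\<close>.\<close>
  define \<epsilon> where "\<epsilon> = 1 / (4 * (real k + 1))"
  have \<epsilon>: "0 < \<epsilon>" "2 * \<epsilon> * real k \<le> 1 / 2" by (auto simp: \<epsilon>_def field_simps)
  define D where "D = 2 * fact k * (4 / \<epsilon>) ^ k"
  have D: "0 < D" using \<epsilon> by (simp add: D_def)
  define X0 where "X0 = max (exp 1) (max (L + 1) (D\<^sup>2))"
  obtain r0 where r0: "0 \<le> r0" "\<And>r. r0 \<le> r \<Longrightarrow> X0 \<le> max_modulus v r"
    using max_modulus_unbounded[OF v] by blast
  have e1: "exp 1 \<le> max_modulus v r" if "r0 \<le> r" for r using r0(2)[OF that] by (simp add: X0_def)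
  have pos: "0 < max_modulus v r" if "r0 \<le> r" for r using e1[OF that] less_le_trans[OF exp_gt_zero] by blast
  obtain r where r: "r0 \<le> r" and gr: "ln (max_modulus v (r + 1 / ln (max_modulus v r))) \<le> (1 + \<epsilon>) * ln (max_modulus v r)"
  proof (rule borel_growth[of r0 "\<lambda>r. ln (max_modulus v r)" "1 + \<epsilon>" 1])
    fix x y assume xy: "r0 \<le> x" "x \<le> y"
    then have "0 < max_modulus v x" by (intro pos)
    then show "ln (max_modulus v x) \<le> ln (max_modulus v y)"
      using max_modulus_mono[OF v(1), of x y] xy r0 by (subst ln_le_cancel_iff) auto
  next
    have "ln (exp 1) \<le> ln (max_modulus v r0)" using e1[of r0] pos[of r0] by (subst ln_le_cancel_iff) auto
    then show "0 < ln (max_modulus v r0)" by simp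
  qed (use \<epsilon> that in auto)
  define X where "X = max_modulus v r"
  have X: "exp 1 \<le> X" "L < X" "D\<^sup>2 \<le> X" using r0(2)[OF r] by (auto simp: X_def X0_def)
  have X1: "1 < X" using X(1) by (metis exp_gt_one less_le_trans zero_less_one)
  have lX: "1 \<le> ln X" using X(1) X1 by (metis exp_gt_zero ln_exp ln_le_cancel_iff less_trans zero_less_one)
  define s where "s = 1 / ln X"
  have s: "0 < s" "s \<le> 1" using lX by (auto simp: s_def)
  have Ms: "max_modulus v (r + s) \<le> X powr (1 + \<epsilon>)"
  proof -
    have p: "0 < max_modulus v (r + s)" by (rule pos) (use r s in auto)
    have "ln (max_modulus v (r + s)) \<le> ln (X powr (1 + \<epsilon>))" using gr X1 by (simp add: X_def s_def ln_powr)
    then show ?thesis using p X1 by (subst (asm) ln_le_cancel_iff) auto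
  qed
  have "0 \<le> r" using r r0(1) by simp
  then obtain z where z: "cmod z = r" "cmod (v z) = X" using max_modulus_attained[OF v(1)] unfolding X_def by blast
  \<comment> \<open>Near the circle the derivative of \<open>v\<close> is at most
    \<open>X powr (1 + \<epsilon>) / (s / 2)\<close>, so on a disc of this radius \<open>|v|\<close>
    drops from \<open>X\<close> to no less than \<open>X / 2\<close>.\<close>
  define s' where "s' = s / (4 * X powr \<epsilon>)"
  have Xe: "1 \<le> X powr \<epsilon>" using X1 \<epsilon> by (simp add: ge_one_powr_ge_zero)
  have s': "0 < s'" "s' \<le> s / 2" "s' \<le> 1"
  proof -
    show "0 < s'" using s X1 by (simp add: s'_def)
    show "s' \<le> s / 2" unfolding s'_def by (rule divide_left_mono) (use s Xe in auto)
    then show "s' \<le> 1" using s by simp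
  qed
  have vb: "cmod (v w) \<ge> X / 2" if w: "w \<in> cball z s'" for w
  proof -
    have "cmod (v w - v z) \<le> (X powr (1 + \<epsilon>) / (s / 2)) * cmod (w - z)"
    proof (rule field_differentiable_bound[of "cball z s'" v "deriv v"])
      fix x assume x: "x \<in> cball z s'"
      show "(v has_field_derivative deriv v x) (at x within cball z s')"
        using holomorphic_derivI[OF v(1)] by (auto intro: has_field_derivative_at_within)
      have xr: "cmod x \<le> r + s / 2" using x s' z norm_triangle_ineq[of z "x - z"] by (simp add: dist_norm norm_minus_commute)
      show "cmod (deriv v x) \<le> X powr (1 + \<epsilon>) / (s / 2)"
      proof (rule cauchy_deriv_bound[of v "r + s + 1"])
        fix y assume "cmod (y - x) \<le> s / 2"
        then have "cmod y \<le> r + s" using xr norm_triangle_ineq[of x "y - x"] by simp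
        then show "cmod (v y) \<le> X powr (1 + \<epsilon>)" using max_modulus_bound[OF v(1)] Ms order_trans by blast
      qed (use s xr in \<open>auto intro: holomorphic_on_subset[OF v(1)]\<close>)
    qed (use w s' in auto)
    also have "\<dots> \<le> (X powr (1 + \<epsilon>) / (s / 2)) * s'"
      using w s by (intro mult_left_mono) (auto simp: dist_norm norm_minus_commute)
    also have "\<dots> = X / 2" using s X1 by (simp add: s'_def powr_add)
    finally show ?thesis using z norm_triangle_ineq2[of "v z" "v w"] by (simp add: norm_minus_commute)
  qed
  have vnz: "v w \<noteq> 0" if "w \<in> cball z s'" for w using vb[OF that] X1 by auto
  show ?thesis
  proof (rule that)
    show "L < cmod (v z)" "0 < cmod (v z)" using z X X1 by auto
    fix i assume i: "i < k"
    have "cmod ((deriv ^^ i) (\<lambda>w. 1 / v w) z) \<le> fact i * (2 / X) / s' ^ i"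
    proof (rule Cauchy_inequality)
      show "continuous_on (cball z s') (\<lambda>w. 1 / v w)"
        using vnz by (intro continuous_intros holomorphic_on_imp_continuous_on holomorphic_on_subset[OF v(1)]) auto
      show "(\<lambda>w. 1 / v w) holomorphic_on ball z s'"
        using vnz by (intro holomorphic_intros holomorphic_on_subset[OF v(1)]) auto
      fix w assume "cmod (z - w) = s'"
      then have "X / 2 \<le> cmod (v w)" by (intro vb) (simp add: dist_norm)
      then have "1 / cmod (v w) \<le> 1 / (X / 2)" using X1 by (intro divide_left_mono mult_pos_pos) auto
      then show "cmod (1 / v w) \<le> 2 / X" by (simp add: norm_divide)
    qed (use s' in auto)
    also have "\<dots> \<le> fact k * (2 / X) / s' ^ k"
      using i s' X1 by (intro frac_le mult_mono fact_mono power_decreasing) auto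
    also have "\<dots> = (2 * fact k / X) * (1 / s') ^ k" by (simp add: power_divide)
    also have "1 / s' = 4 * (X powr \<epsilon> * ln X)" using lX by (simp add: s'_def s_def)
    also have "(2 * fact k / X) * (4 * (X powr \<epsilon> * ln X)) ^ k \<le> (2 * fact k / X) * ((4 / \<epsilon>) ^ k * X powr (1 / 2))"
    proof (rule mult_left_mono)
      have "X powr \<epsilon> * ln X \<le> X powr \<epsilon> * (X powr \<epsilon> / \<epsilon>)"
        using ln_powr_bound[of X \<epsilon>] X1 \<epsilon> by (intro mult_left_mono) auto
      also have "\<dots> = X powr (2 * \<epsilon>) / \<epsilon>" using powr_add[of X \<epsilon> \<epsilon>] by simp
      finally have "4 * (X powr \<epsilon> * ln X) \<le> 4 * (X powr (2 * \<epsilon>) / \<epsilon>)" by (rule mult_left_mono) simp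
      moreover have "0 \<le> X powr \<epsilon> * ln X" using lX by (intro mult_nonneg_nonneg) auto
      ultimately have "(4 * (X powr \<epsilon> * ln X)) ^ k \<le> (4 * (X powr (2 * \<epsilon>) / \<epsilon>)) ^ k"
        by (intro power_mono) linarith+
      also have "\<dots> = (4 / \<epsilon> * X powr (2 * \<epsilon>)) ^ k" by simp
      also have "\<dots> = (4 / \<epsilon>) ^ k * X powr (2 * \<epsilon> * real k)"
        using X1 by (simp only: power_mult_distrib) (simp add: powr_power mult_ac)
      also have "\<dots> \<le> (4 / \<epsilon>) ^ k * X powr (1 / 2)"
        using X1 \<epsilon> by (intro mult_left_mono powr_mono) auto
      finally show "(4 * (X powr \<epsilon> * ln X)) ^ k \<le> (4 / \<epsilon>) ^ k * X powr (1 / 2)" .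
    qed (use X1 in auto)
    also have "\<dots> = D * (X powr (1 / 2) / X)" by (simp add: D_def)
    also have "X powr (1 / 2) / X = 1 / sqrt X"
    proof -
      have "X powr (1 / 2) / (sqrt X * sqrt X) = 1 / sqrt X" using X1 unfolding powr_half_sqrt[OF less_imp_le[OF less_trans[OF zero_less_one X1]]] by (simp del: real_sqrt_mult_self)
      then show ?thesis using X1 by simp
    qed
    also have "D * (1 / sqrt X) \<le> 1"
    proof -
      have "D \<le> sqrt X" using X(3) D by (simp add: real_le_rsqrt)
      then show ?thesis using X1 by simp
    qed
    finally show "cmod ((deriv ^^ i) (\<lambda>w. 1 / v w) z) \<le> 1" .
  qed
qed

theorem power_times_diff_polynomial_nonconstant:
  assumes tr: "transcendental_meromorphic f" and dp: "diff_polynomial_in f Q"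
    and Q: "\<not> eventually (\<lambda>z. Q z = 0) (cosparse UNIV)" and \<alpha>: "1 \<le> \<alpha>"
  shows "\<not> eventually (\<lambda>z. f z ^ \<alpha> * Q z = c) (cosparse UNIV)"
proof
  assume ev: "eventually (\<lambda>z. f z ^ \<alpha> * Q z = c) (cosparse UNIV)"
  have f: "nzmero f" by (rule transcendental_nzmero[OF tr])
  have fnz: "eventually (\<lambda>z. f z \<noteq> 0) (cosparse UNIV)" using f by (simp add: nzmero_def)
  have fan: "eventually (\<lambda>z. f analytic_on {z}) (cosparse UNIV)"
    by (rule meromorphic_on_imp_analytic_cosparse[OF nzmero_meromorphic[OF f]])
  obtain ts where ts: "Q = dpoly ts f" using dp unfolding diff_polynomial_in_def dpoly_def[abs_def] by blast
  have c0: "c \<noteq> 0"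
  proof
    assume "c = 0"
    from ev fnz have "eventually (\<lambda>z. Q z = 0) (cosparse UNIV)" by eventually_elim (simp add: \<open>c = 0\<close>)
    then show False using Q by contradiction
  qed
  note at = eventually_cosparse_imp_eventually_at[where A = UNIV and B = UNIV, OF _ UNIV_I]
  \<comment> \<open>Near a zero \<open>f\<close> is, up to a removable singularity, analytic; then
    \<open>Q\<close> stays bounded there and the product would have the limit 0 instead of
    \<open>c\<close>. So \<open>1 / f\<close> has no poles.\<close>
  have ord: "0 \<le> zorder (\<lambda>z. 1 / f z) z0" for z0
  proof (rule ccontr)
    assume "\<not> ?thesis"
    then have "zorder f z0 > 0" by (simp add: zorder_recip[OF f])
    then have iz: "isolated_zero f z0"
      using zorder_pos_imp_isolated_zero[of f z0] nzmero_meromorphic[OF f] nzmero_eventually[OF f] by blast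
    then have l0: "f \<midarrow>z0\<rightarrow> 0" by (simp add: isolated_zero_def)
    define f' where "f' = remove_sings f"
    have f': "f' analytic_on {z0}" "f' z0 = 0" unfolding f'_def
      using remove_sings_analytic_at[OF nzmero_iso[OF f] l0] remove_sings_eqI[OF l0] by auto
    have an: "(\<lambda>z. f' z ^ \<alpha> * dpoly ts f' z) analytic_on {z0}"
      by (intro analytic_intros f' dpoly_analytic)
    have "eventually (\<lambda>z. f' z ^ \<alpha> * dpoly ts f' z = c) (at z0)"
      using at[OF ev] at[OF fan]
    proof eventually_elim
      case (elim z)
      have "eventually (\<lambda>w. f' w = f w) (nhds z)" unfolding f'_def
        by (rule eventually_remove_sings_eq_nhds[OF elim(2)])
      then have "dpoly ts f' z = Q z" "f' z = f z"
        unfolding ts by (rule dpoly_cong, rule eventually_nhds_x_imp_x)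
      then show ?case using elim(1) by simp
    qed
    then have "f' z0 ^ \<alpha> * dpoly ts f' z0 = c"
      using isCont_eventually_const[OF analytic_at_imp_isCont[OF an]] by blast
    then show False using f'(2) c0 \<alpha> by (simp add: zero_power)
  qed
  define v where "v = remove_sings (\<lambda>z. 1 / f z)"
  have v: "v holomorphic_on UNIV" unfolding v_def
    by (rule entire_remove_sings[OF nzmero_inverse[OF f]]) (rule ord)
  have vc: "\<not> v constant_on UNIV"
  proof
    assume "v constant_on UNIV"
    then obtain c1 where c1: "\<And>z. v z = c1" by (auto simp: constant_on_def)
    have "eventually (\<lambda>z. v z = 1 / f z) (cosparse UNIV)" unfolding v_def
      by (rule remove_sings_cosparse_eq[OF nzmero_meromorphic[OF nzmero_inverse[OF f]]])
    then have "eventually (\<lambda>z. f z = poly [:1 / c1:] z / poly 1 z) (cosparse UNIV)"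
      by eventually_elim (simp add: c1)
    then show False using tr unfolding transcendental_meromorphic_def by (metis zero_neq_one)
  qed
  define f1 where "f1 = (\<lambda>z. 1 / v z)"
  \<comment> \<open>The identity for \<open>f\<close> holds only off a discrete set. For
    \<open>1 / v\<close> it extends by continuity to every point with \<open>v z \<noteq> 0\<close>,
    in particular to the point supplied by \<open>small_reciprocal_derivs\<close>, which cannot be
    moved.\<close>
  have F1: "f1 z ^ \<alpha> * dpoly ts f1 z = c" if vz: "v z \<noteq> 0" for z
  proof -
    have "f1 analytic_on {z}" unfolding f1_def using vz entire_analytic[OF v] by (auto intro!: analytic_intros)
    then have an: "(\<lambda>z. f1 z ^ \<alpha> * dpoly ts f1 z) analytic_on {z}"
      by (intro analytic_intros dpoly_analytic)
    have "eventually (\<lambda>w. f1 w ^ \<alpha> * dpoly ts f1 w = c) (at z)"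
      using at[OF ev] at[OF fan] at[OF fnz]
    proof eventually_elim
      case (elim w)
      have "(\<lambda>z. 1 / f z) analytic_on {w}" using elim by (auto intro!: analytic_intros)
      then have "eventually (\<lambda>x. v x = 1 / f x) (nhds w)" unfolding v_def
        by (rule eventually_remove_sings_eq_nhds)
      then have "eventually (\<lambda>x. f1 x = f x) (nhds w)" by eventually_elim (simp add: f1_def)
      then have "dpoly ts f1 w = Q w" "f1 w = f w"
        unfolding ts by (rule dpoly_cong, rule eventually_nhds_x_imp_x)
      then show ?case using elim(1) by simp
    qed
    then show ?thesis using isCont_eventually_const[OF analytic_at_imp_isCont[OF an]] by blast
  qed
  define k where "k = Max (insert 0 ((\<lambda>(a, ns). length ns) ` set ts))"
  have k: "length ns \<le> k" if "(a, ns) \<in> set ts" for a ns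
    unfolding k_def by (rule Max_ge) (use that in force)+
  define A where "A = (\<Sum>(a, ns)\<leftarrow>ts. cmod a)"
  obtain z where z: "max 1 (A / cmod c) < cmod (v z)" "0 < cmod (v z)"
      "\<And>i. i < k \<Longrightarrow> cmod ((deriv ^^ i) (\<lambda>w. 1 / v w) z) \<le> 1"
    using small_reciprocal_derivs[OF v vc] by metis
  have "cmod (dpoly ts f1 z) \<le> A" unfolding A_def
    by (rule dpoly_bound[of k]) (use z(3) k in \<open>auto simp: f1_def\<close>)
  moreover have "dpoly ts f1 z = c * v z ^ \<alpha>"
    using F1[of z] z(2) by (simp add: f1_def field_simps)
  ultimately have "cmod c * cmod (v z) ^ \<alpha> \<le> A" by (simp add: norm_mult norm_power)
  moreover have "cmod (v z) ^ 1 \<le> cmod (v z) ^ \<alpha>" using z(1) \<alpha> by (intro power_increasing) auto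
  then have "cmod c * cmod (v z) \<le> cmod c * cmod (v z) ^ \<alpha>" by (intro mult_left_mono) auto
  moreover have "A < cmod c * cmod (v z)" using z(1) c0 by (simp add: field_simps)
  ultimately show False by linarith
qed

section \<open>Rarely taken values of an entire function\<close>

lemma lead_ln_nonzero:
  assumes "f analytic_on {0}" "f 0 \<noteq> 0" shows "lead_ln f = ln (cmod (f 0))"
proof -
  have z: "zorder f 0 = 0" by (rule zorder_eq_0I[OF assms])
  have ev: "eventually (\<lambda>w. f w \<noteq> 0) (at 0)"
    using eventually_nhds_good_point[OF assms] by (auto simp: eventually_at_filter elim: eventually_mono)
  have "zor_poly f 0 0 = f 0"
  proof (rule zor_poly_eqI[of f 0 "\<lambda>x. x" "f 0" "at 0"])
    show "((\<lambda>x. f x * (x - 0) powi - zorder f 0) \<longlongrightarrow> f 0) (at 0)"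
      using analytic_at_imp_isCont[OF assms(1)] by (simp add: z isCont_def)
    show "\<exists>\<^sub>F w in at 0. f w \<noteq> 0" using ev by (rule eventually_frequently[rotated]) simp
  qed (use assms in \<open>auto intro: isolated_singularity_at_analytic not_essential_analytic filterlim_ident\<close>)
  then show ?thesis by (simp add: lead_ln_def)
qed

lemma lead_ln_cmult:
  assumes f: "nzmero f" and c: "c \<noteq> 0" shows "lead_ln (\<lambda>z. c * f z) = ln (cmod c) + lead_ln f"
proof -
  have cf: "nzmero (\<lambda>z. c * f z)" by (rule nzmero_mult[OF nzmero_const[OF c] f])
  note P = zorder_exist[OF nzmero_iso[OF f] nzmero_ness[OF f] nzmero_frequently[OF f], of 0]
  obtain s where s: "s > 0" "zor_poly f 0 holomorphic_on cball 0 s" using P by blast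
  have "isCont (zor_poly f 0) 0"
    by (rule analytic_at_imp_isCont) (use s in \<open>auto simp: analytic_at intro!: exI[of _ "ball 0 s"] holomorphic_on_subset[OF s(2)]\<close>)
  then have t: "((\<lambda>w. c * zor_poly f 0 w) \<longlongrightarrow> c * zor_poly f 0 0) (at 0)" by (intro tendsto_intros) (simp add: isCont_def)
  have "eventually (\<lambda>w. c * zor_poly f 0 w = c * f w * (w - 0) powi - zorder (\<lambda>z. c * f z) 0) (at 0)"
    using zor_poly_eq[OF nzmero_iso[OF f] nzmero_ness[OF f] nzmero_frequently[OF f], of 0]
    by eventually_elim (simp add: zorder_cmult[OF c])
  then have "((\<lambda>w. c * f w * (w - 0) powi - zorder (\<lambda>z. c * f z) 0) \<longlongrightarrow> c * zor_poly f 0 0) (at 0)"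
    by (rule Lim_transform_eventually[OF t])
  then have "zor_poly (\<lambda>z. c * f z) 0 0 = c * zor_poly f 0 0"
    by (intro zor_poly_eqI[of _ 0 "\<lambda>x. x" _ "at 0"])
       (assumption | rule nzmero_iso[OF cf] nzmero_ness[OF cf] nzmero_frequently[OF cf] filterlim_ident at_neq_bot)+
  moreover have "zor_poly f 0 0 \<noteq> 0" using P by blast
  ultimately show ?thesis using c by (simp add: lead_ln_def norm_mult ln_mult)
qed

lemma counting_cmult:
  assumes f: "nzmero f" and c: "c \<noteq> 0" and r: "0 < r"
  shows "counting (\<lambda>z. c * f z) r = counting f r"
proof -
  have cf: "nzmero (\<lambda>z. c * f z)" by (rule nzmero_mult[OF nzmero_const[OF c] f])
  have "pord (\<lambda>z. c * f z) p = pord f p" for p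
    by (simp add: pord_eq_zorder[OF cf] pord_eq_zorder[OF f] zorder_cmult[OF c])
  then show ?thesis
    by (simp add: counting_eq'[OF nzmero_meromorphic[OF cf] r] counting_eq'[OF nzmero_meromorphic[OF f] r])
qed

lemma log_plus_norm_diff: "log_plus (cmod (a - b)) \<le> log_plus (cmod a) + log_plus (cmod b) + ln 2"
  using log_plus_mono[OF norm_triangle_ineq4[of a b]] log_plus_add[of "cmod a" "cmod b"] by simp

lemma ln2_le_1: "ln 2 \<le> (1::real)" using ln_le_minus_one[of 2] by simp

lemma log_plus_le_of_exp: "0 \<le> V \<Longrightarrow> x \<le> exp V \<Longrightarrow> log_plus x \<le> V"
  by (rule log_plus_le, assumption) (metis ln_exp ln_le_cancel_iff exp_gt_zero)

text \<open>If \<open>g\<close> takes the value \<open>w\<close> only rarely in a disc, then \<open>g - w = e\<^sup>h B\<close> with a Blaschke product \<open>B\<close>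
  that hardly matters, and the Taylor coefficients of \<open>h\<close> can be estimated on any smaller circle.\<close>

lemma few_zeros_factorization:
  assumes g: "g holomorphic_on UNIV" "\<not> g constant_on UNIV"
    and w: "1 \<le> cmod (w - g 0)" "cmod w \<le> exp V" "0 \<le> V"
    and \<rho>: "good (\<lambda>z. g z - w) \<rho>" "1 \<le> \<rho>" "counting (\<lambda>z. 1 / (g z - w)) \<rho> \<le> V"
  obtains h R where "\<rho> < R" "h holomorphic_on ball 0 R"
    "Re (h 0) \<le> 2 * V + ln (1 + cmod (g 0))"
    "\<And>z. cmod z \<le> \<rho> \<Longrightarrow> g z \<noteq> w \<Longrightarrow> ln (cmod (g z - w)) \<le> Re (h z)"
    "\<And>t n. good (\<lambda>z. g z - w) t \<Longrightarrow> 1 \<le> t \<Longrightarrow> t < \<rho> \<Longrightarrow> 1 \<le> n \<Longrightarrow>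
       cmod ((deriv ^^ n) h 0 / fact n) * t ^ n \<le> 4 * log_plus (max_modulus g t) + 6 * V + 4"
proof -
  define u where "u = (\<lambda>z. g z - w)"
  have u0: "u 0 \<noteq> 0" using w by (auto simp: u_def)
  have uh: "u holomorphic_on UNIV" unfolding u_def by (intro holomorphic_intros g)
  have un: "nzmero u" by (rule nzmero_entire[OF uh u0])
  have gu: "good u \<rho>" using \<rho>(1) by (simp add: u_def)
  obtain h R where h: "\<rho> < R" "h holomorphic_on ball 0 R"
    and lf: "\<And>z. cmod z \<le> \<rho> \<Longrightarrow> u analytic_on {z} \<Longrightarrow> zorder u z = 0 \<Longrightarrow>
       ln (cmod (u z)) = Re (h z) + (\<Sum>p | cmod p < \<rho> \<and> zorder u p \<noteq> 0.
          real_of_int (zorder u p) * ln (cmod (blaschke \<rho> p z)))"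
    and h0: "Re (h 0) = lead_ln u + counting (\<lambda>z. 1 / u z) \<rho> - counting u \<rho>"
    by (rule blaschke_log_factorization[OF un gu], rule that) assumption+
  have ld: "lead_ln u = ln (cmod (u 0))" by (rule lead_ln_nonzero[OF entire_analytic[OF uh] u0])
  have ld0: "0 \<le> lead_ln u" unfolding ld using w by (simp add: u_def norm_minus_commute)
  have "cmod (u 0) \<le> (1 + cmod (g 0)) * exp V"
  proof -
    have "cmod (u 0) \<le> cmod (g 0) * 1 + 1 * cmod w" unfolding u_def using norm_triangle_ineq4 by simp
    also have "\<dots> \<le> cmod (g 0) * exp V + 1 * exp V" using w by (intro add_mono mult_left_mono) auto
    finally show ?thesis by (simp add: algebra_simps)
  qed
  then have "ln (cmod (u 0)) \<le> ln ((1 + cmod (g 0)) * exp V)"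
    using u0 by (subst ln_le_cancel_iff) (auto intro!: mult_pos_pos add_pos_nonneg)
  also have "\<dots> = ln (1 + cmod (g 0)) + V" by (subst ln_mult_pos) (auto intro!: add_pos_nonneg)
  finally have ldV: "lead_ln u \<le> ln (1 + cmod (g 0)) + V" by (simp add: ld)
  have cu: "counting u t = 0" if "0 < t" for t by (rule entire_counting[OF uh that])
  have cn: "0 \<le> counting (\<lambda>z. 1 / u z) t" if "1 \<le> t" for t
    by (rule counting_nonneg[OF nzmero_meromorphic[OF nzmero_inverse[OF un]] that])
  have c\<rho>: "counting (\<lambda>z. 1 / u z) \<rho> \<le> V" using \<rho>(3) by (simp add: u_def)
  have le: "ln (cmod (u z)) \<le> Re (h z)" if z: "cmod z \<le> \<rho>" "u z \<noteq> 0" for z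
  proof -
    have "ln (cmod (u z)) = Re (h z) + (\<Sum>p | cmod p < \<rho> \<and> zorder u p \<noteq> 0.
          real_of_int (zorder u p) * ln (cmod (blaschke \<rho> p z)))"
      by (rule lf) (use z entire_analytic[OF uh] in \<open>auto intro!: zorder_eq_0I\<close>)
    also have "\<dots> \<le> Re (h z) + 0"
    proof (intro add_left_mono sum_nonpos)
      fix p assume p: "p \<in> {p. cmod p < \<rho> \<and> zorder u p \<noteq> 0}"
      have "0 \<le> zorder u p" using zorder_eq_pord[OF un, of p] entire_pord[OF uh] by simp
      moreover have "ln (cmod (blaschke \<rho> p z)) \<le> 0"
        using p z blaschke_norm_le_1[of p \<rho> z] by (cases "blaschke \<rho> p z = 0") auto
      ultimately show "real_of_int (zorder u p) * ln (cmod (blaschke \<rho> p z)) \<le> 0"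
        by (simp add: mult_nonneg_nonpos)
    qed
    finally show ?thesis by simp
  qed
  have co: "cmod ((deriv ^^ n) h 0 / fact n) * t ^ n \<le> 4 * log_plus (max_modulus g t) + 6 * V + 4"
    if t: "good u t" "1 \<le> t" "t < \<rho>" and n: "1 \<le> n" for t n
  proof -
    have t0: "0 < t" "0 \<le> t" "t < R" using t h by auto
    have hc: "continuous_on (sphere 0 t) h"
      by (intro holomorphic_on_imp_continuous_on holomorphic_on_subset[OF h(2)]) (use t0 in auto)
    have lc: "continuous_on (sphere 0 t) (\<lambda>z. ln (cmod (u z)))" by (rule good_ln_continuous[OF t(1)])
    have le': "ln (cmod (u z)) \<le> Re (h z)" if "cmod z = t" for z
      by (rule le) (use that t in \<open>auto simp: good_def\<close>)
    \<comment> \<open>The difference \<open>Re h - ln |u|\<close> is nonnegative, and by Jensen's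
      formula its mean is a difference of counting functions, at most \<open>V\<close>. The mean of
      \<open>ln |u|\<close> is nonnegative because \<open>1 \<le> |w - g 0|\<close>, so the mean of
      \<open>|ln |u||\<close> is at most twice the proximity function.\<close>
    have "cmean (\<lambda>z. \<bar>Re (h z)\<bar>) t \<le> cmean (\<lambda>z. \<bar>ln (cmod (u z))\<bar> + (Re (h z) - ln (cmod (u z)))) t"
    proof (rule cmean_mono)
      fix z assume "cmod z = t"
      then have "ln (cmod (u z)) \<le> Re (h z)" by (rule le')
      then show "\<bar>Re (h z)\<bar> \<le> \<bar>ln (cmod (u z))\<bar> + (Re (h z) - ln (cmod (u z)))" by linarith
    qed (use t0 in \<open>auto intro!: continuous_intros hc lc\<close>)
    also have "\<dots> = cmean (\<lambda>z. \<bar>ln (cmod (u z))\<bar>) t + (cmean (\<lambda>z. Re (h z)) t - cmean (\<lambda>z. ln (cmod (u z))) t)"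
      using t0 by (subst cmean_add, (intro continuous_intros hc lc)+, simp, subst cmean_diff) (auto intro!: continuous_intros hc lc)
    also have "cmean (\<lambda>z. Re (h z)) t = Re (h 0)" by (rule cmean_Re_holomorphic[OF h(2) t0(1) t0(3)])
    also have "cmean (\<lambda>z. \<bar>ln (cmod (u z))\<bar>) t = 2 * proximity u t - cmean (\<lambda>z. ln (cmod (u z))) t"
      using cmean_abs_ln_eq_proximity[OF t(1)] cmean_ln_eq_proximity[OF t(1)] by simp
    also have "cmean (\<lambda>z. ln (cmod (u z))) t = lead_ln u + counting (\<lambda>z. 1 / u z) t"
      using jensen[OF un t(1)] cu[of t] t0 by simp
    finally have 1: "cmean (\<lambda>z. \<bar>Re (h z)\<bar>) t \<le> 2 * proximity u t + V"
      using h0 cu[of \<rho>] cn[OF t(2)] c\<rho> ld0 \<rho>(2) by simp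
    have "proximity u t \<le> log_plus (max_modulus g t) + V + 1" unfolding proximity_eq_cmean
    proof (rule cmean_le)
      show "continuous_on (sphere 0 t) (\<lambda>z. log_plus (cmod (u z)))"
        by (rule reg_log_plus_continuous[OF good_imp_reg[OF t(1)]])
      fix z assume z: "cmod z = t"
      have "log_plus (cmod (u z)) \<le> log_plus (cmod (g z)) + log_plus (cmod w) + ln 2"
        unfolding u_def by (rule log_plus_norm_diff)
      also have "log_plus (cmod (g z)) \<le> log_plus (max_modulus g t)"
        by (intro log_plus_mono max_modulus_bound[OF g(1)]) (use z in auto)
      also have "log_plus (cmod w) \<le> V" by (rule log_plus_le_of_exp) (use w in auto)
      finally show "log_plus (cmod (u z)) \<le> log_plus (max_modulus g t) + V + 1" using ln2_le_1 by linarith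
    qed (use t0 in auto)
    then show ?thesis using coeff_bound_Re[OF h(2) t0(1) t0(3) n] 1 by linarith
  qed
  show ?thesis
    by (rule that[OF h]) (use h0 cu[of \<rho>] \<rho> c\<rho> ldV le co in \<open>auto simp: u_def\<close>)
qed

text \<open>As \<eta> tends to 0 the first expression behaves like a power with exponent
  \<open>b - \<mu> > 0\<close>; as \<open>K\<close> grows the second has the exponent
  \<open>b - \<mu> - 1 < 0\<close>. They govern the Taylor terms of order up to \<mu> and above
  \<mu>; the two quarters leave half of the left-hand side for the contradiction in
  \<open>growth_step\<close>.\<close>

lemma growth_constants:
  fixes b \<mu> :: real
  assumes "\<mu> < b" "b < \<mu> + 1" "0 \<le> \<mu>"
  obtains \<eta> K where "0 < \<eta>" "\<eta> \<le> 1 / 4" "4 * \<mu> * (2 * \<eta>) powr b * \<eta> powr (- \<mu>) \<le> 1 / 4"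
    "8 \<le> K" "8 * (2 / K) powr (\<mu> + 1) * K powr b \<le> 1 / 4"
proof -
  have "eventually (\<lambda>\<eta>. 4 * \<mu> * (2 * \<eta>) powr b * \<eta> powr (- \<mu>) < 1 / 4) (at_right 0)"
    using assms by (cases "\<mu> = 0") (simp, real_asymp)
  moreover have "eventually (\<lambda>\<eta>::real. \<eta> < 1 / 4) (at_right 0)" by real_asymp
  moreover have "eventually (\<lambda>\<eta>::real. 0 < \<eta>) (at_right 0)" by (rule eventually_at_right_less)
  ultimately have "eventually (\<lambda>\<eta>. 0 < \<eta> \<and> \<eta> < 1 / 4 \<and> 4 * \<mu> * (2 * \<eta>) powr b * \<eta> powr (- \<mu>) < 1 / 4) (at_right 0)"
    by eventually_elim auto
  then obtain \<eta> where \<eta>: "0 < \<eta>" "\<eta> < 1 / 4" "4 * \<mu> * (2 * \<eta>) powr b * \<eta> powr (- \<mu>) < 1 / 4"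
    using eventually_happens'[of "at_right (0::real)"] by auto
  have "eventually (\<lambda>K. 8 * (2 / K) powr (\<mu> + 1) * K powr b < 1 / 4) at_top"
    using assms by real_asymp
  then have "eventually (\<lambda>K. 8 \<le> K \<and> 8 * (2 / K) powr (\<mu> + 1) * K powr b < 1 / 4) at_top"
    using eventually_ge_at_top[of 8] by eventually_elim auto
  then obtain K where "8 \<le> K" "8 * (2 / K) powr (\<mu> + 1) * K powr b < 1 / 4"
    using eventually_happens'[of "at_top :: real filter"] by auto
  then show ?thesis using \<eta> that[of \<eta> K] by auto
qed

lemma eventually_powr_dominates:
  fixes \<beta> b A B k c :: real
  assumes "0 < \<beta>" "\<beta> < b" "0 < k" "0 < c"
  shows "eventually (\<lambda>r. A + B * (k * r) powr \<beta> < c * r powr b) at_top"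
  using assms by real_asymp

lemma max_modulus_nonneg:
  assumes "g holomorphic_on UNIV" "0 \<le> r" shows "0 \<le> max_modulus g r"
  by (rule max_modulus_attained[OF assms]) (metis norm_ge_zero)

lemma gt_1_if_ln_pos: "0 \<le> x \<Longrightarrow> 0 < ln x \<Longrightarrow> 1 < x" for x :: real
  by (cases "x = 0") (auto intro: ln_gt_zero_imp_gt_one)

text \<open>Coefficients of order up to \<open>m\<close> will be estimated on a smaller circle than
  \<open>|z|\<close>, the later ones on a much larger circle, where they form a geometric series of
  ratio at most 1/2.\<close>

lemma power_series_split_bound:
  assumes h: "h holomorphic_on ball 0 R" "cmod z < R"
    and lo: "\<And>n. n < m \<Longrightarrow> cmod ((deriv ^^ Suc n) h 0 / fact (Suc n)) * cmod z ^ Suc n \<le> A"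
    and hi: "\<And>n. m \<le> n \<Longrightarrow> cmod ((deriv ^^ Suc n) h 0 / fact (Suc n)) * cmod z ^ Suc n \<le> H * q ^ Suc n"
    and q: "0 \<le> q" "q \<le> 1 / 2" and H: "0 \<le> H"
  shows "cmod (h z - h 0) \<le> real m * A + 2 * H * q ^ Suc m"
proof -
  let ?c = "\<lambda>n. (deriv ^^ n) h 0 / fact n"
  have "(\<lambda>n. ?c n * (z - 0) ^ n) sums h z"
    by (rule holomorphic_power_series[OF h(1)]) (use h in auto)
  then have "(\<lambda>n. ?c (Suc n) * z ^ Suc n) sums (h z - h 0)"
    by (subst sums_Suc_iff) auto
  then have s: "(\<lambda>n. ?c (Suc (n + m)) * z ^ Suc (n + m)) sums (h z - h 0 - (\<Sum>n<m. ?c (Suc n) * z ^ Suc n))"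
    by (subst sums_iff_shift) (simp add: add.commute)
  have "cmod (h z - h 0 - (\<Sum>n<m. ?c (Suc n) * z ^ Suc n)) \<le> H * q ^ Suc m * (1 / (1 - q))"
  proof -
    have g: "(\<lambda>n. H * q ^ Suc m * q ^ n) sums (H * q ^ Suc m * (1 / (1 - q)))"
      by (intro sums_mult geometric_sums) (use q in auto)
    have "cmod (?c (Suc (n + m)) * z ^ Suc (n + m)) \<le> H * q ^ Suc m * q ^ n" for n
    proof -
      have "H * q ^ Suc (n + m) = H * q ^ Suc m * q ^ n" by (simp add: power_add)
      then show ?thesis using hi[of "n + m"] by (simp only: norm_mult norm_power)
    qed
    then show ?thesis
      using s g by (metis (no_types, lifting) norm_suminf_le sums_summable sums_unique)
  qed
  also have "\<dots> \<le> H * q ^ Suc m * 2"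
    using q H by (intro mult_left_mono mult_nonneg_nonneg) (auto simp: divide_le_eq)
  finally have 1: "cmod (h z - h 0 - (\<Sum>n<m. ?c (Suc n) * z ^ Suc n)) \<le> 2 * H * q ^ Suc m" by simp
  have 2: "cmod (\<Sum>n<m. ?c (Suc n) * z ^ Suc n) \<le> real m * A"
  proof -
    have "cmod (?c (Suc n) * z ^ Suc n) \<le> A" if "n < m" for n
      using lo[OF that] by (simp only: norm_mult norm_power)
    then show ?thesis using sum_norm_bound[of "{..<m}" "\<lambda>n. ?c (Suc n) * z ^ Suc n" A] by simp
  qed
  show ?thesis
    using norm_triangle_ineq[of "h z - h 0 - (\<Sum>n<m. ?c (Suc n) * z ^ Suc n)" "\<Sum>n<m. ?c (Suc n) * z ^ Suc n"] 1 2 by simp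
qed

text \<open>If some value is rarely taken up to \<open>8 K r\<close> and \<open>r\<close> is a record of \<open>ln M(t) / t\<^sup>b\<close>, then the ratio
  is still larger at \<open>K r\<close>: the coefficients of \<open>h\<close> up to order \<open>m < b\<close> are too small to account for
  \<open>ln M(r)\<close>, and a term of order at least \<open>m + 1 > b\<close> keeps growing.\<close>

lemma growth_step:
  assumes g: "g holomorphic_on UNIV" "\<not> g constant_on UNIV"
    and b: "0 < \<beta>" "\<beta> < b" "real m < b" "b < real m + 1"
  obtains K Rs where "8 \<le> K" "1 \<le> Rs"
    "\<And>r w. Rs \<le> r \<Longrightarrow> r powr b \<le> ln (max_modulus g r) \<Longrightarrow>
      \<forall>t. 1 \<le> t \<longrightarrow> t \<le> r \<longrightarrow> ln (max_modulus g t) \<le> (t / r) powr b * ln (max_modulus g r) \<Longrightarrow>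
      1 \<le> cmod (w - g 0) \<Longrightarrow> cmod w \<le> exp ((8 * K * r) powr \<beta>) \<Longrightarrow>
      counting (\<lambda>z. 1 / (g z - w)) (8 * K * r) < (8 * K * r) powr \<beta> \<Longrightarrow>
      K powr b * ln (max_modulus g r) < ln (max_modulus g (K * r))"
proof -
  define L where "L = (\<lambda>r. ln (max_modulus g r))"
  obtain \<eta> K where \<eta>: "0 < \<eta>" "\<eta> \<le> 1 / 4" "4 * real m * (2 * \<eta>) powr b * \<eta> powr (- real m) \<le> 1 / 4"
    and K: "8 \<le> K" "8 * (2 / K) powr (real m + 1) * K powr b \<le> 1 / 4"
    using growth_constants[of "real m" b] b by auto
  define c0 where "c0 = ln (1 + cmod (g 0))"
  define e where "e = (1 / \<eta>) ^ m"
  define k where "k = (2 / K) ^ Suc m"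
  have e: "0 < e" "e = \<eta> powr (- real m)" using \<eta> by (auto simp: e_def powr_minus powr_realpow power_divide inverse_eq_divide)
  have "(2 / K) powr real (Suc m) = k" unfolding k_def by (rule powr_realpow) (use K in auto)
  moreover have "real (Suc m) = real m + 1" by simp
  ultimately have k2: "k = (2 / K) powr (real m + 1)" by metis
  have k: "0 < k" "k = (2 / K) powr (real m + 1)" using K k2 by (simp add: k_def, simp only:)
  have "eventually (\<lambda>r. (ln 2 + c0 + real m * e * 4 + 8 * k) + (2 + real m * e * 6 + 12 * k) * (8 * K * r) powr \<beta> < 1 / 2 * r powr b) at_top"
    by (rule eventually_powr_dominates) (use b K in auto)
  moreover have "eventually (\<lambda>r. ln 2 + 1 * (8 * K * r) powr \<beta> < 1 * r powr b) at_top"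
    by (rule eventually_powr_dominates) (use b K in auto)
  ultimately have "eventually (\<lambda>r. (ln 2 + c0 + real m * e * 4 + 8 * k) + (2 + real m * e * 6 + 12 * k) * (8 * K * r) powr \<beta> < 1 / 2 * r powr b
     \<and> ln 2 + 1 * (8 * K * r) powr \<beta> < 1 * r powr b) at_top" by (rule eventually_conj)
  then obtain R1 where R1: "\<And>r. R1 \<le> r \<Longrightarrow> (ln 2 + c0 + real m * e * 4 + 8 * k) + (2 + real m * e * 6 + 12 * k) * (8 * K * r) powr \<beta> < 1 / 2 * r powr b
     \<and> ln 2 + 1 * (8 * K * r) powr \<beta> < 1 * r powr b" unfolding eventually_at_top_linorder by blast
  define Rs where "Rs = max R1 (1 / \<eta>)"
  have "1 \<le> 1 / \<eta>" using \<eta> by simp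
  then have Rs1: "1 \<le> Rs" by (simp add: Rs_def le_max_iff_disj)
  have main: "K powr b * L r < L (K * r)"
    if r: "Rs \<le> r" "r powr b \<le> L r"
      and rec: "\<And>t. 1 \<le> t \<Longrightarrow> t \<le> r \<Longrightarrow> L t \<le> (t / r) powr b * L r"
      and w: "1 \<le> cmod (w - g 0)" "cmod w \<le> exp ((8 * K * r) powr \<beta>)"
      and cw: "counting (\<lambda>z. 1 / (g z - w)) (8 * K * r) < (8 * K * r) powr \<beta>" for r w
  proof (rule ccontr)
    assume "\<not> K powr b * L r < L (K * r)"
    then have neg: "L (K * r) \<le> K powr b * L r" by simp
    define W where "W = (8 * K * r) powr \<beta>"
    have W0: "0 \<le> W" by (simp add: W_def)
    have r1: "1 \<le> r" "1 / \<eta> \<le> r" using r Rs1 by (auto simp: Rs_def)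
    have big: "(ln 2 + c0 + real m * e * 4 + 8 * k) + (2 + real m * e * 6 + 12 * k) * W < 1 / 2 * r powr b" "ln 2 + W < r powr b"
      using R1[of r] r by (auto simp: Rs_def W_def)
    have er: "1 \<le> \<eta> * r" using r1 \<eta> by (simp add: field_simps)
    define u where "u = (\<lambda>z. g z - w)"
    have u0: "u 0 \<noteq> 0" using w by (auto simp: u_def)
    have uh: "u holomorphic_on UNIV" unfolding u_def by (intro holomorphic_intros g)
    have un: "nzmero u" by (rule nzmero_entire[OF uh u0])
    have ex: "\<exists>t. x < t \<and> t < y \<and> good u t" if "0 \<le> x" "x < y" for x y
      using ex_good[of "{u}" x y] un that by auto
    \<comment> \<open>Three scales: at \<open>t1\<close>, near \<open>\<eta> * r\<close>, the record
      property makes the coefficients of order up to \<open>m\<close> small; at \<open>t2\<close>,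
      near \<open>K * r\<close>, the negated conclusion bounds the others; and \<open>\<rho>\<close>
      limits the disc in which \<open>w\<close> is taken rarely.\<close>
    obtain t1 where t1: "\<eta> * r < t1" "t1 < 2 * \<eta> * r" "good u t1" using ex[of "\<eta> * r" "2 * \<eta> * r"] er by auto
    obtain t2 where t2: "K * r / 2 < t2" "t2 < K * r" "good u t2" using ex[of "K * r / 2" "K * r"] r1 K by auto
    obtain \<rho> where \<rho>: "K * r < \<rho>" "\<rho> < 2 * K * r" "good u \<rho>" using ex[of "K * r" "2 * K * r"] r1 K by auto
    have Kr: "8 * r \<le> K * r" using K r1 by (intro mult_right_mono) auto
    have \<rho>1: "1 \<le> \<rho>" "r < \<rho>" "r < K * r" using Kr r1 \<rho> by linarith+
    have "counting (\<lambda>z. 1 / (g z - w)) \<rho> \<le> counting (\<lambda>z. 1 / (g z - w)) (8 * K * r)"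
      using counting_mono[OF nzmero_meromorphic[OF nzmero_inverse[OF un]], of \<rho> "8 * K * r"] \<rho> \<rho>1 by (simp add: u_def)
    then have c\<rho>: "counting (\<lambda>z. 1 / (g z - w)) \<rho> \<le> W" using cw by (simp add: W_def)
    obtain h R where h: "\<rho> < R" "h holomorphic_on ball 0 R"
      and h0: "Re (h 0) \<le> 2 * W + ln (1 + cmod (g 0))"
      and le: "\<And>z. cmod z \<le> \<rho> \<Longrightarrow> g z \<noteq> w \<Longrightarrow> ln (cmod (g z - w)) \<le> Re (h z)"
      and co: "\<And>t n. good (\<lambda>z. g z - w) t \<Longrightarrow> 1 \<le> t \<Longrightarrow> t < \<rho> \<Longrightarrow> 1 \<le> n \<Longrightarrow>
         cmod ((deriv ^^ n) h 0 / fact n) * t ^ n \<le> 4 * log_plus (max_modulus g t) + 6 * W + 4"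
      by (rule few_zeros_factorization[OF g w(1) w(2)[folded W_def] W0 \<rho>(3)[unfolded u_def] \<rho>1(1) c\<rho>], rule that) assumption+
    have Lr: "1 \<le> L r" using r(2) ge_one_powr_ge_zero[of r b] r1 b by auto
    then have Mr: "1 < max_modulus g r"
      unfolding L_def using max_modulus_nonneg[OF g(1), of r] r1 by (intro gt_1_if_ln_pos) auto
    have r0: "0 \<le> r" using r1 by simp
    obtain z where z: "cmod z = r" "cmod (g z) = max_modulus g r" using max_modulus_attained[OF g(1) r0] by blast
    \<comment> \<open>At a point where \<open>|g|\<close> is maximal the value \<open>w\<close> is
      at most half as large as \<open>g z\<close>, so \<open>ln |g z - w|\<close> is still at least
      \<open>L r - ln 2\<close>.\<close>
    have "exp W \<le> max_modulus g r / 2"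
    proof -
      have "W \<le> L r - ln 2" using big(2) r(2) by linarith
      then have "exp W \<le> exp (L r - ln 2)" by simp
      also have "\<dots> = max_modulus g r / 2" using Mr by (simp add: exp_diff L_def)
      finally show ?thesis .
    qed
    then have half: "max_modulus g r / 2 \<le> cmod (g z - w)"
      using norm_triangle_ineq2[of "g z" w] z w(2) by (simp add: W_def)
    then have gw: "g z \<noteq> w" using Mr by auto
    have "L r - ln 2 = ln (max_modulus g r / 2)" using Mr by (simp add: L_def ln_div)
    also have "\<dots> \<le> ln (cmod (g z - w))" using half Mr by (subst ln_le_cancel_iff) auto
    also have "\<dots> \<le> Re (h z)" by (rule le) (use z \<rho>1 gw in auto)
    also have "\<dots> \<le> Re (h 0) + cmod (h z - h 0)" using complex_Re_le_cmod[of "h z - h 0"] by simp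
    also have "cmod (h z - h 0) \<le> real m * (e * (4 * (2 * \<eta>) powr b * L r + 6 * W + 4))
        + 2 * (4 * (K powr b * L r) + 6 * W + 4) * (2 / K) ^ Suc m"
    proof (rule power_series_split_bound[OF h(2)])
      show "cmod z < R" using z \<rho>1 h by simp
      fix n :: nat
      define a where "a = cmod ((deriv ^^ Suc n) h 0 / fact (Suc n))"
      have a0: "0 \<le> a" by (simp add: a_def)
      {
        assume n: "n < m"
        have "2 * \<eta> * r \<le> 1 * r" by (rule mult_right_mono) (use \<eta> r1 in auto)
        then have t1r: "t1 \<le> r" using t1 by linarith
        have lp: "log_plus (max_modulus g t1) \<le> (2 * \<eta>) powr b * L r"
        proof (rule log_plus_le)
          have "ln (max_modulus g t1) \<le> (t1 / r) powr b * L r"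
            using rec[of t1] t1r t1 er by (simp add: L_def)
          also have "\<dots> \<le> (2 * \<eta>) powr b * L r"
            by (intro mult_right_mono powr_mono2) (use t1 r1 b Lr er in \<open>auto simp: field_simps\<close>)
          finally show "ln (max_modulus g t1) \<le> (2 * \<eta>) powr b * L r" .
        qed (use Lr in auto)
        have t1\<rho>: "t1 < \<rho>" using t1r \<rho>1 by linarith
        have "a * r ^ Suc n = a * t1 ^ Suc n * (r / t1) ^ Suc n" using t1 er by (simp add: power_divide)
        also have "\<dots> \<le> (4 * (2 * \<eta>) powr b * L r + 6 * W + 4) * e"
        proof (rule mult_mono)
          show "a * t1 ^ Suc n \<le> 4 * (2 * \<eta>) powr b * L r + 6 * W + 4"
            using co[of t1 "Suc n"] t1 t1\<rho> er lp by (simp add: a_def u_def)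
          have "(r / t1) ^ Suc n \<le> (1 / \<eta>) ^ Suc n"
            by (intro power_mono) (use t1 er r1 \<eta> in \<open>auto simp: field_simps\<close>)
          also have "\<dots> \<le> (1 / \<eta>) ^ m" by (intro power_increasing) (use n \<eta> in auto)
          finally show "(r / t1) ^ Suc n \<le> e" by (simp add: e_def)
        qed (use Lr W0 r1 t1 er in auto)
        finally show "cmod ((deriv ^^ Suc n) h 0 / fact (Suc n)) * cmod z ^ Suc n \<le> e * (4 * (2 * \<eta>) powr b * L r + 6 * W + 4)"
          unfolding a_def[symmetric] z(1) by (simp only: mult.commute)
      }
      {
        have lp: "log_plus (max_modulus g t2) \<le> K powr b * L r"
        proof (rule log_plus_le)
          assume "0 < max_modulus g t2"
          then have "ln (max_modulus g t2) \<le> L (K * r)" unfolding L_def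
            using max_modulus_mono[OF g(1), of t2 "K * r"] t2 Kr r1 by (subst ln_le_cancel_iff) auto
          then show "ln (max_modulus g t2) \<le> K powr b * L r" using neg by linarith
        qed (use Lr in auto)
        have t20: "0 < t2" "1 \<le> t2" using t2 Kr r1 by linarith+
        have "a * r ^ Suc n = a * t2 ^ Suc n * (r / t2) ^ Suc n" using t20 by (simp add: power_divide)
        also have "\<dots> \<le> (4 * (K powr b * L r) + 6 * W + 4) * (2 / K) ^ Suc n"
        proof (rule mult_mono)
          show "a * t2 ^ Suc n \<le> 4 * (K powr b * L r) + 6 * W + 4"
            using co[of t2 "Suc n"] t2 t20 \<rho> lp by (simp add: a_def u_def)
          show "(r / t2) ^ Suc n \<le> (2 / K) ^ Suc n"
            by (intro power_mono) (use t2 t20 r1 K in \<open>auto simp: field_simps\<close>)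
        qed (use Lr W0 r1 t20 in auto)
        finally show "cmod ((deriv ^^ Suc n) h 0 / fact (Suc n)) * cmod z ^ Suc n \<le> (4 * (K powr b * L r) + 6 * W + 4) * (2 / K) ^ Suc n"
          unfolding a_def[symmetric] z(1) .
      }
    qed (use K Lr W0 in auto)
    finally have fin: "L r - ln 2 \<le> Re (h 0) + (real m * (e * (4 * (2 * \<eta>) powr b * L r + 6 * W + 4)) + 2 * (4 * (K powr b * L r) + 6 * W + 4) * k)"
      by (simp add: k_def)
    \<comment> \<open>By the choice of \<open>\<eta>\<close> and \<open>K\<close> both groups of
      terms take at most a quarter of \<open>L r\<close>; everything else is of order
      \<open>r powr \<beta>\<close>, hence negligible against
      \<open>r powr b \<le> L r\<close>.\<close>
    have q1: "real m * e * (4 * (2 * \<eta>) powr b) * L r \<le> 1 / 4 * L r"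
      by (rule mult_right_mono) (use \<eta>(3) Lr in \<open>auto simp: e mult_ac\<close>)
    have q2: "8 * k * K powr b * L r \<le> 1 / 4 * L r"
      by (rule mult_right_mono) (use K(2) Lr in \<open>auto simp: k mult_ac\<close>)
    have "real m * (e * (4 * (2 * \<eta>) powr b * L r + 6 * W + 4)) + 2 * (4 * (K powr b * L r) + 6 * W + 4) * k
      = real m * e * (4 * (2 * \<eta>) powr b) * L r + 8 * k * K powr b * L r + (real m * e * 4 + 8 * k) + (real m * e * 6 + 12 * k) * W"
      by (simp add: algebra_simps)
    then have "L r - ln 2 \<le> (2 * W + c0) + (1 / 2 * L r + (real m * e * 4 + 8 * k) + (real m * e * 6 + 12 * k) * W)"
      using fin q1 q2 h0 unfolding c0_def by linarith
    then have "1 / 2 * L r \<le> (ln 2 + c0 + real m * e * 4 + 8 * k) + (2 + real m * e * 6 + 12 * k) * W"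
      by (simp add: algebra_simps)
    then show False using big(1) r(2) by linarith
  qed
  show ?thesis by (rule that[OF K(1) Rs1]) (use main in \<open>auto simp: L_def\<close>)
qed

lemma deriv_nzmero:
  assumes g: "g holomorphic_on UNIV" "\<not> g constant_on UNIV" shows "nzmero (deriv g)"
proof -
  have "\<exists>z. deriv g z \<noteq> 0"
  proof (rule ccontr)
    assume "\<not> ?thesis"
    then have "(g has_field_derivative 0) (at x within UNIV)" for x
      using holomorphic_derivI[OF g(1), of x] by auto
    then have "g constant_on UNIV"
      by (metis UNIV_I constant_on_def has_field_derivative_zero_constant convex_UNIV)
    then show False using g(2) by contradiction
  qed
  then obtain z where z: "deriv g z \<noteq> 0" by blast
  have "deriv g holomorphic_on UNIV" by (intro holomorphic_intros g open_UNIV)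
  then show ?thesis using z by (rule nzmero_entire)
qed

text \<open>In \<open>rare_values_close\<close> the variable \<open>Y\<close> is
  \<open>ln M(t)\<close> at a suitable radius, and \<open>k * Y powr \<theta>\<close> bounds the
  counting functions. The first inequality makes the size parameter polynomial in \<open>Y\<close>,
  the second contradicts the upper bound finally obtained for \<open>Y\<close>.\<close>

lemma close_constants:
  fixes \<theta> b k c0 A lg :: real
  assumes "0 < \<theta>" "\<theta> < 1" "0 < b" "0 < k"
  obtains Y0 where "exp 2 \<le> Y0"
    "\<And>Y. Y0 \<le> Y \<Longrightarrow> Y\<^sup>2 + 2 * (k * Y powr \<theta>) + c0 + ln Y / b + 2 \<le> Y ^ 3"
    "\<And>Y. Y0 \<le> Y \<Longrightarrow> (100 * (A + 7 * (k * Y powr \<theta>) + 9 * ln Y + ln Y / b) + lg) * ln Y < Y"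
proof -
  have "eventually (\<lambda>Y. Y\<^sup>2 + 2 * (k * Y powr \<theta>) + c0 + ln Y / b + 2 < Y ^ 3) at_top"
    using assms by real_asymp
  moreover have "eventually (\<lambda>Y. (100 * (A + 7 * (k * Y powr \<theta>) + 9 * ln Y + ln Y / b) + lg) * ln Y < Y) at_top"
    using assms by real_asymp
  ultimately have "eventually (\<lambda>Y. Y\<^sup>2 + 2 * (k * Y powr \<theta>) + c0 + ln Y / b + 2 < Y ^ 3 \<and>
      (100 * (A + 7 * (k * Y powr \<theta>) + 9 * ln Y + ln Y / b) + lg) * ln Y < Y) at_top"
    by (rule eventually_conj)
  then obtain Y1 where Y1: "\<And>Y. Y1 \<le> Y \<Longrightarrow> Y\<^sup>2 + 2 * (k * Y powr \<theta>) + c0 + ln Y / b + 2 < Y ^ 3 \<and>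
      (100 * (A + 7 * (k * Y powr \<theta>) + 9 * ln Y + ln Y / b) + lg) * ln Y < Y"
    unfolding eventually_at_top_linorder by blast
  show ?thesis by (rule that[of "max (exp 2) Y1"]) (use Y1 in \<open>auto simp: less_imp_le\<close>)
qed

text \<open>Two separated values cannot both be taken rarely, by the second fundamental theorem.\<close>

lemma rare_values_close:
  assumes g: "g holomorphic_on UNIV" "\<not> g constant_on UNIV"
    and b: "0 < \<beta>" "\<beta> < b" and \<kappa>: "0 < \<kappa>"
  obtains Rs where "1 \<le> Rs"
    "\<And>r w1 w2. Rs \<le> r \<Longrightarrow> r powr b \<le> ln (max_modulus g r) \<Longrightarrow>
      1 \<le> cmod (w1 - g 0) \<Longrightarrow> cmod w1 \<le> exp ((\<kappa> * r) powr \<beta>) \<Longrightarrow>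
      1 \<le> cmod (w2 - g 0) \<Longrightarrow> cmod w2 \<le> exp ((\<kappa> * r) powr \<beta>) \<Longrightarrow>
      counting (\<lambda>z. 1 / (g z - w1)) (4 * r) \<le> (\<kappa> * r) powr \<beta> \<Longrightarrow>
      counting (\<lambda>z. 1 / (g z - w2)) (4 * r) \<le> (\<kappa> * r) powr \<beta> \<Longrightarrow> cmod (w1 - w2) < 1 / r"
proof -
  define L where "L = (\<lambda>r. ln (max_modulus g r))"
  define c0 where "c0 = ln (1 + cmod (g 0))"
  define lg where "lg = \<bar>lead_ln g\<bar>"
  define lg' where "lg' = \<bar>lead_ln (deriv g)\<bar>"
  define CE where "CE = ln (1200 * 9216 :: real)"
  define A where "A = CE + 2 * c0 + lg' + 2"
  define k where "k = \<kappa> powr \<beta>"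
  have gd: "nzmero (deriv g)" by (rule deriv_nzmero[OF g])
  obtain x0 where "g x0 \<noteq> 0" using g(2) unfolding constant_on_def by blast
  then have gn: "nzmero g" by (rule nzmero_entire[OF g(1)])
  have c0: "0 \<le> c0" by (simp add: c0_def)
  obtain Y0 where Y0: "exp 2 \<le> Y0"
    "\<And>Y. Y0 \<le> Y \<Longrightarrow> Y\<^sup>2 + 2 * (k * Y powr (\<beta> / b)) + c0 + ln Y / b + 2 \<le> Y ^ 3"
    "\<And>Y. Y0 \<le> Y \<Longrightarrow> (100 * (A + 7 * (k * Y powr (\<beta> / b)) + 9 * ln Y + ln Y / b) + 50 * lg) * ln Y < Y"
    by (rule close_constants[of "\<beta> / b" b k c0 A "50 * lg"]) (use b \<kappa> in \<open>auto simp: k_def\<close>)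
  have Y01: "1 < Y0" using Y0(1) exp_gt_one[of "2::real"] by linarith
  define Rs where "Rs = max 1 (Y0 powr (1 / b))"
  have main: "cmod (w1 - w2) < 1 / r"
    if r: "Rs \<le> r" "r powr b \<le> L r"
      and w1: "1 \<le> cmod (w1 - g 0)" "cmod w1 \<le> exp ((\<kappa> * r) powr \<beta>)"
      and w2: "1 \<le> cmod (w2 - g 0)" "cmod w2 \<le> exp ((\<kappa> * r) powr \<beta>)"
      and n1: "counting (\<lambda>z. 1 / (g z - w1)) (4 * r) \<le> (\<kappa> * r) powr \<beta>"
      and n2: "counting (\<lambda>z. 1 / (g z - w2)) (4 * r) \<le> (\<kappa> * r) powr \<beta>" for r w1 w2
  proof (rule ccontr)
    assume "\<not> cmod (w1 - w2) < 1 / r"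
    define c where "c = w2 - w1"
    have cr: "1 / r \<le> cmod c" using \<open>\<not> cmod (w1 - w2) < 1 / r\<close> by (simp add: c_def norm_minus_commute)
    have r1: "1 \<le> r" "Y0 powr (1 / b) \<le> r" using r by (auto simp: Rs_def)
    have cn: "c \<noteq> 0" using cr r1 by auto
    define V where "V = (\<kappa> * r) powr \<beta>"
    have V0: "0 \<le> V" by (simp add: V_def)
    have "(Y0 powr (1 / b)) powr b \<le> r powr b" using r1 b by (intro powr_mono2) auto
    then have rY: "Y0 \<le> r powr b" using Y01 b by (simp add: powr_powr)
    have mono: "0 \<le> x \<Longrightarrow> x \<le> y \<Longrightarrow> max_modulus g x \<le> max_modulus g y" for x y
      by (rule max_modulus_mono[OF g(1)])
    have Lr: "Y0 \<le> L r" using r rY by linarith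
    have M1: "1 < max_modulus g r" using Lr Y01 r1 max_modulus_nonneg[OF g(1), of r]
      by (intro gt_1_if_ln_pos) (auto simp: L_def)
    have Lmono: "L x \<le> L y" if "r \<le> x" "x \<le> y" for x y
      unfolding L_def using mono[of r x] mono[of x y] M1 that r1 by (subst ln_le_cancel_iff) auto
    \<comment> \<open>Borel's lemma for \<open>ln (L x)\<close> with growth factor 2 gives
      \<open>L(t + r / ln (L t)) \<le> (L t)\<^sup>2\<close>. So all auxiliary radii may be spaced
      by \<open>r / (8 * ln Y)\<close>, and the quotient of radius and spacing is only logarithmic
      in \<open>Y\<close>.\<close>
    obtain t where t: "2 * r \<le> t" "t \<le> 2 * r + r * 2 / ((2 - 1) * ln (L (2 * r)))"
      "ln (L (t + r / ln (L t))) \<le> 2 * ln (L t)"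
    proof (rule borel_growth[of "2 * r" "\<lambda>x. ln (L x)" 2 r])
      fix x y assume xy: "2 * r \<le> x" "x \<le> y"
      then show "ln (L x) \<le> ln (L y)"
        using Lmono[of r x] Lmono[of x y] Lr Y01 r1 by (subst ln_le_cancel_iff) auto
    next
      have "1 < L (2 * r)" using Lmono[of r "2 * r"] Lr Y01 r1 by simp
      then show "0 < ln (L (2 * r))" by simp
    qed (use r1 that in auto)
    define Y where "Y = L t"
    define l where "l = ln Y"
    have Yr: "L r \<le> Y" unfolding Y_def using t(1) r1 by (intro Lmono) auto
    have YY0: "Y0 \<le> Y" using Yr Lr by linarith
    have Y1: "1 < Y" using YY0 Y01 by linarith
    have ge2: "2 \<le> ln y" if "Y0 \<le> y" for y
    proof -
      have "ln (exp 2) \<le> ln y" using that Y0(1) Y01 by (subst ln_le_cancel_iff) auto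
      then show ?thesis by simp
    qed
    have l2: "2 \<le> l" unfolding l_def by (rule ge2[OF YY0])
    have t3: "t \<le> 3 * r"
    proof -
      have "2 \<le> ln (L (2 * r))" using Lmono[of r "2 * r"] Lr r1 by (intro ge2) auto
      then have "r * 2 / ((2 - 1) * ln (L (2 * r))) \<le> r * 2 / 2" using r1 by (intro divide_left_mono) auto
      then show ?thesis using t(2) by simp
    qed
    define s where "s = r / l / 8"
    have s: "0 < s" "s \<le> r / 16" using r1 l2 by (auto simp: s_def field_simps)
    have LY2: "L (t + 8 * s) \<le> Y\<^sup>2"
    proof -
      have "1 < L (t + 8 * s)" using Lmono[of t "t + 8 * s"] Y1 s t r1 by (simp add: Y_def)
      moreover have "ln (L (t + 8 * s)) \<le> ln (Y\<^sup>2)" using t(3) Y1 by (simp add: s_def l_def Y_def ln_realpow)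
      ultimately show ?thesis using Y1 by (subst (asm) ln_le_cancel_iff) auto
    qed
    \<comment> \<open>\<open>G\<close> carries the two values to 0 and 1. As they are at least
      \<open>1 / r\<close> apart, the factor \<open>1 / c\<close> changes logarithms by at most
      \<open>ln r\<close> upwards.\<close>
    define G where "G = (\<lambda>z. (1 / c) * (g z - w1))"
    have G1: "(\<lambda>z. G z - 1) = (\<lambda>z. (1 / c) * (g z - w2))" using cn by (auto simp: G_def c_def fun_eq_iff field_simps)
    have u0: "g 0 - w1 \<noteq> 0" "g 0 - w2 \<noteq> 0" using w1 w2 by auto
    have uh: "(\<lambda>z. g z - w) holomorphic_on UNIV" for w by (intro holomorphic_intros g)
    have un1: "nzmero (\<lambda>z. g z - w1)" by (rule nzmero_entire[OF uh u0(1)])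
    have un2: "nzmero (\<lambda>z. g z - w2)" by (rule nzmero_entire[OF uh u0(2)])
    have ic: "1 / c \<noteq> 0" using cn by simp
    have Gn: "nzmero G" unfolding G_def by (rule nzmero_mult[OF nzmero_const[OF ic] un1])
    have G1n: "nzmero (\<lambda>z. G z - 1)" unfolding G1 by (rule nzmero_mult[OF nzmero_const[OF ic] un2])
    have Gh: "G holomorphic_on UNIV" unfolding G_def by (intro holomorphic_intros g)
    have dG: "deriv G = (\<lambda>z. (1 / c) * deriv g z)"
    proof
      fix z
      have "(g has_field_derivative deriv g z) (at z)" using holomorphic_derivI[OF g(1)] by auto
      then have "(G has_field_derivative (1 / c) * (deriv g z - 0)) (at z)" unfolding G_def
        by (intro DERIV_cmult DERIV_diff DERIV_const)
      then show "deriv G z = (1 / c) * deriv g z" by (simp add: DERIV_imp_deriv)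
    qed
    have dGn: "nzmero (deriv G)" unfolding dG by (rule nzmero_mult[OF nzmero_const[OF ic] gd])
    obtain \<rho> where \<rho>: "t + 3 * s < \<rho>" "\<rho> < t + 4 * s" "good G \<rho>" "good (\<lambda>z. G z - 1) \<rho>"
      by (rule ex_good[of "{G, \<lambda>z. G z - 1}" "t + 3 * s" "t + 4 * s"]) (use Gn G1n s t r1 in auto)
    obtain \<rho>' where \<rho>': "t + 5 * s < \<rho>'" "\<rho>' < t + 6 * s" "good G \<rho>'" "good (\<lambda>z. G z - 1) \<rho>'"
      by (rule ex_good[of "{G, \<lambda>z. G z - 1}" "t + 5 * s" "t + 6 * s"]) (use Gn G1n s t r1 in auto)
    have lnr: "ln r \<le> ln Y / b"
    proof -
      have "ln (r powr b) \<le> ln Y" using r(2) Yr Y1 r1 by (subst ln_le_cancel_iff) auto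
      then show ?thesis using b r1 by (simp add: ln_powr field_simps)
    qed
    have lnr0: "0 \<le> ln r" using r1 by simp
    have VY: "V \<le> k * Y powr (\<beta> / b)"
    proof -
      have "r = (r powr b) powr (1 / b)" using b r1 by (simp add: powr_powr)
      also have "\<dots> \<le> Y powr (1 / b)" using r(2) Yr b r1 by (intro powr_mono2) auto
      finally have "r powr \<beta> \<le> (Y powr (1 / b)) powr \<beta>" using b r1 by (intro powr_mono2) auto
      also have "\<dots> = Y powr (\<beta> / b)" by (simp add: powr_powr)
      finally have "k * r powr \<beta> \<le> k * Y powr (\<beta> / b)" by (intro mult_left_mono) (auto simp: k_def)
      then show ?thesis using \<kappa> r1 by (simp add: V_def k_def powr_mult)
    qed
    have lc: "ln (cmod (1 / c)) \<le> ln r" "log_plus (cmod (1 / c)) \<le> ln r"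
    proof -
      have "cmod (1 / c) \<le> r" using cr r1 cn by (simp add: norm_divide field_simps)
      then show "ln (cmod (1 / c)) \<le> ln r" using cn r1 by (subst ln_le_cancel_iff) auto
      then show "log_plus (cmod (1 / c)) \<le> ln r" using lnr0 by (intro log_plus_le) auto
    qed
    have lw: "log_plus (cmod w1) \<le> V" "log_plus (cmod w2) \<le> V"
      using log_plus_le_of_exp[OF V0] w1(2) w2(2) by (auto simp: V_def)
    have lpc: "log_plus (cmod c) \<le> 2 * V + 1"
      using log_plus_norm_diff[of w2 w1] lw ln2_le_1 unfolding c_def by linarith
    have ldu: "0 \<le> ln (cmod (g 0 - w))" "ln (cmod (g 0 - w)) \<le> V + c0"
      if w: "1 \<le> cmod (w - g 0)" "cmod w \<le> exp V" for w
    proof -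
      show "0 \<le> ln (cmod (g 0 - w))" using w by (simp add: norm_minus_commute)
      have "cmod (g 0 - w) \<le> cmod (g 0) * 1 + 1 * cmod w" using norm_triangle_ineq4 by simp
      also have "\<dots> \<le> cmod (g 0) * exp V + 1 * exp V" using w V0 by (intro add_mono mult_left_mono) auto
      finally have "cmod (g 0 - w) \<le> (1 + cmod (g 0)) * exp V" by (simp add: algebra_simps)
      then have "ln (cmod (g 0 - w)) \<le> ln ((1 + cmod (g 0)) * exp V)"
        using w by (subst ln_le_cancel_iff) (auto intro!: mult_pos_pos add_pos_nonneg simp: norm_minus_commute)
      also have "\<dots> = c0 + V" unfolding c0_def by (subst ln_mult_pos) (auto intro!: add_pos_nonneg)
      finally show "ln (cmod (g 0 - w)) \<le> V + c0" by simp
    qed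
    note ld1 = ldu[OF w1[folded V_def]] and ld2 = ldu[OF w2[folded V_def]]
    have lead1: "lead_ln G = ln (cmod (1 / c)) + ln (cmod (g 0 - w1))"
      unfolding G_def by (subst lead_ln_cmult[OF un1 ic]) (simp add: lead_ln_nonzero[OF entire_analytic[OF uh] u0(1)])
    have lead2: "lead_ln (\<lambda>z. G z - 1) = ln (cmod (1 / c)) + ln (cmod (g 0 - w2))"
      unfolding G1 by (subst lead_ln_cmult[OF un2 ic]) (simp add: lead_ln_nonzero[OF entire_analytic[OF uh] u0(2)])
    have lead3: "lead_ln (deriv G) = ln (cmod (1 / c)) + lead_ln (deriv g)"
      unfolding dG by (rule lead_ln_cmult[OF gd ic])
    have lc2: "- (2 * V + 1) \<le> ln (cmod (1 / c))"
    proof -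
      have "ln (cmod c) \<le> log_plus (cmod c)" using cn by (intro ln_le_log_plus) auto
      then show ?thesis using lpc cn by (simp add: norm_divide ln_div)
    qed
    define \<Theta> where "\<Theta> = Y\<^sup>2 + 2 * V + c0 + ln r + 2"
    have TG: "nevanlinna_T G x \<le> Y\<^sup>2 + V + ln r + 1" if x: "good G x" "t \<le> x" "x \<le> t + 8 * s" for x
    proof -
      have x0: "0 < x" using x t r1 by linarith
      have "proximity G x \<le> Y\<^sup>2 + V + ln r + 1" unfolding proximity_eq_cmean
      proof (rule cmean_le)
        show "continuous_on (sphere 0 x) (\<lambda>z. log_plus (cmod (G z)))"
          by (rule reg_log_plus_continuous[OF good_imp_reg[OF x(1)]])
        fix z assume z: "cmod z = x"
        have "log_plus (cmod (G z)) \<le> log_plus (cmod (1 / c)) + log_plus (cmod (g z - w1))"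
          unfolding G_def norm_mult by (rule log_plus_mult) auto
        also have "log_plus (cmod (g z - w1)) \<le> log_plus (cmod (g z)) + log_plus (cmod w1) + ln 2" by (rule log_plus_norm_diff)
        also have "log_plus (cmod (g z)) \<le> log_plus (max_modulus g (t + 8 * s))"
          by (intro log_plus_mono max_modulus_bound[OF g(1)]) (use z x in auto)
        also have "log_plus (max_modulus g (t + 8 * s)) \<le> Y\<^sup>2"
          by (rule log_plus_le) (use LY2 in \<open>auto simp: L_def\<close>)
        finally show "log_plus (cmod (G z)) \<le> Y\<^sup>2 + V + ln r + 1" using lc lw ln2_le_1 by linarith
      qed (use x0 in auto)
      then show ?thesis using entire_counting[OF Gh x0] by (simp add: nevanlinna_T_def)
    qed
    have "1 \<le> t + s" using t r1 s by linarith
    moreover have "t + s + s + s \<le> \<rho>" "\<rho> + s \<le> \<rho>'" using \<rho> \<rho>' by linarith+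
    moreover have Th: "1 \<le> \<Theta>" using zero_le_power2[of Y] V0 c0 lnr0 unfolding \<Theta>_def by linarith
    moreover have "nevanlinna_T G \<rho> \<le> \<Theta>" "nevanlinna_T G \<rho>' \<le> \<Theta>"
      using TG[OF \<rho>(3)] TG[OF \<rho>'(3)] \<rho> \<rho>' s V0 c0 unfolding \<Theta>_def by linarith+
    moreover have "\<bar>lead_ln G\<bar> \<le> \<Theta>" "\<bar>lead_ln (\<lambda>z. G z - 1)\<bar> \<le> \<Theta>"
      using ld1 ld2 lc(1) lc2 zero_le_power2[of Y] V0 c0 lnr0 unfolding lead1 lead2 \<Theta>_def by linarith+
    ultimately obtain x where x: "t + s < x" "x < t + s + s" "good g x" "good G x" and
      TGx: "nevanlinna_T G x \<le> counting G x + counting (\<lambda>z. 1 / G z) x + counting (\<lambda>z. 1 / (G z - 1)) x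
       + ln (1200 * (\<Theta> * \<rho>' / s)\<^sup>2 * (1 + 1 / s)) + lead_ln G + lead_ln (\<lambda>z. G z - 1) - lead_ln (deriv G)"
      using second_main_estimate[OF Gn G1n dGn \<rho>(3) \<rho>'(3) \<rho>(4) \<rho>'(4) _ s(1), of "t + s" \<Theta> "{g}"] gn by auto
    have x0: "0 < x" "1 \<le> x" "x \<le> 4 * r" using x t t3 r1 s by linarith+
    have C0: "counting G x = 0" by (rule entire_counting[OF Gh x0(1)])
    have cnt: "counting (\<lambda>z. 1 / (1 / c * (g z - w))) x \<le> V"
      if "nzmero (\<lambda>z. g z - w)" "counting (\<lambda>z. 1 / (g z - w)) (4 * r) \<le> V" for w
    proof -
      have "(\<lambda>z. 1 / (1 / c * (g z - w))) = (\<lambda>z. c * (1 / (g z - w)))" using cn by auto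
      then have "counting (\<lambda>z. 1 / (1 / c * (g z - w))) x = counting (\<lambda>z. 1 / (g z - w)) x"
        using counting_cmult[OF nzmero_inverse[OF that(1)] cn x0(1)] by simp
      also have "\<dots> \<le> counting (\<lambda>z. 1 / (g z - w)) (4 * r)"
        by (rule counting_mono[OF nzmero_meromorphic[OF nzmero_inverse[OF that(1)]] x0(1) x0(3)])
      finally show ?thesis using that(2) by linarith
    qed
    have C1: "counting (\<lambda>z. 1 / G z) x \<le> V" unfolding G_def by (rule cnt[OF un1]) (use n1 in \<open>simp add: V_def\<close>)
    have "counting (\<lambda>z. 1 / (1 / c * (g z - w2))) x \<le> V" by (rule cnt[OF un2]) (use n2 in \<open>simp add: V_def\<close>)
    moreover have "(\<lambda>z. 1 / (1 / c * (g z - w2))) = (\<lambda>z. 1 / (G z - 1))" using fun_cong[OF G1] by auto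
    ultimately have C2: "counting (\<lambda>z. 1 / (G z - 1)) x \<le> V" by simp
    \<comment> \<open>Every quantity is polynomial in \<open>Y\<close>, in total of degree 9 = 2 * 4
      + 1; the constant is 9216 = 32 * 32 * 9.\<close>
    have E: "ln (1200 * (\<Theta> * \<rho>' / s)\<^sup>2 * (1 + 1 / s)) \<le> CE + 9 * l"
    proof -
      have YY: "l \<le> Y" unfolding l_def using ln_le_minus_one[of Y] Y1 by linarith
      have T3: "\<Theta> \<le> Y ^ 3" using Y0(2)[OF YY0] VY lnr unfolding \<Theta>_def by linarith
      have "\<rho>' / s \<le> (4 * r) / s" using \<rho>' t3 s r1 by (intro divide_right_mono) auto
      also have "\<dots> = 32 * l" using r1 l2 by (simp add: s_def)
      finally have \<rho>s: "\<rho>' / s \<le> 32 * Y" using YY by linarith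
      have "1 / s = 8 * l / r" using r1 l2 by (simp add: s_def)
      also have "\<dots> \<le> 8 * l / 1" using r1 l2 by (intro divide_left_mono) auto
      finally have inv_s: "1 + 1 / s \<le> 9 * Y" using YY Y1 by linarith
      have p': "0 < \<rho>'" using \<rho>' t r1 s by linarith
      have "\<Theta> * \<rho>' / s = \<Theta> * (\<rho>' / s)" by simp
      also have "\<dots> \<le> Y ^ 3 * (32 * Y)" by (rule mult_mono[OF T3 \<rho>s]) (use Y1 p' s in auto)
      finally have "(\<Theta> * \<rho>' / s)\<^sup>2 \<le> (Y ^ 3 * (32 * Y))\<^sup>2" using Th p' s by (intro power_mono) auto
      then have "1200 * (\<Theta> * \<rho>' / s)\<^sup>2 * (1 + 1 / s) \<le> 1200 * (Y ^ 3 * (32 * Y))\<^sup>2 * (9 * Y)"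
        using inv_s Y1 s by (intro mult_mono) auto
      also have "\<dots> = (1200 * 9216) * Y ^ 9" by (simp add: power_mult_distrib power_numeral_reduce power2_eq_square)
      finally have "ln (1200 * (\<Theta> * \<rho>' / s)\<^sup>2 * (1 + 1 / s)) \<le> ln ((1200 * 9216) * Y ^ 9)"
        using Th p' s Y1 by (subst ln_le_cancel_iff) (auto intro!: mult_pos_pos add_pos_pos divide_pos_pos)
      also have "\<dots> = CE + 9 * l" using Y1 by (subst ln_mult_pos) (auto simp: CE_def l_def ln_realpow)
      finally show ?thesis .
    qed
    define P where "P = proximity g x"
    have P0: "0 \<le> P" unfolding P_def by (rule proximity_nonneg[OF good_imp_reg[OF x(3)]])
    have "P \<le> proximity G x + (3 * V + 2)"
    proof -
      have "P \<le> cmean (\<lambda>z. log_plus (cmod (G z)) + (3 * V + 2)) x" unfolding P_def proximity_eq_cmean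
      proof (rule cmean_mono)
        fix z assume "cmod z = x"
        have "g z = c * G z - (- w1)" using cn by (simp add: G_def)
        then have "log_plus (cmod (g z)) \<le> log_plus (cmod (c * G z)) + log_plus (cmod (- w1)) + ln 2"
          using log_plus_norm_diff by metis
        also have "log_plus (cmod (c * G z)) \<le> log_plus (cmod c) + log_plus (cmod (G z))"
          unfolding norm_mult by (rule log_plus_mult) auto
        finally show "log_plus (cmod (g z)) \<le> log_plus (cmod (G z)) + (3 * V + 2)"
          using lpc lw ln2_le_1 by simp
      qed (use x0 in \<open>auto intro!: reg_log_plus_continuous good_imp_reg x continuous_intros\<close>)
      also have "\<dots> = cmean (\<lambda>z. log_plus (cmod (G z))) x + (3 * V + 2)"
        using x0 by (subst cmean_add) (auto intro!: reg_log_plus_continuous good_imp_reg x continuous_intros)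
      finally show ?thesis by (simp add: proximity_eq_cmean)
    qed
    moreover have "proximity G x \<le> V + V + (CE + 9 * l) + (ln r + 2 * (V + c0) + lg')"
    proof -
      define e where "e = ln (1200 * (\<Theta> * \<rho>' / s)\<^sup>2 * (1 + 1 / s))"
      define lnc where "lnc = ln (cmod (1 / c))"
      have "nevanlinna_T G x = proximity G x" using C0 by (simp add: nevanlinna_T_def)
      moreover have "- lead_ln (deriv g) \<le> lg'" by (simp add: lg'_def)
      moreover have "e \<le> CE + 9 * l" "lnc \<le> ln r" using E lc(1) by (simp_all add: e_def lnc_def)
      moreover note TGx[folded e_def, unfolded lead1 lead2 lead3, folded lnc_def] C0 C1 C2 ld1 ld2
      ultimately show ?thesis by argo
    qed
    ultimately have PV: "P \<le> A + 7 * V + 9 * l + ln r" unfolding A_def by argo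
    \<comment> \<open>The bound for \<open>P\<close> is sublinear in \<open>Y\<close>, and returning
      from the proximity function at \<open>x\<close> to the maximum modulus at \<open>t\<close>
      costs only a factor of order \<open>ln Y\<close>. So \<open>Y\<close> would be smaller than
      itself.\<close>
    obtain z where z: "cmod z = t" "cmod (g z) = max_modulus g t"
      using max_modulus_attained[OF g(1), of t] t r1 by auto
    have gz: "g z \<noteq> 0"
      using z mono[of r t] M1 t r1 by auto
    have "Y = ln (cmod (g z))" by (simp add: Y_def L_def z)
    also have "\<dots> \<le> P + (4 * P + 2 * lg) * (cmod z / (x - cmod z))"
      unfolding P_def lg_def by (rule entire_log_bound[OF g(1) gn x(3)]) (use x0 x z s gz in auto)
    also have "\<dots> \<le> P + (4 * P + 2 * lg) * (3 * r / s)"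
      using z x t3 s P0 t r1 by (intro add_left_mono mult_left_mono frac_le) (auto simp: lg_def)
    also have "3 * r / s = 24 * l" using r1 l2 by (simp add: s_def)
    also have "P + (4 * P + 2 * lg) * (24 * l) \<le> P * l + (4 * P + 2 * lg) * (24 * l)"
      using mult_left_mono[of 1 l P] l2 P0 by simp
    also have "\<dots> \<le> (100 * P + 50 * lg) * l"
    proof -
      have "0 \<le> P * l" "0 \<le> lg * l" using P0 l2 by (auto simp: lg_def)
      then show ?thesis by (simp add: algebra_simps)
    qed
    also have "\<dots> \<le> (100 * (A + 7 * (k * Y powr (\<beta> / b)) + 9 * ln Y + ln Y / b) + 50 * lg) * ln Y"
      using PV VY lnr l2 unfolding l_def by (intro mult_right_mono) auto
    finally show False using Y0(3)[OF YY0] by linarith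
  qed
  show ?thesis by (rule that[of Rs]) (use main in \<open>auto simp: L_def Rs_def\<close>)
qed

section \<open>Order of growth and records of the maximum modulus\<close>

lemma frequently_greater_if_less_Limsup:
  fixes X :: "real \<Rightarrow> ereal"
  assumes "c < Limsup at_top X" shows "\<exists>r\<ge>r0. c < X r"
proof (rule ccontr)
  assume "\<not> ?thesis"
  then have "eventually (\<lambda>r. X r \<le> c) at_top"
    by (auto simp: eventually_at_top_linorder not_less intro!: exI[of _ r0])
  then have "Limsup at_top X \<le> c" by (rule Limsup_bounded)
  then show False using assms by simp
qed

lemma entire_order_growth:
  assumes g: "g holomorphic_on UNIV" and \<beta>: "0 < \<beta>" "ereal \<beta> < entire_order g"
  shows "\<not> g constant_on UNIV" "\<And>X. \<exists>r\<ge>X. r powr \<beta> < ln (max_modulus g r)"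
proof -
  have fr: "\<exists>r\<ge>X. \<beta> < ln (ln (max_modulus g r)) / ln r" for X
    using frequently_greater_if_less_Limsup[OF \<beta>(2)[unfolded entire_order_def], of X] by simp
  show nc: "\<not> g constant_on UNIV"
  proof
    assume "g constant_on UNIV"
    then obtain c where c: "\<And>z. g z = c" by (auto simp: constant_on_def)
    \<comment> \<open>Whatever default \<open>ln\<close> may return here, \<open>a\<close> is a
      fixed number and \<open>a / ln r\<close> tends to 0, so a constant has no positive
      order.\<close>
    define a where "a = ln (ln (cmod c))"
    have M: "max_modulus g r = cmod c" if "0 \<le> r" for r
      using max_modulus_attained[OF g that] c by metis
    have "((\<lambda>r. a / ln r) \<longlongrightarrow> 0) at_top" by real_asymp
    then have "eventually (\<lambda>r. a / ln r < \<beta>) at_top" using \<beta>(1) by (rule order_tendstoD)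
    then obtain X where X: "\<And>r. X \<le> r \<Longrightarrow> a / ln r < \<beta>" unfolding eventually_at_top_linorder by blast
    obtain r where "r \<ge> max 0 X" "\<beta> < ln (ln (max_modulus g r)) / ln r" using fr by blast
    then show False using X[of r] M[of r] by (simp add: a_def)
  qed
  fix X :: real
  obtain r0 where r0: "0 \<le> r0" "\<And>r. r0 \<le> r \<Longrightarrow> exp 1 \<le> max_modulus g r"
    using max_modulus_unbounded[OF g nc] by blast
  obtain r where r: "r \<ge> Max {X, r0, 2}" "\<beta> < ln (ln (max_modulus g r)) / ln r" using fr by blast
  then have r': "X \<le> r" "r0 \<le> r" "2 \<le> r" by auto
  have M: "exp 1 \<le> max_modulus g r" using r0 r' by blast
  then have "0 < max_modulus g r" using exp_gt_zero less_le_trans by blast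
  then have "ln (exp 1) \<le> ln (max_modulus g r)" using M by (subst ln_le_cancel_iff) auto
  then have l1: "0 < ln (max_modulus g r)" by simp
  have "\<beta> * ln r < ln (ln (max_modulus g r))" using r(2) r' by (simp add: field_simps)
  then have "ln (r powr \<beta>) < ln (ln (max_modulus g r))" using r' by (simp add: ln_powr)
  then have "r powr \<beta> < ln (max_modulus g r)" using l1 r' by (subst (asm) ln_less_cancel_iff) auto
  then show "\<exists>r\<ge>X. r powr \<beta> < ln (max_modulus g r)" using r' by blast
qed

text \<open>Radial projection takes a maximum point on one circle to a point of the other circle at
  distance \<open>|r - s|\<close>; uniform continuity of \<open>g\<close> does the rest. Continuity
  lets the quotient defining records attain its maximum.\<close>

lemma max_modulus_continuous:
  assumes g: "g holomorphic_on UNIV" shows "continuous_on {0..X} (max_modulus g)"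
proof -
  have "uniformly_continuous_on (cball 0 X) g"
    by (intro compact_uniformly_continuous holomorphic_on_imp_continuous_on holomorphic_on_subset[OF g]) auto
  then have uc: "\<exists>d>0. \<forall>x\<in>cball 0 X. \<forall>x'\<in>cball 0 X. dist x' x < d \<longrightarrow> dist (g x') (g x) < e" if "0 < e" for e
    using that unfolding uniformly_continuous_on_def by blast
  have half: "max_modulus g s < max_modulus g r + e"
    if d: "\<forall>x\<in>cball 0 X. \<forall>x'\<in>cball 0 X. dist x' x < d \<longrightarrow> dist (g x') (g x) < e"
      and rs: "0 \<le> r" "r \<le> X" "0 \<le> s" "s \<le> X" "\<bar>r - s\<bar> < d" for r s d e
  proof -
    obtain z where z: "cmod z = s" "cmod (g z) = max_modulus g s" using max_modulus_attained[OF g rs(3)] by blast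
    define x where "x = (if s = 0 then of_real r else of_real (r / s) * z)"
    have x: "cmod x = r" using z rs by (auto simp: x_def norm_mult norm_divide)
    have "dist z x = \<bar>r - s\<bar>"
    proof (cases "s = 0")
      case False
      have "z - x = of_real ((s - r) / s) * z" using False by (simp add: x_def field_simps)
      then have "cmod (z - x) = \<bar>(s - r) / s\<bar> * s" using z by (simp only: norm_mult norm_of_real)
      also have "\<dots> = \<bar>r - s\<bar>" using False rs by (simp add: abs_divide)
      finally show ?thesis by (simp add: dist_norm)
    qed (use z rs in \<open>auto simp: x_def dist_norm\<close>)
    then have "dist (g z) (g x) < e" using d rs z x by (auto simp: dist_commute)
    then have "cmod (g z) < cmod (g x) + e" using norm_triangle_ineq2[of "g z" "g x"] by (simp add: dist_norm)
    also have "cmod (g x) \<le> max_modulus g r" by (rule max_modulus_bound[OF g]) (simp add: x)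
    finally show ?thesis using z by simp
  qed
  show ?thesis unfolding continuous_on_iff
  proof (intro ballI allI impI)
    fix x e :: real assume x: "x \<in> {0..X}" and e: "0 < e"
    obtain d where d: "d > 0" "\<forall>x\<in>cball 0 X. \<forall>x'\<in>cball 0 X. dist x' x < d \<longrightarrow> dist (g x') (g x) < e"
      using uc[OF e] by blast
    show "\<exists>d>0. \<forall>x'\<in>{0..X}. dist x' x < d \<longrightarrow> dist (max_modulus g x') (max_modulus g x) < e"
    proof (intro exI[of _ d] conjI ballI impI)
      fix x' assume x': "x' \<in> {0..X}" "dist x' x < d"
      show "dist (max_modulus g x') (max_modulus g x) < e"
      proof -
        have a: "\<bar>x - x'\<bar> < d" "\<bar>x' - x\<bar> < d" using x' by (auto simp: dist_real_def)
        have "max_modulus g x' < max_modulus g x + e" "max_modulus g x < max_modulus g x' + e"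
          using half[OF d(2) _ _ _ _ a(1)] half[OF d(2) _ _ _ _ a(2)] x x' by auto
        then show ?thesis by (simp add: dist_real_def abs_less_iff)
      qed
    qed (use d in auto)
  qed
qed

lemma max_modulus_pos:
  assumes g: "g holomorphic_on UNIV" "\<not> g constant_on UNIV" and r: "0 < r"
  shows "0 < max_modulus g r"
proof (rule ccontr)
  assume "\<not> ?thesis"
  then have z: "g z = 0" if "z \<in> ball 0 r" for z
  proof -
    have "cmod (g z) \<le> max_modulus g r" by (rule max_modulus_bound[OF g(1)]) (use that in auto)
    then have "cmod (g z) \<le> 0" using \<open>\<not> 0 < max_modulus g r\<close> by linarith
    then show ?thesis by simp
  qed
  have "g w = 0" for w
    by (rule analytic_continuation_open[of "ball 0 r" UNIV g "\<lambda>_. 0" w])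
       (use r g z in \<open>auto intro: exI[of _ 0]\<close>)
  then show False using g(2) by (auto simp: constant_on_def)
qed

text \<open>The lower bound \<open>r powr b\<close> makes \<open>ln M(r)\<close> dominate errors of
  order \<open>r powr \<beta>\<close> with \<open>\<beta> < b\<close>, which being a maximum of the
  quotient alone would not ensure.\<close>

definition growth_record :: "(complex \<Rightarrow> complex) \<Rightarrow> real \<Rightarrow> real \<Rightarrow> bool" where
  "growth_record g b r \<longleftrightarrow> 1 \<le> r \<and> r powr b \<le> ln (max_modulus g r) \<and>
     (\<forall>t. 1 \<le> t \<and> t \<le> r \<longrightarrow> ln (max_modulus g t) / t powr b \<le> ln (max_modulus g r) / r powr b)"

lemma growth_record_exists:
  assumes g: "g holomorphic_on UNIV" "\<not> g constant_on UNIV"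
    and X: "1 \<le> t0" "t0 \<le> X" "t0 powr b \<le> ln (max_modulus g t0)"
  obtains r where "growth_record g b r" "1 \<le> r" "r \<le> X"
    "\<And>t. 1 \<le> t \<Longrightarrow> t \<le> X \<Longrightarrow> ln (max_modulus g t) / t powr b \<le> ln (max_modulus g r) / r powr b"
proof -
  let ?q = "\<lambda>t. ln (max_modulus g t) / t powr b"
  have "continuous_on {1..X} ?q"
  proof (intro continuous_on_divide continuous_on_ln continuous_on_powr continuous_on_id continuous_on_const)
    show "continuous_on {1..X} (max_modulus g)"
      by (rule continuous_on_subset[OF max_modulus_continuous[OF g(1), of X]]) auto
    show "\<forall>t\<in>{1..X}. max_modulus g t \<noteq> 0" using max_modulus_pos[OF g] by (metis atLeastAtMost_iff less_irrefl less_le_trans zero_less_one)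
  qed auto
  then obtain r where r: "r \<in> {1..X}" "\<And>t. t \<in> {1..X} \<Longrightarrow> ?q t \<le> ?q r"
    using continuous_attains_sup[of "{1..X}" ?q] X by auto
  have "1 \<le> ?q t0" using X by simp
  also have "\<dots> \<le> ?q r" using X by (intro r) auto
  finally have "r powr b \<le> ln (max_modulus g r)" using r(1) by (simp add: le_divide_eq split: if_splits)
  then have "growth_record g b r" using r by (auto simp: growth_record_def)
  then show ?thesis using that[of r] r by auto
qed

text \<open>Along the sequence of records constructed here, all rarely taken values lie in one bounded set,
  since those belonging to consecutive records are close to each other.\<close>

theorem values_taken_often:
  assumes g: "g holomorphic_on UNIV" and \<beta>: "0 < \<beta>" "ereal \<beta> < entire_order g"
  obtains D where "\<And>X. \<exists>\<rho>\<ge>X. \<forall>w. D < cmod w \<longrightarrow> cmod w \<le> exp (\<rho> powr \<beta>) \<longrightarrow>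
    \<rho> powr \<beta> \<le> counting (\<lambda>z. 1 / (g z - w)) \<rho>"
proof -
  have nc: "\<not> g constant_on UNIV" by (rule entire_order_growth(1)[OF g \<beta>])
  obtain b1 where b1: "\<beta> < b1" "ereal b1 < entire_order g"
    using ereal_dense2[OF \<beta>(2)] by auto
  define m where "m = nat \<lfloor>\<beta>\<rfloor>"
  have m: "real m \<le> \<beta>" "\<beta> < real m + 1" using \<beta>(1) unfolding m_def by linarith+
  \<comment> \<open>Below the next integer, as \<open>growth_step\<close> demands, and below
    \<open>b1\<close>, so that \<open>ln M(r) / r powr b\<close> is unbounded and the first record
    can be found beyond any given radius.\<close>
  define b where "b = (\<beta> + min b1 (real m + 1)) / 2"
  have b: "\<beta> < b" "b < b1" "real m < b" "b < real m + 1" using b1 m by (auto simp: b_def min_def)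
  define q where "q = (\<lambda>t. ln (max_modulus g t) / t powr b)"
  \<comment> \<open>Values closer than 1 to \<open>g 0\<close> are left out, so that
    \<open>ln |g 0 - w|\<close> is nonnegative in all applications of Jensen's formula.\<close>
  define Exc where "Exc = (\<lambda>\<rho>. {w. 1 \<le> cmod (w - g 0) \<and> cmod w \<le> exp (\<rho> powr \<beta>) \<and>
      counting (\<lambda>z. 1 / (g z - w)) \<rho> < \<rho> powr \<beta>})"
  show ?thesis
  \<comment> \<open>If the exceptional set is empty at arbitrarily large radii, these radii already
    serve. Otherwise all large radii have exceptional values, and each of them forces a further
    record.\<close>
  proof (cases "\<forall>X. \<exists>\<rho>\<ge>X. Exc \<rho> = {}")
    case True
    have "\<exists>\<rho>\<ge>X. \<forall>w. cmod (g 0) + 1 < cmod w \<longrightarrow> cmod w \<le> exp (\<rho> powr \<beta>) \<longrightarrow>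
      \<rho> powr \<beta> \<le> counting (\<lambda>z. 1 / (g z - w)) \<rho>" for X
    proof -
      obtain \<rho> where \<rho>: "X \<le> \<rho>" "Exc \<rho> = {}" using True by blast
      have "\<rho> powr \<beta> \<le> counting (\<lambda>z. 1 / (g z - w)) \<rho>"
        if "cmod (g 0) + 1 < cmod w" "cmod w \<le> exp (\<rho> powr \<beta>)" for w
      proof -
        have "1 \<le> cmod (w - g 0)" using norm_triangle_ineq2[of w "g 0"] that by linarith
        moreover have "w \<notin> Exc \<rho>" using \<rho> by simp
        ultimately show ?thesis using that by (auto simp: Exc_def not_less)
      qed
      then show ?thesis using \<rho> by blast
    qed
    then show ?thesis by (rule that)
  next
    case False
    then obtain \<rho>0 where \<rho>0: "\<And>\<rho>. \<rho>0 \<le> \<rho> \<Longrightarrow> Exc \<rho> \<noteq> {}" by auto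
    obtain K Rs1 where K: "8 \<le> K" "1 \<le> Rs1"
      and gs: "\<And>r w. Rs1 \<le> r \<Longrightarrow> r powr b \<le> ln (max_modulus g r) \<Longrightarrow>
      \<forall>t. 1 \<le> t \<longrightarrow> t \<le> r \<longrightarrow> ln (max_modulus g t) \<le> (t / r) powr b * ln (max_modulus g r) \<Longrightarrow>
      1 \<le> cmod (w - g 0) \<Longrightarrow> cmod w \<le> exp ((8 * K * r) powr \<beta>) \<Longrightarrow>
      counting (\<lambda>z. 1 / (g z - w)) (8 * K * r) < (8 * K * r) powr \<beta> \<Longrightarrow>
      K powr b * ln (max_modulus g r) < ln (max_modulus g (K * r))"
      by (rule growth_step[OF g nc \<beta>(1) b(1,3,4)], rule that) assumption+
    \<comment> \<open>Consecutive records differ by a factor of at most \<open>2 * K\<close>, so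
      \<open>8 * K\<close> times the later record is at most
      \<open>\<kappa> = 8 * K * (2 * K)\<close> times the earlier one.\<close>
    define \<kappa> where "\<kappa> = 16 * K * K"
    have \<kappa>: "0 < \<kappa>" using K by (simp add: \<kappa>_def)
    obtain Rs2 where Rs2: "1 \<le> Rs2"
      and rv: "\<And>r w1 w2. Rs2 \<le> r \<Longrightarrow> r powr b \<le> ln (max_modulus g r) \<Longrightarrow>
      1 \<le> cmod (w1 - g 0) \<Longrightarrow> cmod w1 \<le> exp ((\<kappa> * r) powr \<beta>) \<Longrightarrow>
      1 \<le> cmod (w2 - g 0) \<Longrightarrow> cmod w2 \<le> exp ((\<kappa> * r) powr \<beta>) \<Longrightarrow>
      counting (\<lambda>z. 1 / (g z - w1)) (4 * r) \<le> (\<kappa> * r) powr \<beta> \<Longrightarrow>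
      counting (\<lambda>z. 1 / (g z - w2)) (4 * r) \<le> (\<kappa> * r) powr \<beta> \<Longrightarrow> cmod (w1 - w2) < 1 / r"
      by (rule rare_values_close[OF g nc \<beta>(1) b(1) \<kappa>], rule that) assumption+
    define R where "R = max \<rho>0 (max Rs1 Rs2)"
    have R1: "1 \<le> R" "\<rho>0 \<le> R" "Rs1 \<le> R" "Rs2 \<le> R" using K(2) by (auto simp: R_def)
    have recq: "ln (max_modulus g t) \<le> (t / r) powr b * ln (max_modulus g r)"
      if "growth_record g b r" "1 \<le> t" "t \<le> r" for r t
    proof -
      have "ln (max_modulus g t) / t powr b \<le> ln (max_modulus g r) / r powr b" using that by (auto simp: growth_record_def)
      then have "ln (max_modulus g t) / t powr b * t powr b \<le> ln (max_modulus g r) / r powr b * t powr b"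
        by (rule mult_right_mono) simp
      then show ?thesis using that by (simp add: powr_divide mult_ac)
    qed
    have Exc_ne: "Exc (8 * K * r) \<noteq> {}" if "R \<le> r" for r
    proof (rule \<rho>0)
      have "1 * r \<le> 8 * K * r" by (rule mult_right_mono) (use K that R1 in auto)
      then show "\<rho>0 \<le> 8 * K * r" using that R1 by linarith
    qed
    \<comment> \<open>Let \<open>r2\<close> in \<open>[r, 2 * r]\<close> maximise the quotient over
      \<open>[1, 2 * r]\<close>. By \<open>growth_step\<close> the quotient is larger at
      \<open>K * r2\<close>, so its maximum over \<open>[1, K * r2]\<close> is attained beyond
      \<open>2 * r\<close>. The doubling makes the distances \<open>1 / f n\<close> between
      exceptional values summable.\<close>
    have step: "\<exists>r'. (growth_record g b r' \<and> R \<le> r') \<and> 2 * r < r' \<and> r' \<le> 2 * K * r" if r: "growth_record g b r" "R \<le> r" for r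
    proof -
      have r1: "1 \<le> r" using r R1 by simp
      obtain r1 where rr1: "growth_record g b r1" "1 \<le> r1" "r1 \<le> 2 * r" "\<And>t. 1 \<le> t \<Longrightarrow> t \<le> 2 * r \<Longrightarrow> q t \<le> q r1"
        using growth_record_exists[OF g nc, of r "2 * r" b] r r1 unfolding q_def growth_record_def by auto
      have "\<exists>r2. growth_record g b r2 \<and> r \<le> r2 \<and> r2 \<le> 2 * r \<and> (\<forall>t. 1 \<le> t \<longrightarrow> t \<le> 2 * r \<longrightarrow> q t \<le> q r2)"
      proof (cases "r \<le> r1")
        case False
        then have "q r1 \<le> q r" using r(1) rr1(2) by (auto simp: growth_record_def q_def)
        then have "q t \<le> q r" if "1 \<le> t" "t \<le> 2 * r" for t using rr1(4)[OF that] by linarith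
        then show ?thesis using r(1) r1 by (intro exI[of _ r]) auto
      qed (use rr1 in blast)
      then obtain r2 where r2: "growth_record g b r2" "r \<le> r2" "r2 \<le> 2 * r" "\<And>t. 1 \<le> t \<Longrightarrow> t \<le> 2 * r \<Longrightarrow> q t \<le> q r2" by blast
      obtain w where "w \<in> Exc (8 * K * r2)" using Exc_ne[of r2] r2 r by auto
      then have "K powr b * ln (max_modulus g r2) < ln (max_modulus g (K * r2))"
        using r2 r R1 by (intro gs allI impI recq) (auto simp: Exc_def growth_record_def)
      then have qK: "q r2 < q (K * r2)"
        using K r1 r2 by (simp add: q_def powr_mult divide_simps mult_ac)
      have "1 * r2 \<le> K * r2" by (rule mult_right_mono) (use K r1 r2 in auto)
      then obtain r' where r': "growth_record g b r'" "1 \<le> r'" "r' \<le> K * r2" "\<And>t. 1 \<le> t \<Longrightarrow> t \<le> K * r2 \<Longrightarrow> q t \<le> q r'"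
        using growth_record_exists[OF g nc, of r2 "K * r2" b] r2 r1 unfolding q_def growth_record_def by auto
      have "1 \<le> K * r2" using \<open>1 * r2 \<le> K * r2\<close> r1 r2(2) by linarith
      then have "q (K * r2) \<le> q r'" by (intro r') auto
      then have "2 * r < r'" using r2(4)[OF r'(2)] qK by (cases "r' \<le> 2 * r") auto
      moreover have "K * r2 \<le> K * (2 * r)" using K r2 by (intro mult_left_mono) auto
      ultimately show ?thesis using r' r r1 by (intro exI[of _ r']) auto
    qed
    have init: "\<exists>r. growth_record g b r \<and> R \<le> r"
    proof -
      define B where "B = max 1 (ln (max_modulus g R))"
      have "eventually (\<lambda>X. B < X powr (b1 - b)) at_top" using b by real_asymp
      then obtain X0 where X0: "\<And>X. X0 \<le> X \<Longrightarrow> B < X powr (b1 - b)" unfolding eventually_at_top_linorder by blast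
      obtain X where X: "X \<ge> max 1 X0" "X powr b1 < ln (max_modulus g X)"
        using entire_order_growth(2)[OF g _ b1(2)] b1 \<beta> by (meson less_trans)
      have "X powr b \<le> X powr b1" using X b by (intro powr_mono) auto
      then obtain r where r: "growth_record g b r" "1 \<le> r" "r \<le> X" "\<And>t. 1 \<le> t \<Longrightarrow> t \<le> X \<Longrightarrow> q t \<le> q r"
        using growth_record_exists[OF g nc, of X X b] X unfolding q_def by auto
      have "R \<le> r"
      proof (rule ccontr)
        assume "\<not> R \<le> r"
        then have "ln (max_modulus g r) \<le> ln (max_modulus g R)"
          using max_modulus_mono[OF g, of r R] max_modulus_pos[OF g nc, of r] r by (subst ln_le_cancel_iff) auto
        moreover have "q r \<le> ln (max_modulus g r)"
        proof -
          have "0 \<le> ln (max_modulus g r)" using r(1) powr_ge_zero order_trans unfolding growth_record_def by blast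
          moreover have "1 \<le> r powr b" using r b \<beta> by (intro ge_one_powr_ge_zero) auto
          ultimately show ?thesis unfolding q_def using r(2) by (simp add: divide_le_eq mult_le_cancel_left1)
        qed
        moreover have "X powr (b1 - b) < q X" using X b by (simp add: q_def powr_diff divide_strict_right_mono)
        moreover have "q X \<le> q r" using X by (intro r) auto
        moreover have "B < X powr (b1 - b)" using X by (intro X0) auto
        ultimately show False by (simp add: B_def)
      qed
      then show ?thesis using r by blast
    qed
    obtain f :: "nat \<Rightarrow> real" where f: "\<And>n. growth_record g b (f n) \<and> R \<le> f n" "\<And>n. 2 * f n < f (Suc n) \<and> f (Suc n) \<le> 2 * K * f n"
      using dependent_nat_choice[of "\<lambda>_ r. growth_record g b r \<and> R \<le> r" "\<lambda>_ r r'. 2 * r < r' \<and> r' \<le> 2 * K * r"] init step by metis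
    define \<rho> where "\<rho> = (\<lambda>n. 8 * K * f n)"
    define W where "W = (\<lambda>n. SOME w. w \<in> Exc (\<rho> n))"
    have W: "W n \<in> Exc (\<rho> n)" for n
    proof -
      have "Exc (\<rho> n) \<noteq> {}" using Exc_ne[of "f n"] f(1)[of n] unfolding \<rho>_def by blast
      then show ?thesis unfolding W_def by (simp add: some_in_eq)
    qed
    have f1: "1 \<le> f n" for n using f(1)[of n] R1 by simp
    have \<rho>1: "4 * f n \<le> \<rho> n" "\<rho> n \<le> \<kappa> * f n" "\<rho> (Suc n) \<le> \<kappa> * f n" "\<rho> n \<le> \<rho> (Suc n)" "0 < \<rho> n" for n
    proof -
      show "4 * f n \<le> \<rho> n" unfolding \<rho>_def by (rule mult_right_mono) (use K f1[of n] in auto)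
      have "8 * K * 1 \<le> 8 * K * (2 * K)" by (rule mult_left_mono) (use K in auto)
      then have "8 * K \<le> \<kappa>" by (simp add: \<kappa>_def)
      then show "\<rho> n \<le> \<kappa> * f n" unfolding \<rho>_def by (rule mult_right_mono) (use f1[of n] in auto)
      have "8 * K * f (Suc n) \<le> 8 * K * (2 * K * f n)" by (rule mult_left_mono) (use f(2)[of n] K in auto)
      then show "\<rho> (Suc n) \<le> \<kappa> * f n" by (simp add: \<rho>_def \<kappa>_def mult_ac)
      show "\<rho> n \<le> \<rho> (Suc n)" unfolding \<rho>_def by (rule mult_left_mono) (use f(2)[of n] f1[of n] K in auto)
      show "0 < \<rho> n" using K f1[of n] by (simp add: \<rho>_def)
    qed
    have rare: "1 \<le> cmod (w - g 0) \<and> cmod w \<le> exp ((\<kappa> * f n) powr \<beta>) \<and> counting (\<lambda>z. 1 / (g z - w)) (4 * f n) \<le> (\<kappa> * f n) powr \<beta>"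
      if w: "w \<in> Exc x" and x: "4 * f n \<le> x" "x \<le> \<kappa> * f n" for w x n
    proof -
      have w1: "1 \<le> cmod (w - g 0)" "cmod w \<le> exp (x powr \<beta>)" "counting (\<lambda>z. 1 / (g z - w)) x < x powr \<beta>"
        using w by (auto simp: Exc_def)
      have xk: "x powr \<beta> \<le> (\<kappa> * f n) powr \<beta>" using x f1[of n] \<beta> by (intro powr_mono2) auto
      have uh: "(\<lambda>z. g z - w) holomorphic_on UNIV" by (intro holomorphic_intros g)
      have "g 0 - w \<noteq> 0" using w1 by auto
      then have un: "nzmero (\<lambda>z. g z - w)" using nzmero_entire[OF uh] by blast
      have "counting (\<lambda>z. 1 / (g z - w)) (4 * f n) \<le> counting (\<lambda>z. 1 / (g z - w)) x"
        by (rule counting_mono[OF nzmero_meromorphic[OF nzmero_inverse[OF un]]]) (use f1[of n] x in auto)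
      moreover have "exp (x powr \<beta>) \<le> exp ((\<kappa> * f n) powr \<beta>)" using xk by simp
      ultimately show ?thesis using w1 xk by linarith
    qed
    have close: "cmod (w - w') < 1 / f n" if "w \<in> Exc (\<rho> n)" "w' \<in> Exc (\<rho> (Suc n))" for w w' n
    proof -
      note a = rare[OF that(1) \<rho>1(1,2)] and a' = rare[OF that(2) order_trans[OF \<rho>1(1,4)] \<rho>1(3)]
      have "Rs2 \<le> f n" "f n powr b \<le> ln (max_modulus g (f n))" using f(1)[of n] R1 by (auto simp: growth_record_def)
      then show ?thesis using a a' by (intro rv) auto
    qed
    have f2: "2 ^ n \<le> f n" for n
    proof (induction n)
      case (Suc n) then show ?case using f(2)[of n] by simp
    qed (use f1[of 0] in simp)
    have Wd: "cmod (W n - W 0) \<le> 2 - 2 / 2 ^ n" for n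
    proof (induction n)
      case (Suc n)
      have "cmod (W n - W (Suc n)) < 1 / f n" by (rule close[OF W W])
      also have "\<dots> \<le> 1 / 2 ^ n" using f2[of n] by (intro divide_left_mono) (auto intro!: mult_pos_pos less_le_trans[OF _ f2[of n]])
      finally have "cmod (W (Suc n) - W n) < 1 / 2 ^ n" by (simp add: norm_minus_commute)
      moreover have "cmod (W (Suc n) - W 0) \<le> cmod (W (Suc n) - W n) + cmod (W n - W 0)"
        using norm_triangle_ineq[of "W (Suc n) - W n" "W n - W 0"] by simp
      moreover have "2 / (2::real) ^ n = 1 / 2 ^ n + 2 / 2 ^ Suc n" by (simp add: field_simps)
      ultimately show ?case using Suc by linarith
    qed simp
    \<comment> \<open>3 = 2 + 1: each \<open>W n\<close> is within 2 of \<open>W 0\<close>, and an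
      exceptional value at the next radius is within 1 of \<open>W n\<close>. The summand
      \<open>|g 0|\<close> ensures that values beyond \<open>D\<close> have distance at least 1 from
      \<open>g 0\<close>.\<close>
    define D where "D = cmod (W 0) + 3 + cmod (g 0)"
    have "\<exists>\<rho>\<ge>X. \<forall>w. D < cmod w \<longrightarrow> cmod w \<le> exp (\<rho> powr \<beta>) \<longrightarrow>
      \<rho> powr \<beta> \<le> counting (\<lambda>z. 1 / (g z - w)) \<rho>" for X
    proof -
      obtain n where n: "X < 2 ^ n" using real_arch_pow[of 2 X] by auto
      have "X \<le> \<rho> (Suc n)" using \<rho>1(1,4)[of n] f2[of n] f1[of n] n by linarith
      moreover have "\<rho> (Suc n) powr \<beta> \<le> counting (\<lambda>z. 1 / (g z - w)) (\<rho> (Suc n))"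
        if w: "D < cmod w" "cmod w \<le> exp (\<rho> (Suc n) powr \<beta>)" for w
      proof (rule ccontr)
        assume c: "\<not> ?thesis"
        have "1 \<le> cmod (w - g 0)" using norm_triangle_ineq2[of w "g 0"] w norm_ge_zero[of "W 0"] unfolding D_def by linarith
        then have "w \<in> Exc (\<rho> (Suc n))" using c w by (auto simp: Exc_def not_le)
        then have "cmod (W n - w) < 1 / f n" by (rule close[OF W])
        also have "\<dots> \<le> 1" using f1[of n] by simp
        finally have "cmod (w - W n) \<le> 1" by (simp add: norm_minus_commute)
        moreover have "cmod (W n - W 0) \<le> 2"
        proof -
          have "0 \<le> 2 / (2::real) ^ n" by simp
          then show ?thesis using Wd[of n] by linarith
        qed
        moreover have "cmod w \<le> cmod (w - W n) + (cmod (W n - W 0) + cmod (W 0))"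
          using norm_triangle_ineq[of "w - W n" "W n"] norm_triangle_ineq[of "W n - W 0" "W 0"] by simp
        ultimately show False using w norm_ge_zero[of "g 0"] unfolding D_def by linarith
      qed
      ultimately show ?thesis by blast
    qed
    then show ?thesis by (rule that)
  qed
qed

section \<open>Composition with an entire function\<close>

lemma entire_minus_nzmero:
  assumes "g holomorphic_on UNIV" "\<not> g constant_on UNIV" shows "nzmero (\<lambda>z. g z - w)"
proof -
  obtain z where "g z - w \<noteq> 0" using assms(2) unfolding constant_on_def by (metis eq_iff_diff_eq_0)
  moreover have "(\<lambda>z. g z - w) holomorphic_on UNIV" by (intro holomorphic_intros assms)
  ultimately show ?thesis using nzmero_entire[of "\<lambda>z. g z - w" z] by blast
qed

lemma eventually_ne_value:
  assumes "g holomorphic_on UNIV" "\<not> g constant_on UNIV" shows "eventually (\<lambda>w. g w \<noteq> g z) (at z)"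
  using nzmero_eventually[OF entire_minus_nzmero[OF assms, of "g z"], of z] by simp

lemma compose_meromorphic:
  assumes "\<phi> meromorphic_on UNIV" "g holomorphic_on UNIV" shows "(\<phi> \<circ> g) meromorphic_on UNIV"
  using meromorphic_on_compose[OF assms(1) entire_analytic[OF assms(2)], of UNIV] by (simp add: o_def)

lemma compose_nzmero:
  assumes \<phi>: "nzmero \<phi>" and g: "g holomorphic_on UNIV" "\<not> g constant_on UNIV"
  shows "nzmero (\<phi> \<circ> g)"
proof -
  have "eventually (\<lambda>w. (\<phi> \<circ> g) w \<noteq> 0) (at z)" for z
  proof -
    have "filterlim g (at (g z)) (at z)"
      unfolding filterlim_at using eventually_ne_value[OF g, of z] analytic_at_imp_isCont[OF entire_analytic[OF g(1), of "{z}"]]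
      by (auto simp: isCont_def)
    from filterlim_iff[THEN iffD1, OF this, rule_format, OF nzmero_eventually[OF \<phi>]] show ?thesis by simp
  qed
  then show ?thesis using compose_meromorphic[OF nzmero_meromorphic[OF \<phi>] g(1)]
    by (simp add: nzmero_def eventually_cosparse_open_eq)
qed

text \<open>Orders multiply: the pole of \<open>\<phi>\<close> at \<open>g z\<close> is repeated
  with the multiplicity with which \<open>g\<close> takes the value \<open>g z\<close> at
  \<open>z\<close>.\<close>

lemma pord_compose:
  assumes \<phi>: "nzmero \<phi>" and g: "g holomorphic_on UNIV" "\<not> g constant_on UNIV"
  shows "pord (\<phi> \<circ> g) z = pord \<phi> (g z) * pord (\<lambda>x. 1 / (g x - g z)) z"
proof -
  have gn: "nzmero (\<lambda>x. g x - g z)" by (rule entire_minus_nzmero[OF g])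
  have "zorder (\<phi> \<circ> g) z = zorder \<phi> (g z) * zorder (\<lambda>x. g x - g z) z"
    by (rule zorder_compose') (use \<phi> g nzmero_facts entire_analytic[OF g(1)] eventually_ne_value[OF g] in auto)
  moreover have "0 \<le> zorder (\<lambda>x. g x - g z) z"
  proof -
    have "(\<lambda>x. g x - g z) holomorphic_on UNIV" by (intro holomorphic_intros g)
    then show ?thesis using zorder_eq_pord[OF gn, of z] entire_pord[of "\<lambda>x. g x - g z" z] by simp
  qed
  ultimately show ?thesis
    by (simp add: pord_eq_zorder[OF \<phi>] pord_eq_zorder[OF compose_nzmero[OF \<phi> g]] pord_recip[OF gn]
        nat_mult_distrib_neg flip: mult_minus_left) (metis mult.commute nat_mult_distrib)
qed

text \<open>The fibres of \<open>g\<close> over different points are disjoint, so the poles of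
  \<open>\<phi> \<circ> g\<close> over the points of \<open>S\<close> may be counted fibre by fibre,
  with multiplied orders.\<close>

lemma counting_compose_ge:
  assumes \<phi>: "nzmero \<phi>" and g: "g holomorphic_on UNIV" "\<not> g constant_on UNIV"
    and S: "finite S" and r: "1 \<le> r"
  shows "(\<Sum>w\<in>S. real (pord \<phi> w) * counting (\<lambda>z. 1 / (g z - w)) r) \<le> counting (\<phi> \<circ> g) r"
proof -
  define Z where "Z = (\<lambda>w. {z. cmod z \<le> r \<and> g z = w})"
  have finZ: "finite (Z w)" for w
    using finite_cball_cosparse[of "\<lambda>z. g z - w \<noteq> 0" r] entire_minus_nzmero[OF g, of w]
    by (simp add: nzmero_def Z_def)
  let ?A = "(\<Union>w\<in>S. Z w) \<union> {z. cmod z \<le> r \<and> pord (\<phi> \<circ> g) z \<noteq> 0}"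
  have h: "(\<phi> \<circ> g) meromorphic_on UNIV" by (rule nzmero_meromorphic[OF compose_nzmero[OF \<phi> g]])
  have finA: "finite ?A" using S finZ finite_pord[OF h] by auto
  have "(\<Sum>w\<in>S. real (pord \<phi> w) * counting (\<lambda>z. 1 / (g z - w)) r) = (\<Sum>w\<in>S. \<Sum>z\<in>Z w. real (pord (\<phi> \<circ> g) z) * wt r z)"
  proof (rule sum.cong[OF refl])
    fix w assume "w \<in> S"
    have gn: "nzmero (\<lambda>x. g x - w)" by (rule entire_minus_nzmero[OF g])
    have "counting (\<lambda>z. 1 / (g z - w)) r = (\<Sum>z\<in>Z w. real (pord (\<lambda>z. 1 / (g z - w)) z) * wt r z)"
    proof (rule counting_eq[OF nzmero_meromorphic[OF nzmero_inverse[OF gn]] _ finZ])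
      fix z assume z: "cmod z \<le> r" "pord (\<lambda>z. 1 / (g z - w)) z \<noteq> 0"
      have "g z = w"
      proof (rule ccontr)
        assume "g z \<noteq> w"
        then have "(\<lambda>z. 1 / (g z - w)) analytic_on {z}" using entire_analytic[OF g(1)] by (auto intro!: analytic_intros)
        then show False using z(2) not_pole_pord[OF analytic_at_imp_no_pole] by simp
      qed
      then show "z \<in> Z w" using z by (simp add: Z_def)
    qed (use r in auto)
    then show "real (pord \<phi> w) * counting (\<lambda>z. 1 / (g z - w)) r = (\<Sum>z\<in>Z w. real (pord (\<phi> \<circ> g) z) * wt r z)"
      by (simp add: sum_distrib_left) (rule sum.cong, auto simp: Z_def pord_compose[OF \<phi> g])
  qed
  also have "\<dots> = (\<Sum>z\<in>(\<Union>w\<in>S. Z w). real (pord (\<phi> \<circ> g) z) * wt r z)"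
    by (rule sum.UNION_disjoint[symmetric]) (use S finZ in \<open>auto simp: Z_def\<close>)
  also have "\<dots> \<le> (\<Sum>z\<in>?A. real (pord (\<phi> \<circ> g) z) * wt r z)"
    by (rule sum_mono2[OF finA]) (use r in \<open>auto intro!: mult_nonneg_nonneg wt_nonneg\<close>)
  also have "\<dots> = counting (\<phi> \<circ> g) r"
    by (rule counting_eq[symmetric, OF h _ finA]) (use r in auto)
  finally show ?thesis .
qed

text \<open>A far pole \<open>w\<close> of \<open>\<phi>\<close> has weight at most
  \<open>ln R = \<rho> powr \<beta>\<close>, which by hypothesis does not exceed the counting
  function of its preimages. The finitely many poles near the origin, of which \<open>g\<close> may
  omit some, are paid for by \<open>C\<close>.\<close>

lemma counting_compose_lower:
  assumes \<phi>: "nzmero \<phi>" and g: "g holomorphic_on UNIV" "\<not> g constant_on UNIV"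
  obtains C where "0 \<le> C" "\<And>\<rho> r. 1 \<le> \<rho> \<Longrightarrow> \<rho> \<le> r \<Longrightarrow>
     \<forall>w. D < cmod w \<longrightarrow> cmod w \<le> exp (\<rho> powr \<beta>) \<longrightarrow> \<rho> powr \<beta> \<le> counting (\<lambda>z. 1 / (g z - w)) \<rho> \<Longrightarrow>
     counting \<phi> (exp (\<rho> powr \<beta>)) \<le> counting (\<phi> \<circ> g) r + C * (1 + \<rho> powr \<beta>)"
proof -
  have m: "\<phi> meromorphic_on UNIV" by (rule nzmero_meromorphic[OF \<phi>])
  \<comment> \<open>Outside the unit disc \<open>ln |w|\<close> is nonnegative, so the weight at
    radius \<open>R\<close> is at most \<open>ln R\<close>.\<close>
  define D' where "D' = max 1 D"
  define A where "A = {w. cmod w \<le> D' \<and> pord \<phi> w \<noteq> 0}"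
  have finA: "finite A" unfolding A_def by (rule finite_pord[OF m])
  define c where "c = (\<lambda>w. if w = 0 then 0 else \<bar>ln (cmod w)\<bar>)"
  define C where "C = (\<Sum>w\<in>A. real (pord \<phi> w) * (1 + c w))"
  have c0: "0 \<le> c w" for w by (simp add: c_def)
  show ?thesis
  proof (rule that[of C])
    show "0 \<le> C" unfolding C_def by (intro sum_nonneg mult_nonneg_nonneg add_nonneg_nonneg c0) auto
    fix \<rho> r assume \<rho>: "1 \<le> \<rho>" "\<rho> \<le> r"
      and H: "\<forall>w. D < cmod w \<longrightarrow> cmod w \<le> exp (\<rho> powr \<beta>) \<longrightarrow> \<rho> powr \<beta> \<le> counting (\<lambda>z. 1 / (g z - w)) \<rho>"
    define V where "V = \<rho> powr \<beta>"
    define R where "R = exp V"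
    have V0: "0 \<le> V" by (simp add: V_def)
    have R1: "1 \<le> R" "ln R = V" using V0 by (auto simp: R_def)
    define S where "S = {w. cmod w \<le> R \<and> pord \<phi> w \<noteq> 0}"
    have finS: "finite S" unfolding S_def by (rule finite_pord[OF m])
    have "counting \<phi> R = (\<Sum>w\<in>S. real (pord \<phi> w) * wt R w)"
      unfolding S_def by (rule counting_eq'[OF m]) (use R1 in auto)
    also have "\<dots> = (\<Sum>w\<in>S \<inter> A. real (pord \<phi> w) * wt R w) + (\<Sum>w\<in>S - A. real (pord \<phi> w) * wt R w)"
      by (rule sum.Int_Diff[OF finS])
    also have "(\<Sum>w\<in>S \<inter> A. real (pord \<phi> w) * wt R w) \<le> (\<Sum>w\<in>A. real (pord \<phi> w) * (V + c w))"
    proof -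
      have "(\<Sum>w\<in>S \<inter> A. real (pord \<phi> w) * wt R w) \<le> (\<Sum>w\<in>S \<inter> A. real (pord \<phi> w) * (V + c w))"
        by (intro sum_mono mult_left_mono) (use R1 V0 in \<open>auto simp: wt_def c_def\<close>)
      also have "\<dots> \<le> (\<Sum>w\<in>A. real (pord \<phi> w) * (V + c w))"
        by (rule sum_mono2[OF finA]) (auto intro!: mult_nonneg_nonneg add_nonneg_nonneg V0 c0)
      finally show ?thesis .
    qed
    also have "\<dots> \<le> C * (1 + V)"
      unfolding C_def sum_distrib_right
    proof (rule sum_mono)
      fix w
      have "V + c w \<le> (1 + c w) * (1 + V)" using V0 c0[of w] by (simp add: algebra_simps)
      then show "real (pord \<phi> w) * (V + c w) \<le> real (pord \<phi> w) * (1 + c w) * (1 + V)"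
        by (simp only: mult.assoc mult_left_mono of_nat_0_le_iff)
    qed
    also have "(\<Sum>w\<in>S - A. real (pord \<phi> w) * wt R w) \<le> (\<Sum>w\<in>S - A. real (pord \<phi> w) * counting (\<lambda>z. 1 / (g z - w)) r)"
    proof (intro sum_mono mult_left_mono)
      fix w assume w: "w \<in> S - A"
      then have wD: "D < cmod w" "1 < cmod w" "cmod w \<le> R" by (auto simp: S_def A_def D'_def)
      then have "wt R w \<le> V" using R1 by (auto simp: wt_def)
      also have "\<dots> \<le> counting (\<lambda>z. 1 / (g z - w)) \<rho>" using H wD by (simp add: V_def R_def)
      also have "\<dots> \<le> counting (\<lambda>z. 1 / (g z - w)) r"
        by (rule counting_mono[OF nzmero_meromorphic[OF nzmero_inverse[OF entire_minus_nzmero[OF g]]]]) (use \<rho> in auto)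
      finally show "wt R w \<le> counting (\<lambda>z. 1 / (g z - w)) r" .
    qed auto
    also have "\<dots> \<le> counting (\<phi> \<circ> g) r"
      by (rule counting_compose_ge[OF \<phi> g]) (use finS \<rho> in auto)
    finally show "counting \<phi> (exp (\<rho> powr \<beta>)) \<le> counting (\<phi> \<circ> g) r + C * (1 + \<rho> powr \<beta>)"
      by (simp add: R_def V_def)
  qed
qed

section \<open>Lower bounds for \<open>T(r, f \<circ> g)\<close> with transcendental
  \<open>f\<close>\<close>

lemma transcendental_nonconstant:
  assumes "transcendental_meromorphic f" shows "\<not> eventually (\<lambda>z. f z = c) (cosparse UNIV)"
proof
  assume "eventually (\<lambda>z. f z = c) (cosparse UNIV)"
  then have "eventually (\<lambda>z. f z = poly [:c:] z / poly 1 z) (cosparse UNIV)" by simp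
  then show False using assms unfolding transcendental_meromorphic_def by (metis zero_neq_one)
qed

text \<open>A pole of \<open>f\<close> is also a pole of the derivative, so a vanishing derivative
  leaves no poles; after removal of singularities \<open>f\<close> is entire with derivative 0,
  hence constant.\<close>

lemma transcendental_deriv_nzmero:
  assumes tr: "transcendental_meromorphic f" shows "nzmero (deriv f)"
proof (rule ccontr)
  assume c: "\<not> nzmero (deriv f)"
  have f: "nzmero f" by (rule transcendental_nzmero[OF tr])
  note m = nzmero_meromorphic[OF f]
  have ev: "eventually (\<lambda>z. deriv f z = 0) (cosparse UNIV)"
    using meromorphic_zero_or_nzmero[OF meromorphic_on_deriv[OF m]] c by blast
  have np: "\<not> is_pole f z" for z
  proof
    assume "is_pole f z"
    then have "is_pole (deriv f) z" using is_pole_deriv_iff[OF m] by simp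
    then have "frequently (\<lambda>w. deriv f w \<noteq> 0) (at z)" by (rule pole_frequently_nonzero)
    then show False using eventually_cosparse_imp_eventually_at[OF ev, of z UNIV] by (simp add: frequently_def)
  qed
  define E where "E = remove_sings f"
  have E: "E holomorphic_on UNIV" unfolding E_def
    by (rule entire_remove_sings[OF f]) (simp add: zorder_eq_pord[OF f] not_pole_pord[OF np])
  have EE: "eventually (\<lambda>z. E z = f z) (cosparse UNIV)" unfolding E_def by (rule remove_sings_cosparse_eq[OF m])
  have nc: "\<not> E constant_on UNIV"
  proof
    assume "E constant_on UNIV"
    then obtain c where "\<And>z. E z = c" by (auto simp: constant_on_def)
    then have "eventually (\<lambda>z. f z = c) (cosparse UNIV)" using EE by (auto elim: eventually_mono)
    then show False using transcendental_nonconstant[OF tr] by blast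
  qed
  have "eventually (\<lambda>z. deriv E z \<noteq> 0) (cosparse UNIV)" using deriv_nzmero[OF E nc] by (simp add: nzmero_def)
  moreover have "eventually (\<lambda>z. f analytic_on {z}) (cosparse UNIV)" by (rule meromorphic_on_imp_analytic_cosparse[OF m])
  ultimately have "eventually (\<lambda>z. False) (cosparse (UNIV :: complex set))"
    using ev
  proof eventually_elim
    case (elim z)
    have "eventually (\<lambda>w. E w = f w) (nhds z)" unfolding E_def by (rule eventually_remove_sings_eq_nhds[OF elim(2)])
    then have "deriv E z = deriv f z" by (rule deriv_cong_ev) simp
    then show False using elim by simp
  qed
  then show False by (simp add: eventually_False)
qed

lemma transcendental_minus_nzmero:
  assumes tr: "transcendental_meromorphic f" shows "nzmero (\<lambda>z. f z - c)"
proof -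
  have "(\<lambda>z. f z - c) meromorphic_on UNIV"
    using nzmero_meromorphic[OF transcendental_nzmero[OF tr]] by (intro meromorphic_intros) auto
  from meromorphic_zero_or_nzmero[OF this] show ?thesis using transcendental_nonconstant[OF tr, of c] by simp
qed

lemma compose_minus_one: "(\<lambda>z. f z - 1) \<circ> g = (\<lambda>z. (f \<circ> g) z - (1::complex))"
  by (simp add: o_def)

text \<open>86400 = 1200 * 36 * 2, and its logarithm is crudely bounded by the number
  itself.\<close>

lemma ln_error_bound:
  assumes "1 \<le> s" "0 < \<rho>'" "\<rho>' \<le> 6 * s" "1 \<le> \<Theta>"
  shows "ln (1200 * (\<Theta> * \<rho>' / s)\<^sup>2 * (1 + 1 / s)) \<le> 86400 + 2 * ln (\<Theta>::real)"
proof -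
  have "\<rho>' / s \<le> 6" "0 < \<rho>' / s" using assms by (auto simp: field_simps)
  then have "\<Theta> * \<rho>' / s \<le> \<Theta> * 6" "0 < \<Theta> * \<rho>' / s"
    using assms mult_left_mono[of "\<rho>' / s" 6 \<Theta>] mult_pos_pos[of \<Theta> "\<rho>' / s"] by auto
  note 0 = this
  have 1: "(\<Theta> * \<rho>' / s)\<^sup>2 \<le> (\<Theta> * 6)\<^sup>2" "0 < (\<Theta> * \<rho>' / s)\<^sup>2"
    using power_mono[OF 0(1) less_imp_le[OF 0(2)], of 2] zero_less_power[OF 0(2), of 2] by blast+
  have 2: "1 + 1 / s \<le> 2" "0 < 1 + 1 / s" using assms by (auto simp: field_simps)
  have "1200 * (\<Theta> * \<rho>' / s)\<^sup>2 * (1 + 1 / s) \<le> 1200 * (\<Theta> * 6)\<^sup>2 * 2"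
    by (intro mult_mono) (use 1 2 in auto)
  also have "\<dots> = 86400 * \<Theta>\<^sup>2" by (simp add: power_mult_distrib)
  finally have "ln (1200 * (\<Theta> * \<rho>' / s)\<^sup>2 * (1 + 1 / s)) \<le> ln (86400 * \<Theta>\<^sup>2)"
    using 1 2 assms by (subst ln_le_cancel_iff) (auto intro!: mult_pos_pos)
  also have "\<dots> = ln 86400 + 2 * ln \<Theta>" using assms by (simp add: ln_mult ln_realpow)
  also have "ln 86400 \<le> (86400::real)" using ln_le_minus_one[of 86400] by simp
  finally show ?thesis by simp
qed

text \<open>The error of the second main estimate at \<open>t\<close> involves \<open>T\<close> at
  larger radii up to \<open>R\<close>; the hypothesis \<open>slow\<close> is what allows its
  logarithm to be absorbed into \<open>T(t, f)\<close>. The errors \<open>O(ln R)\<close> from the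
  poles near the origin are absorbed because \<open>T(t, f)\<close> exceeds any multiple of
  \<open>ln t\<close>.\<close>

lemma compose_T_lower:
  assumes tr: "transcendental_meromorphic f" and g: "g holomorphic_on UNIV"
    and \<beta>: "0 < \<beta>" "ereal \<beta> < entire_order g"
    and slow: "\<And>R t \<rho>. R0 \<le> R \<Longrightarrow> R / 8 \<le> t \<Longrightarrow> t \<le> R \<Longrightarrow> R / 8 \<le> \<rho> \<Longrightarrow> \<rho> \<le> R \<Longrightarrow> good f t \<Longrightarrow> good f \<rho>
        \<Longrightarrow> ln (nevanlinna_T f \<rho>) \<le> nevanlinna_T f t / 16"
  shows "\<exists>\<rho>\<ge>X. \<exists>t\<ge>exp (\<rho> powr \<beta>) / 8. good f t \<and> (\<forall>r\<ge>\<rho>. good (f \<circ> g) r \<longrightarrow> good (\<lambda>z. (f \<circ> g) z - 1) r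
      \<longrightarrow> nevanlinna_T f t \<le> 6 * nevanlinna_T (f \<circ> g) r)"
proof -
  let ?T = "nevanlinna_T f"
  have gc: "\<not> g constant_on UNIV" by (rule entire_order_growth(1)[OF g \<beta>])
  have f: "nzmero f" by (rule transcendental_nzmero[OF tr])
  have f1: "nzmero (\<lambda>z. f z - 1)" by (rule transcendental_minus_nzmero[OF tr])
  have f': "nzmero (deriv f)" by (rule transcendental_deriv_nzmero[OF tr])
  note fi = nzmero_inverse[OF f] and f1i = nzmero_inverse[OF f1]
  have fg: "nzmero (f \<circ> g)" by (rule compose_nzmero[OF f g gc])
  have fg1: "nzmero (\<lambda>z. (f \<circ> g) z - 1)" using compose_nzmero[OF f1 g gc] by (simp add: compose_minus_one)
  obtain D where D: "\<And>X. \<exists>\<rho>\<ge>X. \<forall>w. D < cmod w \<longrightarrow> cmod w \<le> exp (\<rho> powr \<beta>) \<longrightarrow> \<rho> powr \<beta> \<le> counting (\<lambda>z. 1 / (g z - w)) \<rho>"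
    by (rule values_taken_often[OF g \<beta>]) blast
  obtain C1 where C1: "0 \<le> C1" "\<And>\<rho> r. 1 \<le> \<rho> \<Longrightarrow> \<rho> \<le> r \<Longrightarrow>
     \<forall>w. D < cmod w \<longrightarrow> cmod w \<le> exp (\<rho> powr \<beta>) \<longrightarrow> \<rho> powr \<beta> \<le> counting (\<lambda>z. 1 / (g z - w)) \<rho> \<Longrightarrow>
     counting f (exp (\<rho> powr \<beta>)) \<le> counting (f \<circ> g) r + C1 * (1 + \<rho> powr \<beta>)"
    by (rule counting_compose_lower[OF f g gc, of D \<beta>]) (rule that, assumption+)
  obtain C2 where C2: "0 \<le> C2" "\<And>\<rho> r. 1 \<le> \<rho> \<Longrightarrow> \<rho> \<le> r \<Longrightarrow>
     \<forall>w. D < cmod w \<longrightarrow> cmod w \<le> exp (\<rho> powr \<beta>) \<longrightarrow> \<rho> powr \<beta> \<le> counting (\<lambda>z. 1 / (g z - w)) \<rho> \<Longrightarrow>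
     counting (\<lambda>z. 1 / f z) (exp (\<rho> powr \<beta>)) \<le> counting ((\<lambda>z. 1 / f z) \<circ> g) r + C2 * (1 + \<rho> powr \<beta>)"
    by (rule counting_compose_lower[OF fi g gc, of D \<beta>]) (rule that, assumption+)
  obtain C3 where C3: "0 \<le> C3" "\<And>\<rho> r. 1 \<le> \<rho> \<Longrightarrow> \<rho> \<le> r \<Longrightarrow>
     \<forall>w. D < cmod w \<longrightarrow> cmod w \<le> exp (\<rho> powr \<beta>) \<longrightarrow> \<rho> powr \<beta> \<le> counting (\<lambda>z. 1 / (g z - w)) \<rho> \<Longrightarrow>
     counting (\<lambda>z. 1 / (f z - 1)) (exp (\<rho> powr \<beta>)) \<le> counting ((\<lambda>z. 1 / (f z - 1)) \<circ> g) r + C3 * (1 + \<rho> powr \<beta>)"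
    by (rule counting_compose_lower[OF f1i g gc, of D \<beta>]) (rule that, assumption+)
  define l0 l1 l2 L0 L1 where "l0 = \<bar>lead_ln f\<bar>" and "l1 = \<bar>lead_ln (\<lambda>z. f z - 1)\<bar>" and "l2 = \<bar>lead_ln (deriv f)\<bar>"
    and "L0 = \<bar>lead_ln (f \<circ> g)\<bar>" and "L1 = \<bar>lead_ln (\<lambda>z. (f \<circ> g) z - 1)\<bar>"
  define c where "c = 1 + l0 + l1"
  define A where "A = 86400 + 2 * ln (2 + c) + l0 + l1 + l2 + L0 + L1 + 1"
  define C where "C = C1 + C2 + C3"
  have c1: "1 \<le> c" by (simp add: c_def l0_def l1_def)
  then have "0 \<le> ln (2 + c)" by simp
  then have A0: "0 \<le> A" by (simp add: A_def l0_def l1_def l2_def L0_def L1_def)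
  have C0: "0 \<le> C" using C1(1) C2(1) C3(1) by (simp add: C_def)
  \<comment> \<open>Together with \<open>(1 + V) / 2 \<le> ln t\<close> this makes
    \<open>(A + C) * (1 + V)\<close> at most a quarter of \<open>T(t, f)\<close>.\<close>
  define K where "K = 8 * (A + C) + 1"
  have K1: "1 \<le> K" using A0 C0 by (simp add: K_def)
  obtain R1 where R1: "\<And>R. R1 \<le> R \<Longrightarrow> good f R \<Longrightarrow> K * ln R < ?T R"
    by (rule transcendental_T_growth[OF tr, of K]) (rule that, assumption+)
  \<comment> \<open>\<open>15 \<le> V\<close> is exactly what \<open>(1 + V) / 2 \<le> V - 7\<close>
    requires, where 7 bounds \<open>ln 8\<close>.\<close>
  define M where "M = max (max (exp 15) R0) (8 * R1)"
  have "eventually (\<lambda>\<rho>. M \<le> exp (\<rho> powr \<beta>)) at_top" using \<beta>(1) by real_asymp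
  then obtain X1 where X1: "\<And>\<rho>. X1 \<le> \<rho> \<Longrightarrow> M \<le> exp (\<rho> powr \<beta>)" by (auto simp: eventually_at_top_linorder)
  obtain \<rho> where \<rho>: "max (max X 1) X1 \<le> \<rho>" and H: "\<forall>w. D < cmod w \<longrightarrow> cmod w \<le> exp (\<rho> powr \<beta>) \<longrightarrow> \<rho> powr \<beta> \<le> counting (\<lambda>z. 1 / (g z - w)) \<rho>"
    using D[of "max (max X 1) X1"] by blast
  define V where "V = \<rho> powr \<beta>"
  define R where "R = exp V"
  have "M \<le> R" using X1[of \<rho>] \<rho> by (simp add: R_def V_def)
  then have RR: "exp 15 \<le> R" "R0 \<le> R" "R1 \<le> R / 8" by (auto simp: M_def)
  have V15: "15 \<le> V" using RR(1) by (simp add: R_def)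
  have R16: "16 \<le> R" using exp_ge_add_one_self[of 15] RR(1) by simp
  have l8: "ln 8 \<le> (7::real)" using ln_le_minus_one[of 8] by simp
  have lnlow: "(1 + V) / 2 \<le> ln t" if "R / 8 \<le> t" for t
  proof -
    have "ln (R / 8) = V - ln 8" using R16 by (simp add: ln_div R_def)
    moreover have "ln (R / 8) \<le> ln t" using that R16 by simp
    ultimately show ?thesis using V15 l8 by argo
  qed
  have Tl: "K * ((1 + V) / 2) < ?T t" if "R / 8 \<le> t" "good f t" for t
    using R1[of t] mult_left_mono[OF lnlow[OF that(1)], of K] that RR K1 by linarith
  have T1: "1 \<le> ?T t" if "R / 8 \<le> t" "good f t" for t
  proof -
    have "1 * 1 \<le> K * ((1 + V) / 2)" by (rule mult_mono) (use K1 V15 in auto)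
    then show ?thesis using Tl[OF that] by linarith
  qed
  let ?G = "{f, \<lambda>z. f z - 1}"
  have G: "finite ?G" "\<And>h. h \<in> ?G \<Longrightarrow> nzmero h" using f f1 by auto
  obtain \<rho>1 where \<rho>1: "3 * R / 8 < \<rho>1" "\<rho>1 < 4 * R / 8" "\<And>h. h \<in> ?G \<Longrightarrow> good h \<rho>1"
    by (rule ex_good[OF G, of "3 * R / 8" "4 * R / 8"]) (use R16 in \<open>auto\<close>)
  obtain \<rho>2 where \<rho>2: "5 * R / 8 < \<rho>2" "\<rho>2 < 6 * R / 8" "\<And>h. h \<in> ?G \<Longrightarrow> good h \<rho>2"
    by (rule ex_good[OF G, of "5 * R / 8" "6 * R / 8"]) (use R16 in \<open>auto\<close>)
  have g1: "good f \<rho>1" "good f \<rho>2" "good (\<lambda>z. f z - 1) \<rho>1" "good (\<lambda>z. f z - 1) \<rho>2" using \<rho>1(3) \<rho>2(3) by auto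
  have TT: "1 \<le> ?T \<rho>1" "1 \<le> ?T \<rho>2" using T1[of \<rho>1] T1[of \<rho>2] g1 \<rho>1(1) \<rho>2(1) R16 by auto
  define \<Theta> where "\<Theta> = ?T \<rho>1 + ?T \<rho>2 + c"
  have \<Theta>: "1 \<le> \<Theta>" "?T \<rho>1 \<le> \<Theta>" "?T \<rho>2 \<le> \<Theta>" "\<bar>lead_ln f\<bar> \<le> \<Theta>" "\<bar>lead_ln (\<lambda>z. f z - 1)\<bar> \<le> \<Theta>"
    using TT by (simp_all add: \<Theta>_def c_def l0_def l1_def)
  obtain t where t: "R / 8 < t" "t < R / 8 + R / 8" "good f t"
    "?T t \<le> counting f t + counting (\<lambda>z. 1 / f z) t + counting (\<lambda>z. 1 / (f z - 1)) t
       + ln (1200 * (\<Theta> * \<rho>2 / (R / 8))\<^sup>2 * (1 + 1 / (R / 8))) + lead_ln f + lead_ln (\<lambda>z. f z - 1) - lead_ln (deriv f)"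
    by (rule second_main_estimate[OF f f1 f' g1 _ _ _ _ \<Theta> G, of "R / 8" "R / 8"]) (use R16 \<rho>1 \<rho>2 in \<open>auto\<close>)
  have lnE: "ln (1200 * (\<Theta> * \<rho>2 / (R / 8))\<^sup>2 * (1 + 1 / (R / 8))) \<le> 86400 + 2 * ln \<Theta>"
    by (rule ln_error_bound) (use R16 \<rho>2 \<Theta> in auto)
  \<comment> \<open>A product bound, so that the logarithm splits into the two that
    \<open>slow\<close> bounds by \<open>T(t, f) / 16\<close> each.\<close>
  have "\<Theta> \<le> (2 + c) * (?T \<rho>1 * ?T \<rho>2)"
  proof -
    have a: "?T \<rho>1 \<le> ?T \<rho>1 * ?T \<rho>2" "?T \<rho>2 \<le> ?T \<rho>1 * ?T \<rho>2"
      using TT mult_left_mono[of 1 "?T \<rho>2" "?T \<rho>1"] mult_right_mono[of 1 "?T \<rho>1" "?T \<rho>2"] by auto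
    then have "1 \<le> ?T \<rho>1 * ?T \<rho>2" using TT by linarith
    then have "c \<le> c * (?T \<rho>1 * ?T \<rho>2)" using c1 mult_left_mono[of 1 "?T \<rho>1 * ?T \<rho>2" c] by simp
    then show ?thesis using a unfolding \<Theta>_def distrib_right by linarith
  qed
  then have "ln \<Theta> \<le> ln ((2 + c) * (?T \<rho>1 * ?T \<rho>2))" using \<Theta>(1) by simp
  also have "\<dots> = ln (2 + c) + (ln (?T \<rho>1) + ln (?T \<rho>2))" using TT c1 by (simp add: ln_mult)
  finally have ln\<Theta>: "ln \<Theta> \<le> ln (2 + c) + ?T t / 8"
    using slow[of R t \<rho>1] slow[of R t \<rho>2] RR t \<rho>1 \<rho>2 g1 R16 by simp
  have cm: "counting h t \<le> counting h R" if "nzmero h" for h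
    by (rule counting_mono[OF nzmero_meromorphic[OF that]]) (use t R16 in auto)
  show ?thesis
  proof (rule exI[of _ \<rho>], rule conjI, use \<rho> in simp, rule exI[of _ t], intro conjI allI impI)
    show "exp (\<rho> powr \<beta>) / 8 \<le> t" using t by (simp add: R_def V_def)
    show "good f t" by (rule t)
    fix r assume r: "\<rho> \<le> r" and gr: "good (f \<circ> g) r" "good (\<lambda>z. (f \<circ> g) z - 1) r"
    have r1: "1 \<le> \<rho>" "1 \<le> r" using \<rho> r by auto
    define S where "S = nevanlinna_T (f \<circ> g) r"
    have good_inv: "reg (\<lambda>z. 1 / h z) r" if "good h r" for h
      using that by (auto simp: good_def reg_def intro!: analytic_intros)
    have "counting (f \<circ> g) r \<le> S" unfolding S_def by (rule counting_le_T[OF good_imp_reg[OF gr(1)]])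
    then have n1: "counting f R \<le> S + C1 * (1 + V)" using C1(2)[OF r1(1) r H] by (simp add: R_def V_def)
    have "counting ((\<lambda>z. 1 / f z) \<circ> g) r \<le> S + L0"
      using counting_le_T[OF good_inv[OF gr(1)]] first_main_theorem[OF fg gr(1)] by (simp add: o_def S_def L0_def)
    then have n2: "counting (\<lambda>z. 1 / f z) R \<le> S + L0 + C2 * (1 + V)" using C2(2)[OF r1(1) r H] by (simp add: R_def V_def)
    have "counting ((\<lambda>z. 1 / (f z - 1)) \<circ> g) r \<le> S + ln 2 + L1"
      using counting_le_T[OF good_inv[OF gr(2)]] first_main_theorem[OF fg1 gr(2)]
        T_minus_one_le[OF nzmero_meromorphic[OF fg] good_imp_reg[OF gr(1)] r1(2)] by (simp add: o_def S_def L1_def)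
    then have n3: "counting (\<lambda>z. 1 / (f z - 1)) R \<le> S + 1 + L1 + C3 * (1 + V)"
      using C3(2)[OF r1(1) r H] ln2_le_1 by (simp add: R_def V_def)
    have "C1 * (1 + V) + C2 * (1 + V) + C3 * (1 + V) = C * (1 + V)" by (simp add: C_def distrib_right)
    moreover have "lead_ln f \<le> l0" "lead_ln (\<lambda>z. f z - 1) \<le> l1" "- lead_ln (deriv f) \<le> l2"
      by (auto simp: l0_def l1_def l2_def)
    \<comment> \<open>One quarter of \<open>T(t, f)\<close> comes from
      \<open>2 * ln \<Theta>\<close>, another will come from \<open>A\<close> and \<open>C\<close>;
      moving both to the left turns the factor 3 into 6.\<close>
    ultimately have "?T t \<le> 3 * S + A + C * (1 + V) + ?T t / 4"
      using n1 n2 n3 cm[OF f] cm[OF fi] cm[OF f1i] t(4) lnE ln\<Theta> unfolding A_def by argo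
    moreover have "A + C * (1 + V) \<le> (A + C) * (1 + V)" using A0 V15 by (simp add: distrib_right distrib_left)
    moreover have "4 * ((A + C) * (1 + V)) \<le> ?T t"
      using Tl[of t] t V15 unfolding K_def by (simp add: field_simps)
    ultimately show "?T t \<le> 6 * nevanlinna_T (f \<circ> g) r" unfolding S_def by argo
  qed
qed

section \<open>Iterated logarithms\<close>

text \<open>\<open>iter_exp k 0 \<le> x\<close> is the threshold above which all \<open>k\<close>
  logarithms are taken of positive numbers, so that monotonicity is not spoiled by default values of
  \<open>ln\<close>.\<close>

definition iter_exp :: "nat \<Rightarrow> real \<Rightarrow> real" where "iter_exp k = exp ^^ k"

lemma iter_exp_simps [simp]: "iter_exp 0 x = x" "iter_exp (Suc k) x = exp (iter_exp k x)"
  by (simp_all add: iter_exp_def)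

lemma iter_log_0 [simp]: "iter_log 0 x = x"
  by (simp add: iter_log_def)

lemma iter_log_Suc: "iter_log (Suc k) x = ln (iter_log k x)"
  by (simp add: iter_log_def)

lemma iter_log_Suc': "iter_log (Suc k) x = iter_log k (ln x)"
  by (simp add: iter_log_def funpow_swap1)

lemma iter_exp_mono: "x \<le> y \<Longrightarrow> iter_exp k x \<le> iter_exp k y"
  by (induction k) auto

lemma iter_log_exp [simp]: "iter_log k (iter_exp k x) = x"
  by (induction k) (auto simp: iter_log_Suc')

lemma le_iter_log: "iter_exp k y \<le> x \<Longrightarrow> y \<le> iter_log k x"
proof (induction k arbitrary: x)
  case (Suc k)
  then have "0 < x" by (auto intro: less_le_trans[OF exp_gt_zero])
  then have "iter_exp k y \<le> ln x" using Suc.prems by (simp add: ln_ge_iff)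
  then show ?case using Suc.IH by (simp add: iter_log_Suc')
qed simp

lemma iter_log_mono: "iter_exp k 0 \<le> x \<Longrightarrow> x \<le> y \<Longrightarrow> iter_log k x \<le> iter_log k y"
proof (induction k arbitrary: x y)
  case (Suc k)
  then have "0 < x" by (auto intro: less_le_trans[OF exp_gt_zero])
  then have "iter_exp k 0 \<le> ln x" "ln x \<le> ln y" using Suc.prems by (simp_all add: ln_ge_iff)
  then show ?case using Suc.IH by (simp add: iter_log_Suc')
qed simp

lemma le_iter_exp: "iter_exp k 0 \<le> x \<Longrightarrow> iter_log k x \<le> y \<Longrightarrow> x \<le> iter_exp k y"
proof (induction k arbitrary: x)
  case (Suc k)
  then have x: "0 < x" by (auto intro: less_le_trans[OF exp_gt_zero])
  then have "iter_exp k 0 \<le> ln x" using Suc.prems by (simp add: ln_ge_iff)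
  then have "ln x \<le> iter_exp k y" using Suc.IH Suc.prems by (simp add: iter_log_Suc')
  then show ?case using x exp_le_cancel_iff[of "ln x" "iter_exp k y"] by simp
qed simp

lemma filterlim_iter_log: "filterlim a at_top F \<Longrightarrow> filterlim (\<lambda>x. iter_log k (a x)) at_top F"
  by (induction k) (auto simp: iter_log_Suc intro: filterlim_compose[OF ln_at_top])

text \<open>\<open>ln a = ln b + ln (a / b)\<close>, where the second summand converges and the
  first tends to infinity.\<close>

lemma ln_ratio_tendsto_1:
  fixes a b :: "'a \<Rightarrow> real"
  assumes "((\<lambda>x. a x / b x) \<longlongrightarrow> c) F" "0 < c" "filterlim b at_top F"
  shows "((\<lambda>x. ln (a x) / ln (b x)) \<longlongrightarrow> 1) F"
proof -
  have lb: "filterlim (\<lambda>x. ln (b x)) at_top F" by (rule filterlim_compose[OF ln_at_top assms(3)])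
  have "((\<lambda>x. ln (a x / b x) / ln (b x) + 1) \<longlongrightarrow> 0 + 1) F"
    by (intro tendsto_add tendsto_const real_tendsto_divide_at_top[OF tendsto_ln[OF assms(1)] lb]) (use assms(2) in auto)
  then have "((\<lambda>x. ln (a x / b x) / ln (b x) + 1) \<longlongrightarrow> 1) F" by simp
  then show ?thesis
  proof (rule Lim_transform_eventually)
    show "eventually (\<lambda>x. ln (a x / b x) / ln (b x) + 1 = ln (a x) / ln (b x)) F"
      using order_tendstoD(1)[OF assms(1,2)] filterlim_at_top_dense[THEN iffD1, OF assms(3), rule_format, of 1]
    proof eventually_elim
      case (elim x)
      then have "0 < a x" by (simp add: zero_less_divide_iff)
      then show ?case using elim by (simp add: ln_div field_simps)
    qed
  qed
qed

text \<open>One logarithm turns any positive limit into 1, and further logarithms keep it there.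
  This is why constant factors vanish as soon as \<open>1 \<le> k\<close>.\<close>

lemma iter_log_ratio_tendsto_1:
  assumes "((\<lambda>x. a x / b x) \<longlongrightarrow> c) F" "0 < c" "filterlim b at_top F" "1 \<le> k"
  shows "((\<lambda>x. iter_log k (a x) / iter_log k (b x)) \<longlongrightarrow> 1) F"
  using assms(4)
proof (induction k rule: dec_induct)
  case base
  then show ?case using ln_ratio_tendsto_1[OF assms(1-3)] by (simp add: iter_log_Suc)
next
  case (step n)
  then show ?case using ln_ratio_tendsto_1[OF step.IH _ filterlim_iter_log[OF assms(3)]] by (simp add: iter_log_Suc)
qed

lemma eventually_iter_log_cmult_ge:
  assumes "0 < c" "\<theta> < 1" "1 \<le> k"
  shows "eventually (\<lambda>x. \<theta> * iter_log k x \<le> iter_log k (c * x)) at_top"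
proof -
  have "((\<lambda>x. c * x / x) \<longlongrightarrow> c) at_top"
    by real_asymp
  from iter_log_ratio_tendsto_1[OF this assms(1) filterlim_ident assms(3)]
  have "((\<lambda>x. iter_log k (c * x) / iter_log k x) \<longlongrightarrow> 1) at_top" .
  from order_tendstoD(1)[OF this assms(2)]
    filterlim_at_top_dense[THEN iffD1, OF filterlim_iter_log[OF filterlim_ident], rule_format, of 0 k]
  show ?thesis by eventually_elim (simp add: field_simps)
qed

lemma eventually_iter_log_affine_le:
  assumes "0 < c" "1 < \<theta>" "1 \<le> k"
  shows "eventually (\<lambda>x. iter_log k (c * x + d) \<le> \<theta> * iter_log k x) at_top"
proof -
  have "((\<lambda>x. (c * x + d) / x) \<longlongrightarrow> c) at_top" using assms(1) by real_asymp
  from iter_log_ratio_tendsto_1[OF this assms(1) filterlim_ident assms(3)]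
  have "((\<lambda>x. iter_log k (c * x + d) / iter_log k x) \<longlongrightarrow> 1) at_top" .
  from order_tendstoD(2)[OF this assms(2)]
    filterlim_at_top_dense[THEN iffD1, OF filterlim_iter_log[OF filterlim_ident], rule_format, of 0 k]
  show ?thesis by eventually_elim (simp add: field_simps)
qed

text \<open>Applying \<open>k\<close> logarithms to \<open>ln x\<close> gives the logarithm of
  \<open>iter_log k x\<close>, which is eventually below any fixed fraction of
  \<open>iter_log k x\<close>.\<close>

lemma eventually_iter_log_ln_less:
  assumes "0 < c" shows "eventually (\<lambda>x. C * iter_log k (ln x) < iter_log k (c * x)) at_top"
proof (cases k)
  case 0
  then show ?thesis using assms by simp real_asymp
next
  case (Suc j)
  have "eventually (\<lambda>y. C * ln y < y / 2) at_top" by real_asymp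
  from filterlim_iff[THEN iffD1, OF filterlim_iter_log[OF filterlim_ident], rule_format, OF this, of k]
  have "eventually (\<lambda>x. C * ln (iter_log k x) < iter_log k x / 2) at_top" .
  moreover have "eventually (\<lambda>x. 1 / 2 * iter_log k x \<le> iter_log k (c * x)) at_top"
    by (rule eventually_iter_log_cmult_ge[OF assms]) (use Suc in auto)
  ultimately show ?thesis
    by eventually_elim (simp flip: iter_log_Suc' add: iter_log_Suc)
qed

section \<open>From orders to inequalities at large radii\<close>

lemma le_Limsup_at_top:
  fixes Y :: "real \<Rightarrow> ereal"
  assumes "\<And>X. \<exists>r\<ge>X. c \<le> Y r" shows "c \<le> Limsup at_top Y"
proof (rule ccontr)
  assume "\<not> ?thesis"
  then have "eventually (\<lambda>r. Y r < c) at_top" by (intro Limsup_lessD) simp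
  then obtain X where "\<And>r. X \<le> r \<Longrightarrow> Y r < c" by (auto simp: eventually_at_top_linorder)
  then show False using assms[of X] by (meson not_less)
qed

lemma pq_order_bounds:
  assumes "pq_order p q f < ereal u" "ereal l < pq_lower_order p q f"
  obtains R0 where "\<And>r. R0 \<le> r \<Longrightarrow> l * iter_log q r \<le> iter_log (p - 1) (nevanlinna_T f r)
     \<and> iter_log (p - 1) (nevanlinna_T f r) \<le> u * iter_log q r"
proof -
  have "eventually (\<lambda>r. l * iter_log q r \<le> iter_log (p - 1) (nevanlinna_T f r)
     \<and> iter_log (p - 1) (nevanlinna_T f r) \<le> u * iter_log q r) at_top"
    using Limsup_lessD[OF assms(1)[unfolded pq_order_def]] less_LiminfD[OF assms(2)[unfolded pq_lower_order_def]]
      filterlim_at_top_dense[THEN iffD1, OF filterlim_iter_log[OF filterlim_ident], rule_format, of 0 q]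
    by eventually_elim (simp add: field_simps)
  then show ?thesis using that by (auto simp: eventually_at_top_linorder)
qed

lemma pq_order_1_infinite:
  assumes tr: "transcendental_meromorphic f" shows "pq_order 1 1 f = \<infinity>"
proof (rule ereal_top, rule ccontr)
  fix B assume "\<not> ereal B \<le> pq_order 1 1 f"
  then have "eventually (\<lambda>r. ereal (iter_log (1 - 1) (nevanlinna_T f r) / iter_log 1 r) < ereal B) at_top"
    unfolding pq_order_def by (intro Limsup_lessD) simp
  then have "eventually (\<lambda>r. nevanlinna_T f r \<le> B * ln r) at_top"
    using eventually_gt_at_top[of "1::real"] by eventually_elim (simp add: iter_log_Suc field_simps)
  then obtain X where X: "\<And>r. X \<le> r \<Longrightarrow> nevanlinna_T f r \<le> B * ln r" by (auto simp: eventually_at_top_linorder)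
  obtain R0 where R0: "\<And>R. R0 \<le> R \<Longrightarrow> good f R \<Longrightarrow> B * ln R < nevanlinna_T f R"
    by (rule transcendental_T_growth[OF tr, of B]) (rule that, assumption+)
  obtain r where r: "max 0 (max X R0) < r" "\<And>h. h \<in> {f} \<Longrightarrow> good h r"
    by (rule ex_good[of "{f}" "max 0 (max X R0)" "max 0 (max X R0) + 1"]) (use transcendental_nzmero[OF tr] in auto)
  have "good f r" using r(2) by simp
  then show False using X[of r] R0[of r] r(1) by force
qed

lemma transcendental_T_eventually_large:
  assumes "transcendental_meromorphic f"
  obtains R0 where "\<And>R. R0 \<le> R \<Longrightarrow> good f R \<Longrightarrow> Y \<le> nevanlinna_T f R"
proof -
  obtain R0 where R0: "\<And>R. R0 \<le> R \<Longrightarrow> good f R \<Longrightarrow> 1 * ln R < nevanlinna_T f R"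
    by (rule transcendental_T_growth[OF assms, of 1]) (rule that, assumption+)
  show ?thesis
  proof (rule that[of "max R0 (exp Y)"])
    fix R assume R: "max R0 (exp Y) \<le> R" "good f R"
    then have "Y \<le> ln R" by (simp add: ln_ge_iff good_pos)
    then show "Y \<le> nevanlinna_T f R" using R0[of R] R by simp
  qed
qed

section \<open>Comparison of \<open>f \<circ> g\<close> with \<open>F\<close>\<close>

text \<open>The calculus of \<open>dominated\<close> needs a majorant that is monotone at all radii.
  Therefore \<open>T(r, f)\<close> is replaced by the explicit function whose k-fold logarithm is
  \<open>u * iter_log q r\<close>.\<close>

lemma upper_growth_F:
  assumes tr: "transcendental_meromorphic f" and q: "1 \<le> q" and k: "1 \<le> k"
    and Q: "diff_polynomial_in f Q" "\<not> eventually (\<lambda>z. Q z = 0) (cosparse UNIV)" and \<alpha>: "1 \<le> \<alpha>"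
    and u: "0 < u" "u < u'" and up: "\<And>r. R0 \<le> r \<Longrightarrow> iter_log k (nevanlinna_T f r) \<le> u * iter_log q r"
  obtains S0 B where "countable B" "\<And>S. S0 \<le> S \<Longrightarrow> S \<notin> B \<Longrightarrow>
    0 < iter_log k (nevanlinna_T (\<lambda>z. f z ^ \<alpha> * Q z) S) \<and>
    iter_log k (nevanlinna_T (\<lambda>z. f z ^ \<alpha> * Q z) S) \<le> u' * iter_log q S"
proof -
  let ?F = "\<lambda>z. f z ^ \<alpha> * Q z"
  note f = transcendental_nzmero[OF tr]
  define \<Phi> where "\<Phi> x = iter_exp k (u * iter_log q x)" for x
  have mono: "\<Phi> x \<le> \<Phi> y" if "iter_exp q 0 \<le> x" "x \<le> y" for x y
    unfolding \<Phi>_def by (intro iter_exp_mono mult_left_mono iter_log_mono that) (use u in simp)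
  have nn: "0 \<le> \<Phi> x" if "iter_exp q 0 \<le> x" for x
    unfolding \<Phi>_def using k by (cases k) auto
  obtain R1 where R1: "\<And>R. R1 \<le> R \<Longrightarrow> good f R \<Longrightarrow> iter_exp k 0 \<le> nevanlinna_T f R"
    by (rule transcendental_T_eventually_large[OF tr, of "iter_exp k 0"]) (rule that, assumption+)
  have "dominated \<Phi> f"
  proof (rule dominatedI[of _ 1 1 "{r. 0 < r \<and> \<not> good f r}" "max 1 (max R0 R1)"])
    fix r assume "max 1 (max R0 R1) \<le> r" "r \<notin> {r. 0 < r \<and> \<not> good f r}"
    then have r: "R0 \<le> r" "R1 \<le> r" "good f r" by auto
    have "nevanlinna_T f r \<le> \<Phi> r" unfolding \<Phi>_def by (rule le_iter_exp[OF R1[OF r(2,3)] up[OF r(1)]])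
    then show "reg f r \<and> nevanlinna_T f r \<le> 1 * \<Phi> (1 * r) + 1" using good_imp_reg[OF r(3)] by simp
  qed (use nzmero_meromorphic[OF f] countable_bad[OF f] in auto)
  then have dom: "dominated \<Phi> ?F"
    by (intro dominated_mult[OF mono nn] dominated_power[OF mono nn] dominated_diff_polynomial[OF mono nn _ Q(1)])
  then obtain C K r1 B1 where C: "0 \<le> C" "1 \<le> K" "countable B1" and
    TF: "\<And>r. r1 \<le> r \<Longrightarrow> r \<notin> B1 \<Longrightarrow> nevanlinna_T ?F r \<le> C * \<Phi> (K * r) + C"
    unfolding dominated_def by blast
  obtain C' R2 B2 where B2: "countable B2" "\<And>R. R2 \<le> R \<Longrightarrow> R \<notin> B2 \<Longrightarrow> reg ?F R \<and> ln R - C' \<le> nevanlinna_T ?F R"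
    by (rule T_lower_nonconstant[of ?F])
       (use dom power_times_diff_polynomial_nonconstant[OF tr Q \<alpha>] in \<open>auto simp: dominated_def\<close>)
  \<comment> \<open>One factor \<open>\<theta>\<close> absorbs the constants around
    \<open>\<Phi>\<close>, the other the factor \<open>K\<close> in its argument.\<close>
  define \<theta> where "\<theta> = sqrt (u' / u)"
  have \<theta>: "1 < \<theta>" "\<theta> * \<theta> * u = u'" using u by (auto simp: \<theta>_def)
  have lq: "filterlim (\<lambda>x. iter_log q (K * x)) at_top at_top"
    by (rule filterlim_iter_log) (use C in real_asymp)
  have "filterlim (\<lambda>x. u * iter_log q (K * x)) at_top at_top"
    by (rule filterlim_tendsto_pos_mult_at_top[OF tendsto_const u(1) lq])
  then have "filterlim (\<lambda>x. \<Phi> (K * x)) at_top at_top"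
    unfolding \<Phi>_def
    by (rule filterlim_compose[rotated]) (induction k, auto intro: filterlim_compose[OF exp_at_top] filterlim_ident)
  from filterlim_iff[THEN iffD1, OF this, rule_format, OF eventually_iter_log_affine_le[of "C + 1" \<theta> k C]]
  have e1: "eventually (\<lambda>x. iter_log k ((C + 1) * \<Phi> (K * x) + C) \<le> \<theta> * iter_log k (\<Phi> (K * x))) at_top"
    using C \<theta> k by simp
  have e2: "eventually (\<lambda>x. iter_log q (K * x + 0) \<le> \<theta> * iter_log q x) at_top"
    by (rule eventually_iter_log_affine_le) (use C \<theta> q in auto)
  have e3: "eventually (\<lambda>x. iter_exp k 1 \<le> ln x - C') at_top" by real_asymp
  have e4: "eventually (\<lambda>x. iter_exp q 0 \<le> K * x) at_top" using C by real_asymp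
  have "eventually (\<lambda>S. S \<notin> B1 \<union> B2 \<longrightarrow> 0 < iter_log k (nevanlinna_T ?F S) \<and> iter_log k (nevanlinna_T ?F S) \<le> u' * iter_log q S) at_top"
    using e1 e2 e3 e4 eventually_ge_at_top[of r1] eventually_ge_at_top[of R2]
  proof eventually_elim
    case (elim S)
    show ?case
    proof (intro impI)
      assume S: "S \<notin> B1 \<union> B2"
      have lo: "iter_exp k 1 \<le> nevanlinna_T ?F S" using B2(2)[of S] elim S by auto
      then have lo0: "iter_exp k 0 \<le> nevanlinna_T ?F S" using iter_exp_mono[of 0 1 k] by simp
      \<comment> \<open>\<open>C\<close> may be 0, whereas the comparison of logarithms asks for a
        positive factor.\<close>
      have "nevanlinna_T ?F S \<le> (C + 1) * \<Phi> (K * S) + C" using TF[of S] nn[of "K * S"] elim S by (simp add: distrib_right)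
      then have "iter_log k (nevanlinna_T ?F S) \<le> iter_log k ((C + 1) * \<Phi> (K * S) + C)" by (rule iter_log_mono[OF lo0])
      also have "\<dots> \<le> \<theta> * (u * iter_log q (K * S))" using elim by (simp add: \<Phi>_def)
      also have "\<dots> \<le> \<theta> * (u * (\<theta> * iter_log q S))" by (intro mult_left_mono) (use elim \<theta> u in auto)
      also have "\<dots> = u' * iter_log q S" using \<theta>(2) by (simp add: mult_ac)
      finally show "0 < iter_log k (nevanlinna_T ?F S) \<and> iter_log k (nevanlinna_T ?F S) \<le> u' * iter_log q S"
        using le_iter_log[OF lo] by simp
    qed
  qed
  then obtain S0 where S0: "\<And>S. S0 \<le> S \<Longrightarrow> S \<notin> B1 \<union> B2 \<Longrightarrow>
    0 < iter_log k (nevanlinna_T ?F S) \<and> iter_log k (nevanlinna_T ?F S) \<le> u' * iter_log q S"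
    by (auto simp: eventually_at_top_linorder)
  show ?thesis by (rule that[of "B1 \<union> B2" S0]) (use C(3) B2(1) in blast, rule S0)
qed

text \<open>Supplies the hypothesis \<open>slow\<close> of \<open>compose_T_lower\<close>. At radii
  between \<open>R / 8\<close> and \<open>R\<close> the order bounds determine the iterated
  logarithm of \<open>T\<close> up to a constant factor, and this is far less than the gap between
  \<open>T(t, f)\<close> and its logarithm.\<close>

lemma slow_growth_on_scale:
  assumes tr: "transcendental_meromorphic f" and q: "1 \<le> q" and l: "0 < l" and u: "0 < u"
    and up: "\<And>r. R0 \<le> r \<Longrightarrow> iter_log (Suc j) (nevanlinna_T f r) \<le> u * iter_log q r"
    and low: "\<And>r. R0 \<le> r \<Longrightarrow> l * iter_log q r \<le> iter_log (Suc j) (nevanlinna_T f r)"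
  obtains R1 where "\<And>R t \<rho>. R1 \<le> R \<Longrightarrow> R / 8 \<le> t \<Longrightarrow> t \<le> R \<Longrightarrow> R / 8 \<le> \<rho> \<Longrightarrow> \<rho> \<le> R \<Longrightarrow> good f t \<Longrightarrow> good f \<rho>
        \<Longrightarrow> ln (nevanlinna_T f \<rho>) \<le> nevanlinna_T f t / 16"
proof -
  define C where "C = 2 * u / l"
  have C0: "0 < C" using l u by (simp add: C_def)
  have "eventually (\<lambda>y. C * iter_log j (ln y) < iter_log j (1 / 16 * y)) at_top"
    by (rule eventually_iter_log_ln_less) simp
  then obtain Y where Y: "\<And>y. Y \<le> y \<Longrightarrow> C * iter_log j (ln y) < iter_log j (1 / 16 * y)"
    by (auto simp: eventually_at_top_linorder)
  obtain R2 where R2: "\<And>R. R2 \<le> R \<Longrightarrow> good f R \<Longrightarrow> max Y (16 * iter_exp j 0) \<le> nevanlinna_T f R"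
    by (rule transcendental_T_eventually_large[OF tr, of "max Y (16 * iter_exp j 0)"]) (rule that, assumption+)
  have "eventually (\<lambda>R. 1 / 2 * iter_log q R \<le> iter_log q (1 / 8 * R)) at_top"
    by (rule eventually_iter_log_cmult_ge) (use q in auto)
  then obtain R3 where R3: "\<And>R. R3 \<le> R \<Longrightarrow> 1 / 2 * iter_log q R \<le> iter_log q (1 / 8 * R)"
    by (auto simp: eventually_at_top_linorder)
  show ?thesis
  proof (rule that[of "max (8 * iter_exp q 0) (max R3 (max (8 * R0) (8 * R2)))"])
    fix R t \<rho> assume R: "max (8 * iter_exp q 0) (max R3 (max (8 * R0) (8 * R2))) \<le> R"
      and t: "R / 8 \<le> t" "t \<le> R" "R / 8 \<le> \<rho>" "\<rho> \<le> R" "good f t" "good f \<rho>"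
    let ?a = "nevanlinna_T f \<rho>" and ?b = "nevanlinna_T f t"
    have rad: "R0 \<le> t" "R0 \<le> \<rho>" "R2 \<le> t" "iter_exp q 0 \<le> \<rho>" "iter_exp q 0 \<le> R / 8" "R3 \<le> R" using R t by auto
    have b: "Y \<le> ?b" "iter_exp j 0 \<le> 1 / 16 * ?b" using R2[OF rad(3) t(5)] by auto
    show "ln ?a \<le> ?b / 16"
    proof (rule ccontr)
      assume "\<not> ?thesis"
      then have "1 / 16 * ?b \<le> ln ?a" by simp
      then have "iter_log j (1 / 16 * ?b) \<le> iter_log (Suc j) ?a"
        unfolding iter_log_Suc' by (rule iter_log_mono[OF b(2)])
      also have "\<dots> \<le> u * iter_log q \<rho>" by (rule up[OF rad(2)])
      also have "\<dots> \<le> u * iter_log q R" by (intro mult_left_mono iter_log_mono rad t) (use u in simp)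
      also have "\<dots> \<le> u * (2 * iter_log q (1 / 8 * R))" using R3[OF rad(6)] u by (intro mult_left_mono) auto
      also have "\<dots> \<le> u * (2 * iter_log q t)" using rad t u by (intro mult_left_mono iter_log_mono) auto
      also have "\<dots> = C * (l * iter_log q t)" using l by (simp add: C_def)
      also have "\<dots> \<le> C * iter_log (Suc j) ?b" using low[OF rad(1)] C0 by (intro mult_left_mono) auto
      also have "\<dots> < iter_log j (1 / 16 * ?b)" unfolding iter_log_Suc' by (rule Y[OF b(1)])
      finally show False by simp
    qed
  qed
qed

lemma lower_growth_compose:
  assumes tr: "transcendental_meromorphic f" and q: "1 \<le> q" and k: "1 \<le> k"
    and g: "g holomorphic_on UNIV" and \<beta>: "0 < \<beta>" "ereal \<beta> < entire_order g"
    and l: "0 < l'" "l' < l" and u: "0 < u"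
    and up: "\<And>r. R0 \<le> r \<Longrightarrow> iter_log k (nevanlinna_T f r) \<le> u * iter_log q r"
    and low: "\<And>r. R0 \<le> r \<Longrightarrow> l * iter_log q r \<le> iter_log k (nevanlinna_T f r)"
  shows "\<exists>b\<ge>X. \<forall>r\<ge>b. good (f \<circ> g) r \<longrightarrow> good (\<lambda>z. (f \<circ> g) z - 1) r \<longrightarrow>
    l' * iter_log q (exp (b powr \<beta>)) \<le> iter_log k (nevanlinna_T (f \<circ> g) r)"
proof -
  obtain j where j: "k = Suc j" using k by (cases k) auto
  obtain R1 where R1: "\<And>R t \<rho>. R1 \<le> R \<Longrightarrow> R / 8 \<le> t \<Longrightarrow> t \<le> R \<Longrightarrow> R / 8 \<le> \<rho> \<Longrightarrow> \<rho> \<le> R \<Longrightarrow> good f t \<Longrightarrow> good f \<rho>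
        \<Longrightarrow> ln (nevanlinna_T f \<rho>) \<le> nevanlinna_T f t / 16"
    by (rule slow_growth_on_scale[OF tr q _ u up[unfolded j] low[unfolded j]])
       (use l in simp, assumption+, rule that, assumption+)
  \<comment> \<open>One factor \<open>\<theta>\<close> absorbs the 1/6 in front of
    \<open>T(t, f)\<close>, the other the 1/8 in the radius.\<close>
  define \<theta> where "\<theta> = sqrt (l' / l)"
  have \<theta>: "0 < \<theta>" "\<theta> < 1" "\<theta> * \<theta> * l = l'" using l by (auto simp: \<theta>_def)
  have "eventually (\<lambda>y. \<theta> * iter_log k y \<le> iter_log k (1 / 6 * y)) at_top"
    by (rule eventually_iter_log_cmult_ge) (use \<theta> k in auto)
  then obtain Y where Y: "\<And>y. Y \<le> y \<Longrightarrow> \<theta> * iter_log k y \<le> iter_log k (1 / 6 * y)"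
    by (auto simp: eventually_at_top_linorder)
  obtain R2 where R2: "\<And>R. R2 \<le> R \<Longrightarrow> good f R \<Longrightarrow> max Y (6 * iter_exp k 0) \<le> nevanlinna_T f R"
    by (rule transcendental_T_eventually_large[OF tr, of "max Y (6 * iter_exp k 0)"]) (rule that, assumption+)
  have "eventually (\<lambda>R. \<theta> * iter_log q R \<le> iter_log q (1 / 8 * R)) at_top"
    by (rule eventually_iter_log_cmult_ge) (use \<theta> q in auto)
  then obtain R3 where R3: "\<And>R. R3 \<le> R \<Longrightarrow> \<theta> * iter_log q R \<le> iter_log q (1 / 8 * R)"
    by (auto simp: eventually_at_top_linorder)
  define M where "M = max (8 * iter_exp q 0) (max R3 (max (8 * R0) (8 * R2)))"
  have "eventually (\<lambda>b. M \<le> exp (b powr \<beta>)) at_top" using \<beta>(1) by real_asymp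
  then obtain X1 where X1: "\<And>b. X1 \<le> b \<Longrightarrow> M \<le> exp (b powr \<beta>)" by (auto simp: eventually_at_top_linorder)
  have "\<exists>b\<ge>max X X1. \<exists>t\<ge>exp (b powr \<beta>) / 8. good f t \<and> (\<forall>r\<ge>b. good (f \<circ> g) r \<longrightarrow> good (\<lambda>z. (f \<circ> g) z - 1) r
      \<longrightarrow> nevanlinna_T f t \<le> 6 * nevanlinna_T (f \<circ> g) r)"
    by (rule compose_T_lower[OF tr g \<beta>]) (rule R1, assumption+)
  then obtain b t where b: "max X X1 \<le> b" and t: "exp (b powr \<beta>) / 8 \<le> t" "good f t"
    and H: "\<forall>r\<ge>b. good (f \<circ> g) r \<longrightarrow> good (\<lambda>z. (f \<circ> g) z - 1) r \<longrightarrow> nevanlinna_T f t \<le> 6 * nevanlinna_T (f \<circ> g) r"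
    by blast
  define R where "R = exp (b powr \<beta>)"
  have "M \<le> R" using X1[of b] b by (simp add: R_def)
  then have rad: "iter_exp q 0 \<le> 1 / 8 * R" "R3 \<le> R" "R0 \<le> t" "R2 \<le> t" "1 / 8 * R \<le> t"
    using t by (auto simp: M_def R_def)
  have Tt: "Y \<le> nevanlinna_T f t" "iter_exp k 0 \<le> 1 / 6 * nevanlinna_T f t" using R2[OF rad(4) t(2)] by auto
  have "l' * iter_log q R = \<theta> * (l * (\<theta> * iter_log q R))" using \<theta>(3) by (simp add: mult_ac)
  also have "\<dots> \<le> \<theta> * (l * iter_log q (1 / 8 * R))" using R3[OF rad(2)] \<theta> l by (intro mult_left_mono) auto
  also have "\<dots> \<le> \<theta> * (l * iter_log q t)" using rad \<theta> l by (intro mult_left_mono iter_log_mono) auto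
  also have "\<dots> \<le> \<theta> * iter_log k (nevanlinna_T f t)" using low[OF rad(3)] \<theta> by (intro mult_left_mono) auto
  also have "\<dots> \<le> iter_log k (1 / 6 * nevanlinna_T f t)" by (rule Y[OF Tt(1)])
  finally have fin: "l' * iter_log q R \<le> iter_log k (1 / 6 * nevanlinna_T f t)" .
  show ?thesis
  proof (rule exI[of _ b], rule conjI, use b in simp, intro allI impI)
    fix r assume r: "b \<le> r" "good (f \<circ> g) r" "good (\<lambda>z. (f \<circ> g) z - 1) r"
    have "1 / 6 * nevanlinna_T f t \<le> nevanlinna_T (f \<circ> g) r" using H[rule_format, OF r] by linarith
    from iter_log_mono[OF Tt(2) this] fin
    show "l' * iter_log q (exp (b powr \<beta>)) \<le> iter_log k (nevanlinna_T (f \<circ> g) r)" by (simp add: R_def)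
  qed
qed

text \<open>The bound is an explicit quotient of iterated logarithms of powers of \<open>r\<close>,
  so that the three cases of the final theorem differ only in the limit of this quotient.\<close>

lemma growth_ratio_frequently:
  assumes tr: "transcendental_meromorphic f" and q: "1 \<le> q" and k: "1 \<le> k"
    and g: "g holomorphic_on UNIV" and \<beta>: "0 < \<mu>" "\<mu> < \<beta>" "ereal \<beta> < entire_order g"
    and Q: "diff_polynomial_in f Q" "\<not> eventually (\<lambda>z. Q z = 0) (cosparse UNIV)" and \<alpha>: "1 \<le> \<alpha>"
    and l: "0 < l'" "l' < l" and u: "0 < u" "u < u'"
    and up: "\<And>r. R0 \<le> r \<Longrightarrow> iter_log k (nevanlinna_T f r) \<le> u * iter_log q r"
    and low: "\<And>r. R0 \<le> r \<Longrightarrow> l * iter_log q r \<le> iter_log k (nevanlinna_T f r)"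
  shows "\<exists>r\<ge>X. l' / u' * (iter_log (q - 1) (r powr \<beta>) / iter_log (q - 1) (r powr \<mu>))
    \<le> iter_log k (nevanlinna_T (f \<circ> g) r) / iter_log k (nevanlinna_T (\<lambda>z. f z ^ \<alpha> * Q z) (exp (r powr \<mu>)))"
proof -
  let ?F = "\<lambda>z. f z ^ \<alpha> * Q z"
  \<comment> \<open>The numerator is bounded in terms of \<open>b\<close>, while \<open>r\<close> is
    picked afterwards in \<open>(b, b + 1)\<close>; the spare exponent covers
    \<open>(b + 1) powr \<beta> \<le> b powr \<beta>'\<close>.\<close>
  obtain \<beta>' where \<beta>': "\<beta> < \<beta>'" "ereal \<beta>' < entire_order g"
    using ereal_dense2[OF \<beta>(3)] by auto
  have \<beta>0: "0 < \<beta>" "0 < \<beta>'" using \<beta> \<beta>' by auto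
  obtain S0 B where B: "countable B" and S0: "\<And>S. S0 \<le> S \<Longrightarrow> S \<notin> B \<Longrightarrow>
      0 < iter_log k (nevanlinna_T ?F S) \<and> iter_log k (nevanlinna_T ?F S) \<le> u' * iter_log q S"
    by (rule upper_growth_F[OF tr q k Q \<alpha> u up]) (assumption, rule that, assumption+)
  have gc: "\<not> g constant_on UNIV" by (rule entire_order_growth(1)[OF g \<beta>0(1) \<beta>(3)])
  have fg: "nzmero (f \<circ> g)" by (rule compose_nzmero[OF transcendental_nzmero[OF tr] g gc])
  have fg1: "nzmero (\<lambda>z. (f \<circ> g) z - 1)"
    using compose_nzmero[OF transcendental_minus_nzmero[OF tr, of 1] g gc] by (simp add: compose_minus_one)
  \<comment> \<open>The exceptional set of \<open>F\<close> pulled back to \<open>r\<close>; the map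
    is injective on positive radii, so \<open>E\<close> is countable.\<close>
  define E where "E = {r. 0 < r \<and> exp (r powr \<mu>) \<in> B}"
  have E: "countable E"
  proof (rule countable_image_inj_on)
    show "countable ((\<lambda>r. exp (r powr \<mu>)) ` E)" by (rule countable_subset[OF _ B]) (auto simp: E_def)
    show "inj_on (\<lambda>r. exp (r powr \<mu>)) E"
    proof (rule inj_onI)
      fix x y assume "x \<in> E" "y \<in> E" "exp (x powr \<mu>) = exp (y powr \<mu>)"
      then have "0 < x" "0 < y" "x powr \<mu> = y powr \<mu>" by (auto simp: E_def)
      then have "(x powr \<mu>) powr (1 / \<mu>) = (y powr \<mu>) powr (1 / \<mu>)" by simp
      then show "x = y" using \<open>0 < x\<close> \<open>0 < y\<close> \<beta>(1) by (simp add: powr_powr)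
    qed
  qed
  let ?bad = "{r. 0 < r \<and> \<not> good (f \<circ> g) r} \<union> {r. 0 < r \<and> \<not> good (\<lambda>z. (f \<circ> g) z - 1) r} \<union> E"
  have bad: "countable ?bad" using countable_bad[OF fg] countable_bad[OF fg1] E by blast
  \<comment> \<open>With \<open>iter_exp q 1\<close> instead of \<open>iter_exp q 0\<close> the
    q-fold logarithm is at least 1, hence a positive denominator.\<close>
  have ev: "eventually (\<lambda>b. S0 \<le> exp (b powr \<mu>) \<and> (b + 1) powr \<beta> \<le> b powr \<beta>' \<and> iter_exp q 1 \<le> exp (b powr \<mu>)) at_top"
    by (intro eventually_conj) (use \<beta> \<beta>' \<beta>0 in real_asymp)+
  then obtain X1 where X1: "\<And>b. X1 \<le> b \<Longrightarrow> S0 \<le> exp (b powr \<mu>) \<and> (b + 1) powr \<beta> \<le> b powr \<beta>' \<and> iter_exp q 1 \<le> exp (b powr \<mu>)"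
    by (auto simp: eventually_at_top_linorder)
  have "\<exists>b\<ge>max 1 (max X X1). \<forall>r\<ge>b. good (f \<circ> g) r \<longrightarrow> good (\<lambda>z. (f \<circ> g) z - 1) r \<longrightarrow>
    l' * iter_log q (exp (b powr \<beta>')) \<le> iter_log k (nevanlinna_T (f \<circ> g) r)"
    by (rule lower_growth_compose[OF tr q k g \<beta>0(2) \<beta>'(2) l u(1) up low]) assumption+
  then obtain b where b: "max 1 (max X X1) \<le> b" and H: "\<forall>r\<ge>b. good (f \<circ> g) r \<longrightarrow> good (\<lambda>z. (f \<circ> g) z - 1) r \<longrightarrow>
    l' * iter_log q (exp (b powr \<beta>')) \<le> iter_log k (nevanlinna_T (f \<circ> g) r)"
    by blast
  have "\<not> {b<..<b + 1} \<subseteq> ?bad" using countable_subset[OF _ bad] uncountable_open_interval[of b "b + 1"] by force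
  then obtain r where "r \<in> {b<..<b + 1}" and "r \<notin> ?bad" unfolding subset_iff by blast
  then have r: "b < r" "r < b + 1" "r \<notin> ?bad" by (simp, simp, blast)
  have r0: "0 < r" "1 \<le> b" using r b by auto
  have gd: "good (f \<circ> g) r" "good (\<lambda>z. (f \<circ> g) z - 1) r" "exp (r powr \<mu>) \<notin> B" using r(3) r0 by (auto simp: E_def)
  have rX: "S0 \<le> exp (r powr \<mu>)" "iter_exp q 1 \<le> exp (r powr \<mu>)" using X1[of r] r b by auto
  have pq: "iter_log q (exp x) = iter_log (q - 1) x" for x
    using q by (cases q) (auto simp: iter_log_Suc')
  have le: "r powr \<mu> \<le> r powr \<beta>" using \<beta> r0 r by (intro powr_mono) auto
  have "r powr \<beta> \<le> (b + 1) powr \<beta>" using r r0 \<beta>0 by (intro powr_mono2) auto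
  also have "\<dots> \<le> b powr \<beta>'" using X1[of b] b by auto
  finally have rb: "exp (r powr \<beta>) \<le> exp (b powr \<beta>')" by simp
  have q0: "iter_exp q 0 \<le> exp (r powr \<mu>)" using rX(2) iter_exp_mono[of 0 1 q] by simp
  then have q0': "iter_exp q 0 \<le> exp (r powr \<beta>)" using order_trans[of _ "exp (r powr \<mu>)" "exp (r powr \<beta>)"] le by simp
  have "0 < iter_log q (exp (r powr \<mu>))" using le_iter_log[OF rX(2)] by simp
  then have den: "0 < iter_log (q - 1) (r powr \<mu>)" by (simp only: pq)
  have "iter_log q (exp (r powr \<mu>)) \<le> iter_log q (exp (r powr \<beta>))" by (rule iter_log_mono[OF q0]) (use le in simp)
  then have num: "0 < iter_log (q - 1) (r powr \<beta>)" using den by (simp only: pq)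
  have "l' * iter_log q (exp (r powr \<beta>)) \<le> l' * iter_log q (exp (b powr \<beta>'))"
    by (intro mult_left_mono iter_log_mono[OF q0' rb]) (use l in simp)
  also have "\<dots> \<le> iter_log k (nevanlinna_T (f \<circ> g) r)" using H gd r by simp
  finally have n: "l' * iter_log (q - 1) (r powr \<beta>) \<le> iter_log k (nevanlinna_T (f \<circ> g) r)" by (simp only: pq)
  have d: "0 < iter_log k (nevanlinna_T ?F (exp (r powr \<mu>)))"
    "iter_log k (nevanlinna_T ?F (exp (r powr \<mu>))) \<le> u' * iter_log (q - 1) (r powr \<mu>)"
    using S0[OF rX(1) gd(3)] by (simp_all only: pq)
  have "(l' * iter_log (q - 1) (r powr \<beta>)) / (u' * iter_log (q - 1) (r powr \<mu>))
     \<le> iter_log k (nevanlinna_T (f \<circ> g) r) / iter_log k (nevanlinna_T ?F (exp (r powr \<mu>)))"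
    by (rule frac_le[OF order_trans[OF mult_nonneg_nonneg n] n d]) (use num l in auto)
  then show ?thesis using r b by (intro exI[of _ r]) auto
qed

theorem theorem3:
  fixes f g Q F :: "complex \<Rightarrow> complex" and p q \<alpha> :: nat and \<mu> \<beta> :: real
  assumes "g holomorphic_on UNIV"
    and "transcendental_meromorphic f"
    and "1 \<le> q" and "q \<le> p"
    and "0 < pq_lower_order p q f" and "pq_lower_order p q f \<le> pq_order p q f"
    and "pq_order p q f < \<infinity>"
    and "diff_polynomial_in f Q"
    and "\<not> (\<forall>\<^sub>F z in cosparse UNIV. Q z = 0)"
    and "1 \<le> \<alpha>"
    and "F = (\<lambda>z. f z ^ \<alpha> * Q z)"
    and "0 < \<mu>" and "\<mu> < \<beta>" and "ereal \<beta> < entire_order g"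
  shows "(q = 1 \<longrightarrow>
            Limsup at_top (\<lambda>r. ereal (iter_log (p - 1) (nevanlinna_T (f \<circ> g) r)
              / iter_log (p - 1) (nevanlinna_T F (exp (r powr \<mu>))))) = \<infinity>)
       \<and> (q = 2 \<longrightarrow>
            Limsup at_top (\<lambda>r. ereal (iter_log (p - 1) (nevanlinna_T (f \<circ> g) r)
              / iter_log (p - 1) (nevanlinna_T F (exp (r powr \<mu>)))))
            \<ge> (ereal \<beta> * pq_lower_order p q f) / (ereal \<mu> * pq_order p q f))
       \<and> (q > 2 \<longrightarrow>
            Limsup at_top (\<lambda>r. ereal (iter_log (p - 1) (nevanlinna_T (f \<circ> g) r)
              / iter_log (p - 1) (nevanlinna_T F (exp (r powr \<mu>)))))
            \<ge> pq_lower_order p q f / pq_order p q f)"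
proof -
  note g = assms(1) and tr = assms(2) and ord = assms(5-7) and \<mu> = assms(12) and \<mu>\<beta> = assms(13)
  let ?r = "\<lambda>r. iter_log (p - 1) (nevanlinna_T (f \<circ> g) r) / iter_log (p - 1) (nevanlinna_T F (exp (r powr \<mu>)))"
  let ?h = "\<lambda>r. iter_log (q - 1) (r powr \<beta>) / iter_log (q - 1) (r powr \<mu>)"
  obtain l u where l: "pq_lower_order p q f = ereal l" and u: "pq_order p q f = ereal u"
    using ord by (cases "pq_lower_order p q f"; cases "pq_order p q f") auto
  have lu: "0 < l" "0 < u" using ord unfolding l u by auto
  have p: "1 \<le> p - 1"
  proof (rule ccontr)
    assume "\<not> 1 \<le> p - 1"
    then have "p = 1" "q = 1" using assms(3,4) by auto
    then show False using pq_order_1_infinite[OF tr] ord(3) by simp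
  qed
  \<comment> \<open>Half of the gap between \<open>l1\<close> and \<open>l\<close>, and between
    \<open>u\<close> and \<open>u1\<close>, is spent on bounding \<open>T(r, f)\<close> by its
    orders, the other half on the constants lost later.\<close>
  have main: "\<exists>r\<ge>X. l1 / u1 * ?h r \<le> ?r r" if lu1: "0 < l1" "l1 < l" "u < u1" for l1 u1 X
  proof -
    have b: "pq_order p q f < ereal ((u + u1) / 2)" "ereal ((l1 + l) / 2) < pq_lower_order p q f"
      using lu1 by (simp_all add: l u)
    obtain R0 where R0: "\<And>r. R0 \<le> r \<Longrightarrow> (l1 + l) / 2 * iter_log q r \<le> iter_log (p - 1) (nevanlinna_T f r)
       \<and> iter_log (p - 1) (nevanlinna_T f r) \<le> (u + u1) / 2 * iter_log q r"
      by (rule pq_order_bounds[OF b]) (rule that, assumption)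
    show ?thesis unfolding assms(11)
      by (rule growth_ratio_frequently[OF tr assms(3) p g \<mu> \<mu>\<beta> assms(14,8,9,10),
            where l = "(l1 + l) / 2" and u = "(u + u1) / 2" and ?R0.0 = R0])
         (use lu1 lu R0 in auto)
  qed
  \<comment> \<open>With \<open>l - s\<close> and \<open>u + s\<close> in place of \<open>l\<close>
    and \<open>u\<close> the bound holds for each small \<open>s > 0\<close>; every number below the
    claimed bound is reached by some such \<open>s\<close>.\<close>
  have lim: "ereal (l / u * H) \<le> Limsup at_top (\<lambda>r. ereal (?r r))" if H: "(?h \<longlongrightarrow> H) at_top" for H
  proof (rule dense_le)
    fix y assume y: "y < ereal (l / u * H)"
    have "((\<lambda>s. (l - s) / (u + s) * H) \<longlongrightarrow> (l - 0) / (u + 0) * H) (at_right 0)"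
      by (intro tendsto_intros) (use lu in auto)
    then have "((\<lambda>s. ereal ((l - s) / (u + s) * H)) \<longlongrightarrow> ereal (l / u * H)) (at_right 0)" by simp
    then have "eventually (\<lambda>s. y < ereal ((l - s) / (u + s) * H)) (at_right 0)" using y by (rule order_tendstoD)
    moreover have "eventually (\<lambda>s. s \<in> {0<..<l}) (at_right 0)" by (rule eventually_at_right_real[OF lu(1)])
    ultimately have "eventually (\<lambda>s. y < ereal ((l - s) / (u + s) * H) \<and> s \<in> {0<..<l}) (at_right 0)"
      by (rule eventually_conj)
    from eventually_happens'[OF _ this] obtain s where s: "y < ereal ((l - s) / (u + s) * H)" "0 < s" "s < l" by auto
    have "((\<lambda>r. ereal ((l - s) / (u + s) * ?h r)) \<longlongrightarrow> ereal ((l - s) / (u + s) * H)) at_top"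
      by (intro tendsto_intros H)
    then have "eventually (\<lambda>r. y < ereal ((l - s) / (u + s) * ?h r)) at_top" using s(1) by (rule order_tendstoD)
    then obtain X0 where X0: "\<And>r. X0 \<le> r \<Longrightarrow> y < ereal ((l - s) / (u + s) * ?h r)" by (auto simp: eventually_at_top_linorder)
    show "y \<le> Limsup at_top (\<lambda>r. ereal (?r r))"
    proof (rule le_Limsup_at_top)
      fix X
      obtain r where r: "max X X0 \<le> r" "(l - s) / (u + s) * ?h r \<le> ?r r" using main[of "l - s" "u + s" "max X X0"] s by auto
      have "y \<le> ereal ((l - s) / (u + s) * ?h r)" using X0[of r] r(1) by simp
      also have "\<dots> \<le> ereal (?r r)" using r(2) by simp
      finally show "\<exists>r\<ge>X. y \<le> ereal (?r r)" using r(1) by (intro exI[of _ r]) simp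
    qed
  qed
  have inf: "Limsup at_top (\<lambda>r. ereal (?r r)) = \<infinity>" if H: "filterlim ?h at_top at_top"
  proof (rule ereal_top)
    fix c
    have "filterlim (\<lambda>r. (l / 2) / (u + 1) * ?h r) at_top at_top"
      by (rule filterlim_tendsto_pos_mult_at_top[OF tendsto_const _ H]) (use lu in simp)
    then have "eventually (\<lambda>r. c \<le> (l / 2) / (u + 1) * ?h r) at_top" by (simp add: filterlim_at_top)
    then obtain X0 where X0: "\<And>r. X0 \<le> r \<Longrightarrow> c \<le> (l / 2) / (u + 1) * ?h r" by (auto simp: eventually_at_top_linorder)
    show "ereal c \<le> Limsup at_top (\<lambda>r. ereal (?r r))"
    proof (rule le_Limsup_at_top)
      fix X
      obtain r where "max X X0 \<le> r" "(l / 2) / (u + 1) * ?h r \<le> ?r r" using main[of "l / 2" "u + 1" "max X X0"] lu by auto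
      then show "\<exists>r\<ge>X. ereal c \<le> ereal (?r r)" using X0[of r] by (intro exI[of _ r]) simp
    qed
  qed
  show ?thesis
  proof (intro conjI impI)
    assume q: "q = 1"
    have "filterlim (\<lambda>r. r powr \<beta> / r powr \<mu>) at_top at_top" using \<mu> \<mu>\<beta> by real_asymp
    then show "Limsup at_top (\<lambda>r. ereal (?r r)) = \<infinity>" by (intro inf) (simp add: q)
  next
    assume q: "q = 2"
    have "((\<lambda>r. ln (r powr \<beta>) / ln (r powr \<mu>)) \<longlongrightarrow> \<beta> / \<mu>) at_top" using \<mu> \<mu>\<beta> unfolding divide_inverse[of \<beta> \<mu>] by real_asymp
    then have "ereal (l / u * (\<beta> / \<mu>)) \<le> Limsup at_top (\<lambda>r. ereal (?r r))" by (intro lim) (simp add: q iter_log_Suc)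
    then show "(ereal \<beta> * pq_lower_order p q f) / (ereal \<mu> * pq_order p q f) \<le> Limsup at_top (\<lambda>r. ereal (?r r))"
      using lu \<mu> by (simp add: l u mult_ac)
  next
    assume q: "q > 2"
    then obtain j where j: "q - 1 = Suc j" "1 \<le> j" by (cases "q - 1") auto
    \<comment> \<open>The first logarithm reduces the two powers to the ratio
      \<open>\<beta> / \<mu>\<close>; a further one, present because \<open>q > 2\<close>, replaces
      it by 1.\<close>
    have r: "((\<lambda>r. ln (r powr \<beta>) / ln (r powr \<mu>)) \<longlongrightarrow> \<beta> / \<mu>) at_top" using \<mu> \<mu>\<beta> unfolding divide_inverse[of \<beta> \<mu>] by real_asymp
    have i: "filterlim (\<lambda>r. ln (r powr \<mu>)) at_top at_top" using \<mu> by real_asymp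
    have "0 < \<beta> / \<mu>" using \<mu> \<mu>\<beta> by simp
    from iter_log_ratio_tendsto_1[OF r this i j(2)]
    have "(?h \<longlongrightarrow> 1) at_top" unfolding j(1) iter_log_Suc' .
    from lim[OF this] show "pq_lower_order p q f / pq_order p q f \<le> Limsup at_top (\<lambda>r. ereal (?r r))"
      using lu by (simp add: l u)
  qed
qed

end
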